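(* Let $q_n=\sum_{h\ge0}q_n^{(h)}$ and let $\widetilde H_n$ be the random variable with $\mathbb{P}(\widetilde H_n=h)=q_n^{(h)}/q_n$. As $n\to\infty$: \[ q_n=\frac1n-\frac4{3n^2}+\frac{88}{45n^3}-\frac{976}{315n^4}+\frac{3488}{675n^5}-\frac{276928}{31185n^6}+O\Big(\frac1{n^7}\Big), \] \[ \mathbb{E}\widetilde H_n=\frac{\sqrt{2\pi^3}}4\sqrt n-2+\frac{3\sqrt{2\pi^3}}{16\sqrt n}-\frac{539\sqrt{2\pi^3}}{5760\sqrt{n^3}}+\frac{50713\sqrt{2\pi^3}}{483840\sqrt{n^5}}+O\Big(\frac1{\sqrt{n^7}}\Big), \] \[ \mathbb{V}\widetilde H_n=\frac{28\zeta(3)-\pi^3}8n+\frac{224\zeta(3)-9\pi^3}{48}-\frac{1792\zeta(3)-67\pi^3}{2880n}+\frac{107520\zeta(3)-4189\pi^3}{120960n^2}+O\Big(\frac1{n^3}\Big), \] and for every $r\in\mathbb{N}$, \[ \mathbb{E}\widetilde H_n^r\sim\frac r{\sqrt\pi}\Gamma\Big(\frac{r+1}2\Big)(2^{r+1}-1)2^{-r/2}\zeta(r+1)n^{r/2}. \] Moreover, if $\eta=h/\sqrt n$ satisfies $6/\sqrt{\log n}<\eta<\sqrt{\log n}/2$ and $h\equiv n\bmod 2$, then \[ \mathbb{P}(\widetilde H_n=h)\sim\frac{2\chi(\eta)}{\sqrt n},\qquad \chi(\eta)=\frac{2\sqrt2}{\sqrt\pi}\sum_{k\ge0}\big((2k+1)^2\eta^2-1\big)\exp\Big(-\frac{(2k+1)^2\eta^2}2\Big)=\frac{2\pi^2}{\eta^3}\sum_{k\ge1}(-1)^{k-1}k^2\exp\Big(-\frac{\pi^2k^2}{2\eta^2}\Big).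 \]
   Context: $q_n^{(h)}$ is the probability that the simple symmetric random walk $(S_k)_{0\le k\le n}$ on $\mathbb{Z}$ started at $S_0=0$ (steps $\pm1$ with probability $\tfrac12$ each) satisfies $0\le S_k\le h$ for all $0\le k\le n$ and $S_n=h$; thus $q_n$ is the probability that the walk is nonnegative and ends at its maximum. $\zeta$ is the Riemann zeta function. $a_n\sim b_n$ means $a_n/b_n\to1$; in the local limit statement this holds uniformly over the stated range of $h$. *)

theory Defs
  imports "HOL-Probability.Probability" "HOL-Library.Landau_Symbols"
begin

text \<open>The simple symmetric random walk of length n is represented by its list of n
  independent, uniformly distributed \<open>\<plusminus>1\<close> increments.\<close>

definition srw_steps :: "nat \<Rightarrow> int list pmf" where
  "srw_steps n = replicate_pmf n (pmf_of_set {-1, 1})"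

definition position :: "int list \<Rightarrow> nat \<Rightarrow> int" where
  "position xs k = sum_list (take k xs)"

definition qh :: "nat \<Rightarrow> nat \<Rightarrow> real" where
  "qh n h = measure_pmf.prob (srw_steps n)
     {xs. (\<forall>k\<le>n. 0 \<le> position xs k \<and> position xs k \<le> int h) \<and> position xs n = int h}"

definition q :: "nat \<Rightarrow> real" where
  "q n = (\<Sum>h. qh n h)"

text \<open>The law of the random height. That \<open>embed_pmf\<close> is applied to a genuine probability mass
  function is established in \<open>pmf_height_law\<close> below.\<close>

definition height_law :: "nat \<Rightarrow> nat pmf" where
  "height_law n = embed_pmf (\<lambda>h. qh n h / q n)"

text \<open>The Riemann zeta function on its half-line of convergence \<open>s > 1\<close>; the value at other
  arguments is irrelevant.\<close>

definition zeta :: "real \<Rightarrow> real" where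
  "zeta s = (\<Sum>k. 1 / real (Suc k) powr s)"

definition chi :: "real \<Rightarrow> real" where
  "chi \<eta> = 2 * sqrt 2 / sqrt pi *
     (\<Sum>k. ((2 * real k + 1)\<^sup>2 * \<eta>\<^sup>2 - 1) * exp (- ((2 * real k + 1)\<^sup>2 * \<eta>\<^sup>2 / 2)))"

lemma set_srw_steps: "set_pmf (srw_steps n) = {xs. set xs \<subseteq> {-1, 1} \<and> length xs = n}"
  by (auto simp: srw_steps_def set_replicate_pmf lists_eq_set)

lemma sum_list_steps_le: "set xs \<subseteq> {-1, 1} \<Longrightarrow> sum_list xs \<le> int (length xs)" for xs :: "int list"
  by (induction xs) auto

lemma qh_nonneg: "0 \<le> qh n h"
  by (simp add: qh_def)

lemma qh_eq_0:
  assumes "n < h"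
  shows "qh n h = 0"
proof -
  have "position xs n \<noteq> int h" if "xs \<in> set_pmf (srw_steps n)" for xs
    using that sum_list_steps_le[of xs] assms by (auto simp: set_srw_steps position_def)
  then show ?thesis
    unfolding qh_def measure_pmf_zero_iff by auto
qed

lemma qh_self_pos: "0 < qh n n"
proof -
  let ?xs = "replicate n (1::int)"
  have "position ?xs k = int k" if "k \<le> n" for k
    using that by (simp add: position_def sum_list_replicate min_def)
  moreover have "?xs \<in> set_pmf (srw_steps n)"
    by (auto simp: set_srw_steps)
  ultimately have "qh n n \<noteq> 0"
    unfolding qh_def measure_pmf_zero_iff by auto
  with qh_nonneg[of n n] show ?thesis by linarith
qed

lemma qh_sums: "qh n sums q n"
  unfolding q_def by (rule summable_sums, rule summable_finite[of "{..n}"]) (auto simp: qh_eq_0)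

lemma q_pos: "0 < q n"
  unfolding q_def using qh_sums[of n] qh_nonneg qh_self_pos
  by (intro suminf_pos2[where i = n]) (auto simp: sums_iff)

lemma pmf_height_law: "pmf (height_law n) h = qh n h / q n"
proof -
  have s: "(\<lambda>h. qh n h / q n) sums 1"
    using sums_divide[OF qh_sums[of n], of "q n"] q_pos[of n] by simp
  have "(\<integral>\<^sup>+h. ennreal (qh n h / q n) \<partial>count_space UNIV) = (\<Sum>h. ennreal (qh n h / q n))"
    by (rule nn_integral_count_space_nat)
  also have "\<dots> = ennreal 1"
    using s q_pos[of n] by (intro suminf_ennreal_eq) (auto simp: qh_nonneg less_imp_le)
  finally show ?thesis
    unfolding height_law_def
    by (intro pmf_embed_pmf) (use q_pos[of n] in \<open>auto simp: qh_nonneg less_imp_le\<close>)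
qed

end

theory Submission
  imports Defs "HOL-Complex_Analysis.Complex_Analysis" "HOL-Real_Asymp.Real_Asymp"
begin


text \<open>Write H = h + 2. A walk confined to a strip solves a discrete heat equation with zero
  boundary values, and so does \<open>cos w ^ n * sin (a * w) * sin w / sin (H * w)\<close> as a
  function of n and a, for every complex w. Integrating over a period along a line Im w = c > 0
  gives an exact formula: for n + h even, \<open>qh n h\<close> is 2/pi times the imaginary part of
  the integral of sin^2 w cos^n w / sin(H w) over |Re w| \<le> pi/2
  (\<open>slit_walk_integral\<close>, \<open>qh_LI\<close>). For estimates c is tied to n by n c^2 =
  1. The kernel \<open>phi n\<close> = sin^2 w cos^n w then lives at the scale |w| ~ c and is close
  to w^2 exp(-n w^2/2) (\<open>phi_gauss\<close>, \<open>LI_bound\<close>).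

  For the moments of h + 2, sum H^r / sin(H w) over H \<ge> 2 of the parity of n
  (\<open>Lam\<close>), and apply Euler-Maclaurin summation to u^r / sin u along the ray through w
  (\<open>decaying.euler_maclaurin\<close>, \<open>Lam_expansion\<close>). The integral term is i^r
  S_r / (2 w^(r+1)), where S_r, the integral of y^r / sinh y (\<open>sinh_mom\<close>), carries the
  zeta value. The boundary terms have real coefficients. For r \<le> 2 they are free of poles once
  multiplied by \<open>phi n\<close>, so the line can be moved to the real axis; the vertical sides
  at Re w = +-pi/2 cost less than any power of c because cos is O(c) there. On the real axis the
  boundary terms are real and drop out of the imaginary part.

  Hence, up to errors smaller than every power of 1/n: the second moment is the constant S_2, by
  half a residue (\<open>moment_2\<close>), and the first is S_1/pi times the integral of (sin
  x/x)^2 cos^n x (\<open>moment_1\<close>). For r = 0 the summand 1 / sin u is singular at the start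
  of the ray; Euler-Maclaurin is applied to the derivative of u / sin u instead and integrated back.
  This produces a logarithm, whose imaginary part on the real axis gives \<open>q n\<close> as half
  the integral of |x| (sin x/x)^2 cos^n x (\<open>q_integral\<close>). The real integrals are
  expanded in powers of sin x rather than x (\<open>integral_expansion\<close>): each term is then a
  Beta integral, rational in n up to a Wallis integral (\<open>wallis_asymp\<close>). Division by
  \<open>q n\<close> gives mean and variance.

  For general r only the leading order is wanted. The kernel is replaced by its Gaussian
  (\<open>gauss_compare\<close>), and the integrals of exp(-v^2/2) / v^(r-1) along Im v = 1 supply
  the Gamma factor (\<open>Im_gauss_pole\<close>).

  The same replacement inside the formula for \<open>qh n h\<close> gives 2 c^3 \<open>chi\<close>
  with an additive error (\<open>qh_chi\<close>), since the defining series of \<open>chi\<close> is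
  what results from expanding 1 / sin in exponentials (\<open>chi_gauss_line\<close>). The residue
  theorem turns this line integral into the dual series (\<open>chi_theta\<close>). One series for
  large arguments and the other for small ones show that \<open>chi\<close> is at least n^(-1/6) in
  the stated window (\<open>chi_ge_power\<close>), so the additive error O(n^(-1/2) log n) is also
  small relatively (\<open>local_limit\<close>).\<close>

section \<open>Exact contour integral for the walk in a strip\<close>

lemma norm_sin_ge_sinh: "sinh (Im z) \<le> norm (sin z)" for z :: complex
proof -
  have "norm (sin z) = norm (exp (\<i> * z) - exp (- (\<i> * z))) / 2"
    by (simp add: sin_exp_eq norm_divide norm_mult)
  moreover have "norm (exp (\<i> * z) - exp (- (\<i> * z))) \<ge> norm (exp (- (\<i> * z))) - norm (exp (\<i> * z))"
    by (metis norm_minus_commute norm_triangle_ineq2)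
  ultimately show ?thesis by (simp add: sinh_field_def norm_exp_eq_Re)
qed

lemma sin_nonzero_upper: "0 < Im z \<Longrightarrow> sin z \<noteq> 0" for z :: complex
  using norm_sin_ge_sinh[of z] sinh_real_pos_iff[of "Im z"] by auto

text \<open>The free starting point a makes a first-step recursion possible. The walls at 0 and H
  are forbidden; start 1 and H = h + 2 give back \<open>qh n h\<close>.\<close>

definition slit_walk :: "nat \<Rightarrow> int \<Rightarrow> int \<Rightarrow> real" where
  "slit_walk n a H = measure_pmf.prob (srw_steps n)
     {xs. (\<forall>k\<le>n. 0 < a + position xs k \<and> a + position xs k < H) \<and> a + position xs n = H - 1}"

lemma srw_steps_Suc:
  "srw_steps (Suc n) = pmf_of_set {-1, 1} \<bind> (\<lambda>x. map_pmf ((#) x) (srw_steps n))"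
  by (simp add: srw_steps_def map_pmf_def)

lemma position_Cons_Suc: "position (x # xs) (Suc k) = x + position xs k"
  by (simp add: position_def)

lemma position_0: "position xs 0 = 0"
  by (simp add: position_def)

lemma all_le_Suc_iff: "(\<forall>k\<le>Suc n. P k) \<longleftrightarrow> P 0 \<and> (\<forall>k\<le>n. P (Suc k))"
  by (metis Suc_le_mono le0 not0_implies_Suc)

lemma slit_walk_0: "slit_walk 0 a H = (if 0 < a \<and> a = H - 1 then 1 else 0)"
  by (auto simp: slit_walk_def srw_steps_def position_0 indicator_def)

lemma slit_walk_Suc:
  "slit_walk (Suc n) a H = (if 0 < a \<and> a < H then (slit_walk n (a + 1) H + slit_walk n (a - 1) H) / 2 else 0)"
proof -
  define A where "A = {xs. (\<forall>k\<le>Suc n. 0 < a + position xs k \<and> a + position xs k < H) \<and> a + position xs (Suc n) = H - 1}"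
  have V: "(#) x -` A = (if 0 < a \<and> a < H then
      {xs. (\<forall>k\<le>n. 0 < (a + x) + position xs k \<and> (a + x) + position xs k < H) \<and> (a + x) + position xs n = H - 1} else {})" for x
    unfolding A_def all_le_Suc_iff by (auto simp: position_Cons_Suc position_0 add.assoc)
  have "slit_walk (Suc n) a H = measure_pmf.expectation (srw_steps (Suc n)) (indicator A :: _ \<Rightarrow> real)"
    by (simp add: slit_walk_def A_def)
  also have "\<dots> = (\<Sum>x\<in>{-1,1::int}. measure_pmf.expectation (map_pmf ((#) x) (srw_steps n)) (indicator A :: _ \<Rightarrow> real) /\<^sub>R 2)"
  proof -
    have "finite (set_pmf (map_pmf ((#) x) (srw_steps n)))" for x
      by (simp add: srw_steps_def set_replicate_pmf finite_lists_length_eq)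
        (auto intro!: finite_imageI finite_subset[OF _ finite_lists_length_eq[of "{-1,1::int}" n]] simp: lists_eq_set)
    thus ?thesis
      unfolding srw_steps_Suc by (subst pmf_expectation_bind_pmf_of_set) auto
  qed
  also have "\<dots> = (\<Sum>x\<in>{-1,1::int}. measure_pmf.prob (srw_steps n) ((#) x -` A) / 2)"
    by (simp add: field_simps)
  finally show ?thesis
    unfolding V by (auto simp: slit_walk_def add.commute)
qed

lemma qh_eq_slit_walk: "qh n h = slit_walk n 1 (int h + 2)"
proof -
  have "(0 < 1 + position xs k \<and> 1 + position xs k < int h + 2) \<longleftrightarrow> (0 \<le> position xs k \<and> position xs k \<le> int h)" for xs k
    by auto
  moreover have "1 + position xs n = int h + 2 - 1 \<longleftrightarrow> position xs n = int h" for xs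
    by auto
  ultimately show ?thesis
    unfolding qh_def slit_walk_def by presburger
qed

lemma circle_mean_value:
  assumes "f holomorphic_on cball 0 r" "0 < r"
  shows "((\<lambda>x. f (of_real r * cis x)) has_integral (2 * of_real pi * f 0)) {0..2*pi}"
proof -
  have "((\<lambda>u. f u / (u - 0)) has_contour_integral 2 * of_real pi * \<i> * f 0) (circlepath 0 r)"
    by (rule Cauchy_integral_circlepath_simple) (use assms in auto)
  hence "((\<lambda>t. f (of_real r * cis t) / (of_real r * cis t) * of_real r * \<i> * cis t) has_integral 2 * of_real pi * \<i> * f 0) {0..2*pi}"
    by (simp add: circlepath_def has_contour_integral_part_circlepath_iff)
  hence "((\<lambda>t. \<i> * f (of_real r * cis t)) has_integral 2 * of_real pi * \<i> * f 0) {0..2*pi}"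
    by (rule has_integral_eq[rotated]) (use assms in \<open>auto simp: field_simps\<close>)
  hence "((\<lambda>t. - \<i> * (\<i> * f (of_real r * cis t))) has_integral - \<i> * (2 * of_real pi * \<i> * f 0)) {0..2*pi}"
    by (rule has_integral_mult_right)
  also have "(\<lambda>t. - \<i> * (\<i> * f (of_real r * cis t))) = (\<lambda>t. f (of_real r * cis t))"
    by (simp add: fun_eq_iff flip: mult.assoc)
  also have "- \<i> * (2 * of_real pi * \<i> * f 0) = 2 * of_real pi * f 0"
    by (simp add: complex_eq_iff)
  finally show ?thesis .
qed

text \<open>By the addition formula for the sine, averaging over a + 1 and a - 1 multiplies the
  kernel by \<open>cos w\<close>, so it obeys the recursion \<open>slit_walk_Suc\<close> inside the
  strip. It vanishes at a = 0, and at a = H it becomes cos^n w sin w, which integrates to zero over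
  a period.\<close>

definition slit_kernel :: "nat \<Rightarrow> int \<Rightarrow> int \<Rightarrow> complex \<Rightarrow> complex" where
  "slit_kernel n a H w = cos w ^ n * sin (of_int a * w) * sin w / sin (of_int H * w)"

lemma continuous_on_Complex_line [continuous_intros]:
  "continuous_on A (\<lambda>x. Complex x c)"
  unfolding Complex_eq by (intro continuous_intros)

lemma slit_kernel_integrable:
  assumes "0 < c" "0 < H"
  shows "(\<lambda>x. slit_kernel n a H (Complex x c)) integrable_on {l..u}"
  unfolding slit_kernel_def
  by (intro integrable_continuous_interval continuous_intros ballI sin_nonzero_upper) (use assms in auto)

lemma has_integral_cos_power_sin_line:
  "((\<lambda>x. cos (Complex x c) ^ n * sin (Complex x c)) has_integral
     (cos (Complex l c) ^ Suc n - cos (Complex u c) ^ Suc n) / of_nat (Suc n)) {l..u}" if "l \<le> u"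
proof -
  have "((\<lambda>x. - (cos (Complex x c) ^ Suc n / of_nat (Suc n))) has_vector_derivative
      cos (Complex x c) ^ n * sin (Complex x c)) (at x within {l..u})" for x
  proof -
    have "((\<lambda>z. - (cos z ^ Suc n / of_nat (Suc n))) has_field_derivative cos z ^ n * sin z) (at z)" for z :: complex
      by (auto intro!: derivative_eq_intros simp del: of_nat_Suc power_Suc) 
    moreover have "((\<lambda>x. Complex x c) has_vector_derivative 1) (at x within {l..u})"
      unfolding Complex_eq by (auto intro!: derivative_eq_intros)
    ultimately show ?thesis
      using field_vector_diff_chain_within[of "\<lambda>x. Complex x c" 1 x "{l..u}" "\<lambda>z. - (cos z ^ Suc n / of_nat (Suc n))"]
      by (auto simp: o_def has_field_derivative_at_within)
  qed
  from fundamental_theorem_of_calculus[OF that this] show ?thesis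
    by (simp add: diff_divide_distrib)
qed

lemma sin_of_int_exp:
  "sin (of_int k * w) = (exp (\<i> * w) powi k - exp (\<i> * w) powi (-k)) / (2 * \<i>)" for w :: complex
  by (simp add: sin_exp_eq exp_minus power_int_minus exp_power_int mult_ac)

text \<open>In the variable q = exp(i w) the line becomes the circle of radius exp(-c) < 1 and the
  kernel becomes a function F holomorphic in the disc, since its poles are roots of unity. The mean
  value property leaves the constant term, which is nonzero only if a = H - 1.\<close>

lemma slit_kernel_0_integral:
  assumes "0 < c" "0 < a" "a < H"
  shows "((\<lambda>x. slit_kernel 0 a H (Complex x c)) has_integral (if a = H - 1 then of_real pi * \<i> else 0)) {0..2*pi}"
proof -
  \<comment> \<open>B is the distance from a to the target site H - 1; it becomes the order of the
    factor \<open>q ^ B\<close> in F.\<close>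
  obtain A B :: nat where AB: "a = int A" "H = int A + int B + 1" "A > 0"
    by (metis add_diff_cancel_left' assms(2,3) diff_add_cancel linorder_not_le nonneg_int_cases of_nat_0_less_iff zless_imp_add1_zle le_iff_diff_le_0 diff_diff_eq2 zle_iff_zadd pos_int_cases add.commute add.assoc)
  define F where "F q = q ^ B * (1 - q ^ (2 * A)) * (1 - q ^ 2) / (- 2 * \<i> * (1 - q ^ (2 * (A + B + 1))))" for q :: complex
  define r where "r = exp (-c)"
  have r: "0 < r" "r < 1" using assms by (auto simp: r_def)
  have ne: "1 - q ^ (2 * (A + B + 1)) \<noteq> 0" if "norm q \<le> r" for q :: complex
  proof
    assume "1 - q ^ (2 * (A + B + 1)) = 0"
    hence "norm q ^ (2 * (A + B + 1)) = 1" by (metis eq_iff_diff_eq_0 norm_one norm_power)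
    moreover have "norm q ^ (2 * (A + B + 1)) < 1"
      using that r power_less_one_iff[of "norm q" "2 * (A + B + 1)"] by simp
    ultimately show False by simp
  qed
  have "F holomorphic_on cball 0 r"
    unfolding F_def by (intro holomorphic_intros) (use ne in auto)
  from circle_mean_value[OF this r(1)]
  have "((\<lambda>x. F (of_real r * cis x)) has_integral (2 * of_real pi * F 0)) {0..2*pi}" .
  moreover have "2 * of_real pi * F 0 = (if a = H - 1 then of_real pi * \<i> else 0)"
    using AB by (auto simp: F_def power_0_left)
  moreover have "F (of_real r * cis x) = slit_kernel 0 a H (Complex x c)" for x
  proof -
    define q where "q = exp (\<i> * Complex x c)"
    have "norm q \<le> r"
      by (simp add: q_def r_def norm_exp_eq_Re)
    with r have q: "q = of_real r * cis x" "q \<noteq> 0" "norm q \<le> r"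
      by (auto simp: q_def r_def Complex_eq algebra_simps exp_diff exp_minus cis_conv_exp exp_of_real norm_mult divide_inverse simp flip: exp_of_real)
    have sm: "sin (of_nat m * Complex x c) = (q ^ m - inverse (q ^ m)) / (2 * \<i>)" for m
      using sin_of_int_exp[of "int m" "Complex x c"] by (simp add: q_def[symmetric] power_int_minus)
    have s1: "sin (of_int a * Complex x c) = (q ^ A - inverse (q ^ A)) / (2 * \<i>)"
      using sm[of A] by (simp add: AB)
    have s2: "sin (Complex x c) = (q - inverse q) / (2 * \<i>)"
      using sm[of 1] by simp
    have s3: "sin (of_int H * Complex x c) = (q ^ (A + B + 1) - inverse (q ^ (A + B + 1))) / (2 * \<i>)"
      unfolding sm[symmetric] by (simp add: AB add_ac)
    define X Y where "X = q ^ A" and "Y = q ^ B"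
    have XY: "X \<noteq> 0" "Y \<noteq> 0" using q by (auto simp: X_def Y_def)
    have P: "q ^ (A + B + 1) = X * Y * q" "q ^ (2 * (A + B + 1)) = X^2 * Y^2 * q^2" "q ^ (2 * A) = X^2"
      by (auto simp: X_def Y_def power_add power_mult power2_eq_square power_mult_distrib mult_ac)
    have ne1: "1 - X^2 * Y^2 * q^2 \<noteq> 0"
      using ne[OF q(3)] unfolding P .
    have ne': "X * Y * q - inverse (X * Y * q) \<noteq> 0"
    proof
      assume "X * Y * q - inverse (X * Y * q) = 0"
      moreover have "X * Y * q \<noteq> 0" using XY q by simp
      ultimately have "(X * Y * q) * (X * Y * q) = 1"
        by (metis eq_iff_diff_eq_0 left_inverse)
      hence "X^2 * Y^2 * q^2 = 1" by (simp add: power2_eq_square algebra_simps)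
      thus False using ne1 by simp
    qed
    show ?thesis
      unfolding slit_kernel_def F_def q(1)[symmetric] s1 s2 s3 P X_def[symmetric] Y_def[symmetric]
      using ne1 ne' XY q(2) by (simp add: divide_simps) (simp add: algebra_simps power2_eq_square)
  qed
  ultimately show ?thesis by simp
qed

lemma Complex_2pi: "cos (Complex (2 * pi) c) = cos (Complex 0 c)"
proof -
  have "Complex (2 * pi) c = Complex 0 c + of_real (2 * pi)" by (simp add: Complex_eq)
  thus ?thesis by (metis cos_periodic_pi2 cos_add cos_of_real sin_of_real cos_two_pi sin_two_pi of_real_0 of_real_1 mult.right_neutral mult_zero_right diff_zero)
qed

lemma slit_walk_integral:
  assumes "0 < c" "0 < H" "0 \<le> a" "a \<le> H"
  shows "((\<lambda>x. slit_kernel n a H (Complex x c)) has_integral of_real pi * \<i> * of_real (slit_walk n a H)) {0..2*pi}"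
  using assms(3,4)
proof (induction n arbitrary: a)
  \<comment> \<open>The wall values are settled for all n at once, because the induction step at an
    interior point may refer to the wall points a - 1 = 0 or a + 1 = H.\<close>
  have edge: "((\<lambda>x. slit_kernel n a H (Complex x c)) has_integral 0) {0..2*pi}" if "\<not> (0 < a \<and> a < H)" "0 \<le> a" "a \<le> H" for a n
  proof (cases "a = 0")
    case False
    with that have "a = H" by auto
    have "slit_kernel n a H (Complex x c) = cos (Complex x c) ^ n * sin (Complex x c)" for x
      using sin_nonzero_upper[of "of_int H * Complex x c"] assms by (simp add: slit_kernel_def \<open>a = H\<close>)
    thus ?thesis using has_integral_cos_power_sin_line[of 0 "2*pi" c n] by (simp add: Complex_2pi)
  qed (simp add: slit_kernel_def)
  {
    case 0
    thus ?case using edge[of a 0] slit_kernel_0_integral[of c a H] assms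
      by (cases "0 < a \<and> a < H") (auto simp: slit_walk_0)
  next
    case (Suc n)
    show ?case
    proof (cases "0 < a \<and> a < H")
      case True
      have "((\<lambda>x. (slit_kernel n (a + 1) H (Complex x c) + slit_kernel n (a - 1) H (Complex x c)) / 2) has_integral
          (of_real pi * \<i> * of_real (slit_walk n (a + 1) H) + of_real pi * \<i> * of_real (slit_walk n (a - 1) H)) / 2) {0..2*pi}"
        by (intro has_integral_divide has_integral_add Suc.IH) (use True in auto)
      \<comment> \<open>This is sin((a+1)w) + sin((a-1)w) = 2 cos w sin(a w).\<close>
      moreover have "(slit_kernel n (a + 1) H w + slit_kernel n (a - 1) H w) / 2 = slit_kernel (Suc n) a H w" for w
        by (simp add: slit_kernel_def ring_distribs sin_add sin_diff) (simp add: field_simps add_divide_distrib[symmetric])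
      ultimately show ?thesis using True by (simp add: slit_walk_Suc algebra_simps add_divide_distrib)
    qed (use edge[of a "Suc n"] Suc.prems in \<open>auto simp: slit_walk_Suc\<close>)
  }
qed


section \<open>Folding the period and the parity of the walk\<close>

definition phi :: "nat \<Rightarrow> complex \<Rightarrow> complex" where
  "phi n w = sin w ^ 2 * cos w ^ n"

definition LI :: "real \<Rightarrow> (complex \<Rightarrow> complex) \<Rightarrow> complex" where
  "LI c f = integral {-(pi/2)..pi/2} (\<lambda>x. f (Complex x c))"

text \<open>A shift by pi multiplies the integrand by the sign \<open>\<sigma>\<close>, so the
  period folds onto the half-period centred at 0. For sign -1 the integral vanishes, which is the
  parity obstruction of the walk; for sign 1 only the zero of \<open>sin w ^ 2\<close> at the centre
  matters, the cosine being small at both ends.\<close>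

lemma half_period_integral:
  fixes g :: "real \<Rightarrow> complex"
  assumes cont: "continuous_on UNIV g" and per: "\<And>x. g (x + pi) = \<sigma> * g x" and \<sigma>: "\<sigma> * \<sigma> = 1"
  shows "integral {0..2*pi} g = (1 + \<sigma>) * integral {-(pi/2)..pi/2} g"
proof -
  have int: "g integrable_on {a..b}" for a b
    using cont by (intro integrable_continuous_interval) (auto intro: continuous_on_subset)
  have shift: "integral {a + pi..b + pi} g = \<sigma> * integral {a..b} g" for a b
  proof -
    have "integral {a + pi..b + pi} g = integral {a..b} (g \<circ> (\<lambda>x. x + pi))"
      using integral_shift[of a pi b g] continuous_on_subset[OF cont, of "{a + pi..b + pi}"] by (simp add: add_ac)
    also have "\<dots> = integral {a..b} (\<lambda>x. \<sigma> * g x)"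
      by (simp add: o_def per)
    finally show ?thesis by simp
  qed
  have *: "integral {a..b} g + integral {b..c} g = integral {a..c} g" if "a \<le> b" "b \<le> c" for a b c
    using Henstock_Kurzweil_Integration.integral_combine[OF that int] .
  have "integral {0..2*pi} g = integral {0..pi/2} g + integral {pi/2..pi/2 + pi} g + integral {pi/2 + pi..2*pi} g"
    using *[of 0 "pi/2" "pi/2+pi"] *[of 0 "pi/2+pi" "2*pi"] by simp
  also have "integral {pi/2..pi/2 + pi} g = \<sigma> * integral {-(pi/2)..pi/2} g"
    using shift[of "-(pi/2)" "pi/2"] by simp
  \<comment> \<open>The last quarter is moved back by two half-periods, with total factor
    \<open>\<sigma> * \<sigma>\<close> = 1.\<close>
  also have "integral {pi/2 + pi..2*pi} g = integral {-(pi/2)..0} g"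
    using shift[of "pi/2" pi] shift[of "-(pi/2)" 0] \<sigma> by (simp flip: mult.assoc)
  finally show ?thesis
    using *[of "-(pi/2)" 0 "pi/2"] by (simp add: algebra_simps)
qed

lemma Complex_add_pi: "cos (Complex (x + pi) c) = - cos (Complex x c)" "sin (Complex (x + pi) c) = - sin (Complex x c)"
proof -
  have "Complex (x + pi) c = Complex x c + of_real pi" by (simp add: Complex_eq)
  thus "cos (Complex (x + pi) c) = - cos (Complex x c)" "sin (Complex (x + pi) c) = - sin (Complex x c)"
    by (simp_all add: cos_add sin_add del: of_real_add flip: cos_of_real sin_of_real)
qed

lemma sin_of_nat_add_pi: "sin (of_nat m * Complex (x + pi) c) = (-1) ^ m * sin (of_nat m * Complex x c)"
proof (induction m)
  case (Suc m)
  have C: "cos (of_nat m * Complex (x + pi) c) = (-1) ^ m * cos (of_nat m * Complex x c)" for m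
  proof -
    have "of_nat m * Complex (x + pi) c = of_nat m * Complex x c + of_real (of_nat m * pi)" 
      by (simp add: Complex_eq algebra_simps)
    thus ?thesis by (simp only: cos_add flip: cos_of_real sin_of_real) simp
  qed
  have "sin (of_nat (Suc m) * Complex (x + pi) c) = sin (of_nat m * Complex (x + pi) c + Complex (x + pi) c)"
    by (simp add: algebra_simps)
  also have "\<dots> = (-1) ^ Suc m * sin (of_nat m * Complex x c + Complex x c)"
    by (simp only: sin_add C Suc.IH Complex_add_pi) (simp add: algebra_simps)
  also have "of_nat m * Complex x c + Complex x c = of_nat (Suc m) * Complex x c"
    by (simp add: algebra_simps)
  finally show ?case .
qed simp

lemma qh_integral:
  assumes "0 < c" "2 \<le> H"
  shows "(1 + (-1) ^ (n + H)) * LI c (\<lambda>w. phi n w / sin (of_nat H * w)) = of_real pi * \<i> * of_real (qh n (H - 2))"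
proof -
  let ?g = "\<lambda>x. phi n (Complex x c) / sin (of_nat H * Complex x c)"
  have "slit_kernel n 1 (int (H - 2) + 2) w = phi n w / sin (of_nat H * w)" for w
    using assms by (simp add: slit_kernel_def phi_def power2_eq_square of_nat_diff)
  with slit_walk_integral[of c "int (H - 2) + 2" 1 n] assms
  have "integral {0..2*pi} ?g = of_real pi * \<i> * of_real (qh n (H - 2))"
    by (simp add: qh_eq_slit_walk integral_unique)
  moreover have "continuous_on UNIV ?g"
    unfolding phi_def by (intro continuous_intros ballI sin_nonzero_upper) (use assms in auto)
  moreover have "?g (x + pi) = (-1) ^ (n + H) * ?g x" for x
    by (simp add: sin_of_nat_add_pi phi_def Complex_add_pi power_add power_minus[of "cos _"] divide_simps)
  ultimately show ?thesis
    using half_period_integral[of ?g "(-1) ^ (n + H)"] by (simp add: LI_def flip: power_add)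
qed

lemma qh_odd: "odd (n + h) \<Longrightarrow> qh n h = 0"
  using qh_integral[of 1 "h + 2" n] by simp

text \<open>The line integral is purely imaginary by \<open>qh_integral\<close>. Recording only the
  imaginary part allows real contributions to be discarded later.\<close>

lemma qh_LI:
  assumes "0 < c" "2 \<le> H" "even (n + H)"
  shows "qh n (H - 2) = 2 / pi * Im (LI c (\<lambda>w. phi n w / sin (of_nat H * w)))"
proof -
  have "2 * LI c (\<lambda>w. phi n w / sin (of_nat H * w)) = of_real pi * \<i> * of_real (qh n (H - 2))"
    using qh_integral[OF assms(1,2), of n] assms(3) by simp
  hence "2 * Im (LI c (\<lambda>w. phi n w / sin (of_nat H * w))) = pi * qh n (H - 2)"
    by (auto simp: complex_eq_iff)
  thus ?thesis by (simp add: field_simps)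
qed

section \<open>Euler-Maclaurin summation along a ray\<close>

text \<open>These are 2^j B_j(a/2) / j! with Bernoulli polynomials B_j: the recursion says that the
  generating function is 2x exp(a x) / (exp(2x) - 1). The step 2 reflects that H runs through one
  parity class, whose first member will be a.\<close>

fun em_coeff :: "real \<Rightarrow> nat \<Rightarrow> real" where
  "em_coeff a i = a ^ i / fact i - (\<Sum>j<i. em_coeff a j * 2 ^ (Suc i - j) / fact (Suc i - j)) / 2"

declare em_coeff.simps [simp del]

lemma em_coeff_0: "em_coeff a 0 = 1"
  by (subst em_coeff.simps) simp

lemma em_coeff_sum: "(\<Sum>j\<le>i. em_coeff a j * 2 ^ (Suc i - j) / fact (Suc i - j)) = 2 * a ^ i / fact i"
proof -
  have "em_coeff a i * 2 = 2 * a ^ i / fact i - (\<Sum>j<i. em_coeff a j * 2 ^ (Suc i - j) / fact (Suc i - j))"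
    by (subst em_coeff.simps) (simp add: field_simps)
  thus ?thesis
    by (simp flip: lessThan_Suc_atMost)
qed

text \<open>The identity 2x exp(a x) = (exp(2x) - 1) times the generating function of
  \<open>em_coeff\<close>, applied with x = w d/dz and cut off at order K; \<open>g m\<close> stands
  for the m-th derivative at the base point.\<close>

lemma euler_maclaurin_taylor_identity:
  fixes g :: "nat \<Rightarrow> complex" and w :: complex
  shows "2 * w * (\<Sum>m<K. g (Suc m) * (of_real a * w) ^ m / fact m) =
    (\<Sum>j<K. of_real (em_coeff a j) * w ^ j * ((\<Sum>i\<le>K-j. g (j + i) * (2 * w) ^ i / fact i) - g j))"
proof -
  have "(\<Sum>j<K. of_real (em_coeff a j) * w ^ j * ((\<Sum>i\<le>K-j. g (j + i) * (2 * w) ^ i / fact i) - g j))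
     = (\<Sum>j<K. \<Sum>m | m \<in> {..<K} \<and> j \<le> m. of_real (em_coeff a j) * 2 ^ (Suc m - j) / fact (Suc m - j) * (g (Suc m) * w ^ Suc m))"
  proof (rule sum.cong[OF refl])
    fix j assume j: "j \<in> {..<K}"
    have "(\<Sum>i\<le>K-j. g (j + i) * (2 * w) ^ i / fact i) - g j = (\<Sum>i<K-j. g (j + Suc i) * (2 * w) ^ Suc i / fact (Suc i))"
      by (subst sum.atMost_shift) simp
    also have "\<dots> = (\<Sum>m | m \<in> {..<K} \<and> j \<le> m. g (Suc m) * (2 * w) ^ (Suc m - j) / fact (Suc m - j))"
      by (rule sum.reindex_bij_witness[of _ "\<lambda>m. m - j" "\<lambda>i. i + j"]) (use j in \<open>auto simp: Suc_diff_le add_ac\<close>)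
    finally have *: "(\<Sum>i\<le>K-j. g (j + i) * (2 * w) ^ i / fact i) - g j =
        (\<Sum>m | m \<in> {..<K} \<and> j \<le> m. g (Suc m) * (2 * w) ^ (Suc m - j) / fact (Suc m - j))" .
    show "of_real (em_coeff a j) * w ^ j * ((\<Sum>i\<le>K-j. g (j + i) * (2 * w) ^ i / fact i) - g j) =
        (\<Sum>m | m \<in> {..<K} \<and> j \<le> m. of_real (em_coeff a j) * 2 ^ (Suc m - j) / fact (Suc m - j) * (g (Suc m) * w ^ Suc m))"
      unfolding * sum_distrib_left
    proof (rule sum.cong[OF refl])
      fix m assume m: "m \<in> {m \<in> {..<K}. j \<le> m}"
      hence "w ^ Suc m = w ^ j * w ^ (Suc m - j)"
        by (simp del: power_Suc flip: power_add)
      thus "of_real (em_coeff a j) * w ^ j * (g (Suc m) * (2 * w) ^ (Suc m - j) / fact (Suc m - j)) =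
          of_real (em_coeff a j) * 2 ^ (Suc m - j) / fact (Suc m - j) * (g (Suc m) * w ^ Suc m)"
        by (simp only: power_mult_distrib) simp
    qed
  qed
  also have "\<dots> = (\<Sum>m<K. \<Sum>j | j \<in> {..<K} \<and> j \<le> m. of_real (em_coeff a j) * 2 ^ (Suc m - j) / fact (Suc m - j) * (g (Suc m) * w ^ Suc m))"
    by (rule sum.swap_restrict) auto
  also have "\<dots> = (\<Sum>m<K. of_real (\<Sum>j\<le>m. em_coeff a j * 2 ^ (Suc m - j) / fact (Suc m - j)) * (g (Suc m) * w ^ Suc m))"
  proof (rule sum.cong[OF refl])
    fix m assume "m \<in> {..<K}"
    hence "{j. j \<in> {..<K} \<and> j \<le> m} = {..m}" by auto
    thus "(\<Sum>j | j \<in> {..<K} \<and> j \<le> m. of_real (em_coeff a j) * 2 ^ (Suc m - j) / fact (Suc m - j) * (g (Suc m) * w ^ Suc m)) =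
        of_real (\<Sum>j\<le>m. em_coeff a j * 2 ^ (Suc m - j) / fact (Suc m - j)) * (g (Suc m) * w ^ Suc m)"
      by (simp add: sum_distrib_right)
  qed
  also have "\<dots> = 2 * w * (\<Sum>m<K. g (Suc m) * (of_real a * w) ^ m / fact m)"
    unfolding em_coeff_sum sum_distrib_left
    by (intro sum.cong refl) (simp add: power_mult_distrib field_simps)
  finally show ?thesis by simp
qed

text \<open>Sum of the Taylor remainders in one cell: the first summand is for the sample point at
  distance at most 3 norm w, the others are for the increments over a step of length 2 norm
  w.\<close>

definition em_const :: "real \<Rightarrow> nat \<Rightarrow> real" where
  "em_const a K = 2 * 3 ^ K + (\<Sum>j<K. \<bar>em_coeff a j\<bar> * 2 ^ (Suc K - j))"

lemma em_const_nonneg: "0 \<le> em_const a K"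
  unfolding em_const_def by (intro add_nonneg_nonneg sum_nonneg) auto

text \<open>The cell runs from z to z + 2w, with \<open>f 1\<close> sampled at z + a w and
  \<open>f 0\<close> its primitive. The Taylor polynomials cancel by the preceding identity, so only
  remainders of order K + 1 are left. As a may be as large as 3, the sample point can lie beyond the
  cell; hence z + 3w must belong to S.\<close>

lemma euler_maclaurin_cell:
  fixes f :: "nat \<Rightarrow> complex \<Rightarrow> complex"
  assumes der: "\<And>i x. x \<in> S \<Longrightarrow> (f i has_field_derivative f (Suc i) x) (at x within S)"
    and S: "convex S" "z \<in> S" "z + 3 * w \<in> S"
    and M: "\<And>x. x \<in> S \<Longrightarrow> norm (f (Suc K) x) \<le> M"
    and a: "0 \<le> a" "a \<le> 3" and K: "1 \<le> K"
  shows "norm (2 * w * f 1 (z + of_real a * w) - (\<Sum>j<K. of_real (em_coeff a j) * w ^ j * (f j (z + 2 * w) - f j z)))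
    \<le> em_const a K * M * norm w ^ Suc K"
proof -
  have inS: "z + of_real t * w \<in> S" if "0 \<le> t" "t \<le> 3" for t
  proof -
    have "z + of_real t * w = (1 - t/3) *\<^sub>R z + (t/3) *\<^sub>R (z + 3 * w)"
      by (simp add: scaleR_conv_of_real algebra_simps)
    thus ?thesis using convexD[OF S, of "1 - t/3" "t/3"] that by simp
  qed
  have M0: "0 \<le> M" using M[OF S(2)] norm_ge_zero order_trans by blast
  have tay: "norm (f j (z + of_real t * w) - (\<Sum>i\<le>K-j. f (j + i) z * (of_real t * w) ^ i / fact i)) \<le> M * (t * norm w) ^ (Suc K - j)"
    if "j \<le> K" "0 \<le> t" "t \<le> 3" for j t
  proof -
    have "norm (f (j + 0) (z + of_real t * w) - (\<Sum>i\<le>K-j. f (j + i) z * ((z + of_real t * w) - z) ^ i / fact i)) \<le> M * norm ((z + of_real t * w) - z) ^ Suc (K - j) / fact (K - j)"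
      by (rule complex_Taylor[where f = "\<lambda>i. f (j + i)" and S = S]) (use S M inS that der in auto)
    also have "\<dots> \<le> M * (t * norm w) ^ (Suc K - j)"
    proof -
      have "norm ((z + of_real t * w) - z) ^ Suc (K - j) = (t * norm w) ^ (Suc K - j)"
        using that by (simp add: norm_mult Suc_diff_le)
      moreover have "M * (t * norm w) ^ (Suc K - j) / fact (K - j) \<le> M * (t * norm w) ^ (Suc K - j) / 1"
        by (intro divide_left_mono) (use that M0 in \<open>auto intro: fact_ge_1\<close>)
      ultimately show ?thesis by simp
    qed
    finally show ?thesis by simp
  qed
  define P where "P t j = (\<Sum>i\<le>K-j. f (j + i) z * (of_real t * w) ^ i / fact i)" for t j
  have id: "2 * w * P a 1 = (\<Sum>j<K. of_real (em_coeff a j) * w ^ j * (P 2 j - f j z))"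
  proof -
    have "{..K - 1} = {..<K}" using K by auto
    thus ?thesis
      using euler_maclaurin_taylor_identity[of w "\<lambda>i. f i z" a K] by (simp add: P_def)
  qed
  have "2 * w * f 1 (z + of_real a * w) - (\<Sum>j<K. of_real (em_coeff a j) * w ^ j * (f j (z + 2 * w) - f j z))
     = 2 * w * (f 1 (z + of_real a * w) - P a 1) - (\<Sum>j<K. of_real (em_coeff a j) * w ^ j * (f j (z + 2 * w) - P 2 j))"
    using id by (simp add: algebra_simps sum_subtractf sum.distrib)
  also have "norm \<dots> \<le> norm (2 * w * (f 1 (z + of_real a * w) - P a 1)) + (\<Sum>j<K. norm (of_real (em_coeff a j) * w ^ j * (f j (z + 2 * w) - P 2 j)))"
    by (rule order_trans[OF norm_triangle_ineq4]) (intro add_left_mono norm_sum)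
  also have "\<dots> \<le> 2 * norm w * (M * (a * norm w) ^ K) + (\<Sum>j<K. \<bar>em_coeff a j\<bar> * norm w ^ j * (M * (2 * norm w) ^ (Suc K - j)))"
    unfolding norm_mult norm_power norm_of_real
    using tay[of 1 a] tay[of _ 2] K a
    by (intro add_mono sum_mono mult_mono) (auto simp: P_def M0)
  also have "\<dots> \<le> 2 * norm w * (M * (3 * norm w) ^ K) + (\<Sum>j<K. \<bar>em_coeff a j\<bar> * norm w ^ j * (M * (2 * norm w) ^ (Suc K - j)))"
    using a M0 by (intro add_mono mult_left_mono power_mono mult_right_mono) auto
  also have "\<dots> = em_const a K * M * norm w ^ Suc K"
  proof -
    have "\<bar>em_coeff a j\<bar> * norm w ^ j * (M * (2 * norm w) ^ (Suc K - j)) = \<bar>em_coeff a j\<bar> * 2 ^ (Suc K - j) * M * norm w ^ Suc K" if "j < K" for j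
    proof -
      have "norm w ^ j * norm w ^ (Suc K - j) = norm w ^ Suc K"
        using that by (simp del: power_Suc flip: power_add)
      thus ?thesis by (metis (no_types, opaque_lifting) mult.assoc mult.commute power_mult_distrib)
    qed
    hence "(\<Sum>j<K. \<bar>em_coeff a j\<bar> * norm w ^ j * (M * (2 * norm w) ^ (Suc K - j))) = (\<Sum>j<K. \<bar>em_coeff a j\<bar> * 2 ^ (Suc K - j)) * M * norm w ^ Suc K"
      unfolding sum_distrib_right by (intro sum.cong) auto
    thus ?thesis
      unfolding em_const_def by (simp add: power_mult_distrib ring_distribs)
  qed
  finally show ?thesis .
qed

lemma power_le_fact_exp: "x ^ p \<le> fact p * exp x" if "0 \<le> x" for x :: real
proof -
  have "(\<Sum>n\<in>{p}. x ^ n /\<^sub>R fact n) \<le> exp x"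
    unfolding exp_def by (rule sum_le_suminf) (use that summable_exp_generic[of x] in auto)
  thus ?thesis by (simp add: field_simps)
qed

text \<open>The disc makes 0, where the rays start, an interior point. Its radius is below pi, the
  first nonzero zero of the sine, so u / sin u is holomorphic on the whole domain.\<close>

definition upper_domain :: "complex set" where
  "upper_domain = {u. 0 < Im u} \<union> ball 0 3"

lemma open_upper_domain: "open upper_domain"
  unfolding upper_domain_def by (intro open_Un open_halfspace_Im_gt open_ball)

text \<open>Modelled on u^r / sin u: exponential decay away from the real axis, with polynomial
  growth at infinity and a polynomial blow-up at the real axis allowed.\<close>

locale decaying =
  fixes \<psi> :: "complex \<Rightarrow> complex" and p :: nat and B :: real
  assumes holo: "\<psi> holomorphic_on upper_domain"
    and bound: "\<And>u. 0 < Im u \<Longrightarrow> norm (\<psi> u) \<le> B * (1 + norm u) ^ p * (1 + 1 / Im u) ^ p * exp (- Im u)"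
begin

lemma B_nonneg: "0 \<le> B"
proof -
  have "0 \<le> B * (1 + norm \<i>) ^ p * (1 + 1 / Im \<i>) ^ p * exp (- Im \<i>)"
    using order_trans[OF norm_ge_zero bound[of \<i>]] by simp
  hence "0 * (2 ^ p * 2 ^ p * exp (- 1)) \<le> B * (2 ^ p * 2 ^ p * exp (- 1))"
    by (simp add: mult.assoc)
  thus ?thesis by (subst (asm) mult_le_cancel_right_pos) auto
qed

lemma holo_deriv: "(deriv ^^ k) \<psi> holomorphic_on upper_domain"
  using holo open_upper_domain by (rule holomorphic_higher_deriv)

text \<open>The bound is for cones norm u \<le> \<rho> Im u. Near 0 it holds by compactness.
  Otherwise Im u > 2/\<rho>, so the circle of radius 1/\<rho> around u stays at height at least
  1/\<rho> and Cauchy's inequality applies; it costs \<rho>^p for the blow-up at the axis and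
  \<rho>^K for the radius.\<close>

lemma deriv_bound:
  "\<exists>B'\<ge>0. \<forall>u \<rho>. 1 \<le> \<rho> \<longrightarrow> norm u \<le> \<rho> * Im u \<longrightarrow>
     norm ((deriv ^^ K) \<psi> u) \<le> B' * \<rho> ^ (p + K) * (1 + norm u) ^ p * exp (- Im u)"
proof -
  have "compact ((deriv ^^ K) \<psi> ` cball 0 2)"
    by (intro compact_continuous_image holomorphic_on_imp_continuous_on holomorphic_on_subset[OF holo_deriv])
       (auto simp: upper_domain_def)
  from compact_imp_bounded[OF this] obtain b where b0: "b > 0" "\<forall>x\<in>(deriv ^^ K) \<psi> ` cball 0 2. norm x \<le> b"
    unfolding bounded_pos by blast
  have b: "b \<ge> 0" "\<And>u. norm u \<le> 2 \<Longrightarrow> norm ((deriv ^^ K) \<psi> u) \<le> b"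
    using b0 by auto
  define B' where "B' = b * exp 2 + fact K * B * 4 ^ p * exp 1"
  have B': "B' \<ge> 0" using b B_nonneg by (simp add: B'_def)
  have "norm ((deriv ^^ K) \<psi> u) \<le> B' * \<rho> ^ (p + K) * (1 + norm u) ^ p * exp (- Im u)"
    if \<rho>: "1 \<le> \<rho>" and u: "norm u \<le> \<rho> * Im u" for u \<rho>
  proof (cases "norm u \<le> 2")
    case True
    have "norm ((deriv ^^ K) \<psi> u) \<le> b * 1 * 1 * 1" using b True by simp
    also have "\<dots> \<le> b * exp (2 - Im u) * \<rho> ^ (p + K) * (1 + norm u) ^ p"
      using b \<rho> True abs_Im_le_cmod[of u] by (intro mult_mono one_le_power mult_nonneg_nonneg) auto
    also have "\<dots> \<le> b * exp (2 - Im u) * \<rho> ^ (p + K) * (1 + norm u) ^ p + (fact K * B * 4 ^ p * exp 1) * \<rho> ^ (p + K) * (1 + norm u) ^ p * exp (- Im u)"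
      using B_nonneg \<rho> by simp
    also have "\<dots> = B' * \<rho> ^ (p + K) * (1 + norm u) ^ p * exp (- Im u)"
      by (simp add: B'_def exp_diff exp_minus field_simps)
    finally show ?thesis .
  next
    case False
    hence "2 < \<rho> * Im u" using u by linarith
    hence Im: "2 / \<rho> < Im u" using \<rho> by (simp add: field_simps)
    have near: "Im x \<ge> 1 / \<rho>" "Im x \<ge> Im u - 1" "norm x \<le> norm u + 1" if "dist u x \<le> 1 / \<rho>" for x
    proof -
      have "1 / \<rho> \<le> 1" using \<rho> by simp
      moreover have "\<bar>Im (u - x)\<bar> \<le> 1 / \<rho>" using that abs_Im_le_cmod[of "u - x"] by (simp add: dist_norm)
      moreover have "norm x \<le> norm u + 1 / \<rho>"
        using that norm_triangle_ineq2[of x u] by (simp add: dist_norm norm_minus_commute)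
      moreover have "2 / \<rho> = 1 / \<rho> + 1 / \<rho>" by simp
      ultimately show "Im x \<ge> 1 / \<rho>" "Im x \<ge> Im u - 1" "norm x \<le> norm u + 1"
        using Im by auto
    qed
    have rpos: "0 < 1 / \<rho>" using \<rho> by simp
    have sub: "cball u (1 / \<rho>) \<subseteq> upper_domain"
    proof
      fix x assume "x \<in> cball u (1 / \<rho>)"
      hence "1 / \<rho> \<le> Im x" using near(1)[of x] by simp
      hence "0 < Im x" using rpos by linarith
      thus "x \<in> upper_domain" by (simp add: upper_domain_def)
    qed
    have "norm ((deriv ^^ K) \<psi> u) \<le> fact K * (B * (2 * (1 + norm u)) ^ p * (2 * \<rho>) ^ p * exp (1 - Im u)) / (1 / \<rho>) ^ K"
    proof (rule Cauchy_inequality)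
      show "\<psi> holomorphic_on ball u (1 / \<rho>)" "continuous_on (cball u (1 / \<rho>)) \<psi>"
        using holo sub by (meson ball_subset_cball holomorphic_on_subset order_trans holomorphic_on_imp_continuous_on)+
      fix x assume x: "norm (u - x) = 1 / \<rho>"
      have nx: "Im x \<ge> 1 / \<rho>" "Im x \<ge> Im u - 1" "norm x \<le> norm u + 1" using near[of x] x by (auto simp: dist_norm)
      have "0 < Im x" using nx(1) rpos by linarith
      moreover from this have "1 / Im x \<le> \<rho>" using nx(1) \<rho> by (simp add: field_simps)
      moreover have nn: "1 + norm x \<le> 2 * (1 + norm u)" using add_mono[OF nx(3) norm_ge_zero[of u]] by simp
      ultimately have "B * (1 + norm x) ^ p * (1 + 1 / Im x) ^ p * exp (- Im x) \<le> B * (2 * (1 + norm u)) ^ p * (2 * \<rho>) ^ p * exp (1 - Im u)"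
        using nx(2) \<rho> B_nonneg nn by (intro mult_mono power_mono) auto
      thus "norm (\<psi> x) \<le> B * (2 * (1 + norm u)) ^ p * (2 * \<rho>) ^ p * exp (1 - Im u)"
        using bound[of x] \<open>0 < Im x\<close> by linarith
    qed (use \<rho> in auto)
    also have "\<dots> = (fact K * B * 4 ^ p * exp 1) * \<rho> ^ (p + K) * (1 + norm u) ^ p * exp (- Im u)"
    proof -
      have "(4::real) ^ p = 2 ^ p * 2 ^ p" by (simp flip: power_mult_distrib)
      thus ?thesis using \<rho> unfolding power_mult_distrib by (simp add: exp_diff exp_minus power_add power_divide field_simps)
    qed
    also have "\<dots> \<le> B' * \<rho> ^ (p + K) * (1 + norm u) ^ p * exp (- Im u)"
      using b \<rho> by (intro mult_right_mono) (auto simp: B'_def)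
    finally show ?thesis .
  qed
  with B' show ?thesis by blast
qed


definition ray_const :: real where
  "ray_const = 2 ^ p * fact p * exp 2"

lemma ray_const_nonneg: "0 \<le> ray_const"
  by (simp add: ray_const_def)

text \<open>Half of the available decay exp(-2 k c) absorbs the polynomial by means of x^p \<le> p!
  exp x; the other half is kept to make a geometric series in k.\<close>

lemma ray_decay:
  assumes c: "0 < c" "c \<le> 1" "Im w = c" and s: "2 * real k \<le> s" "s \<le> 2 * real k + 3"
  shows "(1 + norm (of_real s * w)) ^ p * exp (- Im (of_real s * w)) \<le> ray_const * (norm w / c) ^ p * exp (- real k * c)"
proof -
  define \<rho> where "\<rho> = norm w / c"
  have \<rho>: "1 \<le> \<rho>" "norm w = \<rho> * c" using c abs_Im_le_cmod[of w] by (auto simp: \<rho>_def)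
  have s0: "0 \<le> s" using s by linarith
  have "s * c \<le> (2 * real k + 3) * c" using s c by (intro mult_right_mono) auto
  hence sc: "s * c \<le> 2 * real k * c + 3" using c by (simp add: algebra_simps)
  have "1 + norm (of_real s * w) = 1 + \<rho> * (s * c)" using s0 \<rho> by (simp add: norm_mult)
  also have "\<dots> \<le> \<rho> + \<rho> * (s * c)" using \<rho> by simp
  also have "\<dots> = \<rho> * (1 + s * c)" by (simp add: algebra_simps)
  also have "\<dots> \<le> \<rho> * (4 + 2 * real k * c)" using sc \<rho> by (intro mult_left_mono) auto
  finally have "(1 + norm (of_real s * w)) ^ p \<le> (\<rho> * (4 + 2 * real k * c)) ^ p"
    by (intro power_mono) auto
  also have "\<dots> = \<rho> ^ p * 2 ^ p * (2 + real k * c) ^ p"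
  proof -
    have "\<rho> * (4 + 2 * real k * c) = \<rho> * 2 * (2 + real k * c)" by (simp add: algebra_simps)
    thus ?thesis by (simp only: power_mult_distrib)
  qed
  also have "\<dots> \<le> \<rho> ^ p * 2 ^ p * (fact p * exp (2 + real k * c))"
    using \<rho> c by (intro mult_left_mono power_le_fact_exp) auto
  finally have 1: "(1 + norm (of_real s * w)) ^ p \<le> \<rho> ^ p * 2 ^ p * (fact p * exp (2 + real k * c))" .
  have "2 * real k * c \<le> s * c" using s c by (intro mult_right_mono) auto
  hence 2: "exp (- Im (of_real s * w)) \<le> exp (- (2 * real k * c))"
    using c by simp
  have "(1 + norm (of_real s * w)) ^ p * exp (- Im (of_real s * w)) \<le>
      \<rho> ^ p * 2 ^ p * (fact p * exp (2 + real k * c)) * exp (- (2 * real k * c))"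
    by (intro mult_mono 1 2) (use \<rho> in auto)
  also have "\<dots> = ray_const * \<rho> ^ p * exp (- real k * c)"
    by (simp add: ray_const_def exp_add exp_minus mult_exp_exp field_simps flip: exp_add)
  finally show ?thesis by (simp add: \<rho>_def)
qed

lemma deriv_bound_ray:
  "\<exists>B'\<ge>0. \<forall>c w k s. 0 < c \<longrightarrow> c \<le> 1 \<longrightarrow> Im w = c \<longrightarrow> 2 * real k \<le> s \<longrightarrow> s \<le> 2 * real k + 3 \<longrightarrow>
     norm ((deriv ^^ K) \<psi> (of_real s * w)) \<le> B' * (norm w / c) ^ (2 * p + K) * exp (- c) ^ k"
proof -
  from deriv_bound[of K] obtain B' where B': "B' \<ge> 0"
    "\<And>u \<rho>. 1 \<le> \<rho> \<Longrightarrow> norm u \<le> \<rho> * Im u \<Longrightarrow> norm ((deriv ^^ K) \<psi> u) \<le> B' * \<rho> ^ (p + K) * (1 + norm u) ^ p * exp (- Im u)"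
    by blast
  have "norm ((deriv ^^ K) \<psi> (of_real s * w)) \<le> (B' * ray_const) * (norm w / c) ^ (2 * p + K) * exp (- c) ^ k"
    if c: "0 < c" "c \<le> 1" "Im w = c" and s: "2 * real k \<le> s" "s \<le> 2 * real k + 3" for c w k s
  proof -
    have s0: "0 \<le> s" using s by linarith
    have 1: "1 \<le> norm w / c" using c abs_Im_le_cmod[of w] by (auto simp: field_simps)
    have "norm ((deriv ^^ K) \<psi> (of_real s * w)) \<le> B' * (norm w / c) ^ (p + K) * (1 + norm (of_real s * w)) ^ p * exp (- Im (of_real s * w))"
      by (rule B'(2)[OF 1]) (use c s0 in \<open>simp add: norm_mult field_simps\<close>)
    also have "\<dots> = B' * (norm w / c) ^ (p + K) * ((1 + norm (of_real s * w)) ^ p * exp (- Im (of_real s * w)))"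
      by (simp add: mult_ac)
    also have "\<dots> \<le> B' * (norm w / c) ^ (p + K) * (ray_const * (norm w / c) ^ p * exp (- real k * c))"
      by (intro mult_left_mono ray_decay c s) (use B' 1 in auto)
    also have "\<dots> = (B' * ray_const) * (norm w / c) ^ (2 * p + K) * exp (- c) ^ k"
    proof -
      have "(norm w / c) ^ (2 * p + K) = (norm w / c) ^ (p + K) * (norm w / c) ^ p"
        by (simp only: power_add[symmetric]) (simp add: mult_2 add_ac)
      moreover have "exp (- real k * c) = exp (- c) ^ k"
        by (simp flip: exp_of_nat_mult)
      ultimately show ?thesis by (simp only: mult_ac)
    qed
    finally show ?thesis .
  qed
  thus ?thesis using B' ray_const_nonneg by (intro exI[of _ "B' * ray_const"]) auto
qed

lemma ray_in_domain: "0 < Im w \<Longrightarrow> 0 \<le> s \<Longrightarrow> of_real s * w \<in> upper_domain"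
  by (cases "s = 0") (auto simp: upper_domain_def)

lemma summable_ray:
  assumes "0 < Im w" "Im w \<le> 1" "0 \<le> a" "a \<le> 3"
  shows "summable (\<lambda>k. norm (\<psi> (of_real (2 * real k + a) * w)))"
proof -
  from deriv_bound_ray[of 0] obtain B' where B':
    "\<And>c w k s. 0 < c \<Longrightarrow> c \<le> 1 \<Longrightarrow> Im w = c \<Longrightarrow> 2 * real k \<le> s \<Longrightarrow> s \<le> 2 * real k + 3 \<Longrightarrow>
     norm ((deriv ^^ 0) \<psi> (of_real s * w)) \<le> B' * (norm w / c) ^ (2 * p + 0) * exp (- c) ^ k"
    by blast
  show ?thesis
  proof (rule summable_comparison_test')
    show "summable (\<lambda>k. B' * (norm w / Im w) ^ (2 * p) * exp (- Im w) ^ k)"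
      by (intro summable_mult summable_geometric) (use assms in auto)
    show "norm (norm (\<psi> (of_real (2 * real k + a) * w))) \<le> B' * (norm w / Im w) ^ (2 * p) * exp (- Im w) ^ k" for k
      using B'[of "Im w" w k "2 * real k + a"] assms by simp
  qed
qed

text \<open>Add the cell estimates over 0, 2w, 4w and so on. The increments telescope, the
  derivatives vanish at infinity, and only the values at 0 and the limit L of the primitive remain.
  The power of norm w / c in the error measures how oblique the ray is; it will be absorbed by the
  Gaussian decay of \<open>phi\<close>.\<close>

theorem euler_maclaurin:
  assumes \<Phi>: "\<And>u. u \<in> upper_domain \<Longrightarrow> (\<Phi> has_field_derivative \<psi> u) (at u)"
    and a: "0 \<le> a" "a \<le> 3" and K: "1 \<le> K"
  shows "\<exists>C\<ge>0. \<forall>c w L. 0 < c \<longrightarrow> c \<le> 1 \<longrightarrow> Im w = c \<longrightarrow> (\<lambda>N. \<Phi> (of_real (2 * real N) * w)) \<longlonglongrightarrow> L \<longrightarrow>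
    norm (2 * w * (\<Sum>k. \<psi> (of_real (2 * real k + a) * w)) - (L - \<Phi> 0)
       + (\<Sum>j\<in>{1..<K}. of_real (em_coeff a j) * w ^ j * (deriv ^^ (j - 1)) \<psi> 0))
    \<le> C * norm w ^ Suc K * (norm w / c) ^ (2 * p + K) / c"
proof -
  from deriv_bound_ray[of K] obtain B' where B': "B' \<ge> 0"
    "\<And>c w k s. 0 < c \<Longrightarrow> c \<le> 1 \<Longrightarrow> Im w = c \<Longrightarrow> 2 * real k \<le> s \<Longrightarrow> s \<le> 2 * real k + 3 \<Longrightarrow>
     norm ((deriv ^^ K) \<psi> (of_real s * w)) \<le> B' * (norm w / c) ^ (2 * p + K) * exp (- c) ^ k"
    by blast
  \<comment> \<open>Index shift: position 0 holds the primitive, position j + 1 the j-th derivative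
    of the summand.\<close>
  define f where "f i = (case i of 0 \<Rightarrow> \<Phi> | Suc j \<Rightarrow> (deriv ^^ j) \<psi>)" for i
  have f_simps: "f 0 = \<Phi>" "f 1 = \<psi>" "f (Suc j) = (deriv ^^ j) \<psi>" for j
    by (simp_all add: f_def)
  have der: "(f i has_field_derivative f (Suc i) u) (at u)" if "u \<in> upper_domain" for i u
    using \<Phi>[OF that] holomorphic_derivI[OF holo_deriv open_upper_domain that, of "i - 1"]
    by (cases i) (auto simp: f_def)
  define D where "D = em_const a K * B' * 2"
  have "norm (2 * w * (\<Sum>k. \<psi> (of_real (2 * real k + a) * w)) - (L - \<Phi> 0)
       + (\<Sum>j\<in>{1..<K}. of_real (em_coeff a j) * w ^ j * (deriv ^^ (j - 1)) \<psi> 0))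
    \<le> D * norm w ^ Suc K * (norm w / c) ^ (2 * p + K) / c"
    if c: "0 < c" "c \<le> 1" "Im w = c" and L: "(\<lambda>N. \<Phi> (of_real (2 * real N) * w)) \<longlonglongrightarrow> L" for c w L
  proof -
    define R where "R = B' * (norm w / c) ^ (2 * p + K)"
    have R0: "0 \<le> R" using B' c by (simp add: R_def)
    define z where "z k = of_real (2 * real k) * w" for k
    define T where "T k = 2 * w * \<psi> (of_real (2 * real k + a) * w)" for k
    define E where "E k = (\<Sum>j<K. of_real (em_coeff a j) * w ^ j * (f j (z (Suc k)) - f j (z k)))" for k
    have cell: "norm (T k - E k) \<le> em_const a K * (R * exp (- c) ^ k) * norm w ^ Suc K" for k
    proof -
      have seg: "\<exists>s. 2 * real k \<le> s \<and> s \<le> 2 * real k + 3 \<and> x = of_real s * w" if "x \<in> closed_segment (z k) (z k + 3 * w)" for x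
      proof -
        from that obtain u where u: "0 \<le> u" "u \<le> 1" "x = (1 - u) *\<^sub>R z k + u *\<^sub>R (z k + 3 * w)"
          by (auto simp: closed_segment_def)
        have "x = of_real (2 * real k + 3 * u) * w"
          by (simp add: u z_def scaleR_conv_of_real algebra_simps)
        thus ?thesis using u by (intro exI[of _ "2 * real k + 3 * u"]) auto
      qed
      have sub: "closed_segment (z k) (z k + 3 * w) \<subseteq> upper_domain"
        using seg ray_in_domain[of w] c by force
      have "norm (2 * w * f 1 (z k + of_real a * w) - (\<Sum>j<K. of_real (em_coeff a j) * w ^ j * (f j (z k + 2 * w) - f j (z k))))
        \<le> em_const a K * (R * exp (- c) ^ k) * norm w ^ Suc K"
      proof (rule euler_maclaurin_cell[where S = "closed_segment (z k) (z k + 3 * w)"])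
        fix i x assume "x \<in> closed_segment (z k) (z k + 3 * w)"
        thus "(f i has_field_derivative f (Suc i) x) (at x within closed_segment (z k) (z k + 3 * w))"
          using der sub has_field_derivative_at_within by blast
      next
        fix x assume "x \<in> closed_segment (z k) (z k + 3 * w)"
        with seg obtain s where "2 * real k \<le> s" "s \<le> 2 * real k + 3" "x = of_real s * w" by blast
        thus "norm (f (Suc K) x) \<le> R * exp (- c) ^ k"
          using B'(2)[OF c, of k s] by (simp add: f_simps R_def)
      qed (use a K in auto)
      moreover have "z k + of_real a * w = of_real (2 * real k + a) * w" "z k + 2 * w = z (Suc k)"
        by (simp_all add: z_def algebra_simps)
      ultimately show ?thesis by (simp only: T_def E_def f_simps)
    qed
    have partial: "norm (sum T {..<N} - (\<Sum>j<K. of_real (em_coeff a j) * w ^ j * (f j (z N) - f j 0))) \<le> D * norm w ^ Suc K * (norm w / c) ^ (2 * p + K) / c" for N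
    proof -
      have "sum E {..<N} = (\<Sum>j<K. of_real (em_coeff a j) * w ^ j * (\<Sum>k<N. f j (z (Suc k)) - f j (z k)))"
        unfolding E_def by (subst sum.swap) (simp add: sum_distrib_left)
      also have "\<dots> = (\<Sum>j<K. of_real (em_coeff a j) * w ^ j * (f j (z N) - f j 0))"
        by (simp add: sum_lessThan_telescope[of "\<lambda>k. f _ (z k)"]) (simp add: z_def)
      finally have "norm (sum T {..<N} - (\<Sum>j<K. of_real (em_coeff a j) * w ^ j * (f j (z N) - f j 0))) = norm (\<Sum>k<N. T k - E k)"
        by (simp add: sum_subtractf)
      also have "\<dots> \<le> (\<Sum>k<N. em_const a K * (R * exp (- c) ^ k) * norm w ^ Suc K)"
        by (intro sum_norm_le cell)
      also have "\<dots> = em_const a K * R * norm w ^ Suc K * (\<Sum>k<N. exp (- c) ^ k)"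
        by (simp add: sum_distrib_left mult_ac)
      also have "\<dots> \<le> em_const a K * R * norm w ^ Suc K * (2 / c)"
      proof (rule mult_left_mono)
        \<comment> \<open>For c \<le> 1, 1 - exp(-c) \<ge> 1 - 1/(1+c) \<ge> c/2, which bounds the
          geometric series by 2/c.\<close>
        have "exp (- c) < 1" using c by simp
        hence "(\<Sum>k<N. exp (- c) ^ k) \<le> 1 / (1 - exp (- c))"
          by (simp add: sum_gp_strict divide_right_mono)
        also have "1 + c \<le> exp c" by (rule exp_ge_add_one_self)
        hence "exp (- c) \<le> 1 / (1 + c)"
          using c by (simp add: exp_minus field_simps)
        hence "c / 2 \<le> 1 - exp (- c)"
        proof -
          have "c / 2 \<le> 1 - 1 / (1 + c)" using c by (simp add: field_simps power2_eq_square)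
          thus ?thesis using \<open>exp (- c) \<le> 1 / (1 + c)\<close> by linarith
        qed
        hence "1 / (1 - exp (- c)) \<le> 1 / (c / 2)" using c by (intro divide_left_mono) auto
        finally show "(\<Sum>k<N. exp (- c) ^ k) \<le> 2 / c" by simp
      qed (use em_const_nonneg R0 in auto)
      also have "\<dots> = D * norm w ^ Suc K * (norm w / c) ^ (2 * p + K) / c"
        by (simp add: D_def R_def)
      finally show ?thesis .
    qed
    have "summable (\<lambda>k. \<psi> (of_real (2 * real k + a) * w))"
      by (rule summable_norm_cancel, rule summable_ray) (use c a in auto)
    hence *: "(\<lambda>N. 2 * w * (\<Sum>k<N. \<psi> (of_real (2 * real k + a) * w))) \<longlonglongrightarrow> 2 * w * (\<Sum>k. \<psi> (of_real (2 * real k + a) * w))"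
      by (rule tendsto_mult_left[OF summable_LIMSEQ])
    have lim1: "(\<lambda>N. sum T {..<N}) \<longlonglongrightarrow> 2 * w * (\<Sum>k. \<psi> (of_real (2 * real k + a) * w))"
    proof -
      have "sum T {..<N} = 2 * w * (\<Sum>k<N. \<psi> (of_real (2 * real k + a) * w))" for N
        unfolding sum_distrib_left by (rule sum.cong) (simp_all add: T_def)
      with * show ?thesis by presburger
    qed
    have lim0: "(\<lambda>N. (deriv ^^ j) \<psi> (z N)) \<longlonglongrightarrow> 0" for j
    proof -
      from deriv_bound_ray[of j] obtain B2 where B2:
        "\<And>c w k s. 0 < c \<Longrightarrow> c \<le> 1 \<Longrightarrow> Im w = c \<Longrightarrow> 2 * real k \<le> s \<Longrightarrow> s \<le> 2 * real k + 3 \<Longrightarrow>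
         norm ((deriv ^^ j) \<psi> (of_real s * w)) \<le> B2 * (norm w / c) ^ (2 * p + j) * exp (- c) ^ k"
        by blast
      show ?thesis
      proof (rule Lim_null_comparison)
        show "\<forall>\<^sub>F N in sequentially. norm ((deriv ^^ j) \<psi> (z N)) \<le> B2 * (norm w / c) ^ (2 * p + j) * exp (- c) ^ N"
          unfolding z_def by (intro always_eventually allI B2[OF c]) auto
        show "(\<lambda>N. B2 * (norm w / c) ^ (2 * p + j) * exp (- c) ^ N) \<longlonglongrightarrow> 0"
          using c by (intro tendsto_mult_right_zero LIMSEQ_power_zero) auto
      qed
    qed
    define l where "l j = (if j = 0 then L else 0)" for j :: nat
    have lim2: "(\<lambda>N. f j (z N)) \<longlonglongrightarrow> l j" for j
    proof (cases j)
      case 0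
      thus ?thesis using L by (simp only: f_simps l_def z_def if_True simp_thms)
    next
      case (Suc i)
      thus ?thesis using lim0[of i] by (simp add: f_simps l_def)
    qed
    have "(\<lambda>N. norm (sum T {..<N} - (\<Sum>j<K. of_real (em_coeff a j) * w ^ j * (f j (z N) - f j 0)))) \<longlonglongrightarrow>
       norm (2 * w * (\<Sum>k. \<psi> (of_real (2 * real k + a) * w)) - (\<Sum>j<K. of_real (em_coeff a j) * w ^ j * (l j - f j 0)))"
      by (intro tendsto_intros lim1 lim2)
    from LIMSEQ_le_const2[OF this] partial
    have "norm (2 * w * (\<Sum>k. \<psi> (of_real (2 * real k + a) * w)) - (\<Sum>j<K. of_real (em_coeff a j) * w ^ j * (l j - f j 0)))
        \<le> D * norm w ^ Suc K * (norm w / c) ^ (2 * p + K) / c" by blast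
    moreover have "(\<Sum>j<K. of_real (em_coeff a j) * w ^ j * (l j - f j 0)) =
        (L - \<Phi> 0) - (\<Sum>j\<in>{1..<K}. of_real (em_coeff a j) * w ^ j * (deriv ^^ (j - 1)) \<psi> 0)"
    proof -
      have "{..<K} = insert 0 {1..<K}" using K by auto
      moreover have "(\<Sum>j\<in>{1..<K}. of_real (em_coeff a j) * w ^ j * (l j - f j 0)) = - (\<Sum>j\<in>{1..<K}. of_real (em_coeff a j) * w ^ j * (deriv ^^ (j - 1)) \<psi> 0)"
        unfolding sum_negf[symmetric] by (intro sum.cong) (auto simp: l_def f_def split: nat.splits)
      ultimately show ?thesis by (simp add: l_def f_simps em_coeff_0)
    qed
    moreover have "x - y + z = x - (y - z)" for x y z :: complex by simp
    ultimately show ?thesis by metis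
  qed
  moreover have "D \<ge> 0" using em_const_nonneg B' by (simp add: D_def)
  ultimately show ?thesis by blast
qed

end

section \<open>Gaussian decay of the kernel on the line n c^2 = 1\<close>

text \<open>The function cos t exp(t^2/2) decreases on [0, pi/2], because t cos t \<le> sin t
  there.\<close>

lemma cos_le_exp_minus_half_sq:
  assumes "\<bar>x\<bar> \<le> pi / 2"
  shows "cos x \<le> exp (- x\<^sup>2 / 2)"
proof -
  have pos: "cos y \<le> exp (- y\<^sup>2 / 2)" if y: "0 \<le> y" "y \<le> pi / 2" for y
  proof -
    have sc: "t * cos t \<le> sin t" if "0 \<le> t" "t \<le> pi / 2" for t
    proof -
      have "0 * cos 0 - sin 0 \<ge> t * cos t - sin t"
      proof (rule DERIV_nonpos_imp_nonincreasing[where f = "\<lambda>t. t * cos t - sin t"])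
        fix u assume "0 \<le> u" "u \<le> t"
        have "((\<lambda>t. t * cos t - sin t) has_real_derivative - (u * sin u)) (at u)"
          by (auto intro!: derivative_eq_intros)
        moreover have "- (u * sin u) \<le> 0"
          using \<open>0 \<le> u\<close> \<open>u \<le> t\<close> that by (auto intro!: mult_nonneg_nonneg sin_ge_zero)
        ultimately show "\<exists>y. ((\<lambda>t. t * cos t - sin t) has_real_derivative y) (at u) \<and> y \<le> 0" by blast
      qed (use that in auto)
      thus ?thesis by simp
    qed
    have "cos 0 * exp (0\<^sup>2 / 2) \<ge> cos y * exp (y\<^sup>2 / 2)"
    proof (rule DERIV_nonpos_imp_nonincreasing[where f = "\<lambda>t. cos t * exp (t\<^sup>2 / 2)"])
      fix u assume u: "0 \<le> u" "u \<le> y"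
      have "((\<lambda>t. cos t * exp (t\<^sup>2 / 2)) has_real_derivative exp (u\<^sup>2 / 2) * (u * cos u - sin u)) (at u)"
        by (auto intro!: derivative_eq_intros simp: algebra_simps)
      moreover have "exp (u\<^sup>2 / 2) * (u * cos u - sin u) \<le> 0"
        using sc[of u] u y by (intro mult_nonneg_nonpos) auto
      ultimately show "\<exists>y. ((\<lambda>t. cos t * exp (t\<^sup>2 / 2)) has_real_derivative y) (at u) \<and> y \<le> 0" by blast
    qed (use y in auto)
    thus ?thesis by (simp add: exp_minus field_simps)
  qed
  show ?thesis using pos[of x] pos[of "-x"] assms by (cases "0 \<le> x") auto
qed

lemma sinh_le_2: "0 \<le> c \<Longrightarrow> c \<le> 1 \<Longrightarrow> sinh c \<le> 2 * c" for c :: real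
proof -
  assume c: "0 \<le> c" "c \<le> 1"
  have "exp c \<le> 1 + c + c\<^sup>2" using c by (rule exp_bound)
  moreover have "1 - c \<le> exp (-c)" using exp_ge_add_one_self[of "-c"] by simp
  moreover have "c\<^sup>2 \<le> c" using c by (simp add: power2_eq_square mult_left_le)
  ultimately show ?thesis using c by (simp add: sinh_field_def)
qed

lemma norm_cos_sq: "norm (cos z) ^ 2 = cos (Re z) ^ 2 + sinh (Im z) ^ 2" for z :: complex
proof -
  have "(exp (Im z) + exp (- Im z)) ^ 2 = 4 * (1 + sinh (Im z) ^ 2)"
    by (simp add: sinh_field_def power2_eq_square field_simps flip: exp_add)
  hence "((exp (Im z) + exp (- Im z)) / 2) ^ 2 = 1 + sinh (Im z) ^ 2"
    by (simp add: power_divide)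
  moreover have "norm (cos z) ^ 2 = cos (Re z) ^ 2 * ((exp (Im z) + exp (- Im z)) / 2) ^ 2 + sin (Re z) ^ 2 * sinh (Im z) ^ 2"
    by (simp add: cmod_power2 Re_cos Im_cos sinh_field_def power_mult_distrib power_divide power2_commute[of "exp (- Im z)"])
  ultimately show ?thesis
    using sin_cos_squared_add[of "Re z"] by (simp add: algebra_simps) (simp flip: distrib_right distrib_left)
qed

definition cos_line_const :: real where "cos_line_const = exp (2 * exp 4)"

lemma cos_line_const_ge1: "1 \<le> cos_line_const"
  by (simp add: cos_line_const_def)

text \<open>The square of the norm is cos^2 x + sinh^2 c, at most exp(-x^2) (1 + 4 c^2 exp(x^2)).
  Since x^2 \<le> 4, the second factor is at most exp(4 c^2 exp 4), whose k-th power is bounded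
  because k c^2 \<le> 1. The square root of that bound is \<open>cos_line_const\<close>.\<close>

lemma norm_cos_line_power:
  assumes x: "\<bar>x\<bar> \<le> pi / 2" and c: "0 < c" "c \<le> 1" "real k * c\<^sup>2 \<le> 1"
  shows "norm (cos (Complex x c)) ^ k \<le> cos_line_const * exp (- real k * x\<^sup>2 / 2)"
proof -
  have x4: "x\<^sup>2 \<le> 4"
  proof -
    have "\<bar>x\<bar> \<le> 2" using x pi_less_4 by linarith
    hence "\<bar>x\<bar>\<^sup>2 \<le> 2\<^sup>2" by (intro power_mono) auto
    thus ?thesis by simp
  qed
  have "norm (cos (Complex x c)) ^ 2 = cos x ^ 2 + sinh c ^ 2"
    by (simp add: norm_cos_sq)
  also have "\<dots> \<le> exp (- x\<^sup>2 / 2) ^ 2 + (2 * c) ^ 2"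
    using x c by (intro add_mono power_mono cos_le_exp_minus_half_sq sinh_le_2 cos_ge_zero) auto
  also have "\<dots> = exp (- x\<^sup>2) * (1 + 4 * c\<^sup>2 * exp (x\<^sup>2))"
    by (simp add: exp_minus field_simps flip: exp_of_nat_mult)
  also have "\<dots> \<le> exp (- x\<^sup>2) * exp (4 * c\<^sup>2 * exp 4)"
  proof (rule mult_left_mono)
    have "1 + 4 * c\<^sup>2 * exp (x\<^sup>2) \<le> 1 + 4 * c\<^sup>2 * exp 4"
      using x4 by (intro add_left_mono mult_left_mono) auto
    also have "\<dots> \<le> exp (4 * c\<^sup>2 * exp 4)" by (rule exp_ge_add_one_self)
    finally show "1 + 4 * c\<^sup>2 * exp (x\<^sup>2) \<le> exp (4 * c\<^sup>2 * exp 4)" .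
  qed auto
  finally have "(norm (cos (Complex x c)) ^ 2) ^ k \<le> (exp (- x\<^sup>2) * exp (4 * c\<^sup>2 * exp 4)) ^ k"
    by (intro power_mono) auto
  also have "\<dots> = exp (- real k * x\<^sup>2) * exp (4 * (real k * c\<^sup>2) * exp 4)"
    by (simp add: power_mult_distrib mult_ac flip: exp_of_nat_mult)
  also have "\<dots> \<le> exp (- real k * x\<^sup>2) * exp (4 * 1 * exp 4)"
    using c by (intro mult_left_mono) auto
  also have "\<dots> = (cos_line_const * exp (- real k * x\<^sup>2 / 2)) ^ 2"
    by (simp add: cos_line_const_def power_mult_distrib flip: exp_of_nat_mult)
  finally have "(norm (cos (Complex x c)) ^ k) ^ 2 \<le> (cos_line_const * exp (- real k * x\<^sup>2 / 2)) ^ 2"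
    by (simp add: mult.commute flip: power_mult)
  thus ?thesis
    by (rule power2_le_imp_le) (use cos_line_const_ge1 in auto)
qed

lemma bounded_on_cball0:
  fixes f :: "complex \<Rightarrow> complex"
  assumes "continuous_on UNIV f"
  obtains b where "b \<ge> 0" "\<And>z. norm z \<le> r \<Longrightarrow> norm (f z) \<le> b"
proof -
  have "compact (f ` cball 0 r)"
    using assms by (intro compact_continuous_image) (auto intro: continuous_on_subset)
  from compact_imp_bounded[OF this] obtain b where "b > 0" "\<forall>x\<in>f ` cball 0 r. norm x \<le> b"
    unfolding bounded_pos by blast
  thus ?thesis using that[of b] by auto
qed

lemma taylor_zero_order:
  fixes f :: "nat \<Rightarrow> complex \<Rightarrow> complex"
  assumes der: "\<And>i x. i \<le> n \<Longrightarrow> (f i has_field_derivative f (Suc i) x) (at x)"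
    and zero: "\<And>i. i \<le> n \<Longrightarrow> f i 0 = 0"
    and cont: "continuous_on UNIV (f (Suc n))"
  shows "\<exists>C\<ge>0. \<forall>z. norm z \<le> r \<longrightarrow> norm (f 0 z) \<le> C * norm z ^ Suc n"
proof -
  obtain b where b: "b \<ge> 0" "\<And>z. norm z \<le> r \<Longrightarrow> norm (f (Suc n) z) \<le> b"
    using bounded_on_cball0[OF cont] by blast
  have "norm (f 0 z) \<le> b * norm z ^ Suc n" if z: "norm z \<le> r" for z
  proof -
    have r: "0 \<le> r" using z norm_ge_zero order_trans by blast
    have "norm (f 0 z - (\<Sum>i\<le>n. f i 0 * (z - 0) ^ i / fact i)) \<le> b * norm (z - 0) ^ Suc n / fact n"
      by (rule complex_Taylor[where S = "cball 0 r"])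
        (use b z r in \<open>auto intro: has_field_derivative_at_within der\<close>)
    also have "\<dots> \<le> b * norm z ^ Suc n / 1"
      using b by (intro frac_le) (auto intro: fact_ge_1)
    finally show ?thesis by (simp add: zero)
  qed
  with b show ?thesis by blast
qed

text \<open>Cosine and Gaussian agree to third order at 0, as the explicit list of successive
  derivatives shows.\<close>

lemma cos_minus_gauss_bound:
  "\<exists>C\<ge>0. \<forall>z::complex. norm z \<le> r \<longrightarrow> norm (cos z - exp (- z\<^sup>2 / 2)) \<le> C * norm z ^ 4"
proof -
  define f :: "nat \<Rightarrow> complex \<Rightarrow> complex" where "f i z = [cos z - exp (- z\<^sup>2 / 2), - sin z + z * exp (- z\<^sup>2 / 2),
     - cos z + (1 - z\<^sup>2) * exp (- z\<^sup>2 / 2), sin z + (z ^ 3 - 3 * z) * exp (- z\<^sup>2 / 2),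
     cos z - (z ^ 4 - 6 * z\<^sup>2 + 3) * exp (- z\<^sup>2 / 2)] ! i" for i z
  have le3: "i \<le> 3 \<longleftrightarrow> i = 0 \<or> i = 1 \<or> i = 2 \<or> i = 3" for i :: nat by auto
  have "\<exists>C\<ge>0. \<forall>z. norm z \<le> r \<longrightarrow> norm (f 0 z) \<le> C * norm z ^ Suc 3"
  proof (rule taylor_zero_order)
    fix i x assume "i \<le> (3::nat)"
    thus "(f i has_field_derivative f (Suc i) x) (at x)"
      unfolding le3 f_def[abs_def]
      by (elim disjE) (auto simp: numeral_eq_Suc intro!: derivative_eq_intros, (simp_all add: algebra_simps power2_eq_square power3_eq_cube power4_eq_xxxx)?)
  next
    fix i assume "i \<le> (3::nat)"
    thus "f i 0 = 0" unfolding le3 f_def by (elim disjE) auto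
  next
    show "continuous_on UNIV (f (Suc 3))"
      unfolding f_def[abs_def] by (auto intro!: continuous_intros)
  qed
  thus ?thesis by (simp add: f_def numeral_eq_Suc)
qed

lemma sin_minus_id_bound:
  "\<exists>C\<ge>0. \<forall>z::complex. norm z \<le> r \<longrightarrow> norm (sin z - z) \<le> C * norm z ^ 3"
proof -
  define f :: "nat \<Rightarrow> complex \<Rightarrow> complex" where "f i z = [sin z - z, cos z - 1, - sin z, - cos z] ! i" for i z
  have le2: "i \<le> 2 \<longleftrightarrow> i = 0 \<or> i = 1 \<or> i = 2" for i :: nat by auto
  have "\<exists>C\<ge>0. \<forall>z. norm z \<le> r \<longrightarrow> norm (f 0 z) \<le> C * norm z ^ Suc 2"
  proof (rule taylor_zero_order)
    fix i x assume "i \<le> (2::nat)"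
    thus "(f i has_field_derivative f (Suc i) x) (at x)"
      unfolding le2 f_def[abs_def]
      by (elim disjE) (auto simp: numeral_2_eq_2 intro!: derivative_eq_intros)
  next
    fix i assume "i \<le> (2::nat)"
    thus "f i 0 = 0" unfolding le2 f_def by (elim disjE) auto
  next
    show "continuous_on UNIV (f (Suc 2))"
      unfolding f_def[abs_def] by (auto intro!: continuous_intros)
  qed
  thus ?thesis by (simp add: f_def numeral_eq_Suc)
qed


lemma norm_Complex_line: "norm (Complex x c) ^ 2 = x\<^sup>2 + c\<^sup>2"
  by (simp add: cmod_power2)

lemma rho_ge1: "0 < c \<Longrightarrow> 1 \<le> norm (Complex x c) / c"
  using abs_Im_le_cmod[of "Complex x c"] by (simp add: field_simps)

lemma norm_gauss_line_power:
  assumes c: "0 < c" "c \<le> 1" "real k * c\<^sup>2 \<le> 1"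
  shows "norm (exp (- (Complex x c)\<^sup>2 / 2)) ^ k \<le> cos_line_const * exp (- real k * x\<^sup>2 / 2)"
proof -
  have "norm (exp (- (Complex x c)\<^sup>2 / 2)) = exp ((c\<^sup>2 - x\<^sup>2) / 2)"
    by (simp add: norm_exp_eq_Re power2_eq_square field_simps)
  hence "norm (exp (- (Complex x c)\<^sup>2 / 2)) ^ k = exp (real k * c\<^sup>2 / 2) * exp (- real k * x\<^sup>2 / 2)"
    by (simp add: diff_divide_distrib algebra_simps flip: exp_of_nat_mult exp_add)
  also have "\<dots> \<le> cos_line_const * exp (- real k * x\<^sup>2 / 2)"
  proof (rule mult_right_mono)
    have "real k * c\<^sup>2 / 2 \<le> 2 * exp 4"
      using c exp_ge_add_one_self[of 4] by linarith
    thus "exp (real k * c\<^sup>2 / 2) \<le> cos_line_const" by (simp add: cos_line_const_def)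
  qed auto
  finally show ?thesis .
qed

lemma norm_power_diff_line:
  fixes a b :: complex
  assumes "\<And>k. k \<le> n \<Longrightarrow> norm a ^ k \<le> A * E ^ k" "\<And>k. k \<le> n \<Longrightarrow> norm b ^ k \<le> A * E ^ k" "0 \<le> A" "0 \<le> E"
  shows "norm (a ^ n - b ^ n) \<le> real n * norm (a - b) * (A\<^sup>2 * E ^ (n - 1))"
proof -
  have "norm (a ^ n - b ^ n) = norm (a - b) * norm (\<Sum>i<n. b ^ (n - Suc i) * a ^ i)"
    by (simp add: power_diff_sumr2 norm_mult)
  also have "\<dots> \<le> norm (a - b) * (\<Sum>i<n. A\<^sup>2 * E ^ (n - 1))"
  proof (intro mult_left_mono sum_norm_le)
    fix i assume i: "i \<in> {..<n}"
    have "norm (b ^ (n - Suc i) * a ^ i) \<le> (A * E ^ (n - Suc i)) * (A * E ^ i)"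
      unfolding norm_mult norm_power using assms i by (intro mult_mono) auto
    also have "\<dots> = A\<^sup>2 * (E ^ (n - Suc i) * E ^ i)" by (simp add: power2_eq_square)
    also have "E ^ (n - Suc i) * E ^ i = E ^ (n - 1)" using i by (simp flip: power_add)
    finally show "norm (b ^ (n - Suc i) * a ^ i) \<le> A\<^sup>2 * E ^ (n - 1)" .
  qed auto
  finally show ?thesis by (simp add: mult_ac)
qed

text \<open>Replacing sin w by w changes sin^2 w by O(|w|^4). Replacing the cosine by the Gaussian
  costs n |w|^4 times the factor w^2, through the telescoped difference of n-th powers. With n c^2 =
  1 both are c^4 times powers of norm w / c, and the Gaussian decay in x is kept.\<close>

lemma phi_gauss:
  "\<exists>C\<ge>0. \<forall>n c x. 0 < c \<longrightarrow> c \<le> 1 \<longrightarrow> real n * c\<^sup>2 = 1 \<longrightarrow> \<bar>x\<bar> \<le> pi / 2 \<longrightarrow>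
     norm (phi n (Complex x c) - (Complex x c)\<^sup>2 * exp (- of_nat n * (Complex x c)\<^sup>2 / 2))
      \<le> C * c ^ 4 * (norm (Complex x c) / c) ^ 6 * exp (- real n * x\<^sup>2 / 2)"
proof -
  obtain C1 where C1: "C1 \<ge> 0" "\<And>z::complex. norm z \<le> 3 \<Longrightarrow> norm (sin z - z) \<le> C1 * norm z ^ 3"
    using sin_minus_id_bound by blast
  obtain C2 where C2: "C2 \<ge> 0" "\<And>z::complex. norm z \<le> 3 \<Longrightarrow> norm (cos z - exp (- z\<^sup>2 / 2)) \<le> C2 * norm z ^ 4"
    using cos_minus_gauss_bound by blast
  define A where "A = cos_line_const"
  have A: "1 \<le> A" using cos_line_const_ge1 by (simp add: A_def)
  define C where "C = C1 * (2 + 9 * C1) * A + C2 * A\<^sup>2 * exp 2"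
  have "norm (phi n w - w\<^sup>2 * exp (- of_nat n * w\<^sup>2 / 2)) \<le> C * c ^ 4 * (norm w / c) ^ 6 * exp (- real n * x\<^sup>2 / 2)"
    if c: "0 < c" "c \<le> 1" "real n * c\<^sup>2 = 1" and x: "\<bar>x\<bar> \<le> pi / 2" and w: "w = Complex x c" for n c x w
  proof -
    define \<rho> where "\<rho> = norm w / c"
    define E where "E = exp (- x\<^sup>2 / 2)"
    have \<rho>: "1 \<le> \<rho>" "norm w = c * \<rho>" using rho_ge1[of c x] c by (auto simp: \<rho>_def w)
    have w3: "norm w \<le> 3"
      using cmod_le[of w] x c pi_less_4 by (simp add: w)
    have n1: "n \<ge> 1" using c by (cases n) auto
    have kc: "real k * c\<^sup>2 \<le> 1" if "k \<le> n" for k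
      using mult_right_mono[of "real k" "real n" "c\<^sup>2"] that c by simp
    have Ek: "exp (- real k * x\<^sup>2 / 2) = E ^ k" for k
      by (simp add: E_def flip: exp_of_nat_mult)
    have b1: "norm (cos w) ^ k \<le> A * E ^ k" if "k \<le> n" for k
      unfolding Ek[symmetric] w A_def by (rule norm_cos_line_power[OF x c(1,2) kc[OF that]])
    have b2: "norm (exp (- w\<^sup>2 / 2)) ^ k \<le> A * E ^ k" if "k \<le> n" for k
      unfolding Ek[symmetric] w A_def by (rule norm_gauss_line_power[OF c(1,2) kc[OF that]])
    have en: "exp (- of_nat n * w\<^sup>2 / 2) = exp (- w\<^sup>2 / 2) ^ n"
      by (simp flip: exp_of_nat_mult)
    \<comment> \<open>The telescoped difference has only n - 1 Gaussian factors; as x^2 \<le> 4,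
      restoring the missing one costs exp 2.\<close>
    have E1: "E ^ (n - 1) \<le> exp 2 * E ^ n"
    proof -
      have "\<bar>x\<bar> \<le> 2" using x pi_less_4 by linarith
      hence "\<bar>x\<bar>\<^sup>2 \<le> 2\<^sup>2" by (intro power_mono) auto
      hence "exp (- 2) \<le> E" by (simp add: E_def)
      hence "1 \<le> exp 2 * E" by (simp add: exp_minus field_simps)
      hence "1 * E ^ (n - 1) \<le> exp 2 * E * E ^ (n - 1)"
        by (intro mult_right_mono) (auto simp: E_def)
      thus ?thesis using n1 by (cases n) (auto simp: mult_ac)
    qed
    have s: "norm (sin w ^ 2 - w ^ 2) \<le> C1 * (2 + 9 * C1) * norm w ^ 4"
    proof -
      have s1: "norm (sin w - w) \<le> C1 * norm w ^ 3" using C1 w3 by simp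
      have "norm (sin w + w) \<le> norm (sin w - w) + norm (2 * w)"
        using norm_triangle_ineq[of "sin w - w" "2 * w"] by (simp add: add.commute)
      also have "\<dots> \<le> C1 * norm w ^ 3 + 2 * norm w" using s1 by (simp add: norm_mult)
      also have "C1 * norm w ^ 3 = C1 * (norm w ^ 2 * norm w)" by (simp add: eval_nat_numeral)
      also have "\<dots> \<le> C1 * (3 ^ 2 * norm w)"
        using w3 C1 by (intro mult_left_mono mult_right_mono power_mono) auto
      finally have s2: "norm (sin w + w) \<le> (2 + 9 * C1) * norm w" by (simp add: algebra_simps)
      have "sin w ^ 2 - w ^ 2 = (sin w - w) * (sin w + w)" by (simp add: power2_eq_square algebra_simps)
      hence "norm (sin w ^ 2 - w ^ 2) = norm (sin w - w) * norm (sin w + w)" by (simp add: norm_mult)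
      also have "\<dots> \<le> (C1 * norm w ^ 3) * ((2 + 9 * C1) * norm w)"
        by (intro mult_mono s1 s2) (use C1 in auto)
      also have "\<dots> = C1 * (2 + 9 * C1) * norm w ^ 4" by (simp add: eval_nat_numeral)
      finally show ?thesis .
    qed
    have "phi n w - w\<^sup>2 * exp (- of_nat n * w\<^sup>2 / 2) = (sin w ^ 2 - w ^ 2) * cos w ^ n + w ^ 2 * (cos w ^ n - exp (- w\<^sup>2 / 2) ^ n)"
      unfolding en phi_def by (simp add: algebra_simps)
    hence "norm (phi n w - w\<^sup>2 * exp (- of_nat n * w\<^sup>2 / 2)) \<le>
        norm (sin w ^ 2 - w ^ 2) * norm (cos w) ^ n + norm w ^ 2 * norm (cos w ^ n - exp (- w\<^sup>2 / 2) ^ n)"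
      using norm_triangle_ineq by (metis norm_mult norm_power)
    also have "\<dots> \<le> (C1 * (2 + 9 * C1) * norm w ^ 4) * (A * E ^ n) + norm w ^ 2 * (real n * (C2 * norm w ^ 4) * (A\<^sup>2 * (exp 2 * E ^ n)))"
    proof (intro add_mono mult_mono mult_left_mono s b1)
      have "norm (cos w ^ n - exp (- w\<^sup>2 / 2) ^ n) \<le> real n * norm (cos w - exp (- w\<^sup>2 / 2)) * (A\<^sup>2 * E ^ (n - 1))"
        using b1 b2 A by (intro norm_power_diff_line) (auto simp: E_def)
      also have "\<dots> \<le> real n * (C2 * norm w ^ 4) * (A\<^sup>2 * (exp 2 * E ^ n))"
        using C2 w3 A E1 by (intro mult_mono mult_left_mono) (auto simp: E_def)
      finally show "norm (cos w ^ n - exp (- w\<^sup>2 / 2) ^ n) \<le> real n * (C2 * norm w ^ 4) * (A\<^sup>2 * (exp 2 * E ^ n))" .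
    qed (use C1 in auto)
    \<comment> \<open>Writing norm w = c \<rho> extracts the powers of c; the factor n from the
      telescoping is paired with c^2.\<close>
    also have "\<dots> = C1 * (2 + 9 * C1) * A * c ^ 4 * \<rho> ^ 4 * E ^ n + C2 * A\<^sup>2 * exp 2 * ((real n * c\<^sup>2) * c ^ 4) * \<rho> ^ 6 * E ^ n"
      unfolding \<rho>(2) by (simp add: power_mult_distrib eval_nat_numeral algebra_simps)
    also have "\<dots> \<le> C1 * (2 + 9 * C1) * A * c ^ 4 * \<rho> ^ 6 * E ^ n + C2 * A\<^sup>2 * exp 2 * c ^ 4 * \<rho> ^ 6 * E ^ n"
      unfolding c(3) using C1 C2(1) A \<rho> by (intro add_mono mult_right_mono mult_left_mono power_increasing mult_nonneg_nonneg) (auto simp: E_def)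
    also have "\<dots> = C * c ^ 4 * \<rho> ^ 6 * E ^ n"
      by (simp add: C_def algebra_simps)
    finally show ?thesis unfolding Ek \<rho>_def[symmetric] .
  qed
  moreover have "C \<ge> 0" using C1 C2 A by (simp add: C_def)
  ultimately show ?thesis by blast
qed

lemma phi_line_bound:
  "\<exists>C\<ge>0. \<forall>n c x. 0 < c \<longrightarrow> c \<le> 1 \<longrightarrow> real n * c\<^sup>2 = 1 \<longrightarrow> \<bar>x\<bar> \<le> pi / 2 \<longrightarrow>
     norm (phi n (Complex x c)) \<le> C * c ^ 2 * (norm (Complex x c) / c) ^ 6 * exp (- real n * x\<^sup>2 / 2)"
proof -
  obtain C where C: "C \<ge> 0" "\<And>n c x. 0 < c \<Longrightarrow> c \<le> 1 \<Longrightarrow> real n * c\<^sup>2 = 1 \<Longrightarrow> \<bar>x\<bar> \<le> pi / 2 \<Longrightarrow>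
     norm (phi n (Complex x c) - (Complex x c)\<^sup>2 * exp (- of_nat n * (Complex x c)\<^sup>2 / 2))
      \<le> C * c ^ 4 * (norm (Complex x c) / c) ^ 6 * exp (- real n * x\<^sup>2 / 2)"
    using phi_gauss by blast
  have "norm (phi n w) \<le> (C + cos_line_const) * c ^ 2 * (norm w / c) ^ 6 * exp (- real n * x\<^sup>2 / 2)"
    if c: "0 < c" "c \<le> 1" "real n * c\<^sup>2 = 1" and x: "\<bar>x\<bar> \<le> pi / 2" and w: "w = Complex x c" for n c x w
  proof -
    define \<rho> where "\<rho> = norm w / c"
    define E where "E = exp (- real n * x\<^sup>2 / 2)"
    have \<rho>: "1 \<le> \<rho>" "norm w = c * \<rho>" using rho_ge1[of c x] c by (auto simp: \<rho>_def w)
    have "norm (exp (- of_nat n * w\<^sup>2 / 2)) = norm (exp (- w\<^sup>2 / 2)) ^ n"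
      by (simp flip: exp_of_nat_mult norm_power)
    also have "\<dots> \<le> cos_line_const * E"
      using norm_gauss_line_power[of c n x] c by (simp add: w E_def)
    finally have "norm w ^ 2 * norm (exp (- of_nat n * w\<^sup>2 / 2)) \<le> norm w ^ 2 * (cos_line_const * E)"
      by (rule mult_left_mono) auto
    moreover have "norm (phi n w) \<le> norm (phi n w - w\<^sup>2 * exp (- of_nat n * w\<^sup>2 / 2)) + norm w ^ 2 * norm (exp (- of_nat n * w\<^sup>2 / 2))"
      using norm_triangle_ineq[of "phi n w - w\<^sup>2 * exp (- of_nat n * w\<^sup>2 / 2)" "w\<^sup>2 * exp (- of_nat n * w\<^sup>2 / 2)"]
      by (simp add: norm_mult norm_power)
    ultimately have "norm (phi n w) \<le> C * c ^ 4 * \<rho> ^ 6 * E + c ^ 2 * \<rho> ^ 2 * (cos_line_const * E)"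
      using C(2)[OF c x] unfolding w[symmetric] E_def[symmetric] \<rho>_def[symmetric]
      by (simp add: \<rho>(2) power_mult_distrib)
    also have "\<dots> \<le> C * c ^ 2 * \<rho> ^ 6 * E + c ^ 2 * \<rho> ^ 6 * (cos_line_const * E)"
      using C c \<rho> cos_line_const_ge1 by (intro add_mono mult_right_mono mult_left_mono power_increasing power_decreasing mult_nonneg_nonneg) (auto simp: E_def)
    finally show ?thesis unfolding E_def[symmetric] \<rho>_def[symmetric] by (simp add: algebra_simps)
  qed
  with C cos_line_const_ge1 show ?thesis by (intro exI[of _ "C + cos_line_const"]) auto
qed

text \<open>With t = (norm w / c)^2 = 1 + (x/c)^2 this is the boundedness of t^(L+1) exp(-t/2). A
  Lorentz profile is convenient as majorant, its integral being an arctangent.\<close>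

lemma rho_gauss_bound:
  assumes "0 < c"
  shows "(norm (Complex x c) / c) ^ L * exp (- (x / c)\<^sup>2 / 2) \<le> (2 ^ Suc L * fact (Suc L) * exp (1/2)) / (1 + (x / c)\<^sup>2)"
proof -
  define t where "t = 1 + (x / c)\<^sup>2"
  have t: "t > 0" by (simp add: t_def add_pos_nonneg)
  have \<rho>2: "(norm (Complex x c) / c)\<^sup>2 = t"
    using assms by (simp add: t_def power_divide norm_Complex_line add_divide_distrib)
  \<comment> \<open>Since norm w / c \<ge> 1, the exponent may be doubled, which gives an integral
    power of t.\<close>
  have "(norm (Complex x c) / c) ^ L \<le> (norm (Complex x c) / c) ^ (2 * L)"
    using rho_ge1[OF assms, of x] by (intro power_increasing) auto
  also have "\<dots> = t ^ L" by (simp add: power_mult \<rho>2)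
  finally have "(norm (Complex x c) / c) ^ L * exp (- (x / c)\<^sup>2 / 2) * t \<le> t ^ L * exp (- (x / c)\<^sup>2 / 2) * t"
    using t by (intro mult_right_mono) auto
  also have "\<dots> = 2 ^ Suc L * ((t / 2) ^ Suc L * exp (- (x / c)\<^sup>2 / 2))"
    by (simp add: power_divide)
  also have "\<dots> \<le> 2 ^ Suc L * (fact (Suc L) * exp (t / 2) * exp (- (x / c)\<^sup>2 / 2))"
    using t by (intro mult_left_mono mult_right_mono power_le_fact_exp) auto
  also have "\<dots> = 2 ^ Suc L * fact (Suc L) * exp (1/2)"
    by (simp add: t_def add_divide_distrib exp_add exp_minus)
  finally show ?thesis using t by (simp add: t_def field_simps)
qed

lemma has_integral_lorentz:
  assumes "0 < c" "a \<le> b"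
  shows "((\<lambda>x. 1 / (1 + (x / c)\<^sup>2)) has_integral c * (arctan (b / c) - arctan (a / c))) {a..b}"
proof -
  have "((\<lambda>x. c * arctan (x / c)) has_vector_derivative 1 / (1 + (x / c)\<^sup>2)) (at x within {a..b})" for x
    unfolding has_real_derivative_iff_has_vector_derivative[symmetric]
    by (rule has_field_derivative_at_within)
      (use assms in \<open>auto intro!: derivative_eq_intros simp: divide_inverse\<close>)
  from fundamental_theorem_of_calculus[OF assms(2) this] show ?thesis
    by (simp add: right_diff_distrib)
qed

text \<open>Two of the three factors c come from sin^2 w and one from the width of the Gaussian
  peak; polynomial growth of g in norm w / c only affects the constant.\<close>

lemma LI_bound:
  "\<exists>C\<ge>0. \<forall>n c D g. 0 < c \<longrightarrow> c \<le> 1 \<longrightarrow> real n * c\<^sup>2 = 1 \<longrightarrow> 0 \<le> D \<longrightarrow>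
     continuous_on UNIV (\<lambda>x. g (Complex x c)) \<longrightarrow>
     (\<forall>x. \<bar>x\<bar> \<le> pi/2 \<longrightarrow> norm (g (Complex x c)) \<le> D * (norm (Complex x c) / c) ^ L) \<longrightarrow>
     norm (LI c (\<lambda>w. phi n w * g w)) \<le> C * D * c ^ 3"
proof -
  obtain C where C: "C \<ge> 0" "\<And>n c x. 0 < c \<Longrightarrow> c \<le> 1 \<Longrightarrow> real n * c\<^sup>2 = 1 \<Longrightarrow> \<bar>x\<bar> \<le> pi / 2 \<Longrightarrow>
     norm (phi n (Complex x c)) \<le> C * c ^ 2 * (norm (Complex x c) / c) ^ 6 * exp (- real n * x\<^sup>2 / 2)"
    using phi_line_bound by blast
  define Q :: real where "Q = 2 ^ Suc (6 + L) * fact (Suc (6 + L)) * exp (1/2)"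
  have Q: "Q \<ge> 0" by (simp add: Q_def)
  have "norm (LI c (\<lambda>w. phi n w * g w)) \<le> (C * Q * pi) * D * c ^ 3"
    if c: "0 < c" "c \<le> 1" "real n * c\<^sup>2 = 1" and D: "0 \<le> D"
      and cont: "continuous_on UNIV (\<lambda>x. g (Complex x c))"
      and g: "\<And>x. \<bar>x\<bar> \<le> pi/2 \<Longrightarrow> norm (g (Complex x c)) \<le> D * (norm (Complex x c) / c) ^ L" for n c D g
  proof -
    have "norm (LI c (\<lambda>w. phi n w * g w)) \<le> integral {-(pi/2)..pi/2} (\<lambda>x. C * c\<^sup>2 * D * Q * (1 / (1 + (x / c)\<^sup>2)))"
      unfolding LI_def
    proof (rule integral_norm_bound_integral)
      show "(\<lambda>x. phi n (Complex x c) * g (Complex x c)) integrable_on {- (pi / 2)..pi / 2}"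
        unfolding phi_def by (intro integrable_continuous_interval continuous_intros continuous_on_subset[OF cont]) auto
      show "(\<lambda>x. C * c\<^sup>2 * D * Q * (1 / (1 + (x / c)\<^sup>2))) integrable_on {- (pi / 2)..pi / 2}"
        using has_integral_lorentz[OF c(1), of "-(pi/2)" "pi/2"] by (intro integrable_on_mult_right) (auto simp: integrable_on_def)
      fix x assume "x \<in> {- (pi / 2)..pi / 2}"
      hence x: "\<bar>x\<bar> \<le> pi / 2" by auto
      define \<rho> where "\<rho> = norm (Complex x c) / c"
      have nx: "real n * x\<^sup>2 = (x / c)\<^sup>2" using c by (simp add: power_divide field_simps)
      have "norm (phi n (Complex x c) * g (Complex x c)) \<le> (C * c ^ 2 * \<rho> ^ 6 * exp (- real n * x\<^sup>2 / 2)) * (D * \<rho> ^ L)"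
        unfolding norm_mult \<rho>_def by (intro mult_mono C(2) g c x) (use C c in auto)
      also have "\<dots> = C * c ^ 2 * D * (\<rho> ^ (6 + L) * exp (- (x / c)\<^sup>2 / 2))"
        by (simp add: power_add nx mult_ac)
      also have "\<dots> \<le> C * c ^ 2 * D * (Q / (1 + (x / c)\<^sup>2))"
        unfolding \<rho>_def Q_def using C D by (intro mult_left_mono rho_gauss_bound c) auto
      finally show "norm (phi n (Complex x c) * g (Complex x c)) \<le> C * c\<^sup>2 * D * Q * (1 / (1 + (x / c)\<^sup>2))"
        by simp
    qed
    also have "\<dots> = C * c\<^sup>2 * D * Q * (c * (arctan (pi / 2 / c) - arctan (- (pi / 2) / c)))"
      using has_integral_lorentz[OF c(1), of "-(pi/2)" "pi/2"] 
      by (intro integral_unique has_integral_mult_right) simp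
    also have "\<dots> \<le> C * c\<^sup>2 * D * Q * (c * pi)"
      using arctan_ubound[of "pi / 2 / c"] arctan_lbound[of "- (pi / 2) / c"] C c D Q
      by (intro mult_left_mono) auto
    also have "\<dots> = (C * Q * pi) * D * c ^ 3" by (simp add: eval_nat_numeral)
    finally show ?thesis .
  qed
  moreover have "C * Q * pi \<ge> 0" using C Q by simp
  ultimately show ?thesis by blast
qed

section \<open>Moving the line of integration\<close>

lemma has_contour_integral_horizontal:
  assumes "a < b"
  shows "(f has_contour_integral I) (linepath (Complex a y) (Complex b y)) \<longleftrightarrow> ((\<lambda>x. f (Complex x y)) has_integral I) {a..b}"
proof -
  have l: "linepath (Complex a y) (Complex b y) t = linepath (of_real a) (of_real b) t + \<i> * of_real y" for t
    by (simp add: linepath_def Complex_eq scaleR_conv_of_real algebra_simps)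
  have d: "Complex b y - Complex a y = of_real b - of_real a"
    by (simp add: Complex_eq)
  have "(f has_contour_integral I) (linepath (Complex a y) (Complex b y)) \<longleftrightarrow>
    ((\<lambda>z. f (z + \<i> * of_real y)) has_contour_integral I) (linepath (of_real a) (of_real b))"
    unfolding has_contour_integral_linepath l d ..
  also have "\<dots> \<longleftrightarrow> ((\<lambda>x. f (of_real x + \<i> * of_real y)) has_integral I) {a..b}"
    by (subst has_contour_integral_linepath_Reals_iff) (use assms in auto)
  finally show ?thesis by (simp add: Complex_eq)
qed

text \<open>Both horizontal integrals run from left to right, so top minus bottom plus I is the
  contribution of the two vertical sides. Keeping I general serves Cauchy's theorem as well as
  residues.\<close>

lemma rect_integral:
  assumes R: "0 < R" and y: "y0 < y1"
    and cont: "continuous_on (path_image (rectpath (Complex (- R) y0) (Complex R y1))) f"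
    and I: "(f has_contour_integral I) (rectpath (Complex (- R) y0) (Complex R y1))"
    and M: "\<And>y. y0 \<le> y \<Longrightarrow> y \<le> y1 \<Longrightarrow> norm (f (Complex R y)) \<le> M"
           "\<And>y. y0 \<le> y \<Longrightarrow> y \<le> y1 \<Longrightarrow> norm (f (Complex (- R) y)) \<le> M"
  shows "norm (integral {- R..R} (\<lambda>x. f (Complex x y1)) - integral {- R..R} (\<lambda>x. f (Complex x y0)) + I) \<le> 2 * (y1 - y0) * M"
proof -
  define p q r s where "p = Complex (- R) y0" and "q = Complex R y0" and "r = Complex R y1" and "s = Complex (- R) y1"
  have rect: "rectpath (Complex (- R) y0) (Complex R y1) = linepath p q +++ linepath q r +++ linepath r s +++ linepath s p"
    by (simp add: rectpath_def Let_def p_def q_def r_def s_def)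
  have image: "path_image (rectpath (Complex (- R) y0) (Complex R y1)) = closed_segment p q \<union> closed_segment q r \<union> closed_segment r s \<union> closed_segment s p"
    unfolding rect by (simp add: path_image_join Un_assoc)
  have int: "f contour_integrable_on linepath p q" "f contour_integrable_on linepath q r"
      "f contour_integrable_on linepath r s" "f contour_integrable_on linepath s p"
    using cont unfolding image by (auto intro!: contour_integrable_continuous_linepath intro: continuous_on_subset)
  have 0: "contour_integral (linepath p q) f + contour_integral (linepath q r) f + contour_integral (linepath r s) f + contour_integral (linepath s p) f = I"
    using contour_integral_unique[OF I] int unfolding rect
    by (simp add: contour_integral_join valid_path_join contour_integrable_joinI add_ac)
  have bot: "contour_integral (linepath p q) f = integral {- R..R} (\<lambda>x. f (Complex x y0))"
    using has_contour_integral_integral[OF int(1)] unfolding p_def q_def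
    by (subst (asm) has_contour_integral_horizontal) (use R in \<open>auto dest: integral_unique\<close>)
  have "f contour_integrable_on linepath s r"
    using cont unfolding image by (auto intro!: contour_integrable_continuous_linepath intro: continuous_on_subset simp: closed_segment_commute[of s r])
  from has_contour_integral_integral[OF this] have "contour_integral (linepath s r) f = integral {- R..R} (\<lambda>x. f (Complex x y1))"
    unfolding r_def s_def
    by (subst (asm) has_contour_integral_horizontal) (use R in \<open>auto dest: integral_unique\<close>)
  hence top: "contour_integral (linepath r s) f = - (integral {- R..R} (\<lambda>x. f (Complex x y1)))"
    using contour_integral_reverse_linepath[of r s f] cont unfolding image by (auto intro: continuous_on_subset)
  have M0: "0 \<le> M" using order_trans[OF norm_ge_zero M(1)[of y0]] y by simp
  have nqr: "norm (r - q) = y1 - y0" "norm (p - s) = y1 - y0"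
    using y by (auto simp: p_def q_def r_def s_def cmod_def)
  have vseg: "\<exists>y. y0 \<le> y \<and> y \<le> y1 \<and> z = Complex t y" if "z \<in> closed_segment (Complex t y0) (Complex t y1)" for z t
  proof -
    from that have "Re z = t \<and> Im z \<in> closed_segment y0 y1"
      by (simp add: closed_segment_same_Re)
    thus ?thesis using y by (intro exI[of _ "Im z"]) (auto simp: closed_segment_eq_real_ivl complex_eq_iff)
  qed
  have right: "norm (contour_integral (linepath q r) f) \<le> M * (y1 - y0)"
    unfolding nqr(1)[symmetric]
  proof (rule contour_integral_bound_linepath[OF int(2) M0])
    fix z assume "z \<in> closed_segment q r"
    with vseg[of z "R"] M(1) show "norm (f z) \<le> M" unfolding q_def r_def by blast
  qed
  have left: "norm (contour_integral (linepath s p) f) \<le> M * (y1 - y0)"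
    unfolding nqr(2)[symmetric]
  proof (rule contour_integral_bound_linepath[OF int(4) M0])
    fix z assume "z \<in> closed_segment s p"
    hence "z \<in> closed_segment (Complex (- R) y0) (Complex (- R) y1)"
      unfolding s_def p_def by (simp add: closed_segment_commute)
    with vseg[of z "- R"] M(2) show "norm (f z) \<le> M" by blast
  qed
  have "integral {- R..R} (\<lambda>x. f (Complex x y1)) - integral {- R..R} (\<lambda>x. f (Complex x y0)) + I = contour_integral (linepath q r) f + contour_integral (linepath s p) f"
    using 0 unfolding bot top by (simp add: algebra_simps)
  hence "norm (integral {- R..R} (\<lambda>x. f (Complex x y1)) - integral {- R..R} (\<lambda>x. f (Complex x y0)) + I) \<le> M * (y1 - y0) + M * (y1 - y0)"
    using norm_triangle_mono[OF right left] by simp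
  thus ?thesis by (simp add: algebra_simps)
qed

lemmas LI_rect = rect_integral[of "pi / 2", folded LI_def, OF pi_half_gt_zero]

lemma LI_shift:
  assumes c: "0 < c"
    and cont: "continuous_on (cbox (Complex (-(pi/2)) 0) (Complex (pi/2) c)) f"
    and hol: "\<And>z. 0 < Im z \<Longrightarrow> f field_differentiable at z"
    and M: "\<And>y. 0 \<le> y \<Longrightarrow> y \<le> c \<Longrightarrow> norm (f (Complex (pi/2) y)) \<le> M"
           "\<And>y. 0 \<le> y \<Longrightarrow> y \<le> c \<Longrightarrow> norm (f (Complex (-(pi/2)) y)) \<le> M"
  shows "norm (LI c f - LI 0 f) \<le> 2 * c * M"
proof -
  let ?S = "cbox (Complex (-(pi/2)) 0) (Complex (pi/2) c)"
  have sub: "path_image (rectpath (Complex (-(pi/2)) 0) (Complex (pi/2) c)) \<subseteq> ?S"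
    using c by (intro path_image_rectpath_subset_cbox) auto
  have "interior ?S \<subseteq> {z. 0 < Im z}"
    by (auto simp: interior_cbox in_box_complex_iff)
  hence "(f has_contour_integral 0) (rectpath (Complex (-(pi/2)) 0) (Complex (pi/2) c))"
    by (intro Cauchy_theorem_convex[OF cont, of "{}"] sub) (auto intro: hol)
  from LI_rect[OF c continuous_on_subset[OF cont sub] this M] show ?thesis by simp
qed

definition sincc :: "complex \<Rightarrow> complex" where
  "sincc z = (if z = 0 then 1 else sin z / z)"

lemma sin_eq_sincc: "sin z = z * sincc z"
  by (simp add: sincc_def)

lemma sincc_holomorphic: "sincc holomorphic_on A"
proof -
  have "sincc holomorphic_on UNIV"
  proof (rule no_isolated_singularity'[of "{0}"])
    fix z :: complex assume "z \<in> {0}"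
    have "((\<lambda>h. (sin (0 + h) - sin 0) / h) \<longlongrightarrow> cos (0::complex)) (at 0)"
      using DERIV_sin[of "0::complex"] unfolding DERIV_def .
    hence "((\<lambda>h::complex. sin h / h) \<longlongrightarrow> 1) (at 0)" by simp
    hence "(sincc \<longlongrightarrow> 1) (at 0)"
      by (rule Lim_transform_eventually) (auto simp: sincc_def eventually_at_filter)
    thus "(sincc \<longlongrightarrow> sincc z) (at z within UNIV)" using \<open>z \<in> {0}\<close> by (simp add: sincc_def)
  next
    have "(\<lambda>z. sin z / z) holomorphic_on UNIV - {0::complex}"
      by (intro holomorphic_intros) auto
    thus "sincc holomorphic_on UNIV - {0}"
      by (rule holomorphic_transform) (auto simp: sincc_def)
  qed auto
  thus ?thesis by (rule holomorphic_on_subset) auto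
qed

lemma sincc_holomorphic_compose [holomorphic_intros]:
  "f holomorphic_on A \<Longrightarrow> (\<lambda>z. sincc (f z)) holomorphic_on A"
  using holomorphic_on_compose[of f A sincc] sincc_holomorphic by (simp add: o_def)

lemma continuous_on_sincc [continuous_intros]:
  "continuous_on A f \<Longrightarrow> continuous_on A (\<lambda>z. sincc (f z))"
  by (rule continuous_on_compose2[of UNIV sincc, OF holomorphic_on_imp_continuous_on[OF sincc_holomorphic]]) auto

lemma phi_sincc: "phi n w = sincc w ^ 2 * cos w ^ n * w ^ 2"
  by (simp add: phi_def sin_eq_sincc power_mult_distrib)

lemma norm_sin_le: "norm (sin z) \<le> exp \<bar>Im z\<bar>" for z :: complex
proof -
  have "norm (sin z) = norm (exp (\<i> * z) - exp (- (\<i> * z))) / 2"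
    by (simp add: sin_exp_eq norm_divide norm_mult)
  also have "\<dots> \<le> (exp (- Im z) + exp (Im z)) / 2"
    using norm_triangle_ineq4[of "exp (\<i> * z)" "exp (- (\<i> * z))"] by (simp add: norm_exp_eq_Re)
  also have "\<dots> \<le> (exp \<bar>Im z\<bar> + exp \<bar>Im z\<bar>) / 2"
    by (intro divide_right_mono add_mono) auto
  finally show ?thesis by simp
qed

text \<open>The left side is (4/n)^(n/2). For n \<ge> max 4 K the base 2c is at most 1 and the
  exponent may be lowered to K; for the finitely many other n, c is bounded away from 0.\<close>

lemma side_power_superpoly:
  "\<exists>C\<ge>0. \<forall>n c. 0 < c \<longrightarrow> c \<le> 1 \<longrightarrow> real n * c\<^sup>2 = 1 \<longrightarrow> (2 * c) ^ n \<le> C * c ^ K"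
proof -
  define N where "N = max 4 K"
  have "(2 * c) ^ n \<le> (2 ^ K + 2 ^ N * real N ^ K) * c ^ K" if c: "0 < c" "c \<le> 1" "real n * c\<^sup>2 = 1" for n c
  proof (cases "n \<ge> N")
    case True
    have "4 * c\<^sup>2 \<le> real n * c\<^sup>2" using True c by (intro mult_right_mono) (auto simp: N_def)
    hence "(2 * c)\<^sup>2 \<le> 1\<^sup>2" using c by (simp add: power_mult_distrib)
    hence c2: "2 * c \<le> 1" by (rule power2_le_imp_le) simp
    have "(2 * c) ^ n \<le> (2 * c) ^ K"
      using True c2 c by (intro power_decreasing) (auto simp: N_def)
    also have "\<dots> = 2 ^ K * c ^ K" by (simp add: power_mult_distrib)
    also have "\<dots> \<le> (2 ^ K + 2 ^ N * real N ^ K) * c ^ K"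
      using c by (intro mult_right_mono) auto
    finally show ?thesis .
  next
    case False
    have "(2 * c) ^ n \<le> 2 ^ n" using c by (intro power_mono) auto
    also have "\<dots> \<le> 2 ^ N" using False by (intro power_increasing) auto
    finally have 1: "(2 * c) ^ n \<le> 2 ^ N * 1" by simp
    have "real n * c\<^sup>2 \<le> real N * c\<^sup>2" using False c by (intro mult_right_mono) auto
    also have "\<dots> \<le> real N * c" using c by (intro mult_left_mono) (auto simp: power2_eq_square mult_left_le)
    finally have "1 \<le> (real N * c) ^ K" using c by (intro one_le_power) auto
    hence "2 ^ N * 1 \<le> 2 ^ N * (real N * c) ^ K" by (intro mult_left_mono) auto
    also have "\<dots> = (2 ^ N * real N ^ K) * c ^ K" by (simp add: power_mult_distrib)
    also have "\<dots> \<le> (2 ^ K + 2 ^ N * real N ^ K) * c ^ K"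
      using c by (intro mult_right_mono) auto
    finally show ?thesis using 1 by linarith
  qed
  moreover have "0 \<le> (2::real) ^ K + 2 ^ N * real N ^ K" by simp
  ultimately show ?thesis by blast
qed

lemma norm_cos_side:
  assumes "0 \<le> y" "y \<le> c" "c \<le> 1" "x = pi / 2 \<or> x = - (pi / 2)"
  shows "norm (cos (Complex x y)) \<le> 2 * c"
proof -
  have "cos x = 0" using assms(4) cos_pi_half by (metis cos_minus)
  hence "norm (cos (Complex x y)) ^ 2 = sinh y ^ 2"
    by (simp add: norm_cos_sq)
  hence "norm (cos (Complex x y)) = sinh y"
    using assms by (simp add: power2_eq_iff_nonneg)
  thus ?thesis using sinh_le_2[of y] assms by simp
qed

lemma norm_side:
  assumes "0 \<le> y" "y \<le> 1" "x = pi / 2 \<or> x = - (pi / 2)"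
  shows "1 \<le> norm (Complex x y)" "norm (Complex x y) \<le> 3" "norm (sincc (Complex x y)) \<le> 3"
proof -
  have x: "\<bar>x\<bar> = pi / 2" using assms(3) pi_gt_zero by arith
  show 1: "1 \<le> norm (Complex x y)"
    using abs_Re_le_cmod[of "Complex x y"] pi_ge_two x by simp
  show "norm (Complex x y) \<le> 3" using cmod_le[of "Complex x y"] pi_less_4 assms(1,2) x by simp
  have "norm (sin (Complex x y)) \<le> exp 1"
    using norm_sin_le[of "Complex x y"] assms by (auto intro: order_trans)
  also have "exp 1 \<le> (3::real)" by (rule exp_le)
  finally have "norm (sin (Complex x y)) / norm (Complex x y) \<le> 3 / 1"
    using 1 by (intro frac_le) auto
  thus "norm (sincc (Complex x y)) \<le> 3" using 1 by (auto simp: sincc_def norm_divide)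
qed

lemma LI_cong:
  assumes "\<And>x. \<bar>x\<bar> \<le> pi / 2 \<Longrightarrow> f (Complex x c) = g (Complex x c)"
  shows "LI c f = LI c g"
  unfolding LI_def by (rule integral_cong) (use assms in auto)

text \<open>A holomorphic weight moves the line of integration to the real axis at the price of the
  two vertical sides, where the cosine is at most 2 c.\<close>

lemma LI_to_real_axis:
  fixes g :: "complex \<Rightarrow> complex"
  assumes b: "\<And>x y. 0 \<le> y \<Longrightarrow> y \<le> 1 \<Longrightarrow> x = pi / 2 \<or> x = - (pi / 2) \<Longrightarrow> norm (g (Complex x y)) \<le> b"
    and cont: "continuous_on {z. 0 \<le> Im z} g"
    and hol: "\<And>z. 0 < Im z \<Longrightarrow> g field_differentiable at z"
  shows "\<exists>C\<ge>0. \<forall>n c. 0 < c \<longrightarrow> c \<le> 1 \<longrightarrow> real n * c\<^sup>2 = 1 \<longrightarrow>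
    norm (LI c (\<lambda>w. sincc w ^ 2 * cos w ^ n * g w) - LI 0 (\<lambda>w. sincc w ^ 2 * cos w ^ n * g w)) \<le> C * c ^ K"
proof -
  obtain C where C: "C \<ge> 0" "\<And>n c. 0 < c \<Longrightarrow> c \<le> 1 \<Longrightarrow> real n * c\<^sup>2 = 1 \<Longrightarrow> (2 * c) ^ n \<le> C * c ^ K"
    using side_power_superpoly by blast
  have b0: "0 \<le> b" using order_trans[OF norm_ge_zero b[of 0 "pi/2"]] by simp
  have "norm (LI c (\<lambda>w. sincc w ^ 2 * cos w ^ n * g w) - LI 0 (\<lambda>w. sincc w ^ 2 * cos w ^ n * g w)) \<le> (18 * b * C) * c ^ K"
    if c: "0 < c" "c \<le> 1" "real n * c\<^sup>2 = 1" for n c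
  proof -
    have side: "norm (sincc (Complex x y) ^ 2 * cos (Complex x y) ^ n * g (Complex x y)) \<le> 3 ^ 2 * (2 * c) ^ n * b"
      if "0 \<le> y" "y \<le> c" "x = pi / 2 \<or> x = - (pi / 2)" for x y
      unfolding norm_mult norm_power
      by (intro mult_mono power_mono norm_side norm_cos_side b) (use that c b0 in auto)
    have "norm (LI c (\<lambda>w. sincc w ^ 2 * cos w ^ n * g w) - LI 0 (\<lambda>w. sincc w ^ 2 * cos w ^ n * g w)) \<le> 2 * c * (3 ^ 2 * (2 * c) ^ n * b)"
    proof (rule LI_shift[OF c(1)])
      show "continuous_on (cbox (Complex (- (pi / 2)) 0) (Complex (pi / 2) c)) (\<lambda>w. (sincc w)\<^sup>2 * cos w ^ n * g w)"
        by (intro continuous_intros continuous_on_subset[OF cont]) (auto simp: in_cbox_complex_iff)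
      fix z assume "0 < Im z"
      have "sincc field_differentiable at z"
        using sincc_holomorphic[of UNIV] by (simp add: holomorphic_on_def)
      thus "(\<lambda>w. (sincc w)\<^sup>2 * cos w ^ n * g w) field_differentiable at z"
        by (intro derivative_intros hol \<open>0 < Im z\<close> field_differentiable_power field_differentiable_mult field_differentiable_at_cos)
    qed (use side in auto)
    also have "\<dots> = 18 * b * c * (2 * c) ^ n" by simp
    also have "\<dots> \<le> 18 * b * 1 * (C * c ^ K)"
      using C(2)[OF c] c b0 by (intro mult_mono) auto
    finally show ?thesis by simp
  qed
  moreover have "18 * b * C \<ge> 0" using b0 C by simp
  ultimately show ?thesis by blast
qed

lemma LI_0_real:
  assumes real: "\<And>x. g (of_real x) \<in> \<real>" and cont: "continuous_on UNIV g"
  shows "LI 0 g = of_real (integral {-(pi/2)..pi/2} (\<lambda>x. Re (g (of_real x))))"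
proof -
  have "g (Complex x 0) = of_real (Re (g (of_real x)))" for x
    using real[of x] by (simp add: complex_of_real_def[symmetric])
  moreover have "(\<lambda>x. Re (g (of_real x))) integrable_on {-(pi/2)..pi/2}"
    by (intro integrable_continuous_interval continuous_intros continuous_on_compose2[OF cont]) auto
  hence "((\<lambda>x. complex_of_real (Re (g (of_real x)))) has_integral complex_of_real (integral {-(pi/2)..pi/2} (\<lambda>x. Re (g (of_real x))))) {-(pi/2)..pi/2}"
    by (intro has_integral_of_real integrable_integral)
  ultimately show ?thesis unfolding LI_def by (simp add: integral_unique)
qed

section \<open>The summands u^r / sin u and the derivative of u / sin u\<close>

text \<open>Equivalent to 1 \<le> (1 - exp(-2y)) (1 + 1/y), which follows from exp(2y) \<ge> 1 + 2y.
  The factor 1 + 1/y accounts for the pole at 0.\<close>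

lemma inverse_sinh_le:
  fixes y :: real
  assumes "0 < y" shows "1 / sinh y \<le> 2 * exp (- y) * (1 + 1 / y)"
proof -
  have "1 + 2 * y \<le> exp (2 * y)" by (rule exp_ge_add_one_self)
  hence "exp (- (2 * y)) \<le> 1 / (1 + 2 * y)"
    using assms by (simp add: exp_minus field_simps)
  hence "1 - 1 / (1 + 2 * y) \<le> 1 - exp (- (2 * y))" by simp
  hence "(1 + 1 / y) * (1 - 1 / (1 + 2 * y)) \<le> (1 + 1 / y) * (1 - exp (- (2 * y)))"
    using assms by (intro mult_left_mono) auto
  moreover have "(1 + 1 / y) * (1 - 1 / (1 + 2 * y)) = 1 + 1 / (1 + 2 * y)"
  proof -
    have "1 + 2 * y \<noteq> 0" "y \<noteq> 0" using assms by auto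
    thus ?thesis by (simp add: divide_simps)
  qed
  hence "1 \<le> (1 + 1 / y) * (1 - 1 / (1 + 2 * y))"
    using assms by simp
  moreover have "sinh y * (2 * exp (- y)) = 1 - exp (- (2 * y))"
    by (simp add: sinh_field_def field_simps flip: exp_add)
  ultimately have "1 \<le> sinh y * (2 * exp (- y)) * (1 + 1 / y)" by (simp add: mult.commute)
  thus ?thesis using assms by (simp add: field_simps)
qed

lemma inverse_sin_le:
  assumes "0 < Im z"
  shows "1 / norm (sin z) \<le> 2 * exp (- Im z) * (1 + 1 / Im z)"
proof -
  have "1 / norm (sin z) \<le> 1 / sinh (Im z)"
    using assms norm_sin_ge_sinh[of z] by (intro divide_left_mono mult_pos_pos) auto
  thus ?thesis using inverse_sinh_le[OF assms] by linarith
qed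

lemma sincc_nonzero:
  assumes "z \<in> upper_domain" shows "sincc z \<noteq> 0"
proof
  assume 0: "sincc z = 0"
  hence "z \<noteq> 0" "sin z = 0" by (auto simp: sincc_def split: if_splits)
  then obtain k :: int where k: "z = of_real (of_int k * pi)" unfolding sin_eq_0 by blast
  hence "norm z < 3" using assms by (auto simp: upper_domain_def)
  hence "\<bar>of_int k\<bar> * pi < 3" by (simp add: k norm_mult)
  moreover have "k \<noteq> 0" using k \<open>z \<noteq> 0\<close> by auto
  hence "1 \<le> \<bar>real_of_int k\<bar>" by linarith
  hence "1 * pi \<le> \<bar>of_int k\<bar> * pi" by (intro mult_right_mono) auto
  ultimately show False using pi_gt3 by simp
qed

text \<open>For r \<ge> 1 this is u^r / sin u with the singularity at 0 removed. At u = H w it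
  equals w^r times the term of \<open>Lam\<close> for H.\<close>

definition psi :: "nat \<Rightarrow> complex \<Rightarrow> complex" where
  "psi r u = u ^ (r - 1) / sincc u"

lemma psi_eq: "1 \<le> r \<Longrightarrow> u \<noteq> 0 \<Longrightarrow> psi r u = u ^ r / sin u"
  by (cases r) (auto simp: psi_def sincc_def)

lemma decaying_psi:
  assumes r: "1 \<le> r" shows "decaying (psi r) r 2"
proof
  show "psi r holomorphic_on upper_domain"
    unfolding psi_def[abs_def] by (intro holomorphic_intros sincc_holomorphic) (auto simp: sincc_nonzero)
  fix u :: complex assume u: "0 < Im u"
  hence "norm (psi r u) = norm u ^ r * (1 / norm (sin u))"
    using r by (subst psi_eq) (auto simp: norm_divide norm_power)
  also have "\<dots> \<le> (1 + norm u) ^ r * (2 * exp (- Im u) * (1 + 1 / Im u) ^ 1)"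
    using u inverse_sin_le[OF u] by (intro mult_mono power_mono) auto
  also have "\<dots> \<le> (1 + norm u) ^ r * (2 * exp (- Im u) * (1 + 1 / Im u) ^ r)"
    using u r by (intro mult_left_mono power_increasing) auto
  finally show "norm (psi r u) \<le> 2 * (1 + norm u) ^ r * (1 + 1 / Im u) ^ r * exp (- Im u)"
    by (simp add: mult_ac)
qed

text \<open>Substitute for 1 / sin u in the case r = 0: that function has a pole at the start of the
  rays, whereas the derivative of u / sin u is regular there. Its sum over the ray is the derivative
  of \<open>w * Lam 0 a w\<close> (\<open>Lam0_has_derivative\<close>).\<close>

definition psi0 :: "complex \<Rightarrow> complex" where
  "psi0 = deriv (\<lambda>u. 1 / sincc u)"

lemma inverse_sincc_holomorphic: "(\<lambda>u. 1 / sincc u) holomorphic_on upper_domain"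
  by (intro holomorphic_intros sincc_holomorphic) (auto simp: sincc_nonzero)

lemma inverse_sincc_deriv: "u \<in> upper_domain \<Longrightarrow> ((\<lambda>u. 1 / sincc u) has_field_derivative psi0 u) (at u)"
  unfolding psi0_def by (rule holomorphic_derivI[OF inverse_sincc_holomorphic open_upper_domain])

lemma psi0_has_derivative:
  assumes "0 < Im u"
  shows "((\<lambda>u. u / sin u) has_field_derivative psi0 u) (at u)"
proof -
  have "u \<in> upper_domain" using assms by (simp add: upper_domain_def)
  from inverse_sincc_deriv[OF this] show ?thesis
    by (rule has_field_derivative_transform_within_open[of _ _ _ "{u. 0 < Im u}"])
      (use assms in \<open>auto simp: open_halfspace_Im_gt sincc_def\<close>)
qed

lemma psi0_eq:
  assumes "0 < Im u"
  shows "psi0 u = 1 / sin u - u * cos u / sin u ^ 2"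
proof -
  have "((\<lambda>u. u / sin u) has_field_derivative (1 / sin u - u * cos u / sin u ^ 2)) (at u)"
    using sin_nonzero_upper[OF assms]
    by (auto intro!: derivative_eq_intros simp: field_simps power2_eq_square)
  thus ?thesis using psi0_has_derivative[OF assms] DERIV_unique by blast
qed

lemma norm_cos_le_exp: "norm (cos z) \<le> exp \<bar>Im z\<bar>" for z :: complex
proof -
  have "norm (cos z) = norm (exp (\<i> * z) + exp (- (\<i> * z))) / 2"
    by (simp add: cos_exp_eq norm_divide)
  also have "\<dots> \<le> (exp (- Im z) + exp (Im z)) / 2"
    using norm_triangle_ineq[of "exp (\<i> * z)" "exp (- (\<i> * z))"] by (simp add: norm_exp_eq_Re)
  also have "\<dots> \<le> (exp \<bar>Im z\<bar> + exp \<bar>Im z\<bar>) / 2"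
    by (intro divide_right_mono add_mono) auto
  finally show ?thesis by simp
qed

lemma decaying_psi0: "decaying psi0 2 6"
proof
  show "psi0 holomorphic_on upper_domain"
    unfolding psi0_def by (rule holomorphic_deriv[OF inverse_sincc_holomorphic open_upper_domain])
  fix u :: complex assume u: "0 < Im u"
  define y where "y = Im u"
  define X where "X = 1 + 1 / y"
  define Y where "Y = 1 + norm u"
  have XY: "1 \<le> X" "1 \<le> Y" "norm u \<le> Y" using u by (auto simp: X_def Y_def y_def)
  have isin: "1 / norm (sin u) \<le> 2 * exp (- y) * X"
    using inverse_sin_le[OF u] by (simp add: X_def y_def)
  have "norm (psi0 u) \<le> norm (1 / sin u) + norm (u * cos u / sin u ^ 2)"
    unfolding psi0_eq[OF u] by (rule norm_triangle_ineq4)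
  also have "\<dots> = 1 / norm (sin u) + norm u * norm (cos u) * (1 / norm (sin u)) ^ 2"
    by (simp add: norm_divide norm_mult norm_power power_divide)
  also have "\<dots> \<le> 2 * exp (- y) * X + Y * exp y * (2 * exp (- y) * X) ^ 2"
    using XY isin norm_cos_le_exp[of u] u by (intro add_mono mult_mono power_mono) (auto simp: y_def)
  also have "\<dots> = 2 * exp (- y) * (X * 1) + 4 * exp (- y) * (X ^ 2 * Y)"
    by (simp add: power_mult_distrib power2_eq_square exp_minus)
  also have "\<dots> \<le> 2 * exp (- y) * (X ^ 2 * Y ^ 2) + 4 * exp (- y) * (X ^ 2 * Y ^ 2)"
  proof (intro add_mono mult_left_mono mult_mono)
    show "X \<le> X\<^sup>2" "Y \<le> Y\<^sup>2" using XY by (auto simp: power2_eq_square)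
    show "1 \<le> Y\<^sup>2" using XY by (simp add: one_le_power)
  qed (use XY in auto)
  finally show "norm (psi0 u) \<le> 6 * (1 + norm u) ^ 2 * (1 + 1 / Im u) ^ 2 * exp (- Im u)"
    by (simp add: X_def Y_def y_def mult_ac)
qed

lemma inverse_sincc_tendsto_0:
  assumes "0 < Im w"
  shows "(\<lambda>N. 1 / sincc (of_real (2 * real N) * w)) \<longlonglongrightarrow> 0"
proof (rule Lim_null_comparison)
  define c where "c = Im w"
  have c: "0 < c" using assms by (simp add: c_def)
  show "\<forall>\<^sub>F N in sequentially. norm (1 / sincc (of_real (2 * real N) * w)) \<le> 2 * real N * norm w * (2 * exp (- (2 * real N * c)) * (1 + 1 / c))"
    using eventually_gt_at_top[of 0]
  proof eventually_elim
    case (elim N)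
    let ?u = "of_real (2 * real N) * w"
    have im: "0 < Im ?u" using elim assms by simp
    have "?u \<noteq> 0" using im by (metis less_irrefl zero_complex.sel(2))
    hence "norm (1 / sincc ?u) = norm ?u * (1 / norm (sin ?u))"
      by (simp add: sincc_def norm_divide)
    also have "\<dots> \<le> norm ?u * (2 * exp (- Im ?u) * (1 + 1 / Im ?u))"
      by (intro mult_left_mono inverse_sin_le im) auto
    also have "\<dots> \<le> norm ?u * (2 * exp (- Im ?u) * (1 + 1 / c))"
    proof (intro mult_left_mono add_left_mono divide_left_mono)
      show "c \<le> Im ?u" using c elim by (simp add: c_def[symmetric])
    qed (use c im in auto)
    finally show ?case using elim by (simp add: norm_mult c_def)
  qed
  show "(\<lambda>N. 2 * real N * norm w * (2 * exp (- (2 * real N * c)) * (1 + 1 / c))) \<longlonglongrightarrow> 0"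
    using c by real_asymp
qed

section \<open>Moments as line integrals\<close>

definition Lam :: "nat \<Rightarrow> real \<Rightarrow> complex \<Rightarrow> complex" where
  "Lam r a w = (\<Sum>k. of_real ((2 * real k + a) ^ r) / sin (of_real (2 * real k + a) * w))"

lemma Lam_term_bound:
  assumes c: "0 < c" and a: "2 \<le> a" "a \<le> 3" and w: "Im w = c"
  shows "norm (of_real ((2 * real k + a) ^ r) / sin (of_real (2 * real k + a) * w))
     \<le> 2 * (1 + 1 / c) * ((2 / c) ^ r * fact r) * exp (- c) ^ k"
proof -
  define H where "H = 2 * real k + a"
  have H: "2 * real k \<le> H" "1 \<le> H" using a by (auto simp: H_def)
  have HI: "Im (of_real H * w) = H * c" using w by simp
  have pos: "0 < Im (of_real H * w)" unfolding HI using H c by simp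
  have "norm (of_real (H ^ r) / sin (of_real H * w)) = H ^ r * (1 / norm (sin (of_real H * w)))"
    using H by (simp add: norm_divide norm_power)
  also have "\<dots> \<le> H ^ r * (2 * exp (- (H * c)) * (1 + 1 / (H * c)))"
    using inverse_sin_le[OF pos] H unfolding HI by (intro mult_left_mono) auto
  also have "\<dots> \<le> H ^ r * (2 * exp (- (H * c)) * (1 + 1 / c))"
    using H c by (intro mult_left_mono add_left_mono divide_left_mono) auto
  also have "\<dots> = 2 * (1 + 1 / c) * ((2 / c) ^ r * ((H * c / 2) ^ r * exp (- (H * c))))"
    using c by (simp add: field_simps power_mult_distrib)
  also have "\<dots> \<le> 2 * (1 + 1 / c) * ((2 / c) ^ r * (fact r * exp (H * c / 2) * exp (- (H * c))))"
    using c H by (intro mult_left_mono mult_right_mono power_le_fact_exp) auto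
  also have "fact r * exp (H * c / 2) * exp (- (H * c)) = fact r * exp (- (H * c / 2))"
    by (simp add: mult.assoc flip: exp_add)
  also have "2 * (1 + 1 / c) * ((2 / c) ^ r * (fact r * exp (- (H * c / 2)))) \<le> 2 * (1 + 1 / c) * ((2 / c) ^ r * (fact r * exp (- c) ^ k))"
  proof (intro mult_left_mono)
    have "real k * c \<le> H / 2 * c" using H c by (intro mult_right_mono) auto
    thus "exp (- (H * c / 2)) \<le> exp (- c) ^ k" by (simp flip: exp_of_nat_mult)
  qed (use c in auto)
  finally show ?thesis by (simp add: H_def mult_ac)
qed

lemma geometric_exp_summable: "0 < c \<Longrightarrow> summable (\<lambda>k. A * exp (- c) ^ k)" for A c :: real
  by (intro summable_mult summable_geometric) auto

lemma Lam_uniform_limit: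
  assumes c: "0 < c" and a: "2 \<le> a" "a \<le> 3"
  shows "uniform_limit UNIV (\<lambda>N x. \<Sum>k<N. of_real ((2 * real k + a) ^ r) / sin (of_real (2 * real k + a) * Complex x c)) (\<lambda>x. Lam r a (Complex x c)) sequentially"
  unfolding Lam_def
  by (rule Weierstrass_m_test[OF _ geometric_exp_summable[OF c]])
    (rule Lam_term_bound[OF c a], simp)

lemma Lam_summable:
  assumes c: "0 < Im w" and a: "2 \<le> a" "a \<le> 3"
  shows "summable (\<lambda>k. of_real ((2 * real k + a) ^ r) / sin (of_real (2 * real k + a) * w))"
  by (rule summable_comparison_test'[OF geometric_exp_summable[OF c]]) (rule Lam_term_bound[OF c a refl])

lemma sin_line_nonzero: "0 < c \<Longrightarrow> 2 \<le> a \<Longrightarrow> sin (of_real (2 * real k + a) * Complex x c) \<noteq> 0"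
  by (rule sin_nonzero_upper) (simp add: add_nonneg_pos)

lemma continuous_on_Lam_line:
  assumes c: "0 < c" and a: "2 \<le> a" "a \<le> 3"
  shows "continuous_on UNIV (\<lambda>x. Lam r a (Complex x c))"
  by (rule uniform_limit_theorem[OF _ Lam_uniform_limit[OF c a]])
    (intro always_eventually allI continuous_intros ballI sin_line_nonzero, use assms in auto)

lemma LI_Lam_sums:
  assumes c: "0 < c" and a: "2 \<le> a" "a \<le> 3"
  shows "(\<lambda>k. LI c (\<lambda>w. phi n w * (of_real ((2 * real k + a) ^ r) / sin (of_real (2 * real k + a) * w)))) sums LI c (\<lambda>w. phi n w * Lam r a w)"
proof -
  let ?t = "\<lambda>k w. of_real ((2 * real k + a) ^ r) / sin (of_real (2 * real k + a) * w)"
  have cphi: "continuous_on A (\<lambda>x. phi n (Complex x c))" for A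
    unfolding phi_def by (intro continuous_intros)
  have "compact ((\<lambda>x. phi n (Complex x c)) ` {-(pi/2)..pi/2})"
    by (intro compact_continuous_image cphi) auto
  hence bnd: "bounded ((\<lambda>x. phi n (Complex x c)) ` {-(pi/2)..pi/2})" by (rule compact_imp_bounded)
  have bndL: "bounded ((\<lambda>x. Lam r a (Complex x c)) ` {-(pi/2)..pi/2})"
    by (intro compact_imp_bounded compact_continuous_image continuous_on_subset[OF continuous_on_Lam_line[OF c a]]) auto
  have "uniform_limit {-(pi/2)..pi/2} (\<lambda>N x. phi n (Complex x c) * (\<Sum>k<N. ?t k (Complex x c))) (\<lambda>x. phi n (Complex x c) * Lam r a (Complex x c)) sequentially"
    by (intro uniform_lim_mult uniform_limit_const bnd bndL uniform_limit_on_subset[OF Lam_uniform_limit[OF c a]]) auto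
  hence U: "uniform_limit {-(pi/2)..pi/2} (\<lambda>N x. \<Sum>k<N. phi n (Complex x c) * ?t k (Complex x c)) (\<lambda>x. phi n (Complex x c) * Lam r a (Complex x c)) sequentially"
    by (simp add: sum_distrib_left)
  have ct: "continuous_on A (\<lambda>x. phi n (Complex x c) * ?t k (Complex x c))" for k A
    by (intro continuous_intros cphi ballI sin_line_nonzero) (use assms in auto)
  have int: "(\<lambda>x. phi n (Complex x c) * ?t k (Complex x c)) integrable_on {-(pi/2)..pi/2}" for k
    by (intro integrable_continuous_interval ct)
  obtain I J where I: "\<And>N. ((\<lambda>x. \<Sum>k<N. phi n (Complex x c) * ?t k (Complex x c)) has_integral I N) {-(pi/2)..pi/2}"
    and J: "((\<lambda>x. phi n (Complex x c) * Lam r a (Complex x c)) has_integral J) {-(pi/2)..pi/2}"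
    and lim: "I \<longlonglongrightarrow> J"
    using uniform_limit_integral[OF U continuous_on_sum[OF ct] sequentially_bot] by blast
  have I_eq: "I = (\<lambda>N. \<Sum>k<N. LI c (\<lambda>w. phi n w * ?t k w))"
  proof
    show "I N = (\<Sum>k<N. LI c (\<lambda>w. phi n w * ?t k w))" for N
      using integral_unique[OF I[of N]] int by (simp add: LI_def integral_sum)
  qed
  have J_eq: "J = LI c (\<lambda>w. phi n w * Lam r a w)"
    using integral_unique[OF J] by (simp add: LI_def)
  show ?thesis
    unfolding sums_def I_eq[symmetric] J_eq[symmetric] by (rule lim)
qed

text \<open>Powers of h + 2 are taken because h + 2 is the multiplier of w in the kernel. The mean
  shifts by 2, and the variance is unaffected. The sum is not normalised by
  \<open>q n\<close>.\<close>

definition moment :: "nat \<Rightarrow> nat \<Rightarrow> real" where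
  "moment r n = (\<Sum>h\<le>n. (real h + 2) ^ r * qh n h)"

text \<open>The smallest H = h + 2 of the parity of n; heights of the other parity have probability
  zero.\<close>

definition offs :: "nat \<Rightarrow> nat" where "offs n = (if even n then 2 else 3)"

lemma moment_sums: "(\<lambda>h. (real h + 2) ^ r * qh n h) sums moment r n"
  unfolding moment_def by (rule sums_finite) (auto simp: qh_eq_0)

theorem moment_LI:
  assumes c: "0 < c"
  shows "moment r n = 2 / pi * Im (LI c (\<lambda>w. phi n w * Lam r (real (offs n)) w))"
proof -
  \<comment> \<open>Enumerates the heights of the parity of n, so that
    \<open>g k + 2 = 2 * k + offs n\<close>.\<close>
  define g where "g k = 2 * k + (offs n - 2)" for k
  have offs: "2 \<le> offs n" "offs n \<le> 3" "even (n + offs n)" by (auto simp: offs_def)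
  have "strict_mono g" by (auto simp: g_def strict_mono_def)
  moreover have "(real h + 2) ^ r * qh n h = 0" if "h \<notin> range g" for h
  proof -
    have "odd (n + h)"
    proof (rule ccontr)
      assume "\<not> odd (n + h)"
      hence "h = g (h div 2)" by (auto simp: g_def offs_def elim!: oddE evenE)
      thus False using that by blast
    qed
    thus ?thesis by (simp add: qh_odd)
  qed
  ultimately have "(\<lambda>k. (real (g k) + 2) ^ r * qh n (g k)) sums moment r n"
    using moment_sums[of r n] by (subst sums_mono_reindex)
  moreover have "(real (g k) + 2) ^ r * qh n (g k) =
      2 / pi * Im (LI c (\<lambda>w. phi n w * (of_real ((2 * real k + real (offs n)) ^ r) / sin (of_real (2 * real k + real (offs n)) * w))))" for k
  proof -
    define H where "H = 2 * k + offs n"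
    have H: "2 \<le> H" "even (n + H)" "g k = H - 2" using offs by (auto simp: H_def g_def)
    have Hr: "2 * real k + real (offs n) = real H" by (simp add: H_def)
    have "LI c (\<lambda>w. phi n w * (of_real (real H ^ r) / sin (of_real (real H) * w))) = of_real (real H ^ r) * LI c (\<lambda>w. phi n w / sin (of_nat H * w))"
      unfolding LI_def integral_mult_right[symmetric] by (simp add: mult_ac)
    thus ?thesis unfolding Hr using qh_LI[OF c H(1,2)] H by (simp add: of_nat_diff del: of_real_power)
  qed
  ultimately have "(\<lambda>k. 2 / pi * Im (LI c (\<lambda>w. phi n w * (of_real ((2 * real k + real (offs n)) ^ r) / sin (of_real (2 * real k + real (offs n)) * w))))) sums moment r n"
    by simp
  moreover have "(\<lambda>k. 2 / pi * Im (LI c (\<lambda>w. phi n w * (of_real ((2 * real k + real (offs n)) ^ r) / sin (of_real (2 * real k + real (offs n)) * w))))) sums (2 / pi * Im (LI c (\<lambda>w. phi n w * Lam r (real (offs n)) w)))"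
    using offs by (intro sums_mult sums_Im LI_Lam_sums c) auto
  ultimately show ?thesis using sums_unique2 by blast
qed

section \<open>The integrals of y^r / sinh y and the primitive along a ray\<close>

lemma erlang_has_integral:
  fixes m :: real
  assumes "0 < m"
  shows "((\<lambda>y. y ^ r * exp (- (m * y))) has_integral fact r / m ^ Suc r) {0..}"
proof -
  interpret prob_space "density lborel (erlang_density r m)"
    by (rule prob_space_erlang_density[OF assms])
  have "(\<integral>\<^sup>+y. ennreal (erlang_density r m y) \<partial>lborel) = ennreal 1"
    using emeasure_space_1 by (simp add: emeasure_density)
  moreover have "0 \<le> erlang_density r m y" for y
    using assms by (auto simp: erlang_density_def)
  ultimately have "(erlang_density r m has_integral 1) UNIV"
    by (intro nn_integral_has_integral) auto
  hence "((\<lambda>y. if y \<in> {0..} then m ^ Suc r * y ^ r * exp (- m * y) / fact r else 0) has_integral 1) UNIV"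
    by (rule has_integral_eq[rotated]) (auto simp: erlang_density_def)
  hence "((\<lambda>y. m ^ Suc r * y ^ r * exp (- m * y) / fact r) has_integral 1) {0..}"
    by (simp only: has_integral_restrict_UNIV)
  from has_integral_mult_right[OF this, of "fact r / m ^ Suc r"] assms show ?thesis
    by (simp add: field_simps)
qed

text \<open>The integral of y^r / sinh y over the half-line, defined by its series so that the zeta
  value can be read off.\<close>

definition sinh_mom :: "nat \<Rightarrow> real" where
  "sinh_mom r = 2 * fact r * (\<Sum>m. 1 / (2 * real m + 1) ^ Suc r)"

lemma summable_odd_powers: "1 \<le> r \<Longrightarrow> summable (\<lambda>m. 1 / (2 * real m + 1) ^ Suc r)"
proof (rule summable_comparison_test')
  show "summable (\<lambda>m. inverse (real (Suc m) ^ 2))"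
    using summable_Suc_iff[of "\<lambda>m. inverse (real m ^ 2)"] inverse_power_summable[of 2, where 'a = real] by simp
  fix m :: nat assume r: "1 \<le> r"
  have "real (Suc m) ^ 2 \<le> (2 * real m + 1) ^ 2" by (intro power_mono) auto
  also have "\<dots> \<le> (2 * real m + 1) ^ Suc r" using r by (intro power_increasing) auto
  finally have "real (Suc m) ^ 2 \<le> (2 * real m + 1) ^ Suc r" .
  hence "inverse ((2 * real m + 1) ^ Suc r) \<le> inverse (real (Suc m) ^ 2)"
    by (intro le_imp_inverse_le) auto
  thus "norm (1 / (2 * real m + 1) ^ Suc r) \<le> inverse (real (Suc m) ^ 2)"
    by (simp add: divide_inverse abs_mult power_abs)
qed

lemma inverse_sinh_sums:
  assumes "0 < y"
  shows "(\<lambda>m. 2 * exp (- ((2 * real m + 1) * y))) sums (1 / sinh y)"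
proof -
  have "(\<lambda>m. exp (- 2 * y) ^ m) sums (1 / (1 - exp (- 2 * y)))"
    using assms by (intro geometric_sums) auto
  hence "(\<lambda>m. 2 * exp (- y) * exp (- 2 * y) ^ m) sums (2 * exp (- y) * (1 / (1 - exp (- 2 * y))))"
    by (rule sums_mult)
  moreover have "2 * exp (- y) * (1 / (1 - exp (- 2 * y))) = 1 / sinh y"
  proof -
    have "2 * sinh y = exp y * (1 - exp (- 2 * y))"
      by (simp add: sinh_field_def right_diff_distrib flip: exp_add)
    moreover have "exp (- 2 * y) \<noteq> 1" using assms by simp
    ultimately show ?thesis using assms by (simp add: exp_minus divide_simps) (simp add: field_simps)
  qed
  moreover have "2 * exp (- y) * exp (- 2 * y) ^ m = 2 * exp (- ((2 * real m + 1) * y))" for m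
    by (simp add: algebra_simps flip: exp_of_nat_mult exp_add)
  ultimately show ?thesis by (simp only:)
qed

text \<open>1 / sinh y is a sum of odd exponentials; each term gives a Gamma integral, and monotone
  convergence justifies the exchange.\<close>

lemma sinh_mom_integral:
  assumes r: "1 \<le> r"
  shows "((\<lambda>y. y ^ r / sinh y) has_integral sinh_mom r) {0..}"
proof -
  define f where "f N y = (\<Sum>m<N. 2 * (y ^ r * exp (- ((2 * real m + 1) * y))))" for N y
  have fint: "(f N has_integral (\<Sum>m<N. 2 * (fact r / (2 * real m + 1) ^ Suc r))) {0..}" for N
    unfolding f_def[abs_def]
    by (intro has_integral_sum has_integral_mult_right erlang_has_integral) auto
  have lim: "(\<lambda>N. f N y) \<longlonglongrightarrow> y ^ r / sinh y" if "y \<in> {0..}" for y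
  proof (cases "y = 0")
    case False
    with that have "(\<lambda>m. y ^ r * (2 * exp (- ((2 * real m + 1) * y)))) sums (y ^ r * (1 / sinh y))"
      by (intro sums_mult inverse_sinh_sums) auto
    thus ?thesis by (simp add: sums_def f_def mult_ac)
  qed (use r in \<open>simp add: f_def power_0_left\<close>)
  have S: "(\<lambda>N. \<Sum>m<N. 2 * (fact r / (2 * real m + 1) ^ Suc r)) \<longlonglongrightarrow> sinh_mom r"
  proof -
    have "(\<lambda>m. 2 * fact r * (1 / (2 * real m + 1) ^ Suc r)) sums sinh_mom r"
      unfolding sinh_mom_def by (intro sums_mult summable_sums summable_odd_powers r)
    thus ?thesis by (simp add: sums_def)
  qed
  have "(\<lambda>y::real. y ^ r / sinh y) integrable_on {0..} \<and> (\<lambda>N. integral {0..} (f N)) \<longlonglongrightarrow> integral {0..} (\<lambda>y. y ^ r / sinh y)"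
  proof (rule monotone_convergence_increasing)
    show "f N integrable_on {0..}" for N using fint by blast
    show "f N y \<le> f (Suc N) y" if "y \<in> {0..}" for N y using that by (simp add: f_def)
    show "(\<lambda>N. f N y) \<longlonglongrightarrow> y ^ r / sinh y" if "y \<in> {0..}" for y using lim[OF that] .
    have "bounded (range (\<lambda>N. \<Sum>m<N. 2 * (fact r / (2 * real m + 1) ^ Suc r)))"
      using convergent_imp_bounded[of "\<lambda>N. \<Sum>m<N. 2 * (fact r / (2 * real m + 1) ^ Suc r)"] S by (auto simp: convergent_def)
    thus "bounded (range (\<lambda>N. integral {0..} (f N)))"
      using integral_unique[OF fint] by simp
  qed
  moreover have "(\<lambda>N. integral {0..} (f N)) \<longlonglongrightarrow> sinh_mom r"
    using S integral_unique[OF fint] by simp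
  ultimately show ?thesis
    using LIMSEQ_unique by (metis has_integral_integral)
qed

lemma starlike_upper_domain: "starlike upper_domain"
  unfolding starlike_def
proof (intro bexI[of _ 0] ballI subsetI)
  fix x y :: complex assume x: "x \<in> upper_domain" and y: "y \<in> closed_segment 0 x"
  from y obtain u where u: "0 \<le> u" "u \<le> 1" "y = of_real u * x"
    by (auto simp: closed_segment_def scaleR_conv_of_real)
  show "y \<in> upper_domain"
  proof (cases "x \<in> ball 0 3")
    case True
    hence "norm y \<le> 1 * norm x" using u by (simp only: norm_mult) (intro mult_right_mono, auto)
    thus ?thesis using True by (auto simp: upper_domain_def)
  next
    case False
    hence "0 < Im x" using x by (auto simp: upper_domain_def)
    thus ?thesis using u by (cases "u = 0") (auto simp: upper_domain_def)
  qed
qed (simp add: upper_domain_def)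

text \<open>On the imaginary axis, i psi(i t) = i^r t^r / sinh t, so the primitive tends to its
  value at 0 plus i^r S_r. A point 2 N w of another ray is joined to the axis by a horizontal
  segment of length O(N) on which psi is O(exp(-N c)), so the limit is the same.\<close>

lemma psi_primitive:
  assumes r: "1 \<le> r"
  shows "\<exists>\<Phi>. (\<forall>u\<in>upper_domain. (\<Phi> has_field_derivative psi r u) (at u)) \<and>
     (\<forall>w. 0 < Im w \<longrightarrow> Im w \<le> 1 \<longrightarrow> (\<lambda>N. \<Phi> (of_real (2 * real N) * w)) \<longlonglongrightarrow> \<Phi> 0 + \<i> ^ r * of_real (sinh_mom r))"
proof -
  interpret decaying "psi r" r 2 by (rule decaying_psi[OF r])
  have "\<exists>\<Phi>. \<forall>u\<in>upper_domain. (\<Phi> has_field_derivative psi r u) (at u)"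
    by (rule holomorphic_starlike_primitive[OF holomorphic_on_imp_continuous_on[OF holo] starlike_upper_domain open_upper_domain, of "{}"])
      (use holo open_upper_domain in \<open>auto simp: holomorphic_on_open field_differentiable_def\<close>)
  then obtain \<Phi> where \<Phi>: "\<And>u. u \<in> upper_domain \<Longrightarrow> (\<Phi> has_field_derivative psi r u) (at u)" by blast
  have "(\<lambda>N. \<Phi> (of_real (2 * real N) * w)) \<longlonglongrightarrow> \<Phi> 0 + \<i> ^ r * of_real (sinh_mom r)"
    if w: "0 < Im w" "Im w \<le> 1" for w
  proof -
    define c where "c = Im w"
    define Y where "Y N = 2 * real N * c" for N
    have c: "0 < c" "c \<le> 1" using w by (auto simp: c_def)
    have vert: "\<Phi> (\<i> * of_real y) = \<Phi> 0 + \<i> ^ r * of_real (integral {0..y} (\<lambda>y. y ^ r / sinh y))" if y: "0 \<le> y" for y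
    proof -
      have A: "((\<lambda>t. \<i> * psi r (\<i> * of_real t)) has_integral (\<Phi> (\<i> * of_real y) - \<Phi> (\<i> * of_real 0))) {0..y}"
      proof (rule fundamental_theorem_of_calculus[OF y])
        fix t assume t: "t \<in> {0..y}"
        have "\<i> * of_real t \<in> upper_domain" using t by (cases "t = 0") (auto simp: upper_domain_def)
        hence "(\<Phi> has_field_derivative psi r (\<i> * of_real t)) (at (\<i> * of_real t) within (\<lambda>t. \<i> * of_real t) ` {0..y})"
          by (rule has_field_derivative_at_within[OF \<Phi>])
        moreover have "((\<lambda>t. \<i> * of_real t) has_vector_derivative \<i>) (at t within {0..y})"
          by (auto intro!: derivative_eq_intros)
        ultimately show "((\<lambda>t. \<Phi> (\<i> * of_real t)) has_vector_derivative \<i> * psi r (\<i> * of_real t)) (at t within {0..y})"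
          using field_vector_diff_chain_within[of "\<lambda>t. \<i> * of_real t" \<i> t "{0..y}" \<Phi> "psi r (\<i> * of_real t)"]
          by (simp add: o_def)
      qed
      have B: "\<i> * psi r (\<i> * of_real t) = \<i> ^ r * of_real (t ^ r / sinh t)" if "t \<in> {0..y} - {0}" for t
      proof -
        have "t > 0" using that by auto
        moreover have "sin (\<i> * of_real t) = \<i> * of_real (sinh t)"
          using Re_sin[of "\<i> * of_real t"] Im_sin[of "\<i> * of_real t"] by (simp add: complex_eq_iff sinh_field_def)
        ultimately show ?thesis using r by (subst psi_eq) (auto simp: power_mult_distrib field_simps)
      qed
      have "((\<lambda>t. \<i> ^ r * of_real (t ^ r / sinh t)) has_integral (\<Phi> (\<i> * of_real y) - \<Phi> (\<i> * of_real 0))) {0..y}"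
        by (rule has_integral_spike_finite[of "{0}", OF _ _ A]) (simp, rule B[symmetric])
      moreover have "((\<lambda>t. \<i> ^ r * complex_of_real (t ^ r / sinh t)) has_integral (\<i> ^ r * complex_of_real (integral {0..y} (\<lambda>y. y ^ r / sinh y)))) {0..y}"
      proof (intro has_integral_mult_right has_integral_of_real integrable_integral)
        show "(\<lambda>t. t ^ r / sinh t) integrable_on {0..y}"
          using sinh_mom_integral[OF r] by (intro integrable_on_subinterval[of _ "{0..}"]) (auto simp: integrable_on_def)
      qed
      ultimately have "\<Phi> (\<i> * of_real y) - \<Phi> (\<i> * of_real 0) = \<i> ^ r * complex_of_real (integral {0..y} (\<lambda>y. y ^ r / sinh y))"
        by (rule has_integral_unique)
      thus ?thesis by (simp add: algebra_simps)
    qed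
    have "filterlim Y at_top sequentially"
      unfolding Y_def using c by real_asymp
    have "(\<lambda>N. integral {0..Y N} (\<lambda>y. y ^ r / sinh y)) \<longlonglongrightarrow> sinh_mom r"
    proof -
      let ?g = "\<lambda>y::real. y ^ r / sinh y"
      let ?f = "\<lambda>N y. if y \<in> {0..Y N} then ?g y else 0"
      have gi: "?g integrable_on {0..}" using sinh_mom_integral[OF r] by blast
      have fi: "?f N integrable_on {0..}" "integral {0..} (?f N) = integral {0..Y N} ?g" for N
      proof -
        have "?g integrable_on {0..Y N}" using gi by (rule integrable_on_subinterval) auto
        moreover have "{0..} \<inter> {0..Y N} = {0..Y N}" by auto
        ultimately show "?f N integrable_on {0..}" "integral {0..} (?f N) = integral {0..Y N} ?g"
          using integrable_restrict_Int[of "{0..Y N}" ?g "{0..}"] integral_restrict_Int[of "{0..}" "{0..Y N}" ?g] by auto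
      qed
      have "(\<lambda>N. integral {0..} (?f N)) \<longlonglongrightarrow> integral {0..} ?g"
      proof (rule dominated_convergence(2)[OF fi(1) gi])
        show "norm (?f N y) \<le> ?g y" if "y \<in> {0..}" for N y using that by auto
        show "(\<lambda>N. ?f N y) \<longlonglongrightarrow> ?g y" if "y \<in> {0..}" for y
        proof (rule tendsto_eventually)
          have "eventually (\<lambda>N. y \<le> Y N) sequentially"
            using \<open>filterlim Y at_top sequentially\<close> by (simp add: filterlim_at_top)
          thus "eventually (\<lambda>N. ?f N y = ?g y) sequentially" by eventually_elim (use that in auto)
        qed
      qed
      thus ?thesis unfolding fi(2) using integral_unique[OF sinh_mom_integral[OF r]] by simp
    qed
    hence "(\<lambda>N. \<Phi> 0 + \<i> ^ r * complex_of_real (integral {0..Y N} (\<lambda>y. y ^ r / sinh y))) \<longlonglongrightarrow> \<Phi> 0 + \<i> ^ r * of_real (sinh_mom r)"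
      by (intro tendsto_intros)
    moreover have "\<Phi> (\<i> * of_real (Y N)) = \<Phi> 0 + \<i> ^ r * complex_of_real (integral {0..Y N} (\<lambda>y. y ^ r / sinh y))" for N
      by (rule vert) (use c in \<open>simp add: Y_def\<close>)
    ultimately have lim1: "(\<lambda>N. \<Phi> (\<i> * of_real (Y N))) \<longlonglongrightarrow> \<Phi> 0 + \<i> ^ r * of_real (sinh_mom r)"
      by (simp only:)
    have lim2: "(\<lambda>N. \<Phi> (of_real (2 * real N) * w) - \<Phi> (\<i> * of_real (Y N))) \<longlonglongrightarrow> 0"
    proof (rule Lim_null_comparison)
      define B where "B = 2 * ray_const * (norm w / c) ^ r * (1 + 1 / c) ^ r"
      show "(\<lambda>N. B * exp (- real N * c) * (2 * real N * norm w)) \<longlonglongrightarrow> 0"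
        using c by real_asymp
      show "\<forall>\<^sub>F N in sequentially. norm (\<Phi> (of_real (2 * real N) * w) - \<Phi> (\<i> * of_real (Y N))) \<le> B * exp (- real N * c) * (2 * real N * norm w)"
        using eventually_gt_at_top[of 0]
      proof eventually_elim
        case (elim N)
        define u where "u = of_real (2 * real N) * w"
        have Yc: "c \<le> Y N" using elim c by (simp add: Y_def)
        have Imu: "Im u = Y N" by (simp add: u_def Y_def c_def)
        have "norm (\<Phi> u - \<Phi> (\<i> * of_real (Y N))) \<le> (B * exp (- real N * c)) * norm (u - \<i> * of_real (Y N))"
        proof (rule field_differentiable_bound[of "closed_segment (\<i> * of_real (Y N)) u"])
          fix z assume "z \<in> closed_segment (\<i> * of_real (Y N)) u"
          then obtain t where t: "0 \<le> t" "t \<le> 1" "z = (1 - t) *\<^sub>R (\<i> * of_real (Y N)) + t *\<^sub>R u"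
            by (auto simp: closed_segment_def)
          have Imz: "Im z = Y N" unfolding t(3) by (simp add: Imu algebra_simps)
          have "\<bar>Re z\<bar> = t * \<bar>Re u\<bar>" unfolding t(3) using t by (simp add: abs_mult)
          hence "\<bar>Re z\<bar> \<le> \<bar>Re u\<bar>" using t by (simp add: mult_left_le_one_le)
          hence "(norm z)\<^sup>2 \<le> (norm u)\<^sup>2" using Imz Imu by (simp add: cmod_power2 abs_le_square_iff)
          hence nz: "norm z \<le> norm u" by (rule power2_le_imp_le) simp
          show "(\<Phi> has_field_derivative psi r z) (at z within closed_segment (\<i> * of_real (Y N)) u)"
            using Imz Yc c by (intro has_field_derivative_at_within[OF \<Phi>]) (auto simp: upper_domain_def)
          have "norm (psi r z) \<le> 2 * (1 + norm z) ^ r * (1 + 1 / Im z) ^ r * exp (- Im z)"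
            using Imz Yc c by (intro bound) auto
          also have "\<dots> \<le> 2 * (1 + norm u) ^ r * (1 + 1 / c) ^ r * exp (- Im u)"
            using Imz Imu Yc c nz by (intro mult_mono power_mono add_left_mono divide_left_mono) auto
          also have "\<dots> = 2 * (1 + 1 / c) ^ r * ((1 + norm u) ^ r * exp (- Im u))"
            by (simp add: mult_ac)
          also have "\<dots> \<le> 2 * (1 + 1 / c) ^ r * (ray_const * (norm w / c) ^ r * exp (- real N * c))"
            unfolding u_def using c by (intro mult_left_mono ray_decay) (auto simp: c_def)
          finally show "norm (psi r z) \<le> B * exp (- real N * c)"
            by (simp add: B_def mult_ac)
        qed auto
        also have "u - \<i> * of_real (Y N) = of_real (2 * real N * Re w)"
          by (simp add: u_def complex_eq_iff Y_def c_def)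
        also have "norm \<dots> \<le> 2 * real N * norm w"
          using abs_Re_le_cmod[of w] by (simp add: norm_mult mult_left_mono)
        hence "(B * exp (- real N * c)) * norm (complex_of_real (2 * real N * Re w)) \<le> (B * exp (- real N * c)) * (2 * real N * norm w)"
          using c ray_const_nonneg by (intro mult_left_mono) (auto simp: B_def)
        finally show ?case by (simp add: u_def)
      qed
    qed
    from tendsto_add[OF lim2 lim1] show ?thesis by simp
  qed
  with \<Phi> show ?thesis by blast
qed

section \<open>Expansion of the moments for r \<ge> 1\<close>

definition em_error_exp :: "nat \<Rightarrow> nat \<Rightarrow> nat" where
  "em_error_exp r K = Suc K + (2 * r + K)"

lemma Complex_line_nonzero: "c \<noteq> 0 \<Longrightarrow> Complex x c \<noteq> 0"
  by (simp add: complex_eq_iff)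

text \<open>Euler-Maclaurin for \<open>psi r\<close>, divided by 2 w^(r+1). Dividing by the smaller
  c^(r+1) in the error term leaves all further dependence on w in the power of norm w / c.\<close>

lemma Lam_expansion:
  assumes r: "1 \<le> r" and K: "1 \<le> K" and a: "2 \<le> a" "a \<le> 3"
  shows "\<exists>C\<ge>0. \<forall>c x. 0 < c \<longrightarrow> c \<le> 1 \<longrightarrow>
     norm (Lam r a (Complex x c) - (\<i> ^ r * of_real (sinh_mom r)
         - (\<Sum>j\<in>{1..<K}. of_real (em_coeff a j) * Complex x c ^ j * (deriv ^^ (j - 1)) (psi r) 0)) / (2 * Complex x c ^ Suc r))
      \<le> C * (c ^ Suc K / c ^ (r + 2)) * (norm (Complex x c) / c) ^ em_error_exp r K"
proof -
  interpret decaying "psi r" r 2 by (rule decaying_psi[OF r])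
  obtain \<Phi> where \<Phi>: "\<And>u. u \<in> upper_domain \<Longrightarrow> (\<Phi> has_field_derivative psi r u) (at u)"
    "\<And>w. 0 < Im w \<Longrightarrow> Im w \<le> 1 \<Longrightarrow> (\<lambda>N. \<Phi> (of_real (2 * real N) * w)) \<longlonglongrightarrow> \<Phi> 0 + \<i> ^ r * of_real (sinh_mom r)"
    using psi_primitive[OF r] by blast
  have a': "0 \<le> a" using a by simp
  obtain C where C: "C \<ge> 0" "\<And>c w L. 0 < c \<Longrightarrow> c \<le> 1 \<Longrightarrow> Im w = c \<Longrightarrow> (\<lambda>N. \<Phi> (of_real (2 * real N) * w)) \<longlonglongrightarrow> L \<Longrightarrow>
    norm (2 * w * (\<Sum>k. psi r (of_real (2 * real k + a) * w)) - (L - \<Phi> 0)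
       + (\<Sum>j\<in>{1..<K}. of_real (em_coeff a j) * w ^ j * (deriv ^^ (j - 1)) (psi r) 0))
    \<le> C * norm w ^ Suc K * (norm w / c) ^ (2 * r + K) / c"
    using euler_maclaurin[OF \<Phi>(1) a' a(2) K] by blast
  have "norm (Lam r a w - (\<i> ^ r * of_real (sinh_mom r)
         - (\<Sum>j\<in>{1..<K}. of_real (em_coeff a j) * w ^ j * (deriv ^^ (j - 1)) (psi r) 0)) / (2 * w ^ Suc r))
      \<le> C * (c ^ Suc K / c ^ (r + 2)) * (norm w / c) ^ em_error_exp r K"
    if c: "0 < c" "c \<le> 1" and w: "w = Complex x c" for c x w
  proof -
    have w0: "w \<noteq> 0" "Im w = c" using c by (auto simp: w Complex_line_nonzero)
    define S where "S = (\<Sum>j\<in>{1..<K}. of_real (em_coeff a j) * w ^ j * (deriv ^^ (j - 1)) (psi r) 0)"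
    have "psi r (of_real (2 * real k + a) * w) = w ^ r * (of_real ((2 * real k + a) ^ r) / sin (of_real (2 * real k + a) * w))" for k
    proof -
      have "complex_of_real (2 * real k + a) \<noteq> 0" unfolding of_real_eq_0_iff using a by linarith
      hence "of_real (2 * real k + a) * w \<noteq> 0" using w0 by simp
      from psi_eq[OF r this] show ?thesis
        by (simp only: power_mult_distrib of_real_power) (simp only: times_divide_eq_right mult_ac)
    qed
    hence "(\<Sum>k. psi r (of_real (2 * real k + a) * w)) = w ^ r * Lam r a w"
      unfolding Lam_def using Lam_summable[of w a r] w0 c a by (simp only: suminf_mult)
    hence L: "2 * w * (\<Sum>k. psi r (of_real (2 * real k + a) * w)) = 2 * w ^ Suc r * Lam r a w"
      by simp
    have "norm (2 * w ^ Suc r * Lam r a w - (\<Phi> 0 + \<i> ^ r * of_real (sinh_mom r) - \<Phi> 0) + S) \<le> C * norm w ^ Suc K * (norm w / c) ^ (2 * r + K) / c"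
      unfolding L[symmetric] S_def by (rule C(2)) (use c w0 \<Phi>(2) in auto)
    also have "2 * w ^ Suc r * Lam r a w - (\<Phi> 0 + \<i> ^ r * of_real (sinh_mom r) - \<Phi> 0) + S =
        2 * w ^ Suc r * (Lam r a w - (\<i> ^ r * of_real (sinh_mom r) - S) / (2 * w ^ Suc r))"
    proof -
      have "A * l - (p + t - p) + s = A * (l - (t - s) / A)" if "A \<noteq> 0" for A l p t s :: complex
        using that by (simp add: field_simps)
      thus ?thesis using w0 by simp
    qed
    finally have 1: "2 * norm w ^ Suc r * norm (Lam r a w - (\<i> ^ r * of_real (sinh_mom r) - S) / (2 * w ^ Suc r)) \<le> C * norm w ^ Suc K * (norm w / c) ^ (2 * r + K) / c"
      by (simp only: norm_mult norm_power norm_numeral)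
    have cw: "c \<le> norm w" using abs_Im_le_cmod[of w] w0 c by simp
    have "1 * c ^ Suc r \<le> 2 * norm w ^ Suc r"
      using cw c by (intro mult_mono power_mono) auto
    hence "c ^ Suc r * norm (Lam r a w - (\<i> ^ r * of_real (sinh_mom r) - S) / (2 * w ^ Suc r)) \<le> 
       2 * norm w ^ Suc r * norm (Lam r a w - (\<i> ^ r * of_real (sinh_mom r) - S) / (2 * w ^ Suc r))"
      by (intro mult_right_mono) auto
    also note 1
    also have "C * norm w ^ Suc K * (norm w / c) ^ (2 * r + K) / c = C * c ^ Suc K * (norm w / c) ^ em_error_exp r K / c"
    proof -
      have "norm w ^ Suc K = c ^ Suc K * (norm w / c) ^ Suc K"
        using c by (simp del: power_Suc flip: power_mult_distrib)
      thus ?thesis unfolding em_error_exp_def power_add by (simp only: mult.assoc)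
    qed
    finally have "norm (Lam r a w - (\<i> ^ r * of_real (sinh_mom r) - S) / (2 * w ^ Suc r)) \<le> C * c ^ Suc K * (norm w / c) ^ em_error_exp r K / c / c ^ Suc r"
      using c by (simp add: pos_le_divide_eq mult.commute)
    thus ?thesis using c by (simp add: S_def)
  qed
  with C(1) show ?thesis by blast
qed

lemma LI_integrable:
  fixes f :: "complex \<Rightarrow> complex"
  shows "continuous_on UNIV (\<lambda>x. f (Complex x c)) \<Longrightarrow> (\<lambda>x. f (Complex x c)) integrable_on {-(pi/2)..pi/2}"
  by (intro integrable_continuous_interval) (auto intro: continuous_on_subset)

lemma LI_add:
  assumes "continuous_on UNIV (\<lambda>x. f (Complex x c))" "continuous_on UNIV (\<lambda>x. g (Complex x c))"
  shows "LI c (\<lambda>w. f w + g w) = LI c f + LI c g"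
  unfolding LI_def by (intro integral_add LI_integrable assms)

lemma LI_diff:
  assumes "continuous_on UNIV (\<lambda>x. f (Complex x c))" "continuous_on UNIV (\<lambda>x. g (Complex x c))"
  shows "LI c (\<lambda>w. f w - g w) = LI c f - LI c g"
  unfolding LI_def by (intro integral_diff LI_integrable assms)

lemma LI_cmult: "LI c (\<lambda>w. a * f w) = a * LI c f"
  unfolding LI_def by simp

lemma LI_sum:
  assumes "finite A" "\<And>i. i \<in> A \<Longrightarrow> continuous_on UNIV (\<lambda>x. f i (Complex x c))"
  shows "LI c (\<lambda>w. \<Sum>i\<in>A. f i w) = (\<Sum>i\<in>A. LI c (f i))"
  unfolding LI_def by (intro integral_sum LI_integrable assms)

lemma continuous_on_phi_line: "continuous_on A (\<lambda>x. phi n (Complex x c))"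
  unfolding phi_def by (intro continuous_intros)

lemma offs_range: "2 \<le> real (offs n)" "real (offs n) \<le> 3"
  by (auto simp: offs_def)

text \<open>\<open>Lam_expansion\<close> is inserted into \<open>moment_LI\<close>;
  \<open>LI_bound\<close> contributes c^3 to the error. The parity of n decides between a = 2 and a
  = 3, so the larger of the two constants is taken.\<close>

theorem moment_expansion:
  assumes r: "1 \<le> r" and K: "1 \<le> K"
  shows "\<exists>C\<ge>0. \<forall>n c. 0 < c \<longrightarrow> c \<le> 1 \<longrightarrow> real n * c\<^sup>2 = 1 \<longrightarrow>
    \<bar>moment r n - 1 / pi * Im (\<i> ^ r * of_real (sinh_mom r) * LI c (\<lambda>w. phi n w * (1 / w ^ Suc r))
       - (\<Sum>j\<in>{1..<K}. of_real (em_coeff (real (offs n)) j) * (deriv ^^ (j - 1)) (psi r) 0 * LI c (\<lambda>w. phi n w * (w ^ j / w ^ Suc r))))\<bar>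
     \<le> C * (c ^ (K + 4) / c ^ (r + 2))"
proof -
  obtain C2 C3 where C2: "C2 \<ge> 0" "C3 \<ge> 0" "\<And>c x a. 0 < c \<Longrightarrow> c \<le> 1 \<Longrightarrow> a = 2 \<Longrightarrow>
     norm (Lam r a (Complex x c) - (\<i> ^ r * of_real (sinh_mom r)
         - (\<Sum>j\<in>{1..<K}. of_real (em_coeff a j) * Complex x c ^ j * (deriv ^^ (j - 1)) (psi r) 0)) / (2 * Complex x c ^ Suc r))
      \<le> C2 * (c ^ Suc K / c ^ (r + 2)) * (norm (Complex x c) / c) ^ em_error_exp r K"
    "\<And>c x a. 0 < c \<Longrightarrow> c \<le> 1 \<Longrightarrow> a = 3 \<Longrightarrow>
     norm (Lam r a (Complex x c) - (\<i> ^ r * of_real (sinh_mom r)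
         - (\<Sum>j\<in>{1..<K}. of_real (em_coeff a j) * Complex x c ^ j * (deriv ^^ (j - 1)) (psi r) 0)) / (2 * Complex x c ^ Suc r))
      \<le> C3 * (c ^ Suc K / c ^ (r + 2)) * (norm (Complex x c) / c) ^ em_error_exp r K"
    using Lam_expansion[OF r K, of 2] Lam_expansion[OF r K, of 3] by auto
  define C where "C = max C2 C3"
  have C: "C \<ge> 0" using C2 by (simp add: C_def)
  obtain D where D: "D \<ge> 0" "\<And>n c B g. 0 < c \<Longrightarrow> c \<le> 1 \<Longrightarrow> real n * c\<^sup>2 = 1 \<Longrightarrow> 0 \<le> B \<Longrightarrow>
     continuous_on UNIV (\<lambda>x. g (Complex x c)) \<Longrightarrow>
     (\<And>x. \<bar>x\<bar> \<le> pi/2 \<Longrightarrow> norm (g (Complex x c)) \<le> B * (norm (Complex x c) / c) ^ em_error_exp r K) \<Longrightarrow>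
     norm (LI c (\<lambda>w. phi n w * g w)) \<le> D * B * c ^ 3"
    using LI_bound[of "em_error_exp r K"] by blast
  have "\<bar>moment r n - 1 / pi * Im (\<i> ^ r * of_real (sinh_mom r) * LI c (\<lambda>w. phi n w * (1 / w ^ Suc r))
       - (\<Sum>j\<in>{1..<K}. of_real (em_coeff (real (offs n)) j) * (deriv ^^ (j - 1)) (psi r) 0 * LI c (\<lambda>w. phi n w * (w ^ j / w ^ Suc r))))\<bar>
     \<le> (D * C) * (c ^ (K + 4) / c ^ (r + 2))" if c: "0 < c" "c \<le> 1" "real n * c\<^sup>2 = 1" for n c
  proof -
    define a where "a = real (offs n)"
    define \<beta> where "\<beta> j = of_real (em_coeff a j) * (deriv ^^ (j - 1)) (psi r) 0" for j
    define \<sigma> :: complex where "\<sigma> = \<i> ^ r * of_real (sinh_mom r)"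
    define M where "M w = (\<sigma> - (\<Sum>j\<in>{1..<K}. \<beta> j * w ^ j)) / (2 * w ^ Suc r)" for w
    define E where "E w = Lam r a w - M w" for w
    have M_eq: "M w = (\<sigma> - (\<Sum>j\<in>{1..<K}. of_real (em_coeff a j) * w ^ j * (deriv ^^ (j - 1)) (psi r) 0)) / (2 * w ^ Suc r)" for w
      by (simp add: M_def \<beta>_def mult_ac)
    have a23: "a = 2 \<or> a = 3" by (auto simp: a_def offs_def)
    have Eb: "norm (E (Complex x c)) \<le> (C * (c ^ Suc K / c ^ (r + 2))) * (norm (Complex x c) / c) ^ em_error_exp r K" for x
    proof -
      have "norm (E (Complex x c)) \<le> C2 * (c ^ Suc K / c ^ (r + 2)) * (norm (Complex x c) / c) ^ em_error_exp r K \<or>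
            norm (E (Complex x c)) \<le> C3 * (c ^ Suc K / c ^ (r + 2)) * (norm (Complex x c) / c) ^ em_error_exp r K"
        using a23 C2(3,4)[OF c(1,2), of a x] unfolding E_def M_eq \<sigma>_def by blast
      moreover have pos: "0 \<le> c ^ Suc K / c ^ (r + 2)" "0 \<le> (norm (Complex x c) / c) ^ em_error_exp r K"
        using c by auto
      have "C2 * (c ^ Suc K / c ^ (r + 2)) * (norm (Complex x c) / c) ^ em_error_exp r K \<le> C * (c ^ Suc K / c ^ (r + 2)) * (norm (Complex x c) / c) ^ em_error_exp r K"
        "C3 * (c ^ Suc K / c ^ (r + 2)) * (norm (Complex x c) / c) ^ em_error_exp r K \<le> C * (c ^ Suc K / c ^ (r + 2)) * (norm (Complex x c) / c) ^ em_error_exp r K"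
        by (intro mult_right_mono pos, simp add: C_def)+
      ultimately show ?thesis by linarith
    qed
    have nz: "Complex x c \<noteq> 0" for x using c by (simp add: Complex_line_nonzero)
    have contL: "continuous_on UNIV (\<lambda>x. Lam r a (Complex x c))"
      unfolding a_def by (rule continuous_on_Lam_line[OF c(1) offs_range])
    have contM: "continuous_on UNIV (\<lambda>x. M (Complex x c))"
      unfolding M_def by (intro continuous_intros) (use nz in auto)
    have contE: "continuous_on UNIV (\<lambda>x. E (Complex x c))"
      unfolding E_def by (intro continuous_intros contL contM)
    have "LI c (\<lambda>w. phi n w * Lam r a w) = LI c (\<lambda>w. phi n w * M w + phi n w * E w)"
      by (simp add: E_def ring_distribs)
    also have "\<dots> = LI c (\<lambda>w. phi n w * M w) + LI c (\<lambda>w. phi n w * E w)"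
      by (intro LI_add continuous_intros continuous_on_phi_line contM contE)
    also have "LI c (\<lambda>w. phi n w * M w) = LI c (\<lambda>w. \<sigma> / 2 * (phi n w * (1 / w ^ Suc r)) - (\<Sum>j\<in>{1..<K}. \<beta> j / 2 * (phi n w * (w ^ j / w ^ Suc r))))"
      unfolding M_def by (simp add: diff_divide_distrib right_diff_distrib sum_divide_distrib sum_distrib_left mult_ac del: power_Suc)
    also have "\<dots> = \<sigma> / 2 * LI c (\<lambda>w. phi n w * (1 / w ^ Suc r)) - (\<Sum>j\<in>{1..<K}. \<beta> j / 2 * LI c (\<lambda>w. phi n w * (w ^ j / w ^ Suc r)))"
    proof -
      have c1: "continuous_on UNIV (\<lambda>x. \<sigma> / 2 * (phi n (Complex x c) * (1 / Complex x c ^ Suc r)))"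
        by (intro continuous_intros continuous_on_phi_line) (use nz in auto)
      have c2: "continuous_on UNIV (\<lambda>x. \<beta> j / 2 * (phi n (Complex x c) * (Complex x c ^ j / Complex x c ^ Suc r)))" for j
        by (intro continuous_intros continuous_on_phi_line) (use nz in auto)
      show ?thesis
        unfolding LI_diff[OF c1 continuous_on_sum[OF c2]] LI_sum[OF finite_atLeastLessThan c2] LI_cmult ..
    qed
    also have "\<dots> = (\<sigma> * LI c (\<lambda>w. phi n w * (1 / w ^ Suc r)) - (\<Sum>j\<in>{1..<K}. \<beta> j * LI c (\<lambda>w. phi n w * (w ^ j / w ^ Suc r)))) / 2"
      by (simp add: diff_divide_distrib sum_divide_distrib)
    finally have LIeq: "LI c (\<lambda>w. phi n w * Lam r a w) =
       (\<sigma> * LI c (\<lambda>w. phi n w * (1 / w ^ Suc r)) - (\<Sum>j\<in>{1..<K}. \<beta> j * LI c (\<lambda>w. phi n w * (w ^ j / w ^ Suc r)))) / 2 + LI c (\<lambda>w. phi n w * E w)" .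
    have "moment r n = 2 / pi * Im (LI c (\<lambda>w. phi n w * Lam r a w))"
      unfolding a_def by (rule moment_LI[OF c(1)])
    hence "moment r n - 1 / pi * Im (\<sigma> * LI c (\<lambda>w. phi n w * (1 / w ^ Suc r)) - (\<Sum>j\<in>{1..<K}. \<beta> j * LI c (\<lambda>w. phi n w * (w ^ j / w ^ Suc r))))
        = 2 / pi * Im (LI c (\<lambda>w. phi n w * E w))"
    proof -
      have "2 / pi * Im (X / 2 + Y) - 1 / pi * Im X = 2 / pi * Im Y" for X Y
        by (simp add: field_simps)
      moreover assume "moment r n = 2 / pi * Im (LI c (\<lambda>w. phi n w * Lam r a w))"
      ultimately show ?thesis unfolding LIeq by presburger
    qed
    moreover have "\<bar>2 / pi * Im (LI c (\<lambda>w. phi n w * E w))\<bar> \<le> 1 * norm (LI c (\<lambda>w. phi n w * E w))"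
      unfolding abs_mult using pi_gt3 by (intro mult_mono abs_Im_le_cmod) auto
    moreover have "norm (LI c (\<lambda>w. phi n w * E w)) \<le> D * (C * (c ^ Suc K / c ^ (r + 2))) * c ^ 3"
      by (rule D(2)[OF c _ contE Eb]) (use C c in auto)
    moreover have "D * (C * (c ^ Suc K / c ^ (r + 2))) * c ^ 3 = (D * C) * (c ^ (K + 4) / c ^ (r + 2))"
      by (simp add: power_add eval_nat_numeral)
    ultimately show ?thesis unfolding \<sigma>_def \<beta>_def a_def by linarith
  qed
  moreover have "D * C \<ge> 0" using C D by simp
  ultimately show ?thesis by blast
qed

section \<open>Real boundary terms and the first moment\<close>

text \<open>Conjugating both argument and value maps f to itself on the disc and commutes with
  differentiation. At the fixed point 0 this makes all derivatives real.\<close>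

lemma higher_deriv_symmetric:
  assumes "f holomorphic_on ball 0 \<rho>" "\<And>z. z \<in> ball 0 \<rho> \<Longrightarrow> f (cnj z) = cnj (f z)" "z \<in> ball 0 \<rho>"
  shows "(deriv ^^ i) f (cnj z) = cnj ((deriv ^^ i) f z)"
  using assms(3)
proof (induction i arbitrary: z)
  case (Suc i)
  let ?g = "(deriv ^^ i) f"
  have hol: "?g holomorphic_on ball 0 \<rho>" by (intro holomorphic_higher_deriv assms) auto
  have cz: "cnj z \<in> ball 0 \<rho>" using Suc.prems by simp
  have "(cnj \<circ> ?g \<circ> cnj has_field_derivative cnj (deriv ?g (cnj z))) (at z)"
    by (intro has_field_derivative_cnj_cnj holomorphic_derivI[OF hol _ cz]) auto
  hence "(?g has_field_derivative cnj (deriv ?g (cnj z))) (at z)"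
    by (rule has_field_derivative_transform_within_open[of _ _ _ "ball 0 \<rho>"])
      (use Suc.IH Suc.prems in auto)
  hence "deriv ?g z = cnj (deriv ?g (cnj z))" by (rule DERIV_imp_deriv)
  thus ?case by simp
qed (use assms in simp)

lemma higher_deriv_real:
  assumes "f holomorphic_on ball 0 \<rho>" "\<And>z. z \<in> ball 0 \<rho> \<Longrightarrow> f (cnj z) = cnj (f z)" "0 < \<rho>"
  shows "Im ((deriv ^^ i) f 0) = 0"
proof -
  have "(deriv ^^ i) f (cnj 0) = cnj ((deriv ^^ i) f 0)"
    by (rule higher_deriv_symmetric[OF assms(1,2)]) (use assms(3) in auto)
  thus ?thesis by (simp add: complex_eq_iff)
qed

lemma sincc_cnj: "sincc (cnj z) = cnj (sincc z)"
  by (simp add: sincc_def cnj_sin)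

lemma ball_subset_upper_domain: "ball 0 3 \<subseteq> upper_domain"
  by (auto simp: upper_domain_def)

lemma psi_deriv_real: "1 \<le> r \<Longrightarrow> Im ((deriv ^^ i) (psi r) 0) = 0"
  by (rule higher_deriv_real[of _ 3])
    (auto intro!: holomorphic_on_subset[OF decaying.holo[OF decaying_psi] ball_subset_upper_domain] simp: psi_def sincc_cnj)

lemma psi0_deriv_real: "Im ((deriv ^^ i) psi0 0) = 0"
proof -
  have "Im ((deriv ^^ Suc i) (\<lambda>u. 1 / sincc u) 0) = 0"
    by (rule higher_deriv_real[of _ 3])
      (auto intro!: holomorphic_on_subset[OF inverse_sincc_holomorphic ball_subset_upper_domain] simp: sincc_cnj)
  thus ?thesis by (simp add: psi0_def funpow_swap1)
qed

lemma phi_div_sq: "w \<noteq> 0 \<Longrightarrow> phi n w * (w ^ j / w ^ 2) = sincc w ^ 2 * cos w ^ n * w ^ j"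
  by (simp add: phi_sincc)

lemma LI_phi_div_sq:
  "0 < c \<Longrightarrow> LI c (\<lambda>w. phi n w * (w ^ j / w ^ 2)) = LI c (\<lambda>w. sincc w ^ 2 * cos w ^ n * w ^ j)"
  by (intro LI_cong phi_div_sq Complex_line_nonzero) simp

text \<open>The denominator w^2 cancels the double zero of sin^2 w, so the integrand is entire and
  the line can be moved.\<close>

lemma LI_power_to_real_axis:
  "\<exists>C\<ge>0. \<forall>n c. 0 < c \<longrightarrow> c \<le> 1 \<longrightarrow> real n * c\<^sup>2 = 1 \<longrightarrow>
    norm (LI c (\<lambda>w. phi n w * (w ^ j / w ^ 2)) - LI 0 (\<lambda>w. sincc w ^ 2 * cos w ^ n * w ^ j)) \<le> C * c ^ K"
proof -
  have "\<exists>C\<ge>0. \<forall>n c. 0 < c \<longrightarrow> c \<le> 1 \<longrightarrow> real n * c\<^sup>2 = 1 \<longrightarrow>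
    norm (LI c (\<lambda>w. sincc w ^ 2 * cos w ^ n * w ^ j) - LI 0 (\<lambda>w. sincc w ^ 2 * cos w ^ n * w ^ j)) \<le> C * c ^ K"
    by (rule LI_to_real_axis[where b = "3 ^ j"])
      (auto intro!: continuous_intros derivative_intros power_mono norm_side simp: norm_power)
  then obtain C where "C \<ge> 0" "\<forall>n c. 0 < c \<longrightarrow> c \<le> 1 \<longrightarrow> real n * c\<^sup>2 = 1 \<longrightarrow>
    norm (LI c (\<lambda>w. sincc w ^ 2 * cos w ^ n * w ^ j) - LI 0 (\<lambda>w. sincc w ^ 2 * cos w ^ n * w ^ j)) \<le> C * c ^ K" by blast
  thus ?thesis by (intro exI[of _ C] conjI allI impI) (auto simp only: LI_phi_div_sq)
qed

lemma sincc_of_real: "sincc (of_real x) = of_real (if x = 0 then 1 else sin x / x)"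
  by (simp add: sincc_def flip: sin_of_real)

lemma continuous_on_weight: "continuous_on UNIV (\<lambda>w. sincc w ^ 2 * cos w ^ n * w ^ j)"
  by (intro continuous_intros)

lemma weight_real: "sincc (of_real x) ^ 2 * cos (of_real x) ^ n * of_real x ^ j \<in> \<real>"
  unfolding sincc_of_real cos_of_real by (intro Reals_mult Reals_power Reals_of_real)

lemma LI_0_weight_real: "Im (LI 0 (\<lambda>w. sincc w ^ 2 * cos w ^ n * w ^ j)) = 0"
  by (subst LI_0_real[OF weight_real continuous_on_weight]) simp

lemma LI_power_Im_small:
  "\<exists>C\<ge>0. \<forall>n c. 0 < c \<longrightarrow> c \<le> 1 \<longrightarrow> real n * c\<^sup>2 = 1 \<longrightarrow>
    \<bar>Im (LI c (\<lambda>w. phi n w * (w ^ j / w ^ 2)))\<bar> \<le> C * c ^ K"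
proof -
  obtain C where C: "C \<ge> 0" "\<And>n c. 0 < c \<Longrightarrow> c \<le> 1 \<Longrightarrow> real n * c\<^sup>2 = 1 \<Longrightarrow>
    norm (LI c (\<lambda>w. phi n w * (w ^ j / w ^ 2)) - LI 0 (\<lambda>w. sincc w ^ 2 * cos w ^ n * w ^ j)) \<le> C * c ^ K"
    using LI_power_to_real_axis by blast
  have "\<bar>Im (LI c (\<lambda>w. phi n w * (w ^ j / w ^ 2)))\<bar> \<le> C * c ^ K" if "0 < c" "c \<le> 1" "real n * c\<^sup>2 = 1" for n c
    using order_trans[OF abs_Im_le_cmod C(2)[OF that]] by (simp add: LI_0_weight_real)
  with C(1) show ?thesis by blast
qed

text \<open>The boundary terms of the Euler--Maclaurin formula are real multiples of powers of w; along
  the line they are negligible because their integrals over the real axis are real.\<close>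

lemma boundary_terms_small:
  assumes real: "\<And>n j. Im (\<beta> n j) = 0" and bnd: "\<And>n j. j \<in> J \<Longrightarrow> norm (\<beta> n j) \<le> b j" and fin: "finite J"
  shows "\<exists>C\<ge>0. \<forall>n c. 0 < c \<longrightarrow> c \<le> 1 \<longrightarrow> real n * c\<^sup>2 = 1 \<longrightarrow>
    \<bar>Im (\<Sum>j\<in>J. \<beta> n j * LI c (\<lambda>w. phi n w * (w ^ (e j) / w ^ 2)))\<bar> \<le> C * c ^ K"
proof -
  have "\<forall>j. \<exists>C\<ge>0. \<forall>n c. 0 < c \<longrightarrow> c \<le> 1 \<longrightarrow> real n * c\<^sup>2 = 1 \<longrightarrow>
    \<bar>Im (LI c (\<lambda>w. phi n w * (w ^ (e j) / w ^ 2)))\<bar> \<le> C * c ^ K"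
    using LI_power_Im_small by blast
  then obtain C where C: "\<And>j. C j \<ge> 0" "\<And>j n c. 0 < c \<Longrightarrow> c \<le> 1 \<Longrightarrow> real n * c\<^sup>2 = 1 \<Longrightarrow>
    \<bar>Im (LI c (\<lambda>w. phi n w * (w ^ (e j) / w ^ 2)))\<bar> \<le> C j * c ^ K" by metis
  have "\<bar>Im (\<Sum>j\<in>J. \<beta> n j * LI c (\<lambda>w. phi n w * (w ^ (e j) / w ^ 2)))\<bar> \<le> (\<Sum>j\<in>J. \<bar>b j\<bar> * C j) * c ^ K"
    if c: "0 < c" "c \<le> 1" "real n * c\<^sup>2 = 1" for n c
  proof -
    have "\<bar>Im (\<Sum>j\<in>J. \<beta> n j * LI c (\<lambda>w. phi n w * (w ^ (e j) / w ^ 2)))\<bar> \<le> (\<Sum>j\<in>J. \<bar>b j\<bar> * (C j * c ^ K))"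
      unfolding Im_sum
    proof (rule order_trans[OF sum_abs sum_mono])
      fix j assume j: "j \<in> J"
      have "\<bar>Im (\<beta> n j * LI c (\<lambda>w. phi n w * (w ^ (e j) / w ^ 2)))\<bar> = \<bar>Re (\<beta> n j)\<bar> * \<bar>Im (LI c (\<lambda>w. phi n w * (w ^ (e j) / w ^ 2)))\<bar>"
        by (simp add: real abs_mult)
      also have "\<dots> \<le> \<bar>b j\<bar> * (C j * c ^ K)"
        using bnd[OF j, of n] abs_Re_le_cmod[of "\<beta> n j"] by (intro mult_mono C(2)[OF c]) auto
      finally show "\<bar>Im (\<beta> n j * LI c (\<lambda>w. phi n w * (w ^ (e j) / w ^ 2)))\<bar> \<le> \<bar>b j\<bar> * (C j * c ^ K)" .
    qed
    thus ?thesis by (simp add: sum_distrib_right mult.assoc)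
  qed
  moreover have "(\<Sum>j\<in>J. \<bar>b j\<bar> * C j) \<ge> 0" using C by (intro sum_nonneg) auto
  ultimately show ?thesis by blast
qed

definition weight :: "nat \<Rightarrow> nat \<Rightarrow> real \<Rightarrow> real" where
  "weight n j x = (if x = 0 then 1 else sin x / x) ^ 2 * cos x ^ n * x ^ j"

lemma weight_eq: "sincc (of_real x) ^ 2 * cos (of_real x) ^ n * of_real x ^ j = of_real (weight n j x)"
  by (simp add: sincc_of_real weight_def cos_of_real[symmetric])

lemma LI_0_weight: "LI 0 (\<lambda>w. sincc w ^ 2 * cos w ^ n * w ^ j) = of_real (integral {-(pi/2)..pi/2} (weight n j))"
  by (subst LI_0_real[OF weight_real continuous_on_weight]) (simp only: weight_eq Re_complex_of_real)

lemma em_coeff_bound: "norm (of_real (em_coeff (real (offs n)) j) * z :: complex) \<le> (\<bar>em_coeff 2 j\<bar> + \<bar>em_coeff 3 j\<bar>) * norm z"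
  by (auto simp: offs_def norm_mult intro!: mult_right_mono)

text \<open>As j \<ge> 1, the power w^j / w^(r+1) is w^(j+1-r) / w^2 with j + 1 - r \<ge> 0 exactly
  when r \<le> 2 is assumed; then no pole survives the double zero of sin^2 w and
  \<open>boundary_terms_small\<close> applies.\<close>

lemma moment_boundary_small:
  assumes r: "1 \<le> r" "r \<le> 2" and K: "1 \<le> K"
  shows "\<exists>C\<ge>0. \<forall>n c. 0 < c \<longrightarrow> c \<le> 1 \<longrightarrow> real n * c\<^sup>2 = 1 \<longrightarrow>
    \<bar>Im (\<Sum>j\<in>{1..<K}. of_real (em_coeff (real (offs n)) j) * (deriv ^^ (j - 1)) (psi r) 0 * LI c (\<lambda>w. phi n w * (w ^ j / w ^ Suc r)))\<bar> \<le> C * c ^ L"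
proof -
  obtain C where C: "C \<ge> 0" "\<And>n c. 0 < c \<Longrightarrow> c \<le> 1 \<Longrightarrow> real n * c\<^sup>2 = 1 \<Longrightarrow>
    \<bar>Im (\<Sum>j\<in>{1..<K}. (of_real (em_coeff (real (offs n)) j) * (deriv ^^ (j - 1)) (psi r) 0) * LI c (\<lambda>w. phi n w * (w ^ (j + 1 - r) / w ^ 2)))\<bar> \<le> C * c ^ L"
    using boundary_terms_small[of "\<lambda>n j. of_real (em_coeff (real (offs n)) j) * (deriv ^^ (j - 1)) (psi r) 0" "{1..<K}", OF _ em_coeff_bound] r
    by (force simp: psi_deriv_real)
  have eq: "LI c (\<lambda>w. phi n w * (w ^ j / w ^ Suc r)) = LI c (\<lambda>w. phi n w * (w ^ (j + 1 - r) / w ^ 2))"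
    if "0 < c" "j \<in> {1..<K}" for n c j
  proof (rule LI_cong)
    fix x
    have "Complex x c \<noteq> 0" using that by (intro Complex_line_nonzero) auto
    moreover have "r = 1 \<or> r = 2" using r by auto
    ultimately show "phi n (Complex x c) * (Complex x c ^ j / Complex x c ^ Suc r) = phi n (Complex x c) * (Complex x c ^ (j + 1 - r) / (Complex x c)\<^sup>2)"
      using that by (cases j) (auto simp: power2_eq_square)
  qed
  show ?thesis
  proof (intro exI[of _ C] conjI allI impI C(1))
    fix n :: nat and c :: real assume c: "0 < c" "c \<le> 1" "real n * c\<^sup>2 = 1"
    have "(\<Sum>j\<in>{1..<K}. of_real (em_coeff (real (offs n)) j) * (deriv ^^ (j - 1)) (psi r) 0 * LI c (\<lambda>w. phi n w * (w ^ j / w ^ Suc r)))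
       = (\<Sum>j\<in>{1..<K}. of_real (em_coeff (real (offs n)) j) * (deriv ^^ (j - 1)) (psi r) 0 * LI c (\<lambda>w. phi n w * (w ^ (j + 1 - r) / w ^ 2)))"
      by (intro sum.cong refl arg_cong2[where f = "(*)"] eq c)
    thus "\<bar>Im (\<Sum>j\<in>{1..<K}. of_real (em_coeff (real (offs n)) j) * (deriv ^^ (j - 1)) (psi r) 0 * LI c (\<lambda>w. phi n w * (w ^ j / w ^ Suc r)))\<bar> \<le> C * c ^ L"
      using C(2)[OF c] by (simp only:)
  qed
qed

text \<open>The main term i S_1 / w^2 just cancels the double zero of the kernel, so it too moves to
  the real axis; the factor i turns the real integral found there into an imaginary part.\<close>

theorem moment_1:
  "\<exists>C\<ge>0. \<forall>n c. 0 < c \<longrightarrow> c \<le> 1 \<longrightarrow> real n * c\<^sup>2 = 1 \<longrightarrow>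
    \<bar>moment 1 n - sinh_mom 1 / pi * integral {-(pi/2)..pi/2} (weight n 0)\<bar> \<le> C * c ^ K"
proof -
  obtain C1 where C1: "C1 \<ge> 0" "\<And>n c. 0 < c \<Longrightarrow> c \<le> 1 \<Longrightarrow> real n * c\<^sup>2 = 1 \<Longrightarrow>
    \<bar>moment 1 n - 1 / pi * Im (\<i> ^ 1 * of_real (sinh_mom 1) * LI c (\<lambda>w. phi n w * (1 / w ^ Suc 1))
       - (\<Sum>j\<in>{1..<Suc K}. of_real (em_coeff (real (offs n)) j) * (deriv ^^ (j - 1)) (psi 1) 0 * LI c (\<lambda>w. phi n w * (w ^ j / w ^ Suc 1))))\<bar>
     \<le> C1 * (c ^ (Suc K + 4) / c ^ (1 + 2))"
    using moment_expansion[of 1 "Suc K", OF order_refl Suc_le_mono[THEN iffD2, OF zero_le, folded One_nat_def]] by blast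
  obtain C2 where C2: "C2 \<ge> 0" "\<And>n c. 0 < c \<Longrightarrow> c \<le> 1 \<Longrightarrow> real n * c\<^sup>2 = 1 \<Longrightarrow>
    \<bar>Im (\<Sum>j\<in>{1..<Suc K}. of_real (em_coeff (real (offs n)) j) * (deriv ^^ (j - 1)) (psi 1) 0 * LI c (\<lambda>w. phi n w * (w ^ j / w ^ Suc 1)))\<bar> \<le> C2 * c ^ K"
    using moment_boundary_small[of 1 "Suc K" K] by auto
  obtain C3 where C3: "C3 \<ge> 0" "\<And>n c. 0 < c \<Longrightarrow> c \<le> 1 \<Longrightarrow> real n * c\<^sup>2 = 1 \<Longrightarrow>
    norm (LI c (\<lambda>w. phi n w * (w ^ 0 / w ^ 2)) - LI 0 (\<lambda>w. sincc w ^ 2 * cos w ^ n * w ^ 0)) \<le> C3 * c ^ K"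
    using LI_power_to_real_axis[of 0 K] by blast
  have "\<bar>moment 1 n - sinh_mom 1 / pi * integral {-(pi/2)..pi/2} (weight n 0)\<bar> \<le> (C1 + C2 + \<bar>sinh_mom 1\<bar> * C3) * c ^ K"
    if c: "0 < c" "c \<le> 1" "real n * c\<^sup>2 = 1" for n c
  proof -
    define S where "S = (\<Sum>j\<in>{1..<Suc K}. of_real (em_coeff (real (offs n)) j) * (deriv ^^ (j - 1)) (psi 1) 0 * LI c (\<lambda>w. phi n w * (w ^ j / w ^ Suc 1)))"
    define W where "W = LI c (\<lambda>w. phi n w * (1 / w ^ Suc 1))"
    define J where "J = integral {-(pi/2)..pi/2} (weight n 0)"
    have "c ^ (Suc K + 4) / c ^ (1 + 2) = c ^ K * c ^ 2"
      using c by (simp add: eval_nat_numeral field_simps)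
    also have "\<dots> \<le> c ^ K * 1" using c by (intro mult_left_mono power_le_one) auto
    finally have cK: "C1 * (c ^ (Suc K + 4) / c ^ (1 + 2)) \<le> C1 * c ^ K"
      using C1 by (intro mult_left_mono) auto
    have "norm (W - of_real J) \<le> C3 * c ^ K"
      using C3(2)[OF c] unfolding LI_0_weight W_def J_def by (simp add: power2_eq_square)
    hence W: "\<bar>Re W - J\<bar> \<le> C3 * c ^ K" using abs_Re_le_cmod[of "W - of_real J"] by simp
    have 1: "\<bar>moment 1 n - 1 / pi * (sinh_mom 1 * Re W - Im S)\<bar> \<le> C1 * c ^ K"
      using order_trans[OF C1(2)[OF c] cK] unfolding S_def[symmetric] W_def[symmetric] by simp
    have 2: "\<bar>1 / pi * Im S\<bar> \<le> C2 * c ^ K"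
      using C2(2)[OF c] pi_gt3 C2 c mult_mono[of "1 / pi" 1 "\<bar>Im S\<bar>" "C2 * c ^ K"] unfolding S_def[symmetric] by (simp add: abs_mult)
    have 3: "\<bar>1 / pi * (sinh_mom 1 * (Re W - J))\<bar> \<le> \<bar>sinh_mom 1\<bar> * C3 * c ^ K"
    proof -
      have "\<bar>1 / pi * (sinh_mom 1 * (Re W - J))\<bar> \<le> 1 * (\<bar>sinh_mom 1\<bar> * (C3 * c ^ K))"
        unfolding abs_mult using W pi_gt3 by (intro mult_mono) auto
      thus ?thesis by simp
    qed
    have "moment 1 n - sinh_mom 1 / pi * J = (moment 1 n - 1 / pi * (sinh_mom 1 * Re W - Im S)) - 1 / pi * Im S + 1 / pi * (sinh_mom 1 * (Re W - J))"
      by (simp add: field_simps)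
    also have "\<bar>\<dots>\<bar> \<le> C1 * c ^ K + C2 * c ^ K + \<bar>sinh_mom 1\<bar> * C3 * c ^ K"
      using 1 2 3 by linarith
    finally show ?thesis unfolding J_def by (simp add: algebra_simps)
  qed
  moreover have "C1 + C2 + \<bar>sinh_mom 1\<bar> * C3 \<ge> 0" using C1 C2 C3 by simp
  ultimately show ?thesis by blast
qed


section \<open>The second moment as half a residue\<close>

lemma LI_minus: "LI (- c) f = LI c (\<lambda>w. f (- w))"
proof -
  have "LI c (\<lambda>w. f (- w)) = integral {-(pi/2)..-(-(pi/2))} (\<lambda>x. f (Complex (- x) (- c)))"
    by (simp add: LI_def complex_minus[symmetric])
  also have "\<dots> = integral {-(pi/2)..pi/2} (\<lambda>x. f (Complex x (- c)))"
    by (rule Henstock_Kurzweil_Integration.integral_reflect_real)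
  finally show ?thesis by (simp add: LI_def)
qed

lemma sincc_minus: "sincc (- w) = sincc w"
  by (simp add: sincc_def)

text \<open>The integrand is odd with a simple pole of residue 1 at 0. The rectangle between heights
  -c and c yields 2 pi i, and by oddness the lower line contributes minus the upper one, so the
  upper line carries half of the residue, with negative sign.\<close>

lemma LI_pole:
  "\<exists>C\<ge>0. \<forall>n c. 0 < c \<longrightarrow> c \<le> 1 \<longrightarrow> real n * c\<^sup>2 = 1 \<longrightarrow>
    norm (LI c (\<lambda>w. phi n w * (1 / w ^ 3)) + of_real pi * \<i>) \<le> C * c ^ K"
proof -
  obtain C where C: "C \<ge> 0" "\<And>n c. 0 < c \<Longrightarrow> c \<le> 1 \<Longrightarrow> real n * c\<^sup>2 = 1 \<Longrightarrow> (2 * c) ^ n \<le> C * c ^ K"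
    using side_power_superpoly by blast
  have "norm (LI c (\<lambda>w. phi n w * (1 / w ^ 3)) + of_real pi * \<i>) \<le> (18 * C) * c ^ K"
    if c: "0 < c" "c \<le> 1" "real n * c\<^sup>2 = 1" for n c
  proof -
    define F where "F w = sincc w ^ 2 * cos w ^ n / w" for w
    have nz: "Complex x c \<noteq> 0" for x using c by (intro Complex_line_nonzero) auto
    have LF: "LI c (\<lambda>w. phi n w * (1 / w ^ 3)) = LI c F"
      by (rule LI_cong) (use nz in \<open>simp add: F_def phi_sincc eval_nat_numeral\<close>)
    let ?R = "rectpath (Complex (-(pi/2)) (-c)) (Complex (pi/2) c)"
    have box: "0 \<in> box (Complex (-(pi/2)) (-c)) (Complex (pi/2) c)"
      using c by (simp add: in_box_complex_iff)
    hence path: "path_image ?R \<subseteq> UNIV - {0}"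
      using c by (subst path_image_rectpath_cbox_minus_box) auto
    have "((\<lambda>w. (sincc w ^ 2 * cos w ^ n) / (w - 0)) has_contour_integral
        of_real (2 * pi) * \<i> * winding_number ?R 0 * (sincc 0 ^ 2 * cos 0 ^ n)) ?R"
      by (rule Cauchy_integral_formula_convex_simple[where S = UNIV and f = "\<lambda>w. sincc w ^ 2 * cos w ^ n"])
        (use path in \<open>auto intro!: holomorphic_intros\<close>)
    hence I: "(F has_contour_integral 2 * of_real pi * \<i>) ?R"
      using box by (simp add: winding_number_rectpath sincc_def F_def[abs_def])
    have contF: "continuous_on (UNIV - {0}) F"
      unfolding F_def by (intro continuous_intros) auto
    have side: "norm (F (Complex x y)) \<le> 3 ^ 2 * (2 * c) ^ n" if "0 \<le> y" "y \<le> c" "x = pi / 2 \<or> x = - (pi / 2)" for x y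
    proof -
      have "norm (F (Complex x y)) = norm (sincc (Complex x y)) ^ 2 * norm (cos (Complex x y)) ^ n / norm (Complex x y)"
        by (simp add: F_def norm_mult norm_divide norm_power)
      also have "\<dots> \<le> 3 ^ 2 * (2 * c) ^ n / 1"
        by (intro frac_le mult_mono power_mono norm_side norm_cos_side) (use that c in auto)
      finally show ?thesis by simp
    qed
    have side': "norm (F (Complex x y)) \<le> 3 ^ 2 * (2 * c) ^ n" if "-c \<le> y" "y \<le> c" "x = pi / 2 \<or> x = - (pi / 2)" for x y
    proof (cases "0 \<le> y")
      case False
      have "F (Complex x y) = - F (Complex (-x) (-y))"
        unfolding complex_minus[symmetric] F_def by (simp add: sincc_minus)
      thus ?thesis using side[of "-y" "-x"] False that by (simp only: norm_minus_cancel) auto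
    qed (use side that in auto)
    have "norm (LI c F - LI (-c) F + 2 * of_real pi * \<i>) \<le> 2 * (c - (-c)) * (3 ^ 2 * (2 * c) ^ n)"
      by (rule LI_rect[OF _ continuous_on_subset[OF contF path] I]) (use c side' in auto)
    moreover have "LI (-c) F = - LI c F"
      unfolding LI_minus using LI_cmult[of c "-1" F] by (simp add: F_def[abs_def] sincc_minus)
    ultimately have "norm (2 * (LI c F + of_real pi * \<i>)) \<le> 36 * c * (2 * c) ^ n" by (simp add: algebra_simps)
    also have "\<dots> \<le> 36 * 1 * (C * c ^ K)" using C(2)[OF c] c by (intro mult_mono) auto
    finally show ?thesis unfolding LF norm_mult by simp
  qed
  moreover have "18 * C \<ge> 0" using C by simp
  ultimately show ?thesis by blast
qed

text \<open>The main term is -S_2 times the pole integral -pi i, so that the factor 1/pi leaves S_2.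
  All of the n-dependence of the normalised second moment thus comes from \<open>q n\<close>, up to
  errors smaller than every power of c.\<close>

theorem moment_2:
  "\<exists>C\<ge>0. \<forall>n c. 0 < c \<longrightarrow> c \<le> 1 \<longrightarrow> real n * c\<^sup>2 = 1 \<longrightarrow> \<bar>moment 2 n - sinh_mom 2\<bar> \<le> C * c ^ K"
proof -
  obtain C1 where C1: "C1 \<ge> 0" "\<And>n c. 0 < c \<Longrightarrow> c \<le> 1 \<Longrightarrow> real n * c\<^sup>2 = 1 \<Longrightarrow>
    \<bar>moment 2 n - 1 / pi * Im (\<i> ^ 2 * of_real (sinh_mom 2) * LI c (\<lambda>w. phi n w * (1 / w ^ Suc 2))
       - (\<Sum>j\<in>{1..<Suc K}. of_real (em_coeff (real (offs n)) j) * (deriv ^^ (j - 1)) (psi 2) 0 * LI c (\<lambda>w. phi n w * (w ^ j / w ^ Suc 2))))\<bar>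
     \<le> C1 * (c ^ (Suc K + 4) / c ^ (2 + 2))"
    using moment_expansion[of 2 "Suc K", OF one_le_numeral Suc_le_mono[THEN iffD2, OF zero_le, folded One_nat_def]] by blast
  obtain C2 where C2: "C2 \<ge> 0" "\<And>n c. 0 < c \<Longrightarrow> c \<le> 1 \<Longrightarrow> real n * c\<^sup>2 = 1 \<Longrightarrow>
    \<bar>Im (\<Sum>j\<in>{1..<Suc K}. of_real (em_coeff (real (offs n)) j) * (deriv ^^ (j - 1)) (psi 2) 0 * LI c (\<lambda>w. phi n w * (w ^ j / w ^ Suc 2)))\<bar> \<le> C2 * c ^ K"
    using moment_boundary_small[of 2 "Suc K" K] by auto
  obtain C3 where C3: "C3 \<ge> 0" "\<And>n c. 0 < c \<Longrightarrow> c \<le> 1 \<Longrightarrow> real n * c\<^sup>2 = 1 \<Longrightarrow>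
    norm (LI c (\<lambda>w. phi n w * (1 / w ^ 3)) + of_real pi * \<i>) \<le> C3 * c ^ K"
    using LI_pole[of K] by blast
  have "\<bar>moment 2 n - sinh_mom 2\<bar> \<le> (C1 + C2 + \<bar>sinh_mom 2\<bar> * C3) * c ^ K"
    if c: "0 < c" "c \<le> 1" "real n * c\<^sup>2 = 1" for n c
  proof -
    define S where "S = (\<Sum>j\<in>{1..<Suc K}. of_real (em_coeff (real (offs n)) j) * (deriv ^^ (j - 1)) (psi 2) 0 * LI c (\<lambda>w. phi n w * (w ^ j / w ^ Suc 2)))"
    define W where "W = LI c (\<lambda>w. phi n w * (1 / w ^ Suc 2))"
    have "c ^ (Suc K + 4) / c ^ (2 + 2) = c ^ K * c"
      using c by (simp add: eval_nat_numeral field_simps)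
    also have "\<dots> \<le> c ^ K * 1" using c by (intro mult_left_mono) auto
    finally have cK: "C1 * (c ^ (Suc K + 4) / c ^ (2 + 2)) \<le> C1 * c ^ K"
      using C1 by (intro mult_left_mono) auto
    have "norm (W + of_real pi * \<i>) \<le> C3 * c ^ K"
      using C3(2)[OF c] unfolding W_def by simp
    hence W: "\<bar>Im W + pi\<bar> \<le> C3 * c ^ K" using abs_Im_le_cmod[of "W + of_real pi * \<i>"] by simp
    have 1: "\<bar>moment 2 n - 1 / pi * (- sinh_mom 2 * Im W - Im S)\<bar> \<le> C1 * c ^ K"
      using order_trans[OF C1(2)[OF c] cK] unfolding S_def[symmetric] W_def[symmetric] by simp
    have 2: "\<bar>1 / pi * Im S\<bar> \<le> C2 * c ^ K"
      using C2(2)[OF c] pi_gt3 C2 c mult_mono[of "1 / pi" 1 "\<bar>Im S\<bar>" "C2 * c ^ K"] unfolding S_def[symmetric] by (simp add: abs_mult)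
    have 3: "\<bar>1 / pi * (sinh_mom 2 * (Im W + pi))\<bar> \<le> \<bar>sinh_mom 2\<bar> * C3 * c ^ K"
    proof -
      have "\<bar>1 / pi * (sinh_mom 2 * (Im W + pi))\<bar> \<le> 1 * (\<bar>sinh_mom 2\<bar> * (C3 * c ^ K))"
        unfolding abs_mult using W pi_gt3 by (intro mult_mono) auto
      thus ?thesis by simp
    qed
    have "moment 2 n - sinh_mom 2 = (moment 2 n - 1 / pi * (- sinh_mom 2 * Im W - Im S)) - 1 / pi * Im S - 1 / pi * (sinh_mom 2 * (Im W + pi))"
      by (simp add: field_simps)
    also have "\<bar>\<dots>\<bar> \<le> C1 * c ^ K + C2 * c ^ K + \<bar>sinh_mom 2\<bar> * C3 * c ^ K"
      using 1 2 3 by linarith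
    finally show ?thesis by (simp add: algebra_simps)
  qed
  moreover have "C1 + C2 + \<bar>sinh_mom 2\<bar> * C3 \<ge> 0" using C1 C2 C3 by simp
  ultimately show ?thesis by blast
qed

lemma moment_0: "moment 0 n = q n"
  using moment_sums[of 0 n] qh_sums[of n] sums_unique2 by simp

section \<open>The case r = 0 and its logarithm\<close>

text \<open>The term w / sin(H w) is 1/H times u / sin u at u = H w, so its derivative is
  \<open>psi0\<close> at H w with no power of H left. Uniform convergence on a convex neighbourhood
  of \<open>z0\<close> at positive distance from the real axis allows termwise
  differentiation.\<close>

lemma Lam0_has_derivative:
  assumes a: "2 \<le> a" "a \<le> 3" and z0: "0 < Im z0"
  shows "((\<lambda>z. z * Lam 0 a z) has_field_derivative (\<Sum>k. psi0 (of_real (2 * real k + a) * z0))) (at z0)"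
proof -
  interpret decaying psi0 2 6 by (rule decaying_psi0)
  define c where "c = Im z0 / 2"
  define R where "R = norm z0 + 1"
  define S where "S = {z. c < Im z} \<inter> ball 0 R"
  have c: "0 < c" using z0 by (simp add: c_def)
  have R: "1 \<le> R" by (simp add: R_def)
  have S: "open S" "convex S" "z0 \<in> S"
  proof -
    show "open S" unfolding S_def by (intro open_Int open_halfspace_Im_gt open_ball)
    show "convex S" unfolding S_def by (intro convex_Int convex_halfspace_Im_gt convex_ball)
    show "z0 \<in> S" using z0 by (simp add: S_def c_def R_def)
  qed
  define H where "H k = 2 * real k + a" for k
  have H: "2 * real k \<le> H k" "1 \<le> H k" for k using a by (auto simp: H_def)
  have im: "0 < Im (of_real (H k) * z)" if "z \<in> S" for k z
    using that c H(2)[of k] by (auto simp: S_def)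
  define Q where "Q = 6 * (1 + R) ^ 2 * (1 + 1 / c) ^ 2 * ((2 / c) ^ 2 * fact 2)"
  have bnd: "norm (psi0 (of_real (H k) * z)) \<le> Q * exp (- c) ^ k" if z: "z \<in> S" for k z
  proof -
    let ?u = "of_real (H k) * z"
    have zc: "c < Im z" "norm z \<le> R" using z by (auto simp: S_def)
    have Hc: "H k * c \<le> Im ?u" using zc H(2)[of k] by (simp add: mult_left_mono)
    have "1 * c \<le> H k * c" using H(2)[of k] c by (intro mult_right_mono) auto
    hence cu: "c \<le> Im ?u" using Hc by linarith
    have nu: "1 + norm ?u \<le> H k * (1 + R)"
    proof -
      have "norm ?u \<le> H k * R" using zc H(2)[of k] by (simp add: norm_mult mult_left_mono)
      thus ?thesis using H(2)[of k] by (simp add: distrib_left)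
    qed
    have "norm (psi0 ?u) \<le> 6 * (1 + norm ?u) ^ 2 * (1 + 1 / Im ?u) ^ 2 * exp (- Im ?u)"
      by (rule bound[OF im[OF z]])
    also have "\<dots> \<le> 6 * (H k * (1 + R)) ^ 2 * (1 + 1 / c) ^ 2 * exp (- (H k * c))"
    proof (intro mult_mono power_mono nu add_left_mono divide_left_mono)
      show "exp (- Im ?u) \<le> exp (- (H k * c))" using Hc by simp
    qed (use cu c in auto)
    also have "\<dots> = 6 * (1 + R) ^ 2 * (1 + 1 / c) ^ 2 * ((2 / c) ^ 2 * ((H k * c / 2) ^ 2 * exp (- (H k * c))))"
      using c by (simp add: power_mult_distrib power_divide)
    also have "\<dots> \<le> 6 * (1 + R) ^ 2 * (1 + 1 / c) ^ 2 * ((2 / c) ^ 2 * (fact 2 * exp (H k * c / 2) * exp (- (H k * c))))"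
      using c H(2)[of k] R by (intro mult_left_mono mult_right_mono power_le_fact_exp) auto
    also have "\<dots> = Q * exp (- (H k * c / 2))"
      by (simp add: Q_def mult.assoc flip: exp_add)
    also have "\<dots> \<le> Q * exp (- c) ^ k"
    proof (rule mult_left_mono)
      have "real k * c \<le> H k / 2 * c" using H(1)[of k] c by (intro mult_right_mono) auto
      thus "exp (- (H k * c / 2)) \<le> exp (- c) ^ k" by (simp flip: exp_of_nat_mult)
    qed (simp add: Q_def)
    finally show ?thesis .
  qed
  have der: "((\<lambda>z. z / sin (of_real (H k) * z)) has_field_derivative psi0 (of_real (H k) * z)) (at z within S)" if "z \<in> S" for k z
  proof -
    have "((\<lambda>z. of_real (H k) * z) has_field_derivative of_real (H k)) (at z)"
      by (auto intro!: derivative_eq_intros)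
    from DERIV_chain2[OF psi0_has_derivative[OF im[OF that]] this]
    have "((\<lambda>z. of_real (H k) * z / sin (of_real (H k) * z) / of_real (H k)) has_field_derivative psi0 (of_real (H k) * z) * of_real (H k) / of_real (H k)) (at z)"
      by (rule DERIV_cdivide)
    moreover have "H k \<noteq> 0" using H(2)[of k] by linarith
    ultimately show ?thesis by (auto intro: has_field_derivative_at_within)
  qed
  have unif: "uniformly_convergent_on S (\<lambda>n z. \<Sum>k<n. psi0 (of_real (H k) * z))"
    by (rule Weierstrass_m_test'[OF _ geometric_exp_summable[OF c]]) (rule bnd)
  have summ: "summable (\<lambda>k. z / sin (of_real (H k) * z))" if "0 < Im z" for z
    using summable_mult[OF Lam_summable[OF that a, of 0], of z] by (simp add: H_def)
  have A: "((\<lambda>z. \<Sum>k. z / sin (of_real (H k) * z)) has_field_derivative (\<Sum>k. psi0 (of_real (H k) * z0))) (at z0)"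
    by (rule has_field_derivative_series'(2)[OF S(2) der unif S(3) summ[OF z0]])
      (use S in \<open>simp_all add: interior_open\<close>)
  have B: "(\<Sum>k. z / sin (of_real (H k) * z)) = z * Lam 0 a z" if "z \<in> {z. 0 < Im z}" for z
    using suminf_mult[OF Lam_summable[of z a 0], of z] that a by (simp add: Lam_def H_def)
  have "((\<lambda>z. z * Lam 0 a z) has_field_derivative (\<Sum>k. psi0 (of_real (H k) * z0))) (at z0)"
    by (rule has_field_derivative_transform_within_open[OF A open_halfspace_Im_gt[of 0] _ B]) (use z0 in auto)
  thus ?thesis by (simp only: H_def)
qed

text \<open>The integration constant of \<open>Lam0_expansion\<close> for the line Im w = c: the
  value at i c of the nearly constant function G there. A crude bound on it suffices, because it
  will multiply an integral smaller than every power of c (\<open>LI_odd_small\<close>).\<close>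

definition kappa :: "nat \<Rightarrow> real \<Rightarrow> real \<Rightarrow> complex" where
  "kappa K a c = \<i> * of_real c * Lam 0 a (\<i> * of_real c) + of_real (ln c) / 2
     + (\<Sum>j\<in>{1..<K}. of_real (em_coeff a j / (2 * real j)) * (deriv ^^ (j - 1)) psi0 0 * (\<i> * of_real c) ^ j)"

lemma kappa_bound:
  assumes a: "2 \<le> a" "a \<le> 3"
  shows "\<exists>C\<ge>0. \<forall>c. 0 < c \<longrightarrow> c \<le> 1 \<longrightarrow> norm (kappa K a c) \<le> C / c ^ 2"
proof -
  define b where "b = (\<Sum>j\<in>{1..<K}. norm (of_real (em_coeff a j / (2 * real j)) * (deriv ^^ (j - 1)) psi0 0))"
  have b0: "0 \<le> b" unfolding b_def by (intro sum_nonneg) auto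
  have "norm (kappa K a c) \<le> (8 + 1 + b) / c ^ 2" if c: "0 < c" "c \<le> 1" for c
  proof -
    have im: "Im (\<i> * of_real c) = c" by simp
    have "norm (Lam 0 a (\<i> * of_real c)) \<le> (\<Sum>k. 2 * (1 + 1 / c) * ((2 / c) ^ 0 * fact 0) * exp (- c) ^ k)"
      unfolding Lam_def
      by (rule norm_suminf_le[OF Lam_term_bound[OF c(1) a im] geometric_exp_summable[OF c(1)]])
    also have "\<dots> = 2 * (1 + 1 / c) * (1 / (1 - exp (- c)))"
      using c by (simp add: suminf_mult suminf_geometric)
    also have "\<dots> \<le> 2 * (2 / c) * (2 / c)"
    proof (intro mult_mono)
      show "1 + 1 / c \<le> 2 / c" using c by (simp add: field_simps)
      have "1 + c \<le> exp c" by (rule exp_ge_add_one_self)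
      hence "exp (- c) \<le> 1 / (1 + c)" using c by (simp add: exp_minus field_simps)
      moreover have "c / 2 \<le> 1 - 1 / (1 + c)" using c by (simp add: field_simps power2_eq_square)
      ultimately have "c / 2 \<le> 1 - exp (- c)" by linarith
      hence "1 / (1 - exp (- c)) \<le> 1 / (c / 2)" using c by (intro divide_left_mono) auto
      thus "1 / (1 - exp (- c)) \<le> 2 / c" by simp
    qed (use c in auto)
    finally have L: "norm (Lam 0 a (\<i> * of_real c)) \<le> 8 / c ^ 2" by (simp add: power2_eq_square)
    have 1: "norm (\<i> * of_real c * Lam 0 a (\<i> * of_real c)) \<le> 8 / c ^ 2"
    proof -
      have "norm (\<i> * of_real c * Lam 0 a (\<i> * of_real c)) = c * norm (Lam 0 a (\<i> * of_real c))"
        using c by (simp add: norm_mult)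
      also have "\<dots> \<le> 1 * (8 / c ^ 2)" using c L by (intro mult_mono) auto
      finally show ?thesis by simp
    qed
    have c2: "1 \<le> 1 / c ^ 2" using c by (simp add: power_le_one)
    have 2: "norm (complex_of_real (ln c) / 2) \<le> 1 / c ^ 2"
    proof -
      have "ln (1 / c) \<le> 1 / c - 1" using c by (intro ln_le_minus_one) auto
      hence "\<bar>ln c\<bar> \<le> 1 / c" using c by (simp add: ln_div)
      also have "\<dots> \<le> 1 / c ^ 2" using c by (intro divide_left_mono) (auto simp: power2_eq_square mult_left_le)
      finally have "\<bar>ln c\<bar> \<le> 1 / c ^ 2" using c by simp
      hence "\<bar>ln c\<bar> / 2 \<le> 1 / c ^ 2" using abs_ge_zero[of "ln c"] by linarith
      thus ?thesis by (simp add: norm_divide)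
    qed
    have 3: "norm (\<Sum>j\<in>{1..<K}. of_real (em_coeff a j / (2 * real j)) * (deriv ^^ (j - 1)) psi0 0 * (\<i> * of_real c) ^ j) \<le> b / c ^ 2"
    proof -
      have "norm (\<Sum>j\<in>{1..<K}. of_real (em_coeff a j / (2 * real j)) * (deriv ^^ (j - 1)) psi0 0 * (\<i> * of_real c) ^ j) \<le>
        (\<Sum>j\<in>{1..<K}. norm (of_real (em_coeff a j / (2 * real j)) * (deriv ^^ (j - 1)) psi0 0) * (1 / c ^ 2))"
      proof (rule sum_norm_le)
        fix j
        have "norm ((\<i> * of_real c) ^ j :: complex) \<le> 1" using c by (simp add: norm_power norm_mult power_le_one)
        also note c2
        finally show "norm (of_real (em_coeff a j / (2 * real j)) * (deriv ^^ (j - 1)) psi0 0 * (\<i> * of_real c) ^ j) \<le>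
            norm (of_real (em_coeff a j / (2 * real j)) * (deriv ^^ (j - 1)) psi0 0) * (1 / c ^ 2)"
          unfolding norm_mult[of "_ * _" "_ ^ j"] by (intro mult_left_mono) auto
      qed
      thus ?thesis by (simp add: b_def sum_distrib_right sum_divide_distrib)
    qed
    have "norm (kappa K a c) \<le> 8 / c ^ 2 + 1 / c ^ 2 + b / c ^ 2"
      unfolding kappa_def by (intro norm_triangle_mono 1 2 3)
    thus ?thesis by (simp add: add_divide_distrib)
  qed
  moreover have "0 \<le> 8 + 1 + b" using b0 by simp
  ultimately show ?thesis by blast
qed

text \<open>The primitive u / sin u of \<open>psi0\<close> is 1 at 0 and tends to 0 along rays, so
  Euler-Maclaurin gives the derivative of \<open>w * Lam 0 a w\<close> as -1/(2w) minus boundary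
  terms, up to a small error. Adding Ln(-i w)/2 and the integrated boundary terms produces G with
  small derivative; integrating from i c to w along the line gives the expansion. The rotation by -i
  puts the branch cut on the negative imaginary axis.\<close>

lemma Lam0_expansion:
  assumes K: "1 \<le> K" and a: "2 \<le> a" "a \<le> 3"
  shows "\<exists>C\<ge>0. \<forall>c x. 0 < c \<longrightarrow> c \<le> 1 \<longrightarrow>
     norm (Lam 0 a (Complex x c) - (kappa K a c - Ln (- \<i> * Complex x c) / 2
         - (\<Sum>j\<in>{1..<K}. of_real (em_coeff a j / (2 * real j)) * (deriv ^^ (j - 1)) psi0 0 * Complex x c ^ j)) / Complex x c)
      \<le> C * (c ^ K / c) * (norm (Complex x c) / c) ^ (2 * K + 5)"
proof -
  interpret decaying psi0 2 6 by (rule decaying_psi0)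
  have a': "0 \<le> a" using a by simp
  obtain C where C: "C \<ge> 0" "\<And>c w L. 0 < c \<Longrightarrow> c \<le> 1 \<Longrightarrow> Im w = c \<Longrightarrow> (\<lambda>N. 1 / sincc (of_real (2 * real N) * w)) \<longlonglongrightarrow> L \<Longrightarrow>
    norm (2 * w * (\<Sum>k. psi0 (of_real (2 * real k + a) * w)) - (L - 1 / sincc 0)
       + (\<Sum>j\<in>{1..<K}. of_real (em_coeff a j) * w ^ j * (deriv ^^ (j - 1)) psi0 0))
    \<le> C * norm w ^ Suc K * (norm w / c) ^ (2 * 2 + K) / c"
    using euler_maclaurin[OF inverse_sincc_deriv a' a(2) K] by blast
  define \<gamma> where "\<gamma> j = of_real (em_coeff a j / (2 * real j)) * (deriv ^^ (j - 1)) psi0 0" for j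
  define G where "G z = z * Lam 0 a z + Ln (- \<i> * z) / 2 + (\<Sum>j\<in>{1..<K}. \<gamma> j * z ^ j)" for z
  define G' where "G' z = (\<Sum>k. psi0 (of_real (2 * real k + a) * z)) + 1 / (2 * z) + (\<Sum>j\<in>{1..<K}. \<gamma> j * (of_nat j * z ^ (j - 1)))" for z
  have derG: "(G has_field_derivative G' z) (at z)" if z: "0 < Im z" for z
  proof -
    have "- \<i> * z \<notin> \<real>\<^sub>\<le>\<^sub>0" using z by (auto simp: complex_nonpos_Reals_iff)
    moreover have "z \<noteq> 0" using z by auto
    ultimately have 1: "((\<lambda>z. Ln (- \<i> * z) / 2) has_field_derivative 1 / (2 * z)) (at z)"
      by (auto intro!: derivative_eq_intros simp: field_simps)
    have 2: "((\<lambda>z. \<Sum>j\<in>{1..<K}. \<gamma> j * z ^ j) has_field_derivative (\<Sum>j\<in>{1..<K}. \<gamma> j * (of_nat j * z ^ (j - 1)))) (at z)"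
      by (intro DERIV_sum DERIV_cmult) (auto intro!: derivative_eq_intros)
    show ?thesis unfolding G_def[abs_def] G'_def
      by (intro DERIV_add Lam0_has_derivative a z 1 2)
  qed
  have G'b: "norm (G' z) \<le> C * norm w ^ K * (norm w / c) ^ (4 + K) / c"
    if c: "0 < c" "c \<le> 1" and z: "Im z = c" "norm z \<le> norm w" for c z w
  proof -
    have z0: "z \<noteq> 0" "0 < norm z" using z c by auto
    \<comment> \<open>The derivative 1/(2z) of the logarithm supplies exactly the endpoint value
      \<open>1 / sincc 0\<close> = 1.\<close>
    have "2 * z * G' z = 2 * z * (\<Sum>k. psi0 (of_real (2 * real k + a) * z)) - (0 - 1 / sincc 0)
       + (\<Sum>j\<in>{1..<K}. of_real (em_coeff a j) * z ^ j * (deriv ^^ (j - 1)) psi0 0)"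
    proof -
      have "2 * z * (\<gamma> j * (of_nat j * z ^ (j - 1))) = of_real (em_coeff a j) * z ^ j * (deriv ^^ (j - 1)) psi0 0" if "j \<in> {1..<K}" for j
      proof -
        have "j \<noteq> 0" using that by simp
        then obtain m where m: "j = Suc m" by (cases j) auto
        have "complex_of_real (em_coeff a j / (2 * real j)) * of_nat j = of_real (em_coeff a j / (2 * real j) * real j)" by simp
        also have "em_coeff a j / (2 * real j) * real j = em_coeff a j / 2" using \<open>j \<noteq> 0\<close> by (simp add: field_simps)
        finally have e: "2 * (complex_of_real (em_coeff a j / (2 * real j)) * of_nat j) = of_real (em_coeff a j)" using \<open>j \<noteq> 0\<close> by simp
        have "2 * z * (\<gamma> j * (of_nat j * z ^ (j - 1))) = 2 * (complex_of_real (em_coeff a j / (2 * real j)) * of_nat j) * (z * z ^ (j - 1)) * (deriv ^^ (j - 1)) psi0 0"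
          by (simp only: \<gamma>_def mult_ac)
        thus ?thesis unfolding e by (simp add: m)
      qed
      hence "(\<Sum>j\<in>{1..<K}. 2 * z * (\<gamma> j * (of_nat j * z ^ (j - 1)))) = (\<Sum>j\<in>{1..<K}. of_real (em_coeff a j) * z ^ j * (deriv ^^ (j - 1)) psi0 0)"
        by (intro sum.cong) auto
      moreover have "2 * z * (1 / (2 * z)) = 1" using z0 by simp
      ultimately show ?thesis
        unfolding G'_def distrib_left sum_distrib_left by (simp add: sincc_def)
    qed
    hence "norm (2 * z * G' z) \<le> C * norm z ^ Suc K * (norm z / c) ^ (2 * 2 + K) / c"
      using C(2)[OF c z(1) inverse_sincc_tendsto_0] z c by simp
    hence "norm z * (2 * norm (G' z)) \<le> norm z * (C * norm z ^ K * (norm z / c) ^ (4 + K) / c)"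
      by (simp add: norm_mult mult_ac)
    hence "2 * norm (G' z) \<le> C * norm z ^ K * (norm z / c) ^ (4 + K) / c"
      using z0 by (simp only: mult_le_cancel_left_pos)
    moreover have "norm (G' z) \<le> 2 * norm (G' z)" by simp
    moreover have "C * norm z ^ K * (norm z / c) ^ (4 + K) / c \<le> C * norm w ^ K * (norm w / c) ^ (4 + K) / c"
      using z C c by (intro divide_right_mono mult_mono mult_left_mono power_mono) auto
    ultimately show ?thesis by linarith
  qed
  have "norm (Lam 0 a w - (kappa K a c - Ln (- \<i> * w) / 2 - (\<Sum>j\<in>{1..<K}. \<gamma> j * w ^ j)) / w)
      \<le> C * (c ^ K / c) * (norm w / c) ^ (2 * K + 5)"
    if c: "0 < c" "c \<le> 1" and w: "w = Complex x c" for c x w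
  proof -
    have w0: "w \<noteq> 0" "Im w = c" using c by (auto simp: w Complex_line_nonzero)
    have cw: "c \<le> norm w" using abs_Im_le_cmod[of w] w0 c by simp
    have kap: "kappa K a c = G (\<i> * of_real c)"
      using c by (simp add: kappa_def G_def \<gamma>_def Ln_of_real)
    have "norm (G w - G (\<i> * of_real c)) \<le> (C * norm w ^ K * (norm w / c) ^ (4 + K) / c) * norm (w - \<i> * of_real c)"
    proof (rule field_differentiable_bound[of "closed_segment (\<i> * of_real c) w"])
      fix z assume "z \<in> closed_segment (\<i> * of_real c) w"
      then obtain t where t: "0 \<le> t" "t \<le> 1" "z = (1 - t) *\<^sub>R (\<i> * of_real c) + t *\<^sub>R w"
        by (auto simp: closed_segment_def)
      have Imz: "Im z = c" unfolding t(3) by (simp add: w0 algebra_simps)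
      have "\<bar>Re z\<bar> = t * \<bar>Re w\<bar>" unfolding t(3) using t by (simp add: abs_mult)
      hence "\<bar>Re z\<bar> \<le> \<bar>Re w\<bar>" using t by (simp add: mult_left_le_one_le)
      hence "(norm z)\<^sup>2 \<le> (norm w)\<^sup>2" using Imz w0 by (simp add: cmod_power2 abs_le_square_iff)
      hence nz: "norm z \<le> norm w" by (rule power2_le_imp_le) simp
      show "(G has_field_derivative G' z) (at z within closed_segment (\<i> * of_real c) w)"
        by (rule has_field_derivative_at_within[OF derG]) (use Imz c in simp)
      show "norm (G' z) \<le> C * norm w ^ K * (norm w / c) ^ (4 + K) / c"
        by (rule G'b[OF c Imz nz])
    qed auto
    also have "w - \<i> * of_real c = of_real x" by (simp add: w complex_eq_iff)
    also have "norm (complex_of_real x) \<le> norm w" using abs_Re_le_cmod[of w] by (simp add: w)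
    hence "(C * norm w ^ K * (norm w / c) ^ (4 + K) / c) * norm (complex_of_real x) \<le> (C * norm w ^ K * (norm w / c) ^ (4 + K) / c) * norm w"
      using C c by (intro mult_left_mono) auto
    also have "(C * norm w ^ K * (norm w / c) ^ (4 + K) / c) * norm w = C * c ^ K * (norm w / c) ^ (2 * K + 5)"
    proof -
      have "norm w ^ K * norm w / c = c ^ K * (norm w / c) ^ (K + 1)" using c by (simp add: power_divide)
      moreover have "(norm w / c) ^ (2 * K + 5) = (norm w / c) ^ (K + 1) * (norm w / c) ^ (4 + K)"
      proof -
        have "2 * K + 5 = (K + 1) + (4 + K)" by simp
        thus ?thesis by (simp only: power_add)
      qed
      moreover have "(C * u * v / c) * x = C * (u * x / c) * v" for u v x by simp
      ultimately show ?thesis by (simp only: mult.assoc)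
    qed
    finally have GG: "norm (G w - kappa K a c) \<le> C * c ^ K * (norm w / c) ^ (2 * K + 5)" by (simp only: kap)
    have "Lam 0 a w - (kappa K a c - Ln (- \<i> * w) / 2 - (\<Sum>j\<in>{1..<K}. \<gamma> j * w ^ j)) / w = (G w - kappa K a c) / w"
      using w0 by (simp add: G_def field_simps)
    hence "norm (Lam 0 a w - (kappa K a c - Ln (- \<i> * w) / 2 - (\<Sum>j\<in>{1..<K}. \<gamma> j * w ^ j)) / w) = norm (G w - kappa K a c) / norm w"
      by (simp only: norm_divide)
    also have "\<dots> \<le> (C * c ^ K * (norm w / c) ^ (2 * K + 5)) / c"
      using order_trans[OF norm_ge_zero GG] GG cw c by (intro frac_le) auto
    finally show ?thesis by simp
  qed
  with C(1) show ?thesis unfolding \<gamma>_def by blast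
qed


lemma Ln_rotated_bound:
  assumes "w \<noteq> 0"
  shows "norm (Ln (- \<i> * w)) \<le> \<bar>ln (norm w)\<bar> + 4"
proof -
  have nz: "- \<i> * w \<noteq> 0" using assms by simp
  have "norm (Ln (- \<i> * w)) \<le> \<bar>Re (Ln (- \<i> * w))\<bar> + \<bar>Im (Ln (- \<i> * w))\<bar>" by (rule cmod_le)
  moreover have "Re (Ln (- \<i> * w)) = ln (norm w)" using nz by (simp add: norm_mult)
  moreover have "\<bar>Im (Ln (- \<i> * w))\<bar> \<le> pi" using mpi_less_Im_Ln[OF nz] Im_Ln_le_pi[OF nz] by linarith
  ultimately show ?thesis using pi_less_4 by linarith
qed

lemma rotated_not_nonpos: "0 \<le> Im w \<Longrightarrow> w \<noteq> 0 \<Longrightarrow> - \<i> * w \<notin> \<real>\<^sub>\<le>\<^sub>0"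
  by (auto simp: complex_nonpos_Reals_iff complex_eq_iff)

lemma times_Ln_has_derivative:
  assumes "0 \<le> Im z" "z \<noteq> 0"
  shows "((\<lambda>w. w * Ln (- \<i> * w)) has_field_derivative Ln (- \<i> * z) + 1) (at z)"
  using rotated_not_nonpos[OF assms] assms(2) by (auto intro!: derivative_eq_intros simp: field_simps)

text \<open>Continuity must include the point 0, since the line is moved down to the real axis;
  there |ln x| \<le> 2 / sqrt x for 0 < x < 1 gives the decay.\<close>

lemma continuous_on_times_Ln: "continuous_on {z. 0 \<le> Im z} (\<lambda>w. w * Ln (- \<i> * w))"
  unfolding continuous_on_eq_continuous_within
proof
  fix z assume z: "z \<in> {z. 0 \<le> Im z}"
  show "continuous (at z within {z. 0 \<le> Im z}) (\<lambda>w. w * Ln (- \<i> * w))"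
  proof (cases "z = 0")
    case False
    thus ?thesis using z
      by (intro continuous_at_imp_continuous_within[OF DERIV_isCont[OF times_Ln_has_derivative]]) auto
  next
    case True
    have "((\<lambda>w. w * Ln (- \<i> * w)) \<longlongrightarrow> 0) (at 0)"
    proof (rule Lim_null_comparison)
      show "\<forall>\<^sub>F w in at 0. norm (w * Ln (- \<i> * w)) \<le> 2 * sqrt (norm w) + 4 * norm w"
        unfolding eventually_at
      proof (intro exI[of _ 1] conjI ballI impI)
        fix w :: complex assume w: "w \<noteq> 0 \<and> dist w 0 < 1"
        define x where "x = norm w"
        have x: "0 < x" "x < 1" using w by (auto simp: x_def)
        have "ln (1 / sqrt x) \<le> 1 / sqrt x - 1" using x by (intro ln_le_minus_one) auto
        moreover have "ln (1 / sqrt x) = - ln x / 2" using x by (simp add: ln_div ln_sqrt)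
        moreover have "ln x < 0" using x by simp
        ultimately have "\<bar>ln x\<bar> \<le> 2 * (1 / sqrt x)" by linarith
        hence "x * \<bar>ln x\<bar> \<le> x * (2 * (1 / sqrt x))" using x by (intro mult_left_mono) auto
        also have "\<dots> = 2 * (x / sqrt x)" by simp
        also have "x / sqrt x = sqrt x" using x by (simp add: real_div_sqrt)
        finally have "x * \<bar>ln x\<bar> \<le> 2 * sqrt x" .
        moreover have "norm (w * Ln (- \<i> * w)) \<le> x * (\<bar>ln x\<bar> + 4)"
          unfolding norm_mult x_def using w by (intro mult_left_mono Ln_rotated_bound) auto
        ultimately show "norm (w * Ln (- \<i> * w)) \<le> 2 * sqrt (norm w) + 4 * norm w"
          unfolding x_def by (simp add: algebra_simps)
      qed simp
      show "((\<lambda>w::complex. 2 * sqrt (norm w) + 4 * norm w) \<longlongrightarrow> 0) (at 0)"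
        by (auto intro!: tendsto_eq_intros)
    qed
    thus ?thesis using True by (auto simp: continuous_within intro: tendsto_within_subset)
  qed
qed


text \<open>On the real axis -i x has argument -pi/2 for x > 0 and pi/2 for x < 0, so x Ln(-i x) has
  imaginary part -(pi/2) |x|. This is the source of |x| in the formula for
  \<open>q n\<close>.\<close>

lemma LI_Ln_to_real_axis:
  "\<exists>C\<ge>0. \<forall>n c. 0 < c \<longrightarrow> c \<le> 1 \<longrightarrow> real n * c\<^sup>2 = 1 \<longrightarrow>
    \<bar>Im (LI c (\<lambda>w. phi n w * (Ln (- \<i> * w) / w))) + pi / 2 * integral {-(pi/2)..pi/2} (\<lambda>x. \<bar>x\<bar> * weight n 0 x)\<bar> \<le> C * c ^ K"
proof -
  have "norm (Complex x y * Ln (- \<i> * Complex x y)) \<le> 3 * 6" if "0 \<le> y" "y \<le> 1" "x = pi / 2 \<or> x = - (pi / 2)" for x y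
  proof -
    note n = norm_side(1,2)[OF that]
    have "ln (norm (Complex x y)) \<le> norm (Complex x y) - 1" using n by (intro ln_le_minus_one) auto
    moreover have "0 \<le> ln (norm (Complex x y))" using n by simp
    ultimately have "norm (Ln (- \<i> * Complex x y)) \<le> 6"
      using Ln_rotated_bound[of "Complex x y"] n by fastforce
    thus ?thesis unfolding norm_mult[of "Complex x y"] using n by (intro mult_mono) auto
  qed
  moreover have "(\<lambda>w. w * Ln (- \<i> * w)) field_differentiable at z" if "0 < Im z" for z
  proof -
    have "((\<lambda>w. w * Ln (- \<i> * w)) has_field_derivative Ln (- \<i> * z) + 1) (at z)"
      using that by (intro times_Ln_has_derivative) auto
    thus ?thesis by (auto simp: field_differentiable_def)
  qed
  ultimately obtain C where C: "C \<ge> 0" "\<And>n c. 0 < c \<Longrightarrow> c \<le> 1 \<Longrightarrow> real n * c\<^sup>2 = 1 \<Longrightarrow>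
    norm (LI c (\<lambda>w. sincc w ^ 2 * cos w ^ n * (w * Ln (- \<i> * w))) - LI 0 (\<lambda>w. sincc w ^ 2 * cos w ^ n * (w * Ln (- \<i> * w)))) \<le> C * c ^ K"
    using LI_to_real_axis[of "\<lambda>w. w * Ln (- \<i> * w)" "3 * 6" K, OF _ continuous_on_times_Ln] by blast
  have im: "Im (LI 0 (\<lambda>w. sincc w ^ 2 * cos w ^ n * (w * Ln (- \<i> * w)))) = - (pi / 2 * integral {-(pi/2)..pi/2} (\<lambda>x. \<bar>x\<bar> * weight n 0 x))" for n
  proof -
    let ?f = "\<lambda>x. sincc (Complex x 0) ^ 2 * cos (Complex x 0) ^ n * (Complex x 0 * Ln (- \<i> * Complex x 0))"
    have "continuous_on {-(pi/2)..pi/2} ?f"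
      by (intro continuous_intros continuous_on_compose2[OF continuous_on_times_Ln]) auto
    hence "?f integrable_on {-(pi/2)..pi/2}" by (rule integrable_continuous_interval)
    hence "((\<lambda>x. Im (?f x)) has_integral Im (integral {-(pi/2)..pi/2} ?f)) {-(pi/2)..pi/2}"
      by (rule has_integral_Im[OF integrable_integral])
    moreover have "Im (?f x) = - (pi / 2) * (\<bar>x\<bar> * weight n 0 x)" for x
    proof -
      have 1: "?f x = of_real (weight n 0 x) * (of_real x * Ln (- \<i> * of_real x))"
        using weight_eq[of x n 0] by (simp add: complex_of_real_def[symmetric])
      have 2: "x * Im (Ln (- \<i> * of_real x)) = - (pi / 2) * \<bar>x\<bar>"
      proof (cases x "0::real" rule: linorder_cases)
        case greater
        have "Im (Ln (of_real x * (- \<i>))) = - (pi / 2)"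
          using Ln_times_of_real[OF greater, of "- \<i>"] greater by simp
        thus ?thesis using greater by (simp add: mult.commute)
      next
        case less
        define y where "y = - x"
        have y: "0 < y" "x = - y" using less by (auto simp: y_def)
        have "Im (Ln (of_real y * \<i>)) = pi / 2"
          using Ln_times_of_real[OF y(1), of \<i>] y(1) by simp
        thus ?thesis unfolding y(2) using y(1) by (simp add: mult.commute)
      qed simp
      have "Im (of_real u * (of_real x * z)) = u * (x * Im z)" for u z by simp
      thus ?thesis unfolding 1 by (simp only: 2) simp
    qed
    ultimately have "((\<lambda>x. - (pi / 2) * (\<bar>x\<bar> * weight n 0 x)) has_integral Im (integral {-(pi/2)..pi/2} ?f)) {-(pi/2)..pi/2}"
      by (simp only:)
    hence "Im (integral {-(pi/2)..pi/2} ?f) = integral {-(pi/2)..pi/2} (\<lambda>x. - (pi / 2) * (\<bar>x\<bar> * weight n 0 x))"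
      by (rule integral_unique[symmetric])
    thus ?thesis by (simp add: LI_def)
  qed
  have "\<bar>Im (LI c (\<lambda>w. phi n w * (Ln (- \<i> * w) / w))) + pi / 2 * integral {-(pi/2)..pi/2} (\<lambda>x. \<bar>x\<bar> * weight n 0 x)\<bar> \<le> C * c ^ K"
    if c: "0 < c" "c \<le> 1" "real n * c\<^sup>2 = 1" for n c
  proof -
    have "LI c (\<lambda>w. phi n w * (Ln (- \<i> * w) / w)) = LI c (\<lambda>w. sincc w ^ 2 * cos w ^ n * (w * Ln (- \<i> * w)))"
    proof (rule LI_cong)
      fix x
      have "Complex x c \<noteq> 0" using c by (intro Complex_line_nonzero) auto
      thus "phi n (Complex x c) * (Ln (- \<i> * Complex x c) / Complex x c) = (sincc (Complex x c))\<^sup>2 * cos (Complex x c) ^ n * (Complex x c * Ln (- \<i> * Complex x c))"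
        by (simp add: phi_sincc power2_eq_square)
    qed
    thus ?thesis
      using order_trans[OF abs_Im_le_cmod C(2)[OF c]] im[of n] by simp
  qed
  with C(1) show ?thesis by blast
qed

text \<open>On the real axis the integrand is odd and integrates to 0, so only the cost of moving
  the line remains.\<close>

lemma LI_odd_small:
  "\<exists>C\<ge>0. \<forall>n c. 0 < c \<longrightarrow> c \<le> 1 \<longrightarrow> real n * c\<^sup>2 = 1 \<longrightarrow>
    norm (LI c (\<lambda>w. phi n w * (w ^ 1 / w ^ 2))) \<le> C * c ^ K"
proof -
  obtain C where C: "C \<ge> 0" "\<And>n c. 0 < c \<Longrightarrow> c \<le> 1 \<Longrightarrow> real n * c\<^sup>2 = 1 \<Longrightarrow>
    norm (LI c (\<lambda>w. phi n w * (w ^ 1 / w ^ 2)) - LI 0 (\<lambda>w. sincc w ^ 2 * cos w ^ n * w ^ 1)) \<le> C * c ^ K"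
    using LI_power_to_real_axis by blast
  have "LI 0 (\<lambda>w. sincc w ^ 2 * cos w ^ n * w ^ 1) = 0" for n
    using LI_minus[of 0 "\<lambda>w. sincc w ^ 2 * cos w ^ n * w ^ 1"] LI_cmult[of 0 "-1" "\<lambda>w. sincc w ^ 2 * cos w ^ n * w ^ 1"]
    by (simp add: sincc_minus)
  with C show ?thesis by (intro exI[of _ C]) simp
qed

text \<open>Only the logarithm survives in the imaginary part: \<open>kappa\<close> multiplies an
  odd integrand, and the boundary terms are real on the axis. The factor is (2/pi) (-1/2) (-pi/2) =
  1/2.\<close>

theorem q_integral:
  "\<exists>C\<ge>0. \<forall>n c. 0 < c \<longrightarrow> c \<le> 1 \<longrightarrow> real n * c\<^sup>2 = 1 \<longrightarrow>
    \<bar>q n - 1 / 2 * integral {-(pi/2)..pi/2} (\<lambda>x. \<bar>x\<bar> * weight n 0 x)\<bar> \<le> C * c ^ K"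
proof -
  define K' where "K' = Suc K"
  define \<gamma> where "\<gamma> a j = of_real (em_coeff a j / (2 * real j)) * (deriv ^^ (j - 1)) psi0 0" for a j
  define M where "M a c w = (kappa K' a c - Ln (- \<i> * w) / 2 - (\<Sum>j\<in>{1..<K'}. \<gamma> a j * w ^ j)) / w" for a c w
  have "\<exists>C\<ge>0. \<forall>a\<in>{2,3}. \<forall>c x. 0 < c \<longrightarrow> c \<le> 1 \<longrightarrow>
     norm (Lam 0 a (Complex x c) - M a c (Complex x c)) \<le> C * (c ^ K' / c) * (norm (Complex x c) / c) ^ (2 * K' + 5)"
  proof -
    have "1 \<le> K'" by (simp add: K'_def)
    from Lam0_expansion[OF this, of 2] Lam0_expansion[OF this, of 3] obtain C2 C3 where C23: "C2 \<ge> 0" "C3 \<ge> 0"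
      "\<And>c x. 0 < c \<Longrightarrow> c \<le> 1 \<Longrightarrow> norm (Lam 0 2 (Complex x c) - M 2 c (Complex x c)) \<le> C2 * (c ^ K' / c) * (norm (Complex x c) / c) ^ (2 * K' + 5)"
      "\<And>c x. 0 < c \<Longrightarrow> c \<le> 1 \<Longrightarrow> norm (Lam 0 3 (Complex x c) - M 3 c (Complex x c)) \<le> C3 * (c ^ K' / c) * (norm (Complex x c) / c) ^ (2 * K' + 5)"
      unfolding M_def \<gamma>_def by auto
    have le: "C2 * (c ^ K' / c) * (norm (Complex x c) / c) ^ (2 * K' + 5) \<le> (C2 + C3) * (c ^ K' / c) * (norm (Complex x c) / c) ^ (2 * K' + 5)"
      "C3 * (c ^ K' / c) * (norm (Complex x c) / c) ^ (2 * K' + 5) \<le> (C2 + C3) * (c ^ K' / c) * (norm (Complex x c) / c) ^ (2 * K' + 5)" if "0 < c" for c x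
    proof -
      have pos: "0 \<le> c ^ K' / c" "0 \<le> (norm (Complex x c) / c) ^ (2 * K' + 5)" using that by auto
      show "C2 * (c ^ K' / c) * (norm (Complex x c) / c) ^ (2 * K' + 5) \<le> (C2 + C3) * (c ^ K' / c) * (norm (Complex x c) / c) ^ (2 * K' + 5)"
        "C3 * (c ^ K' / c) * (norm (Complex x c) / c) ^ (2 * K' + 5) \<le> (C2 + C3) * (c ^ K' / c) * (norm (Complex x c) / c) ^ (2 * K' + 5)"
        using C23 by (intro mult_right_mono pos, simp)+
    qed
    show ?thesis
    proof (intro exI[of _ "C2 + C3"] conjI ballI allI impI)
      fix a c x :: real assume a: "a \<in> {2,3}" and c: "0 < c" "c \<le> 1"
      show "norm (Lam 0 a (Complex x c) - M a c (Complex x c)) \<le> (C2 + C3) * (c ^ K' / c) * (norm (Complex x c) / c) ^ (2 * K' + 5)"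
        using a order_trans[OF C23(3)[OF c] le(1)[OF c(1)]] order_trans[OF C23(4)[OF c] le(2)[OF c(1)]] by blast
    qed (use C23 in simp)
  qed
  then obtain C1 where C1: "C1 \<ge> 0" "\<And>a c x. a \<in> {2,3} \<Longrightarrow> 0 < c \<Longrightarrow> c \<le> 1 \<Longrightarrow>
     norm (Lam 0 a (Complex x c) - M a c (Complex x c)) \<le> C1 * (c ^ K' / c) * (norm (Complex x c) / c) ^ (2 * K' + 5)"
    by blast
  obtain D where D: "D \<ge> 0" "\<And>n c B g. 0 < c \<Longrightarrow> c \<le> 1 \<Longrightarrow> real n * c\<^sup>2 = 1 \<Longrightarrow> 0 \<le> B \<Longrightarrow>
     continuous_on UNIV (\<lambda>x. g (Complex x c)) \<Longrightarrow>
     (\<And>x. \<bar>x\<bar> \<le> pi/2 \<Longrightarrow> norm (g (Complex x c)) \<le> B * (norm (Complex x c) / c) ^ (2 * K' + 5)) \<Longrightarrow>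
     norm (LI c (\<lambda>w. phi n w * g w)) \<le> D * B * c ^ 3"
    using LI_bound[of "2 * K' + 5"] by blast
  obtain C2 where C2: "C2 \<ge> 0" "\<And>a c. a \<in> {2,3} \<Longrightarrow> 0 < c \<Longrightarrow> c \<le> 1 \<Longrightarrow> norm (kappa K' a c) \<le> C2 / c ^ 2"
  proof -
    from kappa_bound[of 2 K'] kappa_bound[of 3 K'] obtain A B where AB: "A \<ge> 0" "B \<ge> 0"
      "\<And>c. 0 < c \<Longrightarrow> c \<le> 1 \<Longrightarrow> norm (kappa K' 2 c) \<le> A / c ^ 2" "\<And>c. 0 < c \<Longrightarrow> c \<le> 1 \<Longrightarrow> norm (kappa K' 3 c) \<le> B / c ^ 2"
      by auto
    have "norm (kappa K' a c) \<le> (A + B) / c ^ 2" if "a \<in> {2,3}" "0 < c" "c \<le> 1" for a c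
    proof -
      have "A / c ^ 2 \<le> (A + B) / c ^ 2" "B / c ^ 2 \<le> (A + B) / c ^ 2" using AB by (auto intro!: divide_right_mono)
      thus ?thesis using that AB(3,4)[OF that(2,3)] by auto
    qed
    with AB show ?thesis using that[of "A + B"] by simp
  qed
  \<comment> \<open>The exponent K + 2 pays for the bound \<open>C2 / c ^ 2\<close> on
    \<open>kappa\<close>.\<close>
  obtain C3 where C3: "C3 \<ge> 0" "\<And>n c. 0 < c \<Longrightarrow> c \<le> 1 \<Longrightarrow> real n * c\<^sup>2 = 1 \<Longrightarrow>
    norm (LI c (\<lambda>w. phi n w * (w ^ 1 / w ^ 2))) \<le> C3 * c ^ (K + 2)" using LI_odd_small by blast
  obtain C4 where C4: "C4 \<ge> 0" "\<And>n c. 0 < c \<Longrightarrow> c \<le> 1 \<Longrightarrow> real n * c\<^sup>2 = 1 \<Longrightarrow>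
    \<bar>Im (LI c (\<lambda>w. phi n w * (Ln (- \<i> * w) / w))) + pi / 2 * integral {-(pi/2)..pi/2} (\<lambda>x. \<bar>x\<bar> * weight n 0 x)\<bar> \<le> C4 * c ^ K"
    using LI_Ln_to_real_axis by blast
  obtain C5 where C5: "C5 \<ge> 0" "\<And>n c. 0 < c \<Longrightarrow> c \<le> 1 \<Longrightarrow> real n * c\<^sup>2 = 1 \<Longrightarrow>
    \<bar>Im (\<Sum>j\<in>{1..<K'}. \<gamma> (real (offs n)) j * LI c (\<lambda>w. phi n w * (w ^ (j + 1) / w ^ 2)))\<bar> \<le> C5 * c ^ K"
  proof -
    have "norm (\<gamma> (real (offs n)) j) \<le> norm (\<gamma> 2 j) + norm (\<gamma> 3 j)" for n j by (auto simp: offs_def)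
    moreover have "Im (\<gamma> (real (offs n)) j) = 0" for n j by (simp add: \<gamma>_def psi0_deriv_real)
    ultimately show ?thesis
      using boundary_terms_small[of "\<lambda>n. \<gamma> (real (offs n))" "{1..<K'}" "\<lambda>j. norm (\<gamma> 2 j) + norm (\<gamma> 3 j)" "\<lambda>j. j + 1" K] that by blast
  qed
  define C where "C = D * C1 + C2 * C3 + C4 + C5"
  have "\<bar>q n - 1 / 2 * integral {-(pi/2)..pi/2} (\<lambda>x. \<bar>x\<bar> * weight n 0 x)\<bar> \<le> C * c ^ K"
    if c: "0 < c" "c \<le> 1" "real n * c\<^sup>2 = 1" for n c
  proof -
    define a where "a = real (offs n)"
    have a23: "a \<in> {2,3}" by (auto simp: a_def offs_def)
    define J where "J = integral {-(pi/2)..pi/2} (\<lambda>x. \<bar>x\<bar> * weight n 0 x)"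
    define E where "E w = Lam 0 a w - M a c w" for w
    have nz: "Complex x c \<noteq> 0" for x using c by (simp add: Complex_line_nonzero)
    have nn: "- \<i> * Complex x c \<notin> \<real>\<^sub>\<le>\<^sub>0" for x using c by (intro rotated_not_nonpos nz) auto
    have contL: "continuous_on UNIV (\<lambda>x. Lam 0 a (Complex x c))"
      unfolding a_def by (rule continuous_on_Lam_line[OF c(1) offs_range])
    have contLn: "continuous_on UNIV (\<lambda>x. Ln (- \<i> * Complex x c))"
      by (intro continuous_on_Ln continuous_intros nn)
    have contM: "continuous_on UNIV (\<lambda>x. M a c (Complex x c))"
      unfolding M_def by (intro continuous_intros contLn) (use nz in auto)
    have contE: "continuous_on UNIV (\<lambda>x. E (Complex x c))"
      unfolding E_def by (intro continuous_intros contL contM)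
    have LE: "norm (LI c (\<lambda>w. phi n w * E w)) \<le> D * C1 * c ^ K"
    proof -
      have "norm (LI c (\<lambda>w. phi n w * E w)) \<le> D * (C1 * (c ^ K' / c)) * c ^ 3"
        unfolding E_def by (rule D(2)[OF c _ contE[unfolded E_def] C1(2)[OF a23 c(1,2)]]) (use C1 c in auto)
      also have "\<dots> = D * C1 * (c ^ K * c ^ 3)" using c by (simp add: K'_def)
      also have "\<dots> \<le> D * C1 * (c ^ K * 1)"
        using c C1 D by (intro mult_left_mono power_le_one) auto
      finally show ?thesis by simp
    qed
    have c1: "continuous_on UNIV (\<lambda>x. kappa K' a c * (phi n (Complex x c) * (Complex x c ^ 1 / Complex x c ^ 2)))"
      by (intro continuous_intros continuous_on_phi_line) (use nz in auto)
    have c2: "continuous_on UNIV (\<lambda>x. 1 / 2 * (phi n (Complex x c) * (Ln (- \<i> * Complex x c) / Complex x c)))"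
      by (intro continuous_intros continuous_on_phi_line contLn) (use nz in auto)
    have c3: "continuous_on UNIV (\<lambda>x. \<gamma> a j * (phi n (Complex x c) * (Complex x c ^ (j + 1) / Complex x c ^ 2)))" for j
      by (intro continuous_intros continuous_on_phi_line) (use nz in auto)
    have "LI c (\<lambda>w. phi n w * Lam 0 a w) = LI c (\<lambda>w. phi n w * M a c w + phi n w * E w)"
      by (simp add: E_def ring_distribs)
    also have "\<dots> = LI c (\<lambda>w. phi n w * M a c w) + LI c (\<lambda>w. phi n w * E w)"
      by (intro LI_add continuous_intros continuous_on_phi_line contM contE)
    also have "LI c (\<lambda>w. phi n w * M a c w) = LI c (\<lambda>w. (kappa K' a c * (phi n w * (w ^ 1 / w ^ 2)) - 1 / 2 * (phi n w * (Ln (- \<i> * w) / w)))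
        - (\<Sum>j\<in>{1..<K'}. \<gamma> a j * (phi n w * (w ^ (j + 1) / w ^ 2))))"
    proof (rule LI_cong)
      fix x
      define w where "w = Complex x c"
      have w: "w \<noteq> 0" using nz by (simp add: w_def)
      have "phi n w * M a c w = kappa K' a c * (phi n w * (1 / w)) - 1 / 2 * (phi n w * (Ln (- \<i> * w) / w)) - (\<Sum>j\<in>{1..<K'}. \<gamma> a j * (phi n w * (w ^ j / w)))"
        unfolding M_def by (simp add: diff_divide_distrib right_diff_distrib sum_divide_distrib sum_distrib_left mult_ac)
      moreover have "w ^ 1 / w ^ 2 = 1 / w" "w ^ (j + 1) / w ^ 2 = w ^ j / w" for j using w by (auto simp: power2_eq_square)
      ultimately show "phi n (Complex x c) * M a c (Complex x c) = kappa K' a c * (phi n (Complex x c) * (Complex x c ^ 1 / (Complex x c)\<^sup>2)) -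
         1 / 2 * (phi n (Complex x c) * (Ln (- \<i> * Complex x c) / Complex x c)) -
         (\<Sum>j = 1..<K'. \<gamma> a j * (phi n (Complex x c) * (Complex x c ^ (j + 1) / (Complex x c)\<^sup>2)))"
        unfolding w_def by presburger
    qed
    also have "\<dots> = kappa K' a c * LI c (\<lambda>w. phi n w * (w ^ 1 / w ^ 2)) - 1 / 2 * LI c (\<lambda>w. phi n w * (Ln (- \<i> * w) / w))
        - (\<Sum>j\<in>{1..<K'}. \<gamma> a j * LI c (\<lambda>w. phi n w * (w ^ (j + 1) / w ^ 2)))"
      unfolding LI_diff[OF continuous_on_diff[OF c1 c2] continuous_on_sum[OF c3]] LI_diff[OF c1 c2] LI_sum[OF finite_atLeastLessThan c3] LI_cmult ..
    finally have LIeq: "LI c (\<lambda>w. phi n w * Lam 0 a w) = kappa K' a c * LI c (\<lambda>w. phi n w * (w ^ 1 / w ^ 2)) - 1 / 2 * LI c (\<lambda>w. phi n w * (Ln (- \<i> * w) / w))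
        - (\<Sum>j\<in>{1..<K'}. \<gamma> a j * LI c (\<lambda>w. phi n w * (w ^ (j + 1) / w ^ 2))) + LI c (\<lambda>w. phi n w * E w)" .
    have A: "\<bar>Im (kappa K' a c * LI c (\<lambda>w. phi n w * (w ^ 1 / w ^ 2)))\<bar> \<le> C2 * C3 * c ^ K"
    proof -
      have "\<bar>Im (kappa K' a c * LI c (\<lambda>w. phi n w * (w ^ 1 / w ^ 2)))\<bar> \<le> (C2 / c ^ 2) * (C3 * c ^ (K + 2))"
        using mult_mono[OF C2(2)[OF a23 c(1,2)] C3(2)[OF c]] C2 c
        by (intro order_trans[OF abs_Im_le_cmod]) (simp add: norm_mult)
      thus ?thesis using c by (simp add: power_add power2_eq_square)
    qed
    have "q n = 2 / pi * Im (LI c (\<lambda>w. phi n w * Lam 0 a w))"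
      using moment_LI[OF c(1), of 0 n] by (simp add: moment_0 a_def)
    hence qe: "q n - 1 / 2 * J = 2 / pi * (Im (kappa K' a c * LI c (\<lambda>w. phi n w * (w ^ 1 / w ^ 2)))
        - 1 / 2 * (Im (LI c (\<lambda>w. phi n w * (Ln (- \<i> * w) / w))) + pi / 2 * J)
        - Im (\<Sum>j\<in>{1..<K'}. \<gamma> a j * LI c (\<lambda>w. phi n w * (w ^ (j + 1) / w ^ 2))) + Im (LI c (\<lambda>w. phi n w * E w)))"
    proof -
      have "2 / pi * Im (X - 1 / 2 * Y - Z + V) - 1 / 2 * J = 2 / pi * (Im X - 1 / 2 * (Im Y + pi / 2 * J) - Im Z + Im V)" for X Y Z V
        by (simp add: field_simps)
      moreover assume "q n = 2 / pi * Im (LI c (\<lambda>w. phi n w * Lam 0 a w))"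
      ultimately show ?thesis unfolding LIeq by presburger
    qed
    have "\<bar>q n - 1 / 2 * J\<bar> \<le> 1 * \<bar>Im (kappa K' a c * LI c (\<lambda>w. phi n w * (w ^ 1 / w ^ 2)))
        - 1 / 2 * (Im (LI c (\<lambda>w. phi n w * (Ln (- \<i> * w) / w))) + pi / 2 * J)
        - Im (\<Sum>j\<in>{1..<K'}. \<gamma> a j * LI c (\<lambda>w. phi n w * (w ^ (j + 1) / w ^ 2))) + Im (LI c (\<lambda>w. phi n w * E w))\<bar>"
      unfolding qe abs_mult using pi_gt3 by (intro mult_right_mono) auto
    also have "\<dots> \<le> C2 * C3 * c ^ K + C4 * c ^ K + C5 * c ^ K + D * C1 * c ^ K"
    proof -
      have "1 * \<bar>X - 1 / 2 * Y - Z + V\<bar> \<le> x + y + z + v"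
        if "\<bar>X\<bar> \<le> x" "\<bar>Y\<bar> \<le> y" "\<bar>Z\<bar> \<le> z" "\<bar>V\<bar> \<le> v" for X Y Z V x y z v :: real
        using that by (auto simp: abs_le_iff)
      from this[OF A C4(2)[OF c] C5(2)[OF c] order_trans[OF abs_Im_le_cmod LE]] show ?thesis
        unfolding J_def a_def .
    qed
    also have "\<dots> = C * c ^ K" by (simp add: C_def algebra_simps)
    finally show ?thesis by (simp only: J_def)
  qed
  moreover have "C \<ge> 0" using C1 C2 C3 C4 C5 D by (simp add: C_def)
  ultimately show ?thesis by blast
qed

section \<open>Beta integrals and the expansion of q n\<close>

text \<open>Half the Beta function at ((m+1)/2, (n+1)/2). Odd m gives a rational function of n, even
  m a rational multiple of the Wallis integral \<open>SI 0 n\<close>.\<close>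

definition SI :: "nat \<Rightarrow> nat \<Rightarrow> real" where
  "SI m n = integral {0..pi/2} (\<lambda>x. sin x ^ m * cos x ^ n)"

lemma SI_integrable: "(\<lambda>x::real. sin x ^ m * cos x ^ n) integrable_on {0..pi/2}"
  by (intro integrable_continuous_interval continuous_intros)

text \<open>Integrate the derivative of sin^(m+1) x cos^(n+1) x, which vanishes at both ends, and
  eliminate cos^2.\<close>

lemma SI_rec: "SI (m + 2) n = real (m + 1) / real (m + n + 2) * SI m n"
proof -
  have "((\<lambda>x. real (m + 1) * (sin x ^ m * cos x ^ n) - real (m + n + 2) * (sin x ^ (m + 2) * cos x ^ n)) has_integral
     (sin (pi/2) ^ (m + 1) * cos (pi/2) ^ (n + 1) - sin 0 ^ (m + 1) * cos 0 ^ (n + 1))) {0..pi/2}"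
  proof (rule fundamental_theorem_of_calculus)
    fix x :: real
    have "((\<lambda>x. sin x ^ (m + 1) * cos x ^ (n + 1)) has_real_derivative
        real (m + 1) * (sin x ^ m * cos x ^ n) - real (m + n + 2) * (sin x ^ (m + 2) * cos x ^ n)) (at x within {0..pi/2})"
    proof -
      have c2: "cos x ^ (n + 2) = cos x ^ n * (1 - sin x ^ 2)"
        by (simp only: power_add cos_squared_eq)
      have "((\<lambda>x. sin x ^ (m + 1) * cos x ^ (n + 1)) has_real_derivative
        real (m + 1) * sin x ^ m * cos x ^ (n + 2) - real (n + 1) * sin x ^ (m + 2) * cos x ^ n) (at x within {0..pi/2})"
      proof -
        have "((\<lambda>x. sin x ^ Suc m) has_real_derivative (1 + real m) * (cos x * sin x ^ m)) (at x within {0..pi/2})"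
          by (rule DERIV_power_Suc) (auto intro!: derivative_eq_intros)
        moreover have "((\<lambda>x. cos x ^ Suc n) has_real_derivative (1 + real n) * (- sin x * cos x ^ n)) (at x within {0..pi/2})"
          by (rule DERIV_power_Suc) (auto intro!: derivative_eq_intros)
        ultimately have "((\<lambda>x. sin x ^ Suc m * cos x ^ Suc n) has_real_derivative
          (1 + real m) * (cos x * sin x ^ m) * cos x ^ Suc n + (1 + real n) * (- sin x * cos x ^ n) * sin x ^ Suc m) (at x within {0..pi/2})"
          by (rule DERIV_mult)
        moreover have "(1 + real m) * (cos x * sin x ^ m) * cos x ^ Suc n + (1 + real n) * (- sin x * cos x ^ n) * sin x ^ Suc m
          = real (m + 1) * sin x ^ m * cos x ^ (n + 2) - real (n + 1) * sin x ^ (m + 2) * cos x ^ n"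
          by (simp add: algebra_simps)
        ultimately show ?thesis by (simp only: Suc_eq_plus1)
      qed
      also have "real (m + 1) * sin x ^ m * cos x ^ (n + 2) - real (n + 1) * sin x ^ (m + 2) * cos x ^ n =
        real (m + 1) * (sin x ^ m * cos x ^ n) - real (m + n + 2) * (sin x ^ (m + 2) * cos x ^ n)"
        unfolding c2 by (simp add: algebra_simps power_add power2_eq_square)
      finally show ?thesis .
    qed
    thus "((\<lambda>x. sin x ^ (m + 1) * cos x ^ (n + 1)) has_vector_derivative
        real (m + 1) * (sin x ^ m * cos x ^ n) - real (m + n + 2) * (sin x ^ (m + 2) * cos x ^ n)) (at x within {0..pi/2})"
      by (simp only: has_real_derivative_iff_has_vector_derivative)
  qed simp
  hence A: "((\<lambda>x. real (m + 1) * (sin x ^ m * cos x ^ n) - real (m + n + 2) * (sin x ^ (m + 2) * cos x ^ n)) has_integral 0) {0..pi/2}"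
    by simp
  have B: "((\<lambda>x. real (m + 1) * (sin x ^ m * cos x ^ n) - real (m + n + 2) * (sin x ^ (m + 2) * cos x ^ n)) has_integral
      (real (m + 1) * SI m n - real (m + n + 2) * SI (m + 2) n)) {0..pi/2}"
    unfolding SI_def by (intro has_integral_diff has_integral_mult_right integrable_integral SI_integrable)
  have "real (m + 1) * SI m n = real (m + n + 2) * SI (m + 2) n"
    using has_integral_unique[OF A B] by linarith
  thus ?thesis by (simp add: field_simps)
qed

lemma SI_1: "SI 1 n = 1 / real (n + 1)"
proof -
  have "((\<lambda>x. sin x ^ 1 * cos x ^ n) has_integral (- (cos (pi/2) ^ (n + 1)) / real (n + 1) - - (cos 0 ^ (n + 1)) / real (n + 1))) {0..pi/2}"
  proof (rule fundamental_theorem_of_calculus)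
    fix x :: real
    have "((\<lambda>x. - (cos x ^ (n + 1)) / real (n + 1)) has_real_derivative sin x ^ 1 * cos x ^ n) (at x within {0..pi/2})"
    proof -
      have "((\<lambda>x. cos x ^ (n + 1)) has_real_derivative real (n + 1) * (cos x ^ n * (- sin x))) (at x within {0..pi/2})"
        using DERIV_power_Suc[where f = cos and n = n, OF DERIV_cos[THEN has_field_derivative_at_within], of x "{0..pi/2}"]
        by (simp add: algebra_simps)
      from DERIV_cdivide[OF DERIV_minus[OF this], of "real (n + 1)"] show ?thesis by (simp del: of_nat_add add: mult.commute)
    qed
    thus "((\<lambda>x. - (cos x ^ (n + 1)) / real (n + 1)) has_vector_derivative sin x ^ 1 * cos x ^ n) (at x within {0..pi/2})"
      by (simp only: has_real_derivative_iff_has_vector_derivative)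
  qed simp
  thus ?thesis unfolding SI_def by (simp add: integral_unique)
qed

lemma SI_odd:
  "SI 3 n = 2 / ((real n + 1)*(real n + 3))"
  "SI 5 n = 8 / ((real n + 1)*(real n + 3)*(real n + 5))"
  "SI 7 n = 48 / ((real n + 1)*(real n + 3)*(real n + 5)*(real n + 7))"
  "SI 9 n = 384 / ((real n + 1)*(real n + 3)*(real n + 5)*(real n + 7)*(real n + 9))"
  "SI 11 n = 3840 / ((real n + 1)*(real n + 3)*(real n + 5)*(real n + 7)*(real n + 9)*(real n + 11))"
  "SI 13 n = 46080 / ((real n + 1)*(real n + 3)*(real n + 5)*(real n + 7)*(real n + 9)*(real n + 11)*(real n + 13))"
proof -
  show 3: "SI 3 n = 2 / ((real n + 1)*(real n + 3))" using SI_rec[of 1 n] by (simp add: SI_1[unfolded One_nat_def] add_ac numeral_3_eq_3)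
  show 5: "SI 5 n = 8 / ((real n + 1)*(real n + 3)*(real n + 5))" using SI_rec[of 3 n] by (simp add: 3 add_ac)
  show 7: "SI 7 n = 48 / ((real n + 1)*(real n + 3)*(real n + 5)*(real n + 7))" using SI_rec[of 5 n] by (simp add: 5 add_ac)
  show 9: "SI 9 n = 384 / ((real n + 1)*(real n + 3)*(real n + 5)*(real n + 7)*(real n + 9))" using SI_rec[of 7 n] by (simp add: 7 add_ac)
  show 11: "SI 11 n = 3840 / ((real n + 1)*(real n + 3)*(real n + 5)*(real n + 7)*(real n + 9)*(real n + 11))" using SI_rec[of 9 n] by (simp add: 9 add_ac)
  show "SI 13 n = 46080 / ((real n + 1)*(real n + 3)*(real n + 5)*(real n + 7)*(real n + 9)*(real n + 11)*(real n + 13))" using SI_rec[of 11 n] by (simp add: 11 add_ac)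
qed

lemma SI_even:
  "SI 2 n = SI 0 n / (real n + 2)"
  "SI 4 n = 3 * SI 0 n / ((real n + 2)*(real n + 4))"
  "SI 6 n = 15 * SI 0 n / ((real n + 2)*(real n + 4)*(real n + 6))"
  "SI 8 n = 105 * SI 0 n / ((real n + 2)*(real n + 4)*(real n + 6)*(real n + 8))"
proof -
  show 2: "SI 2 n = SI 0 n / (real n + 2)" using SI_rec[of 0 n] by (simp add: numeral_2_eq_2 add_ac)
  show 4: "SI 4 n = 3 * SI 0 n / ((real n + 2)*(real n + 4))" using SI_rec[of 2 n] by (simp add: 2 add_ac)
  show 6: "SI 6 n = 15 * SI 0 n / ((real n + 2)*(real n + 4)*(real n + 6))" using SI_rec[of 4 n] by (simp add: 4 add_ac)
  show "SI 8 n = 105 * SI 0 n / ((real n + 2)*(real n + 4)*(real n + 6)*(real n + 8))" using SI_rec[of 6 n] by (simp add: 6 add_ac)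
qed

text \<open>Near 0 the functions x and sin x are comparable; away from 0 the quotient by sin^p x is
  continuous on a compact interval.\<close>

lemma bound_by_sin_power:
  fixes f :: "real \<Rightarrow> real"
  assumes cont: "continuous_on {0<..pi/2} f" and O: "f \<in> O[at_right 0](\<lambda>x. x ^ p)"
  shows "\<exists>C\<ge>0. \<forall>x\<in>{0<..pi/2}. \<bar>f x\<bar> \<le> C * sin x ^ p"
proof -
  have "(\<lambda>x::real. x ^ p) \<in> O[at_right 0](\<lambda>x. sin x ^ p)"
  proof -
    have "(\<lambda>x::real. x) \<in> O[at_right 0](\<lambda>x. sin x)" by real_asymp
    thus ?thesis by (rule landau_o.big_power)
  qed
  from landau_o.big_trans[OF O this] obtain C1 where C1: "C1 > 0" "eventually (\<lambda>x. norm (f x) \<le> C1 * norm (sin x ^ p)) (at_right 0)"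
    by (elim landau_o.bigE)
  then obtain d where d: "d > 0" "\<And>x. 0 < x \<Longrightarrow> x < d \<Longrightarrow> norm (f x) \<le> C1 * norm (sin x ^ p)"
    unfolding eventually_at_right_field by auto
  define d' where "d' = min d (pi/2) / 2"
  have d': "0 < d'" "d' < d" "d' < pi / 2" using d pi_gt_zero by (auto simp: d'_def min_def)
  have sp: "0 < sin x" if "x \<in> {0<..pi/2}" for x using that by (intro sin_gt_zero) auto
  have "compact ((\<lambda>x. f x / sin x ^ p) ` {d'..pi/2})"
  proof (intro compact_continuous_image continuous_intros continuous_on_subset[OF cont])
    show "\<forall>x\<in>{d'..pi/2}. sin x ^ p \<noteq> 0" 
    proof
      fix x assume "x \<in> {d'..pi/2}"
      hence "0 < sin x" using d'(1) by (intro sp) auto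
      thus "sin x ^ p \<noteq> 0" by simp
    qed
  qed (use d' in auto)
  from compact_imp_bounded[OF this] obtain C2 where C2: "C2 > 0" "\<forall>y\<in>(\<lambda>x. f x / sin x ^ p) ` {d'..pi/2}. norm y \<le> C2"
    unfolding bounded_pos by blast
  have "\<bar>f x\<bar> \<le> (C1 + C2) * sin x ^ p" if x: "x \<in> {0<..pi/2}" for x
  proof (cases "x < d'")
    case True
    hence "\<bar>f x\<bar> \<le> C1 * sin x ^ p" using d(2)[of x] d' x sp[OF x] by simp
    also have "\<dots> \<le> (C1 + C2) * sin x ^ p" using C2 sp[OF x] by (intro mult_right_mono) auto
    finally show ?thesis .
  next
    case False
    hence "\<bar>f x / sin x ^ p\<bar> \<le> C2" using C2(2) x by auto
    hence "\<bar>f x\<bar> \<le> C2 * sin x ^ p" using sp[OF x] by (simp add: abs_mult field_simps)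
    also have "\<dots> \<le> (C1 + C2) * sin x ^ p" using C1 sp[OF x] by (intro mult_right_mono) auto
    finally show ?thesis .
  qed
  thus ?thesis using C1 C2 by (intro exI[of _ "C1 + C2"]) auto
qed

text \<open>Expanding in powers of the sine instead of powers of the variable turns each term of the
  Laplace expansion into a Beta integral, i.e. a rational function of n (times a Wallis integral).\<close>

lemma integral_expansion:
  fixes g :: "real \<Rightarrow> real" and a :: "nat \<Rightarrow> real"
  assumes fin: "finite A" and cont: "continuous_on {0<..pi/2} g"
    and O: "(\<lambda>x. g x - (\<Sum>k\<in>A. a k * sin x ^ k)) \<in> O[at_right 0](\<lambda>x. x ^ p)"
    and int: "\<And>n. (\<lambda>x. g x * cos x ^ n) integrable_on {0..pi/2}"
  shows "\<exists>C\<ge>0. \<forall>n. \<bar>integral {0..pi/2} (\<lambda>x. g x * cos x ^ n) - (\<Sum>k\<in>A. a k * SI k n)\<bar> \<le> C * SI p n"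
proof -
  have "continuous_on {0<..pi/2} (\<lambda>x. g x - (\<Sum>k\<in>A. a k * sin x ^ k))"
    by (intro continuous_intros cont)
  from bound_by_sin_power[OF this O] obtain C where C: "C \<ge> 0"
    "\<And>x. x \<in> {0<..pi/2} \<Longrightarrow> \<bar>g x - (\<Sum>k\<in>A. a k * sin x ^ k)\<bar> \<le> C * sin x ^ p" by blast
  have "\<bar>integral {0..pi/2} (\<lambda>x. g x * cos x ^ n) - (\<Sum>k\<in>A. a k * SI k n)\<bar> \<le> C * SI p n" for n
  proof -
    let ?R = "\<lambda>x. g x * cos x ^ n - (\<Sum>k\<in>A. a k * (sin x ^ k * cos x ^ n))"
    \<comment> \<open>The bound on g is available only for x > 0, so the remainder is redefined at
      the single point 0.\<close>
    let ?R' = "\<lambda>x. if x = 0 then 0 else ?R x"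
    have "(?R has_integral (integral {0..pi/2} (\<lambda>x. g x * cos x ^ n) - (\<Sum>k\<in>A. a k * SI k n))) {0..pi/2}"
      unfolding SI_def by (intro has_integral_diff has_integral_sum fin has_integral_mult_right integrable_integral SI_integrable int)
    hence R: "(?R' has_integral (integral {0..pi/2} (\<lambda>x. g x * cos x ^ n) - (\<Sum>k\<in>A. a k * SI k n))) {0..pi/2}"
      by (rule has_integral_spike_finite[of "{0}", rotated 2]) auto
    have S: "((\<lambda>x. C * (sin x ^ p * cos x ^ n)) has_integral C * SI p n) {0..pi/2}"
      unfolding SI_def by (intro has_integral_mult_right integrable_integral SI_integrable)
    have "norm (integral {0..pi/2} ?R') \<le> integral {0..pi/2} (\<lambda>x. C * (sin x ^ p * cos x ^ n))"
    proof (rule integral_norm_bound_integral)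
      fix x assume x: "x \<in> {0..pi/2}"
      show "norm (?R' x) \<le> C * (sin x ^ p * cos x ^ n)"
      proof (cases "x = 0")
        case False
        have "?R x = (g x - (\<Sum>k\<in>A. a k * sin x ^ k)) * cos x ^ n"
          by (simp add: left_diff_distrib sum_distrib_right mult.assoc)
        moreover have "0 \<le> cos x ^ n" using x by (intro zero_le_power cos_ge_zero) auto
        moreover have "\<bar>g x - (\<Sum>k\<in>A. a k * sin x ^ k)\<bar> \<le> C * sin x ^ p" using False x by (intro C(2)) auto
        ultimately have "\<bar>?R x\<bar> \<le> C * sin x ^ p * cos x ^ n" by (simp only: abs_mult abs_of_nonneg mult_right_mono)
        thus ?thesis using False by (simp add: mult.assoc)
      next
        case True
        have "0 \<le> sin x ^ p * cos x ^ n" using x by (intro mult_nonneg_nonneg zero_le_power cos_ge_zero sin_ge_zero) auto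
        from mult_nonneg_nonneg[OF C(1) this] show ?thesis using True by simp
      qed
    qed (use R S in blast)+
    thus ?thesis unfolding integral_unique[OF R] integral_unique[OF S] by simp
  qed
  with C(1) show ?thesis by blast
qed

lemma continuous_on_sinc_real: "continuous_on A (\<lambda>x::real. if x = 0 then 1 else sin x / x)"
proof -
  have "continuous_on A (\<lambda>x. Re (sincc (of_real x)))" by (intro continuous_intros)
  thus ?thesis by (simp add: sincc_of_real)
qed

lemma continuous_on_weight_real: "continuous_on A (weight n j)"
  unfolding weight_def by (intro continuous_intros continuous_on_sinc_real)

lemma weight_even: "weight n 0 (- x) = weight n 0 x"
  by (simp add: weight_def)

lemma integral_even:
  fixes f :: "real \<Rightarrow> real"
  assumes "continuous_on UNIV f" "\<And>x. f (- x) = f x" "0 \<le> b"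
  shows "integral {-b..b} f = 2 * integral {0..b} f"
proof -
  have "integral {-b..b} f = integral {-b..0} f + integral {0..b} f"
    using assms by (intro Henstock_Kurzweil_Integration.integral_combine[symmetric] integrable_continuous_interval) (auto intro: continuous_on_subset)
  also have "integral {-b..-0} (\<lambda>x. f (- x)) = integral {0..b} f"
    by (rule Henstock_Kurzweil_Integration.integral_reflect_real)
  hence "integral {-b..0} f = integral {0..b} f" by (simp add: assms(2))
  finally show ?thesis by simp
qed

text \<open>With s = sin x and x > 0 the weight is s^2 / arcsin s; the numbers \<open>a k\<close>
  are its Taylor coefficients. Only odd powers occur, so every term is rational in n, and the
  remainder is \<open>SI 13 n\<close> = O(n^-7).\<close>

lemma q_main_expansion:
  "(\<lambda>n. 1 / 2 * integral {-(pi/2)..pi/2} (\<lambda>x. \<bar>x\<bar> * weight n 0 x) -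
    (1 / real n - 4 / (3 * real n ^ 2) + 88 / (45 * real n ^ 3)
        - 976 / (315 * real n ^ 4) + 3488 / (675 * real n ^ 5) - 276928 / (31185 * real n ^ 6))) \<in> O(\<lambda>n. 1 / real n ^ 7)"
proof -
  define g where "g x = \<bar>x\<bar> * (if x = 0 then 1 else sin x / x) ^ 2" for x :: real
  define A :: "nat set" where "A = {1, 3, 5, 7, 9, 11}"
  define a :: "nat \<Rightarrow> real" where "a k = (if k = 1 then 1 else if k = 3 then -1/6 else if k = 5 then -17/360
    else if k = 7 then -367/15120 else if k = 9 then -27859/1814400 else -1295803/119750400)" for k
  have contg: "continuous_on A g" for A
    unfolding g_def by (intro continuous_intros continuous_on_sinc_real)
  have int2: "1 / 2 * integral {-(pi/2)..pi/2} (\<lambda>x. \<bar>x\<bar> * weight n 0 x) = integral {0..pi/2} (\<lambda>x. g x * cos x ^ n)" for n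
  proof -
    have "integral {-(pi/2)..pi/2} (\<lambda>x. \<bar>x\<bar> * weight n 0 x) = 2 * integral {0..pi/2} (\<lambda>x. \<bar>x\<bar> * weight n 0 x)"
      by (intro integral_even continuous_intros continuous_on_weight_real) (auto simp: weight_even)
    thus ?thesis by (simp add: g_def weight_def mult.assoc)
  qed
  have "(\<lambda>x::real. sin x ^ 2 / x - (sin x - 1/6 * sin x ^ 3 - 17/360 * sin x ^ 5 - 367/15120 * sin x ^ 7 - 27859/1814400 * sin x ^ 9 - 1295803/119750400 * sin x ^ 11)) \<in> O[at_right 0](\<lambda>x. x ^ 13)"
    by real_asymp
  also have "?this \<longleftrightarrow> (\<lambda>x. g x - (\<Sum>k\<in>A. a k * sin x ^ k)) \<in> O[at_right 0](\<lambda>x. x ^ 13)"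
  proof (rule landau_o.big.in_cong)
    show "\<forall>\<^sub>F x in at_right 0. sin x ^ 2 / x - (sin x - 1/6 * sin x ^ 3 - 17/360 * sin x ^ 5 - 367/15120 * sin x ^ 7 - 27859/1814400 * sin x ^ 9 - 1295803/119750400 * sin x ^ 11)
        = g x - (\<Sum>k\<in>A. a k * sin x ^ k)"
      using eventually_at_right_less[of 0]
      by eventually_elim (simp add: g_def A_def a_def power2_eq_square)
  qed
  finally have "\<exists>C\<ge>0. \<forall>n. \<bar>integral {0..pi/2} (\<lambda>x. g x * cos x ^ n) - (\<Sum>k\<in>A. a k * SI k n)\<bar> \<le> C * SI 13 n"
    by (intro integral_expansion integrable_continuous_interval continuous_intros contg) (simp add: A_def)
  then obtain C where C: "\<And>n. \<bar>integral {0..pi/2} (\<lambda>x. g x * cos x ^ n) - (\<Sum>k\<in>A. a k * SI k n)\<bar> \<le> C * SI 13 n" by blast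
  have 1: "(\<lambda>n. integral {0..pi/2} (\<lambda>x. g x * cos x ^ n) - (\<Sum>k\<in>A. a k * SI k n)) \<in> O(\<lambda>n. 1 / real n ^ 7)"
  proof -
    have "(\<lambda>n. integral {0..pi/2} (\<lambda>x. g x * cos x ^ n) - (\<Sum>k\<in>A. a k * SI k n)) \<in> O(\<lambda>n. SI 13 n)"
      by (rule bigoI[of _ C]) (use C in \<open>auto simp: SI_odd intro: order_trans\<close>)
    also have "(\<lambda>n. SI 13 n) \<in> O(\<lambda>n. 1 / real n ^ 7)"
      unfolding SI_odd of_nat_mult of_nat_add of_nat_numeral of_nat_1 by real_asymp
    finally show ?thesis .
  qed
  have "(\<lambda>n. (\<Sum>k\<in>A. a k * SI k n) - (1 / real n - 4 / (3 * real n ^ 2) + 88 / (45 * real n ^ 3)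
        - 976 / (315 * real n ^ 4) + 3488 / (675 * real n ^ 5) - 276928 / (31185 * real n ^ 6))) \<in> O(\<lambda>n. 1 / real n ^ 7)"
  proof -
    have "(\<Sum>k\<in>A. a k * SI k n) = 1/(real n+1) - 1/6 * 2/((real n+1)*(real n+3)) - 17/360 * 8/((real n+1)*(real n+3)*(real n+5)) - 367/15120 * 48/((real n+1)*(real n+3)*(real n+5)*(real n+7))
        - 27859/1814400 * 384/((real n+1)*(real n+3)*(real n+5)*(real n+7)*(real n+9))
        - 1295803/119750400 * 3840/((real n+1)*(real n+3)*(real n+5)*(real n+7)*(real n+9)*(real n+11))" for n
      by (simp add: A_def a_def SI_odd SI_1[unfolded One_nat_def] add_ac)
    thus ?thesis by (simp only:) real_asymp
  qed
  from sum_in_bigo(1)[OF 1 this] show ?thesis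
    by (simp only: int2 add_diff_eq diff_add_cancel)
qed

section \<open>Wallis integrals\<close>

lemma SI_2_diff: "SI 2 n = SI 0 n - SI 0 (n + 2)"
proof -
  have "SI 0 n - SI 0 (n + 2) = integral {0..pi/2} (\<lambda>x. sin x ^ 0 * cos x ^ n - sin x ^ 0 * cos x ^ (n + 2))"
    unfolding SI_def by (intro integral_diff[symmetric] SI_integrable)
  also have "(\<lambda>x::real. sin x ^ 0 * cos x ^ n - sin x ^ 0 * cos x ^ (n + 2)) = (\<lambda>x. sin x ^ 2 * cos x ^ n)"
  proof
    fix x :: real
    have "cos x ^ (n + 2) = cos x ^ n * cos x ^ 2" by (simp only: power_add)
    thus "sin x ^ 0 * cos x ^ n - sin x ^ 0 * cos x ^ (n + 2) = sin x ^ 2 * cos x ^ n"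
      by (simp only: sin_squared_eq) (simp add: algebra_simps)
  qed
  finally show ?thesis by (simp add: SI_def)
qed

lemma wallis_rec: "SI 0 (n + 2) = real (n + 1) / real (n + 2) * SI 0 n"
  using SI_2_diff[of n] SI_even(1)[of n] by (simp add: field_simps)

lemma wallis_antimono: "SI 0 (Suc n) \<le> SI 0 n"
  unfolding SI_def
proof (rule integral_le[OF SI_integrable SI_integrable])
  fix x :: real assume "x \<in> {0..pi/2}"
  hence "0 \<le> cos x" by (intro cos_ge_zero) auto
  thus "sin x ^ 0 * cos x ^ Suc n \<le> sin x ^ 0 * cos x ^ n" by (simp add: mult_left_le_one_le)
qed

lemma wallis_0: "SI 0 0 = pi / 2" by (simp add: SI_def)

lemma wallis_1: "SI 0 1 = 1"
proof -
  have "((\<lambda>x. sin x ^ 0 * cos x ^ 1) has_integral (sin (pi/2) - sin 0)) {0..pi/2}"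
    by (rule fundamental_theorem_of_calculus)
      (auto intro!: derivative_eq_intros simp flip: has_real_derivative_iff_has_vector_derivative)
  thus ?thesis unfolding SI_def by (simp add: integral_unique)
qed

text \<open>By \<open>wallis_rec\<close> the left side does not change with n; the value is that at
  n = 0.\<close>

lemma wallis_product: "real (n + 1) * (SI 0 n * SI 0 (Suc n)) = pi / 2"
proof (induction n)
  case (Suc n)
  have "real (Suc n + 1) * (SI 0 (Suc n) * SI 0 (Suc (Suc n))) = real (n + 1) * (SI 0 n * SI 0 (Suc n))"
    using wallis_rec[of n] by (simp add: field_simps)
  thus ?case using Suc.IH by (simp only:)
qed (simp add: wallis_0 wallis_1[unfolded One_nat_def])

lemma wallis_nonneg: "0 \<le> SI 0 n"
  unfolding SI_def by (intro integral_nonneg SI_integrable mult_nonneg_nonneg zero_le_power cos_ge_zero sin_ge_zero) auto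

text \<open>The asymptotic expansion of \<open>SI 0 n * sqrt n / sqrt (pi / 2)\<close>, cut off
  after n^-3.\<close>

definition wallis_poly :: "real \<Rightarrow> real" where
  "wallis_poly x = 1 - 1/(4*x) + 1/(32*x^2) + 5/(128*x^3)"

definition wallis_ratio :: "nat \<Rightarrow> real" where
  "wallis_ratio n = SI 0 n * sqrt (real n) / (sqrt (pi / 2) * wallis_poly (real n))"

text \<open>Since \<open>SI 0\<close> is decreasing, its square lies between neighbouring products,
  which \<open>wallis_product\<close> evaluates.\<close>

lemma wallis_sqrt_limit: "(\<lambda>n. SI 0 n * sqrt (real n)) \<longlonglongrightarrow> sqrt (pi / 2)"
proof -
  have up: "SI 0 (Suc n) ^ 2 * real (Suc n) \<le> pi / 2" for n
  proof -
    have "SI 0 (Suc n) * SI 0 (Suc n) \<le> SI 0 n * SI 0 (Suc n)"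
      by (intro mult_right_mono wallis_antimono wallis_nonneg)
    hence "real (n + 1) * (SI 0 (Suc n) * SI 0 (Suc n)) \<le> real (n + 1) * (SI 0 n * SI 0 (Suc n))"
      by (intro mult_left_mono) auto
    thus ?thesis unfolding wallis_product by (simp add: power2_eq_square mult.commute)
  qed
  have lo: "pi / 2 * (real (Suc n) / real (n + 2)) \<le> SI 0 (Suc n) ^ 2 * real (Suc n)" for n
  proof -
    have "SI 0 (Suc n) * SI 0 (Suc (Suc n)) \<le> SI 0 (Suc n) * SI 0 (Suc n)"
      by (intro mult_left_mono wallis_antimono wallis_nonneg)
    hence "real (Suc n + 1) * (SI 0 (Suc n) * SI 0 (Suc (Suc n))) \<le> real (Suc n + 1) * (SI 0 (Suc n) * SI 0 (Suc n))"
      by (rule mult_left_mono) auto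
    hence "pi / 2 \<le> real (n + 2) * SI 0 (Suc n) ^ 2" unfolding wallis_product by (simp add: power2_eq_square)
    hence "pi / 2 / real (n + 2) \<le> SI 0 (Suc n) ^ 2" by (simp add: field_simps)
    hence "pi / 2 / real (n + 2) * real (Suc n) \<le> SI 0 (Suc n) ^ 2 * real (Suc n)" by (intro mult_right_mono) auto
    thus ?thesis by simp
  qed
  have "(\<lambda>n. SI 0 (Suc n) ^ 2 * real (Suc n)) \<longlonglongrightarrow> pi / 2"
  proof (rule tendsto_sandwich[OF _ _ _ tendsto_const])
    show "(\<lambda>n. pi / 2 * (real (Suc n) / real (n + 2))) \<longlonglongrightarrow> pi / 2" by real_asymp
  qed (use up lo in auto)
  hence "(\<lambda>n. SI 0 n ^ 2 * real n) \<longlonglongrightarrow> pi / 2" by (rule LIMSEQ_imp_Suc)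
  hence "(\<lambda>n. sqrt (SI 0 n ^ 2 * real n)) \<longlonglongrightarrow> sqrt (pi / 2)" by (rule tendsto_real_sqrt)
  thus ?thesis by (simp add: real_sqrt_mult wallis_nonneg)
qed

lemma wallis_ratio_limit: "wallis_ratio \<longlonglongrightarrow> 1"
proof -
  have "(\<lambda>n. wallis_poly (real n)) \<longlonglongrightarrow> 1" unfolding wallis_poly_def by real_asymp
  hence "(\<lambda>n. SI 0 n * sqrt (real n) / (sqrt (pi / 2) * wallis_poly (real n))) \<longlonglongrightarrow> sqrt (pi / 2) / (sqrt (pi / 2) * 1)"
    by (intro tendsto_intros wallis_sqrt_limit) auto
  thus ?thesis by (simp add: wallis_ratio_def[abs_def])
qed

text \<open>The quotient of consecutive error factors of equal parity is \<open>1 + O(n\<^sup>-\<^sup>5)\<close>; telescoping from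
  infinity, where the factor is 1, gives \<open>1 + O(n\<^sup>-\<^sup>4)\<close>.\<close>

lemma step2_telescope:
  fixes u :: "nat \<Rightarrow> real"
  assumes lim: "u \<longlonglongrightarrow> 1" and step: "(\<lambda>n. u (n + 2) - u n) \<in> O(\<lambda>n. 1 / real n ^ 5)"
  shows "(\<lambda>n. u n - 1) \<in> O(\<lambda>n. 1 / real n ^ 4)"
proof -
  have "(\<lambda>n. 1 / real n ^ 5) \<in> O(\<lambda>n. 1 / real n ^ 4 - 1 / real (n + 2) ^ 4)" by real_asymp
  from landau_o.big_trans[OF step this] obtain C where C: "C > 0"
    "eventually (\<lambda>n. norm (u (n + 2) - u n) \<le> C * norm (1 / real n ^ 4 - 1 / real (n + 2) ^ 4)) at_top"
    by (elim landau_o.bigE)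
  then obtain N where N: "\<And>n. n \<ge> N \<Longrightarrow> norm (u (n + 2) - u n) \<le> C * norm (1 / real n ^ 4 - 1 / real (n + 2) ^ 4)"
    unfolding eventually_at_top_linorder by blast
  have "norm (u n - 1) \<le> C * norm (1 / real n ^ 4)" if n: "n \<ge> max N 1" for n
  proof -
    have dec: "\<bar>u (m + 2) - u m\<bar> \<le> C * (1 / real m ^ 4 - 1 / real (m + 2) ^ 4)" if "m \<ge> max N 1" for m
    proof -
      have "1 / real (m + 2) ^ 4 \<le> 1 / real m ^ 4"
        using that by (intro divide_left_mono power_mono mult_pos_pos) auto
      thus ?thesis using N[of m] that by simp
    qed
    have sub: "strict_mono (\<lambda>k. n + 2 * k)" by (auto simp: strict_mono_def)
    have lim2: "(\<lambda>k. u (n + 2 * k)) \<longlonglongrightarrow> 1" using LIMSEQ_subseq_LIMSEQ[OF lim sub] by (simp add: o_def)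
    have tel: "\<bar>u (n + 2 * k) - u n\<bar> \<le> C * (1 / real n ^ 4 - 1 / real (n + 2 * k) ^ 4)" for k
    proof (induction k)
      case (Suc k)
      have "\<bar>u (n + 2 * Suc k) - u n\<bar> \<le> \<bar>u (n + 2 * k + 2) - u (n + 2 * k)\<bar> + \<bar>u (n + 2 * k) - u n\<bar>"
        by simp
      also have "\<dots> \<le> C * (1 / real (n + 2 * k) ^ 4 - 1 / real (n + 2 * k + 2) ^ 4) + C * (1 / real n ^ 4 - 1 / real (n + 2 * k) ^ 4)"
        by (intro add_mono dec Suc.IH) (use n in auto)
      finally show ?case by (simp add: algebra_simps)
    qed simp
    have tel': "\<bar>u (n + 2 * k) - u n\<bar> \<le> C * (1 / real n ^ 4)" for k
    proof -
      have "C * (1 / real n ^ 4 - 1 / real (n + 2 * k) ^ 4) \<le> C * (1 / real n ^ 4)"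
        using C(1) by (intro mult_left_mono) auto
      with tel[of k] show ?thesis by linarith
    qed
    have "(\<lambda>k. \<bar>u (n + 2 * k) - u n\<bar>) \<longlonglongrightarrow> \<bar>1 - u n\<bar>" by (intro tendsto_intros lim2)
    hence "\<bar>1 - u n\<bar> \<le> C * (1 / real n ^ 4)" by (rule LIMSEQ_le_const2) (use tel' in blast)
    thus ?thesis by (simp add: abs_minus_commute)
  qed
  thus ?thesis by (intro bigoI[of _ C]) (auto simp: eventually_at_top_linorder intro!: exI[of _ "max N 1"])
qed

text \<open>The quotient \<open>wallis_ratio\<close> of the exact value and the polynomial is
  multiplied by 1 + \<open>\<tau> n\<close> when n grows by 2. The coefficients of
  \<open>wallis_poly\<close> make \<open>\<tau>\<close> of order n^-5, and
  \<open>step2_telescope\<close> converts this into closeness to the limit 1.\<close>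

lemma wallis_asymp: "(\<lambda>n. SI 0 n * sqrt (real n) / sqrt (pi / 2) - wallis_poly (real n)) \<in> O(\<lambda>n. 1 / real n ^ 4)"
proof -
  define \<tau> where "\<tau> n = sqrt (real n + 2) * (real n + 1) / (real n + 2) / sqrt (real n) * wallis_poly (real n) / wallis_poly (real n + 2) - 1" for n :: nat
  have P: "eventually (\<lambda>n::nat. wallis_poly (real n) > 0) at_top" "eventually (\<lambda>n::nat. wallis_poly (real n + 2) > 0) at_top"
    unfolding wallis_poly_def by real_asymp+
  have "eventually (\<lambda>n. wallis_ratio (n + 2) - wallis_ratio n = wallis_ratio n * \<tau> n) at_top"
    using P eventually_gt_at_top[of 0]
  proof eventually_elim
    case (elim n)
    have "wallis_ratio (n + 2) = real (n + 1) / real (n + 2) * SI 0 n * sqrt (real n + 2) / (sqrt (pi / 2) * wallis_poly (real n + 2))"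
      unfolding wallis_ratio_def wallis_rec by (simp add: add_ac)
    also have "\<dots> = wallis_ratio n * (\<tau> n + 1)"
      using elim by (simp add: wallis_ratio_def \<tau>_def add_ac mult_ac)
    finally show ?case by (simp add: algebra_simps)
  qed
  moreover have "(\<lambda>n. wallis_ratio n * \<tau> n) \<in> O(\<lambda>n. 1 * (1 / real n ^ 5))"
  proof (rule landau_o.big.mult)
    show "wallis_ratio \<in> O(\<lambda>n. 1)" 
      by (rule bigoI_tendsto[where c = 1]) (use wallis_ratio_limit in simp_all)
    show "\<tau> \<in> O(\<lambda>n. 1 / real n ^ 5)"
      unfolding \<tau>_def[abs_def] wallis_poly_def by real_asymp
  qed
  ultimately have "(\<lambda>n. wallis_ratio (n + 2) - wallis_ratio n) \<in> O(\<lambda>n. 1 / real n ^ 5)"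
    by (subst landau_o.big.in_cong) auto
  from step2_telescope[OF wallis_ratio_limit this]
  have "(\<lambda>n. wallis_ratio n - 1) \<in> O(\<lambda>n. 1 / real n ^ 4)" .
  moreover have "(\<lambda>n. wallis_poly (real n)) \<in> O(\<lambda>n. 1)" unfolding wallis_poly_def by real_asymp
  ultimately have "(\<lambda>n. (wallis_ratio n - 1) * wallis_poly (real n)) \<in> O(\<lambda>n. 1 / real n ^ 4 * 1)"
    by (rule landau_o.big.mult)
  moreover have "eventually (\<lambda>n. (wallis_ratio n - 1) * wallis_poly (real n) = SI 0 n * sqrt (real n) / sqrt (pi / 2) - wallis_poly (real n)) at_top"
    using P(1) by eventually_elim (simp add: wallis_ratio_def left_diff_distrib)
  ultimately show ?thesis by (subst (asm) landau_o.big.in_cong) auto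
qed

section \<open>Expansion of the first-moment integral\<close>

text \<open>Here the weight is (s / arcsin s)^2 with s = sin x. It is even in s, so every term is a
  rational multiple of \<open>SI 0 n\<close>; the numerators 3 and 15 come from
  \<open>SI_even\<close>. The error is therefore also stated relative to
  \<open>SI 0 n\<close>.\<close>

lemma moment_1_main:
  "(\<lambda>n. integral {-(pi/2)..pi/2} (weight n 0) -
     2 * SI 0 n * (1 - 1/3 * (1 / (real n + 2)) - 1/15 * (3 / ((real n + 2) * (real n + 4))) - 31/945 * (15 / ((real n + 2) * (real n + 4) * (real n + 6)))))
   \<in> O(\<lambda>n. SI 0 n * (1 / real n ^ 4))"
proof -
  define g where "g x = (if x = 0 then 1 else sin x / x) ^ 2" for x :: real
  define A :: "nat set" where "A = {0, 2, 4, 6}"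
  define a :: "nat \<Rightarrow> real" where "a k = (if k = 0 then 1 else if k = 2 then -1/3 else if k = 4 then -1/15 else -31/945)" for k
  have contg: "continuous_on A g" for A
    unfolding g_def by (intro continuous_intros continuous_on_sinc_real)
  have int2: "integral {-(pi/2)..pi/2} (weight n 0) = 2 * integral {0..pi/2} (\<lambda>x. g x * cos x ^ n)" for n
  proof -
    have "integral {-(pi/2)..pi/2} (weight n 0) = 2 * integral {0..pi/2} (weight n 0)"
      by (intro integral_even continuous_on_weight_real) (auto simp: weight_even)
    thus ?thesis by (simp add: g_def weight_def[abs_def])
  qed
  have "(\<lambda>x::real. sin x ^ 2 / x ^ 2 - (1 - 1/3 * sin x ^ 2 - 1/15 * sin x ^ 4 - 31/945 * sin x ^ 6)) \<in> O[at_right 0](\<lambda>x. x ^ 8)"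
    by real_asymp
  also have "?this \<longleftrightarrow> (\<lambda>x. g x - (\<Sum>k\<in>A. a k * sin x ^ k)) \<in> O[at_right 0](\<lambda>x. x ^ 8)"
  proof (rule landau_o.big.in_cong)
    show "\<forall>\<^sub>F x in at_right 0. sin x ^ 2 / x ^ 2 - (1 - 1/3 * sin x ^ 2 - 1/15 * sin x ^ 4 - 31/945 * sin x ^ 6)
        = g x - (\<Sum>k\<in>A. a k * sin x ^ k)"
      using eventually_at_right_less[of 0]
      by eventually_elim (simp add: g_def A_def a_def power_divide)
  qed
  finally have "\<exists>C\<ge>0. \<forall>n. \<bar>integral {0..pi/2} (\<lambda>x. g x * cos x ^ n) - (\<Sum>k\<in>A. a k * SI k n)\<bar> \<le> C * SI 8 n"
    by (intro integral_expansion integrable_continuous_interval continuous_intros contg) (simp add: A_def)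
  then obtain C where C: "C \<ge> 0" "\<And>n. \<bar>integral {0..pi/2} (\<lambda>x. g x * cos x ^ n) - (\<Sum>k\<in>A. a k * SI k n)\<bar> \<le> C * SI 8 n" by blast
  have S: "(\<Sum>k\<in>A. a k * SI k n) = SI 0 n * (1 - 1/3 * (1 / (real n + 2)) - 1/15 * (3 / ((real n + 2) * (real n + 4))) - 31/945 * (15 / ((real n + 2) * (real n + 4) * (real n + 6))))" for n
    by (simp add: A_def a_def SI_even algebra_simps)
  have "(\<lambda>n. 2 * (integral {0..pi/2} (\<lambda>x. g x * cos x ^ n) - (\<Sum>k\<in>A. a k * SI k n))) \<in> O(\<lambda>n. SI 8 n)"
  proof (rule bigoI[of _ "2 * C"], rule always_eventually, rule allI)
    fix n
    have "0 \<le> SI 8 n" unfolding SI_even by (intro divide_nonneg_nonneg mult_nonneg_nonneg wallis_nonneg) auto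
    thus "norm (2 * (integral {0..pi/2} (\<lambda>x. g x * cos x ^ n) - (\<Sum>k\<in>A. a k * SI k n))) \<le> 2 * C * norm (SI 8 n)"
      using C(2)[of n] by (simp add: abs_mult)
  qed
  also have "(\<lambda>n. SI 8 n) \<in> O(\<lambda>n. SI 0 n * (1 / real n ^ 4))"
  proof -
    have "(\<lambda>n::nat. 105 / ((real n + 2)*(real n + 4)*(real n + 6)*(real n + 8))) \<in> O(\<lambda>n. 1 / real n ^ 4)" by real_asymp
    from landau_o.big.mult[OF landau_o.big_refl this, of "\<lambda>n. SI 0 n"] show ?thesis
      by (simp add: SI_even mult.commute)
  qed
  finally show ?thesis unfolding int2 S by (simp only: right_diff_distrib[of 2] mult.assoc)
qed

section \<open>From bounds in c to expansions in n\<close>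

text \<open>The choice c = 1 / sqrt n turns c^(2K) into n^-K.\<close>

lemma bigo_from_line_bound:
  assumes "\<exists>C\<ge>0. \<forall>n c. 0 < c \<longrightarrow> c \<le> 1 \<longrightarrow> real n * c\<^sup>2 = 1 \<longrightarrow> \<bar>f n\<bar> \<le> C * c ^ (2 * K)"
  shows "f \<in> O(\<lambda>n. 1 / real n ^ K)"
proof -
  obtain C where C: "\<And>n c. 0 < c \<Longrightarrow> c \<le> 1 \<Longrightarrow> real n * c\<^sup>2 = 1 \<Longrightarrow> \<bar>f n\<bar> \<le> C * c ^ (2 * K)"
    using assms by blast
  show ?thesis
  proof (rule bigoI)
    show "eventually (\<lambda>n. norm (f n) \<le> C * norm (1 / real n ^ K)) at_top"
      using eventually_ge_at_top[of 1]
    proof eventually_elim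
      case (elim n)
      have "\<bar>f n\<bar> \<le> C * (1 / sqrt (real n)) ^ (2 * K)"
        using elim by (intro C) (auto simp: power_divide)
      also have "(1 / sqrt (real n)) ^ (2 * K) = 1 / real n ^ K"
        using elim by (simp add: power_mult power_divide)
      finally show ?case by simp
    qed
  qed
qed

text \<open>The expansion of n \<open>q n\<close>; this normalisation tends to 1 and can safely be
  divided by.\<close>

definition q_poly :: "real \<Rightarrow> real" where
  "q_poly x = 1 - 4 / (3 * x) + 88 / (45 * x ^ 2) - 976 / (315 * x ^ 3) + 3488 / (675 * x ^ 4) - 276928 / (31185 * x ^ 5)"

theorem q_asymp:
  "(\<lambda>n. q n - (1 / real n - 4 / (3 * real n ^ 2) + 88 / (45 * real n ^ 3)
        - 976 / (315 * real n ^ 4) + 3488 / (675 * real n ^ 5) - 276928 / (31185 * real n ^ 6))) \<in> O(\<lambda>n. 1 / real n ^ 7)"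
proof -
  have "(\<lambda>n. q n - 1 / 2 * integral {-(pi/2)..pi/2} (\<lambda>x. \<bar>x\<bar> * weight n 0 x)) \<in> O(\<lambda>n. 1 / real n ^ 7)"
    by (rule bigo_from_line_bound[OF q_integral])
  from sum_in_bigo(1)[OF this q_main_expansion] show ?thesis
    by (simp only: add_diff_eq diff_add_cancel)
qed

lemma q_scaled: "(\<lambda>n. real n * q n - q_poly (real n)) \<in> O(\<lambda>n. 1 / real n ^ 6)"
proof -
  have "(\<lambda>n. real n * (q n - (1 / real n - 4 / (3 * real n ^ 2) + 88 / (45 * real n ^ 3)
        - 976 / (315 * real n ^ 4) + 3488 / (675 * real n ^ 5) - 276928 / (31185 * real n ^ 6)))) \<in> O(\<lambda>n. real n * (1 / real n ^ 7))"
    by (intro landau_o.big.mult q_asymp landau_o.big_refl)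
  also have "(\<lambda>n. real n * (1 / real n ^ 7)) \<in> O(\<lambda>n. 1 / real n ^ 6)" by real_asymp
  finally have "(\<lambda>n. real n * (q n - (1 / real n - 4 / (3 * real n ^ 2) + 88 / (45 * real n ^ 3)
        - 976 / (315 * real n ^ 4) + 3488 / (675 * real n ^ 5) - 276928 / (31185 * real n ^ 6)))) \<in> O(\<lambda>n. 1 / real n ^ 6)" .
  moreover have "eventually (\<lambda>n. real n * (q n - (1 / real n - 4 / (3 * real n ^ 2) + 88 / (45 * real n ^ 3)
        - 976 / (315 * real n ^ 4) + 3488 / (675 * real n ^ 5) - 276928 / (31185 * real n ^ 6))) = real n * q n - q_poly (real n)) at_top"
    using eventually_gt_at_top[of 0]
  proof eventually_elim
    case (elim n)
    define x where "x = real n"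
    have x: "x > 0" using elim by (simp add: x_def)
    have "x * (1 / x - 4 / (3 * x ^ 2) + 88 / (45 * x ^ 3) - 976 / (315 * x ^ 4) + 3488 / (675 * x ^ 5) - 276928 / (31185 * x ^ 6)) = q_poly x"
      using x by (simp add: q_poly_def right_diff_distrib distrib_left eval_nat_numeral)
    thus ?case by (simp add: x_def right_diff_distrib)
  qed
  ultimately show ?thesis by (subst (asm) landau_o.big.in_cong) auto
qed

section \<open>Zeta values and the scaled first moment\<close>

text \<open>Group the zeta series in pairs: the terms with even denominators add up to 2^-(r+1)
  times the whole series.\<close>

lemma odd_power_sum:
  assumes "1 \<le> r"
  shows "(\<Sum>m. 1 / (2 * real m + 1) ^ Suc r) = (1 - 1 / 2 ^ Suc r) * zeta (real r + 1)"
proof -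
  define f where "f k = 1 / real (Suc k) ^ Suc r" for k
  have zf: "zeta (real r + 1) = suminf f"
  proof -
    have "1 / real (Suc k) powr (real r + 1) = f k" for k
    proof -
      have "real (Suc k) powr (real r + 1) = real (Suc k) ^ Suc r"
        using powr_realpow[of "real (Suc k)" "Suc r"] by (simp add: add.commute)
      thus ?thesis by (simp add: f_def)
    qed
    thus ?thesis by (simp only: zeta_def)
  qed
  have sf: "summable f"
  proof -
    have "summable (\<lambda>k. inverse (real (Suc k) ^ Suc r))"
      using summable_Suc_iff[of "\<lambda>k. inverse (real k ^ Suc r)"] inverse_power_summable[of "Suc r", where 'a = real] assms by simp
    thus ?thesis by (simp add: f_def[abs_def] divide_inverse)
  qed
  have "(\<lambda>n. \<Sum>i\<in>{n*2..<n*2+2}. f i) sums suminf f"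
    by (rule sums_group[OF summable_sums[OF sf]]) simp
  moreover have "(\<Sum>i\<in>{n*2..<n*2+2}. f i) = 1 / (2 * real n + 1) ^ Suc r + 1 / 2 ^ Suc r * f n" for n
  proof -
    have "{n*2..<n*2+2} = {n*2, n*2+1}" by auto
    moreover have "f (n * 2 + 1) = 1 / 2 ^ Suc r * f n"
    proof -
      have "real (Suc (n * 2 + 1)) = 2 * real (Suc n)" by simp
      thus ?thesis by (simp only: f_def power_mult_distrib) simp
    qed
    moreover have "f (n * 2) = 1 / (2 * real n + 1) ^ Suc r"
    proof -
      have "real (Suc (n * 2)) = 2 * real n + 1" by simp
      thus ?thesis by (simp only: f_def)
    qed
    ultimately show ?thesis by simp
  qed
  ultimately have "(\<lambda>n. 1 / (2 * real n + 1) ^ Suc r + 1 / 2 ^ Suc r * f n) sums suminf f" by simp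
  from sums_diff[OF this sums_mult[OF summable_sums[OF sf], of "1 / 2 ^ Suc r"]]
  have "(\<lambda>n. 1 / (2 * real n + 1) ^ Suc r) sums (suminf f - 1 / 2 ^ Suc r * suminf f)" by simp
  thus ?thesis by (simp add: zf sums_iff left_diff_distrib)
qed

lemma sinh_mom_zeta: "1 \<le> r \<Longrightarrow> sinh_mom r = 2 * fact r * (1 - 1 / 2 ^ Suc r) * zeta (real r + 1)"
  by (simp only: sinh_mom_def odd_power_sum mult.assoc)

lemma zeta_2: "zeta 2 = pi\<^sup>2 / 6"
proof -
  have "(\<lambda>k. 1 / real (Suc k) powr 2) = (\<lambda>k. 1 / (real k + 1)\<^sup>2)"
  proof
    fix k
    have "real (Suc k) powr 2 = real (Suc k) ^ 2" using powr_numeral[of "real (Suc k)"] by simp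
    thus "1 / real (Suc k) powr 2 = 1 / (real k + 1)\<^sup>2" by (simp add: add.commute)
  qed
  thus ?thesis using inverse_squares_sums by (simp add: zeta_def sums_iff add.commute)
qed

lemma sinh_mom_1: "sinh_mom 1 = pi\<^sup>2 / 4"
  using sinh_mom_zeta[of 1] zeta_2 by (simp add: power2_eq_square)

lemma sinh_mom_2: "sinh_mom 2 = 7 / 2 * zeta 3"
  using sinh_mom_zeta[of 2] by simp

definition moment_1_factor :: "real \<Rightarrow> real" where
  "moment_1_factor x = wallis_poly x * (1 - 1/3 * (1 / (x + 2)) - 1/15 * (3 / ((x + 2) * (x + 4))) - 31/945 * (15 / ((x + 2) * (x + 4) * (x + 6))))"

text \<open>Three errors are added: moment against its integral, integral against the Wallis
  integral times a rational function, Wallis integral against \<open>wallis_poly\<close>. The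
  normalisation sqrt(2 pi^3)/4 is 2 (S_1/pi) sqrt(pi/2) with S_1 = pi^2/4.\<close>

lemma moment_1_scaled:
  "(\<lambda>n. moment 1 n * sqrt (real n) / (sqrt (2 * pi ^ 3) / 4) - moment_1_factor (real n)) \<in> O(\<lambda>n. 1 / real n ^ 4)"
proof -
  define s where "s = sqrt (2 * pi ^ 3) / 4"
  have s: "s = pi / 2 * sqrt (pi / 2)"
  proof -
    have "sqrt 16 = (4 :: real)" by (rule real_sqrt_unique) auto
    hence "s = sqrt (2 * pi ^ 3 / 16)" by (simp only: s_def real_sqrt_divide)
    also have "2 * pi ^ 3 / 16 = (pi / 2)\<^sup>2 * (pi / 2)" by (simp add: power2_eq_square power3_eq_cube)
    also have "sqrt \<dots> = pi / 2 * sqrt (pi / 2)"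
      unfolding real_sqrt_mult real_sqrt_abs by simp
    finally show ?thesis .
  qed
  have s0: "s > 0" by (simp add: s_def)
  define B where "B x = 1 - 1/3 * (1 / (x + 2)) - 1/15 * (3 / ((x + 2) * (x + 4))) - 31/945 * (15 / ((x + 2) * (x + 4) * (x + 6)))" for x :: real
  define W where "W n = SI 0 n * sqrt (real n) / sqrt (pi / 2)" for n
  have BO: "(\<lambda>n. B (real n)) \<in> O(\<lambda>n. 1)" unfolding B_def by real_asymp
  have WO: "W \<in> O(\<lambda>n. 1)"
  proof -
    have "(\<lambda>n. SI 0 n * sqrt (real n)) \<in> O(\<lambda>n. 1)"
      by (rule bigoI_tendsto[where c = "sqrt (pi / 2)"]) (use wallis_sqrt_limit in simp_all)
    thus ?thesis unfolding W_def[abs_def] by simp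
  qed
  have 1: "(\<lambda>n. (moment 1 n - sinh_mom 1 / pi * integral {-(pi/2)..pi/2} (weight n 0)) * sqrt (real n) / s) \<in> O(\<lambda>n. 1 / real n ^ 4)"
  proof -
    have "(\<lambda>n. (moment 1 n - sinh_mom 1 / pi * integral {-(pi/2)..pi/2} (weight n 0)) * sqrt (real n)) \<in> O(\<lambda>n. 1 / real n ^ 5 * sqrt (real n))"
      by (intro landau_o.big.mult bigo_from_line_bound[OF moment_1] landau_o.big_refl)
    also have "(\<lambda>n. 1 / real n ^ 5 * sqrt (real n)) \<in> O(\<lambda>n. 1 / real n ^ 4)" by real_asymp
    finally show ?thesis using s0 by simp
  qed
  have 2: "(\<lambda>n. sinh_mom 1 / pi * (integral {-(pi/2)..pi/2} (weight n 0) - 2 * SI 0 n * B (real n)) * sqrt (real n) / s) \<in> O(\<lambda>n. 1 / real n ^ 4)"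
  proof -
    have "(\<lambda>n. (integral {-(pi/2)..pi/2} (weight n 0) - 2 * SI 0 n * B (real n)) * sqrt (real n)) \<in> O(\<lambda>n. SI 0 n * (1 / real n ^ 4) * sqrt (real n))"
      unfolding B_def by (intro landau_o.big.mult moment_1_main landau_o.big_refl)
    also have "(\<lambda>n. SI 0 n * (1 / real n ^ 4) * sqrt (real n)) = (\<lambda>n. sqrt (pi / 2) * (W n * (1 / real n ^ 4)))"
      by (simp add: W_def fun_eq_iff)
    also have "\<dots> \<in> O(\<lambda>n. 1 * (1 / real n ^ 4))"
      by (intro landau_o.big.cmult_in_iff[THEN iffD2] landau_o.big.mult WO landau_o.big_refl) simp
    finally have "(\<lambda>n. (integral {-(pi/2)..pi/2} (weight n 0) - 2 * SI 0 n * B (real n)) * sqrt (real n)) \<in> O(\<lambda>n. 1 / real n ^ 4)"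
      by simp
    from landau_o.big.mult[OF bigo_const[of "sinh_mom 1 / pi / s"] this]
    have "(\<lambda>n. (sinh_mom 1 / pi / s) * ((integral {-(pi/2)..pi/2} (weight n 0) - 2 * SI 0 n * B (real n)) * sqrt (real n))) \<in> O(\<lambda>n. 1 / real n ^ 4)"
      by (simp only: mult_1)
    moreover have "k / s * (x * y) = k * x * y / s" for k x y by simp
    ultimately show ?thesis by (simp only:)
  qed
  have 3: "(\<lambda>n. (W n - wallis_poly (real n)) * B (real n)) \<in> O(\<lambda>n. 1 / real n ^ 4)"
    using landau_o.big.mult[OF wallis_asymp BO] by (simp add: W_def)
  have "moment 1 n * sqrt (real n) / s - moment_1_factor (real n) =
    (moment 1 n - sinh_mom 1 / pi * integral {-(pi/2)..pi/2} (weight n 0)) * sqrt (real n) / s +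
    sinh_mom 1 / pi * (integral {-(pi/2)..pi/2} (weight n 0) - 2 * SI 0 n * B (real n)) * sqrt (real n) / s +
    (W n - wallis_poly (real n)) * B (real n)" for n
  proof -
    have "sinh_mom 1 / pi * 2 * SI 0 n * B (real n) * sqrt (real n) / s = W n * B (real n)"
      unfolding sinh_mom_1 s W_def by (simp add: power2_eq_square)
    moreover have "M * t / s - v * b = (M - u * I) * t / s + u * (I - 2 * w * b) * t / s + (y - v) * b"
      if "u * 2 * w * b * t / s = y * b" for M u I t w b v y
      using that by (simp add: diff_divide_distrib algebra_simps)
    ultimately show ?thesis unfolding moment_1_factor_def B_def[symmetric] by blast
  qed
  thus ?thesis using sum_in_bigo(1)[OF sum_in_bigo(1)[OF 1 2] 3] by (simp only: s_def)
qed

section \<open>Mean and variance\<close>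

lemma expectation_height_law:
  "measure_pmf.expectation (height_law n) f = (\<Sum>h\<le>n. f h * (qh n h / q n))" for f :: "nat \<Rightarrow> real"
proof -
  have "measure_pmf.expectation (height_law n) f = (\<Sum>h\<in>{..n}. pmf (height_law n) h *\<^sub>R f h)"
    by (rule integral_measure_pmf) (auto simp: set_pmf_iff pmf_height_law, metis not_le qh_eq_0)
  thus ?thesis by (simp add: pmf_height_law mult.commute)
qed

lemma expectation_shifted_power:
  "measure_pmf.expectation (height_law n) (\<lambda>h. (real h + 2) ^ r) = moment r n / q n"
  by (simp add: expectation_height_law moment_def sum_divide_distrib)

lemma sum_height_law: "(\<Sum>h\<le>n. qh n h / q n) = 1"
  using expectation_height_law[of n "\<lambda>_. 1"] by simp

lemma expectation_height: "measure_pmf.expectation (height_law n) real = moment 1 n / q n - 2"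
proof -
  have "(\<Sum>h\<le>n. (real h + 2) * (qh n h / q n)) = (\<Sum>h\<le>n. real h * (qh n h / q n)) + 2 * (\<Sum>h\<le>n. qh n h / q n)"
    by (simp add: distrib_right add_divide_distrib sum.distrib sum_distrib_left)
  moreover have "(\<Sum>h\<le>n. (real h + 2) * (qh n h / q n)) = moment 1 n / q n"
    by (simp add: moment_def sum_divide_distrib)
  ultimately show ?thesis by (simp add: expectation_height_law sum_height_law)
qed

text \<open>The variance does not change under the shift from h to h + 2, so the shifted moments can
  be used directly.\<close>

lemma variance_height: "measure_pmf.variance (height_law n) real = moment 2 n / q n - (moment 1 n / q n) ^ 2"
proof -
  define m where "m = moment 1 n / q n"
  define p where "p h = qh n h / q n" for h
  have m1: "(\<Sum>h\<le>n. (real h + 2) * p h) = m" by (simp add: m_def p_def moment_def sum_divide_distrib)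
  have m2: "(\<Sum>h\<le>n. (real h + 2) ^ 2 * p h) = moment 2 n / q n" by (simp add: p_def moment_def sum_divide_distrib)
  have "measure_pmf.variance (height_law n) real = (\<Sum>h\<le>n. (real h - (m - 2)) ^ 2 * p h)"
    unfolding expectation_height m_def[symmetric] p_def by (rule expectation_height_law)
  also have "\<dots> = (\<Sum>h\<le>n. (real h + 2) ^ 2 * p h - 2 * m * ((real h + 2) * p h) + m ^ 2 * p h)"
    by (intro sum.cong refl) (simp add: power2_eq_square algebra_simps)
  also have "\<dots> = moment 2 n / q n - 2 * m * m + m ^ 2 * 1"
    unfolding sum.distrib sum_subtractf sum_distrib_left[symmetric] m1 m2 using sum_height_law[of n] by (simp add: p_def)
  finally show ?thesis by (simp add: m_def power2_eq_square)
qed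

lemma n_q_limit: "(\<lambda>n. real n * q n) \<longlonglongrightarrow> 1"
proof -
  have "(\<lambda>n. real n * q n - q_poly (real n)) \<longlonglongrightarrow> 0"
  proof -
    have "(\<lambda>n. real n * q n - q_poly (real n)) \<in> o(\<lambda>_. 1)"
      by (rule landau_o.big_small_trans[OF q_scaled]) real_asymp
    from smalloD_tendsto[OF this] show ?thesis by simp
  qed
  moreover have "(\<lambda>n. q_poly (real n)) \<longlonglongrightarrow> 1" unfolding q_poly_def by real_asymp
  ultimately have "(\<lambda>n. (real n * q n - q_poly (real n)) + q_poly (real n)) \<longlonglongrightarrow> 0 + 1"
    by (rule tendsto_add)
  thus ?thesis by simp
qed

text \<open>Allows an expansion R of a quotient to be certified by multiplying back: it is enough
  that A - R Qp is small, where Qp expands the denominator.\<close>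

lemma quotient_bigo:
  fixes A Q R :: "nat \<Rightarrow> real"
  assumes A: "(\<lambda>n. A n - R n * Qp n) \<in> O(\<lambda>n. 1 / real n ^ 4)" and Q: "(\<lambda>n. Q n - Qp n) \<in> O(\<lambda>n. 1 / real n ^ 6)"
    and R: "R \<in> O(\<lambda>n. 1)" and lim: "Q \<longlonglongrightarrow> 1"
  shows "(\<lambda>n. A n / Q n - R n) \<in> O(\<lambda>n. 1 / real n ^ 4)"
proof -
  have ev: "eventually (\<lambda>n. Q n > 0) at_top" using lim by (rule order_tendstoD) simp
  have "(\<lambda>n. R n * (Q n - Qp n)) \<in> O(\<lambda>n. 1 * (1 / real n ^ 6))" by (intro landau_o.big.mult R Q)
  also have "(\<lambda>n::nat. 1 * (1 / real n ^ 6)) \<in> O(\<lambda>n. 1 / real n ^ 4)" by real_asymp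
  finally have "(\<lambda>n. (A n - R n * Qp n) - R n * (Q n - Qp n)) \<in> O(\<lambda>n. 1 / real n ^ 4)"
    by (intro sum_in_bigo A)
  moreover have "(\<lambda>n. 1 / Q n) \<in> O(\<lambda>n. 1)"
    by (rule bigoI_tendsto[where c = "1 / 1"]) (use tendsto_divide[OF tendsto_const lim, of 1] in simp_all)
  ultimately have "(\<lambda>n. ((A n - R n * Qp n) - R n * (Q n - Qp n)) * (1 / Q n)) \<in> O(\<lambda>n. 1 / real n ^ 4 * 1)"
    by (rule landau_o.big.mult)
  moreover have "eventually (\<lambda>n. ((A n - R n * Qp n) - R n * (Q n - Qp n)) * (1 / Q n) = A n / Q n - R n) at_top"
    using ev by eventually_elim (simp add: field_simps)
  ultimately show ?thesis by (subst (asm) landau_o.big.in_cong) auto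
qed

text \<open>The quotient of \<open>moment_1_factor\<close> by \<open>q_poly\<close> up to the order
  x^-3.\<close>

definition mean_poly :: "real \<Rightarrow> real" where
  "mean_poly x = 1 + 3 / (4 * x) - 539 / (1440 * x ^ 2) + 50713 / (120960 * x ^ 3)"

lemma mean_scaled:
  "(\<lambda>n. moment 1 n / q n / (sqrt (real n) * (sqrt (2 * pi ^ 3) / 4)) - mean_poly (real n)) \<in> O(\<lambda>n. 1 / real n ^ 4)"
proof -
  define A where "A n = moment 1 n * sqrt (real n) / (sqrt (2 * pi ^ 3) / 4)" for n
  have "(\<lambda>n::nat. moment_1_factor (real n) - mean_poly (real n) * q_poly (real n)) \<in> O(\<lambda>n. 1 / real n ^ 4)"
    unfolding moment_1_factor_def wallis_poly_def mean_poly_def q_poly_def by real_asymp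
  from sum_in_bigo(1)[OF moment_1_scaled this]
  have "(\<lambda>n. A n - mean_poly (real n) * q_poly (real n)) \<in> O(\<lambda>n. 1 / real n ^ 4)"
    by (simp only: add_diff_eq diff_add_cancel A_def)
  moreover have "(\<lambda>n. mean_poly (real n)) \<in> O(\<lambda>n. 1)" unfolding mean_poly_def by real_asymp
  ultimately have "(\<lambda>n. A n / (real n * q n) - mean_poly (real n)) \<in> O(\<lambda>n. 1 / real n ^ 4)"
    by (intro quotient_bigo[OF _ q_scaled _ n_q_limit])
  moreover have "A n / (real n * q n) = moment 1 n / q n / (sqrt (real n) * (sqrt (2 * pi ^ 3) / 4))" for n
  proof (cases "n = 0")
    case False
    hence "sqrt (real n) / real n = 1 / sqrt (real n)" by (simp add: field_simps)
    moreover have "m * t / S / (x * p) = m / p / S * (t / x)" for m t S x p :: real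
      by (simp add: mult_ac)
    moreover have "m / p / S * (1 / t) = m / p / (t * S)" for m t S p :: real
      by (simp add: mult_ac)
    ultimately show ?thesis by (simp only: A_def)
  qed simp
  ultimately show ?thesis by simp
qed

theorem mean_asymp:
  "(\<lambda>n. measure_pmf.expectation (height_law n) real -
        (sqrt (2 * pi ^ 3) / 4 * sqrt (real n) - 2
          + 3 * sqrt (2 * pi ^ 3) / (16 * sqrt (real n))
          - 539 * sqrt (2 * pi ^ 3) / (5760 * sqrt (real n ^ 3))
          + 50713 * sqrt (2 * pi ^ 3) / (483840 * sqrt (real n ^ 5))))
      \<in> O(\<lambda>n. 1 / sqrt (real n ^ 7))"
proof -
  define s where "s = sqrt (2 * pi ^ 3)"
  have s0: "s > 0" by (simp add: s_def)
  have "(\<lambda>n. s / 4 * (sqrt (real n) * (moment 1 n / q n / (sqrt (real n) * (s / 4)) - mean_poly (real n)))) \<in> O(\<lambda>n. sqrt (real n) * (1 / real n ^ 4))"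
    using landau_o.big.mult[OF landau_o.big_refl[of "\<lambda>n. sqrt (real n)"] mean_scaled] s0 by (simp add: s_def[symmetric])
  also have "(\<lambda>n::nat. sqrt (real n) * (1 / real n ^ 4)) \<in> O(\<lambda>n. 1 / sqrt (real n ^ 7))" by real_asymp
  finally have "(\<lambda>n. s / 4 * (sqrt (real n) * (moment 1 n / q n / (sqrt (real n) * (s / 4)) - mean_poly (real n)))) \<in> O(\<lambda>n. 1 / sqrt (real n ^ 7))" .
  moreover have "eventually (\<lambda>n. s / 4 * (sqrt (real n) * (moment 1 n / q n / (sqrt (real n) * (s / 4)) - mean_poly (real n))) =
     measure_pmf.expectation (height_law n) real - (s / 4 * sqrt (real n) - 2 + 3 * s / (16 * sqrt (real n))
          - 539 * s / (5760 * sqrt (real n ^ 3)) + 50713 * s / (483840 * sqrt (real n ^ 5)))) at_top"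
    using eventually_gt_at_top[of 0]
  proof eventually_elim
    case (elim n)
    define t where "t = sqrt (real n)"
    have t: "t > 0" "real n = t ^ 2" using elim by (auto simp: t_def)
    have "t * t ^ 2 = t ^ 3" "t * t ^ 4 = t ^ 5" by (simp_all add: eval_nat_numeral)
    have sq: "sqrt (real n ^ 3) = t ^ 3" "sqrt (real n ^ 5) = t ^ 5" by (simp_all add: t_def real_sqrt_power)
    have "s / 4 * (t * (moment 1 n / q n / (t * (s / 4)) - mean_poly (real n))) = moment 1 n / q n - s / 4 * (t * mean_poly (t ^ 2))"
      unfolding t(2) using s0 t(1) by (simp add: right_diff_distrib)
    also have "t * mean_poly (t ^ 2) = t + 3 / (4 * t) - 539 / (1440 * t ^ 3) + 50713 / (120960 * t ^ 5)"
      using t(1) by (simp add: mean_poly_def field_simps eval_nat_numeral)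
    also have "moment 1 n / q n - s / 4 * (t + 3 / (4 * t) - 539 / (1440 * t ^ 3) + 50713 / (120960 * t ^ 5)) =
        moment 1 n / q n - 2 - (s / 4 * t - 2 + 3 * s / (16 * t) - 539 * s / (5760 * t ^ 3) + 50713 * s / (483840 * t ^ 5))"
      by (simp add: algebra_simps)
    finally show ?case
      unfolding expectation_height sq t_def[symmetric] .
  qed
  ultimately show ?thesis unfolding s_def by (subst (asm) landau_o.big.in_cong) auto
qed

theorem variance_asymp:
  "(\<lambda>n. measure_pmf.variance (height_law n) real -
        ((28 * zeta 3 - pi ^ 3) / 8 * real n
          + (224 * zeta 3 - 9 * pi ^ 3) / 48
          - (1792 * zeta 3 - 67 * pi ^ 3) / (2880 * real n)
          + (107520 * zeta 3 - 4189 * pi ^ 3) / (120960 * real n ^ 2)))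
      \<in> O(\<lambda>n. 1 / real n ^ 3)"
proof -
  \<comment> \<open>T is the reciprocal of \<open>q_poly\<close> and U below is the square of
    \<open>mean_poly\<close>, both cut off after x^-3.\<close>
  define T where "T x = 1 + 4 / (3 * x) - 8 / (45 * x ^ 2) + 16 / (63 * x ^ 3)" for x :: real
  define U where "U x = 1 + 3 / (2 * x) - 67 / (360 * x ^ 2) + 4189 / (15120 * x ^ 3)" for x :: real
  define E where "E n = moment 1 n / q n / (sqrt (real n) * (sqrt (2 * pi ^ 3) / 4))" for n
  have s2: "sqrt (2 * pi ^ 3) ^ 2 = 2 * pi ^ 3" by simp
  have TQ: "(\<lambda>n::nat. 1 - T (real n) * q_poly (real n)) \<in> O(\<lambda>n. 1 / real n ^ 4)"
    unfolding T_def q_poly_def by real_asymp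
  have "(\<lambda>n. moment 2 n - sinh_mom 2) \<in> O(\<lambda>n. 1 / real n ^ 4)"
    by (rule bigo_from_line_bound[OF moment_2])
  moreover have "(\<lambda>n. sinh_mom 2 * (1 - T (real n) * q_poly (real n))) \<in> O(\<lambda>n. 1 * (1 / real n ^ 4))"
    by (intro landau_o.big.mult TQ bigo_const)
  ultimately have "(\<lambda>n. (moment 2 n - sinh_mom 2) + sinh_mom 2 * (1 - T (real n) * q_poly (real n))) \<in> O(\<lambda>n. 1 / real n ^ 4)"
    unfolding mult_1 by (rule sum_in_bigo(1))
  moreover have "(u - v) + v * (1 - x * y) = u - (v * x) * y" for u v x y :: real by (simp add: algebra_simps)
  ultimately have "(\<lambda>n. moment 2 n - (sinh_mom 2 * T (real n)) * q_poly (real n)) \<in> O(\<lambda>n. 1 / real n ^ 4)"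
    by (simp only:)
  moreover have "(\<lambda>n. sinh_mom 2 * T (real n)) \<in> O(\<lambda>n. 1)" unfolding T_def by real_asymp
  ultimately have M: "(\<lambda>n. moment 2 n / (real n * q n) - sinh_mom 2 * T (real n)) \<in> O(\<lambda>n. 1 / real n ^ 4)"
    by (intro quotient_bigo[OF _ q_scaled _ n_q_limit])
  have E1: "(\<lambda>n. E n - mean_poly (real n)) \<in> O(\<lambda>n. 1 / real n ^ 4)"
    unfolding E_def by (rule mean_scaled)
  \<comment> \<open>Squaring keeps the error order, because E^2 - P^2 = (E - P)((E - P) + 2P) and
    the polynomial P is bounded.\<close>
  have E2: "(\<lambda>n. E n ^ 2 - U (real n)) \<in> O(\<lambda>n. 1 / real n ^ 4)"
  proof -
    have P: "(\<lambda>n. mean_poly (real n)) \<in> O(\<lambda>n. 1)" unfolding mean_poly_def by real_asymp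
    have "(\<lambda>n::nat. 1 / real n ^ 4) \<in> O(\<lambda>n. 1)" by real_asymp
    hence "(\<lambda>n. E n - mean_poly (real n)) \<in> O(\<lambda>n. 1)" using E1 by (rule landau_o.big_trans[rotated])
    hence "(\<lambda>n. (E n - mean_poly (real n)) + 2 * mean_poly (real n)) \<in> O(\<lambda>n. 1)" 
      using sum_in_bigo(1)[OF _ landau_o.big.mult[OF bigo_const[of 2] P]] by (simp only: mult_1)
    hence "(\<lambda>n. (E n - mean_poly (real n)) * ((E n - mean_poly (real n)) + 2 * mean_poly (real n))) \<in> O(\<lambda>n. 1 / real n ^ 4 * 1)"
      by (intro landau_o.big.mult E1)
    moreover have "(\<lambda>n::nat. mean_poly (real n) ^ 2 - U (real n)) \<in> O(\<lambda>n. 1 / real n ^ 4 * 1)"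
      unfolding mean_poly_def U_def by real_asymp
    ultimately have "(\<lambda>n. (E n - mean_poly (real n)) * ((E n - mean_poly (real n)) + 2 * mean_poly (real n)) + (mean_poly (real n) ^ 2 - U (real n))) \<in> O(\<lambda>n. 1 / real n ^ 4 * 1)"
      by (rule sum_in_bigo)
    moreover have "(x - y) * ((x - y) + 2 * y) + (y ^ 2 - u) = x ^ 2 - u" for x y u :: real
      by (simp add: power2_eq_square algebra_simps)
    ultimately show ?thesis by (simp only: mult_1_right)
  qed
  have "(\<lambda>n. real n * ((moment 2 n / (real n * q n) - sinh_mom 2 * T (real n)) - pi ^ 3 / 8 * (E n ^ 2 - U (real n)))) \<in> O(\<lambda>n. real n * (1 / real n ^ 4))"
    using landau_o.big.mult[OF bigo_const[of "pi ^ 3 / 8"] E2]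
    by (intro landau_o.big.mult[OF landau_o.big_refl] sum_in_bigo(2)[OF M]) simp
  also have "(\<lambda>n::nat. real n * (1 / real n ^ 4)) \<in> O(\<lambda>n. 1 / real n ^ 3)" by real_asymp
  finally have "(\<lambda>n. real n * ((moment 2 n / (real n * q n) - sinh_mom 2 * T (real n)) - pi ^ 3 / 8 * (E n ^ 2 - U (real n)))) \<in> O(\<lambda>n. 1 / real n ^ 3)" .
  moreover have "eventually (\<lambda>n. real n * ((moment 2 n / (real n * q n) - sinh_mom 2 * T (real n)) - pi ^ 3 / 8 * (E n ^ 2 - U (real n))) =
    measure_pmf.variance (height_law n) real -
        ((28 * zeta 3 - pi ^ 3) / 8 * real n
          + (224 * zeta 3 - 9 * pi ^ 3) / 48
          - (1792 * zeta 3 - 67 * pi ^ 3) / (2880 * real n)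
          + (107520 * zeta 3 - 4189 * pi ^ 3) / (120960 * real n ^ 2))) at_top"
    using eventually_gt_at_top[of 0]
  proof eventually_elim
    case (elim n)
    define x where "x = real n"
    have x: "x > 0" using elim by (simp add: x_def)
    have 1: "x * (moment 2 n / (x * q n)) = moment 2 n / q n" using x by simp
    have 2: "x * (pi ^ 3 / 8 * E n ^ 2) = (moment 1 n / q n) ^ 2"
    proof -
      have "E n ^ 2 = (moment 1 n / q n) ^ 2 / (x * (2 * pi ^ 3 / 16))"
        unfolding E_def power_divide power_mult_distrib s2 x_def by simp
      thus ?thesis using x by simp
    qed
    have 3: "x * (7 / 2 * z * T x - p / 8 * U x) = (28 * z - p) / 8 * x + (224 * z - 9 * p) / 48
          - (1792 * z - 67 * p) / (2880 * x) + (107520 * z - 4189 * p) / (120960 * x ^ 2)" for z p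
      using x by (simp add: T_def U_def field_simps eval_nat_numeral)
    have "x * ((moment 2 n / (x * q n) - sinh_mom 2 * T x) - pi ^ 3 / 8 * (E n ^ 2 - U x)) =
      x * (moment 2 n / (x * q n)) - x * (pi ^ 3 / 8 * E n ^ 2) - x * (sinh_mom 2 * T x - pi ^ 3 / 8 * U x)"
      by (simp only: right_diff_distrib)
    also have "\<dots> = moment 2 n / q n - (moment 1 n / q n) ^ 2 - ((28 * zeta 3 - pi ^ 3) / 8 * x
          + (224 * zeta 3 - 9 * pi ^ 3) / 48
          - (1792 * zeta 3 - 67 * pi ^ 3) / (2880 * x)
          + (107520 * zeta 3 - 4189 * pi ^ 3) / (120960 * x ^ 2))"
      unfolding 1 2 sinh_mom_2 3 ..
    finally show ?case unfolding x_def variance_height .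
  qed
  ultimately show ?thesis by (subst (asm) landau_o.big.in_cong) auto
qed

section \<open>Gaussian integrals along the line Im v = 1\<close>

lemma norm_gauss_line: "norm (exp (- (Complex s 1)\<^sup>2 / 2)) = exp (1 / 2) * exp (- s\<^sup>2 / 2)"
  by (simp add: norm_exp_eq_Re power2_eq_square flip: exp_add) (simp add: field_simps)

lemma norm_Complex_1_ge_1: "1 \<le> norm (Complex s 1)"
  using abs_Im_le_cmod[of "Complex s 1"] by simp

definition lorentz_const :: "nat \<Rightarrow> real" where
  "lorentz_const L = 2 ^ Suc L * fact (Suc L) * exp (1/2)"

lemma lorentz_const_nonneg: "0 \<le> lorentz_const L"
  by (simp add: lorentz_const_def)

lemma power_gauss_le_lorentz:
  "norm (Complex s 1) ^ L * exp (- s\<^sup>2 / 2) \<le> lorentz_const L * inverse (1 + s\<^sup>2)"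
  using rho_gauss_bound[OF zero_less_one, of s L] unfolding div_by_1 divide_inverse[of _ "1 + s\<^sup>2"] lorentz_const_def .

lemma integrable_lorentz: "integrable lborel (\<lambda>s::real. inverse (1 + s\<^sup>2))"
  using integrable_inverse_1_plus_square by (simp add: set_integrable_def)

lemma integral_lorentz: "(\<integral>s. inverse (1 + s\<^sup>2) \<partial>lborel) = pi"
  using LBINT_inverse_1_plus_square by (simp add: interval_lebesgue_integral_def set_lebesgue_integral_def)

text \<open>The substitution w = c v carries the line Im w = c to Im v = 1. Staying above the real
  axis keeps negative powers of v and 1 / sin free of poles.\<close>

definition gauss_line :: "(complex \<Rightarrow> complex) \<Rightarrow> complex" where
  "gauss_line h = (\<integral>s. exp (- (Complex s 1)\<^sup>2 / 2) * h (Complex s 1) \<partial>lborel)"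

lemma continuous_on_gauss_line:
  assumes "continuous_on UNIV (\<lambda>s. h (Complex s 1))"
  shows "continuous_on UNIV (\<lambda>s. exp (- (Complex s 1)\<^sup>2 / 2) * h (Complex s 1))"
  by (intro continuous_intros assms) auto

lemma gauss_line_integrand_bound:
  fixes z :: complex
  assumes "norm z \<le> C * norm (Complex s 1) ^ L"
  shows "norm (exp (- (Complex s 1)\<^sup>2 / 2) * z) \<le> C * exp (1/2) * lorentz_const L * inverse (1 + s\<^sup>2)"
proof -
  have C: "0 \<le> C * norm (Complex s 1) ^ L" using assms norm_ge_zero by (rule order_trans[rotated])
  have "0 < norm (Complex s 1) ^ L" using norm_Complex_1_ge_1[of s] by (intro zero_less_power) linarith
  hence C0: "0 \<le> C" using C by (simp add: zero_le_mult_iff)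
  have "norm (exp (- (Complex s 1)\<^sup>2 / 2) * z) \<le> exp (1 / 2) * exp (- s\<^sup>2 / 2) * (C * norm (Complex s 1) ^ L)"
    unfolding norm_mult norm_gauss_line using assms by (intro mult_left_mono) auto
  also have "\<dots> = C * exp (1/2) * (norm (Complex s 1) ^ L * exp (- s\<^sup>2 / 2))" by (simp add: mult_ac)
  also have "\<dots> \<le> C * exp (1/2) * (lorentz_const L * inverse (1 + s\<^sup>2))"
    using C0 by (intro mult_left_mono power_gauss_le_lorentz) auto
  finally show ?thesis by (simp add: mult_ac)
qed

lemma gauss_line_integrable:
  assumes "continuous_on UNIV (\<lambda>s. h (Complex s 1))" and "\<And>s. norm (h (Complex s 1)) \<le> C * norm (Complex s 1) ^ L"
  shows "integrable lborel (\<lambda>s. exp (- (Complex s 1)\<^sup>2 / 2) * h (Complex s 1))"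
proof (rule Bochner_Integration.integrable_bound)
  show "integrable lborel (\<lambda>s. C * exp (1/2) * lorentz_const L * inverse (1 + s\<^sup>2))"
    using integrable_lorentz by (rule integrable_mult_right)
  show "(\<lambda>s. exp (- (Complex s 1)\<^sup>2 / 2) * h (Complex s 1)) \<in> borel_measurable lborel"
    using borel_measurable_continuous_onI[OF continuous_on_gauss_line[OF assms(1)]] by simp
  show "AE s in lborel. norm (exp (- (Complex s 1)\<^sup>2 / 2) * h (Complex s 1)) \<le> norm (C * exp (1/2) * lorentz_const L * inverse (1 + s\<^sup>2))"
    by (intro AE_I2 order_trans[OF gauss_line_integrand_bound[OF assms(2)]]) auto
qed

text \<open>The Gaussian factor makes the boundary values at both infinities vanish. All recursions
  for these integrals are instances.\<close>

lemma gauss_line_derivative: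
  assumes der: "\<And>s. (F has_field_derivative f (Complex s 1)) (at (Complex s 1))"
    and f: "\<And>s. f (Complex s 1) = exp (- (Complex s 1)\<^sup>2 / 2) * h (Complex s 1)"
    and F: "\<And>s. F (Complex s 1) = exp (- (Complex s 1)\<^sup>2 / 2) * H (Complex s 1)"
    and cont: "continuous_on UNIV (\<lambda>s. h (Complex s 1))"
    and h: "\<And>s. norm (h (Complex s 1)) \<le> C * norm (Complex s 1) ^ L"
    and H: "\<And>s. norm (H (Complex s 1)) \<le> D * norm (Complex s 1) ^ M"
  shows "gauss_line h = 0"
proof -
  let ?K = "D * exp (1/2) * lorentz_const M"
  have FB: "norm (F (Complex s 1)) \<le> ?K * inverse (1 + s\<^sup>2)" for s
    unfolding F by (rule gauss_line_integrand_bound[OF H])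
  have "((\<lambda>s. ?K * inverse (1 + s\<^sup>2)) \<longlongrightarrow> 0) at_top" "((\<lambda>s. ?K * inverse (1 + s\<^sup>2)) \<longlongrightarrow> 0) at_bot"
    by real_asymp+
  note lim0 = this
  have lim: "((\<lambda>s. F (Complex s 1)) \<longlongrightarrow> 0) at_top" "((\<lambda>s. F (Complex s 1)) \<longlongrightarrow> 0) at_bot"
    by (rule Lim_null_comparison[OF always_eventually lim0(1)], rule allI, rule FB,
        rule Lim_null_comparison[OF always_eventually lim0(2)], rule allI, rule FB)
  have "(LBINT s=-\<infinity>..\<infinity>. f (Complex s 1)) = 0 - 0"
  proof (rule interval_integral_FTC_integrable)
    show "((\<lambda>s. F (Complex s 1)) has_vector_derivative f (Complex s 1)) (at s)" for s
    proof -
      have "((\<lambda>s. Complex s 1) has_vector_derivative 1) (at s)"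
        unfolding Complex_eq has_vector_derivative_def
        by (auto intro!: derivative_eq_intros simp: scaleR_conv_of_real)
      from field_vector_diff_chain_at[OF this der] show ?thesis by (simp add: o_def)
    qed
    show "isCont (\<lambda>s. f (Complex s 1)) s" for s
      unfolding f using continuous_on_gauss_line[OF cont] by (simp add: continuous_on_eq_continuous_at)
    show "set_integrable lborel (einterval (-\<infinity>) \<infinity>) (\<lambda>s. f (Complex s 1))"
      unfolding f set_integrable_def using gauss_line_integrable[OF cont h] by simp
    show "(((\<lambda>s. F (Complex s 1)) \<circ> real_of_ereal) \<longlongrightarrow> 0) (at_right (- \<infinity>))"
      using lim(2) by (simp add: at_right_MInf filterlim_filtermap o_def)
    show "(((\<lambda>s. F (Complex s 1)) \<circ> real_of_ereal) \<longlongrightarrow> 0) (at_left \<infinity>)"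
      using lim(1) by (simp add: at_left_PInf filterlim_filtermap o_def)
  qed auto
  thus ?thesis by (simp add: interval_lebesgue_integral_def set_lebesgue_integral_def gauss_line_def f)
qed

lemma norm_exp_line: "norm (exp (\<i> * of_real t * Complex s 1)) = exp (- t)"
  by (simp add: norm_exp_eq_Re)

text \<open>With v = s + i the exponent -v^2/2 + i t v equals -s^2/2 + i (t-1) s + 1/2 - t, which
  leads to the characteristic function of the standard normal law at t - 1.\<close>

lemma gauss_line_exp: "gauss_line (\<lambda>v. exp (\<i> * of_real t * v)) = of_real (sqrt (2 * pi) * exp (- t\<^sup>2 / 2))"
proof -
  have "of_real (exp (- (t - 1)\<^sup>2 / 2)) = char std_normal_distribution (t - 1)"
    by (simp add: char_std_normal_distribution)
  also have "\<dots> = (\<integral>s. std_normal_density s *\<^sub>R iexp ((t - 1) * s) \<partial>lborel)"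
    unfolding char_def by (subst integral_density) (auto simp: normal_density_nonneg)
  also have "\<dots> = (\<integral>s. of_real (exp (t - 1 / 2) / sqrt (2 * pi)) * (exp (- (Complex s 1)\<^sup>2 / 2) * exp (\<i> * of_real t * Complex s 1)) \<partial>lborel)"
  proof (rule Bochner_Integration.integral_cong[OF refl])
    fix s
    have e: "complex_of_real (t - 1 / 2) + (- (Complex s 1)\<^sup>2 / 2 + \<i> * of_real t * Complex s 1) = of_real (- s\<^sup>2 / 2) + \<i> * of_real ((t - 1) * s)"
      by (simp add: complex_eq_iff power2_eq_square field_simps)
    have "complex_of_real (exp (t - 1/2)) * (exp (- (Complex s 1)\<^sup>2 / 2) * exp (\<i> * of_real t * Complex s 1)) = of_real (exp (- s\<^sup>2 / 2)) * iexp ((t - 1) * s)"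
      unfolding exp_of_real[symmetric] exp_add[symmetric] e ..
    thus "std_normal_density s *\<^sub>R iexp ((t - 1) * s) = of_real (exp (t - 1 / 2) / sqrt (2 * pi)) * (exp (- (Complex s 1)\<^sup>2 / 2) * exp (\<i> * of_real t * Complex s 1))"
      by (simp add: std_normal_density_def scaleR_conv_of_real)
  qed
  also have "\<dots> = of_real (exp (t - 1 / 2) / sqrt (2 * pi)) * gauss_line (\<lambda>v. exp (\<i> * of_real t * v))"
    unfolding gauss_line_def by simp
  finally have "of_real (exp (t - 1 / 2) / sqrt (2 * pi)) * gauss_line (\<lambda>v. exp (\<i> * of_real t * v)) = of_real (exp (- (t - 1)\<^sup>2 / 2))" ..
  moreover have "exp (- (t - 1)\<^sup>2 / 2) = exp (t - 1 / 2) / sqrt (2 * pi) * (sqrt (2 * pi) * exp (- t\<^sup>2 / 2))"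
    by (simp add: power2_eq_square field_simps flip: exp_add)
  ultimately have "of_real (exp (t - 1 / 2) / sqrt (2 * pi)) * gauss_line (\<lambda>v. exp (\<i> * of_real t * v))
     = complex_of_real (exp (t - 1 / 2) / sqrt (2 * pi)) * of_real (sqrt (2 * pi) * exp (- t\<^sup>2 / 2))"
    by (simp only: of_real_mult)
  thus ?thesis by (subst (asm) mult_cancel_left) simp
qed

lemma gauss_line_add:
  assumes "integrable lborel (\<lambda>s. exp (- (Complex s 1)\<^sup>2 / 2) * f (Complex s 1))"
    "integrable lborel (\<lambda>s. exp (- (Complex s 1)\<^sup>2 / 2) * g (Complex s 1))"
  shows "gauss_line (\<lambda>v. f v + g v) = gauss_line f + gauss_line g"
  using assms unfolding gauss_line_def by (simp only: distrib_left Bochner_Integration.integral_add)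

lemma gauss_line_cmult: "gauss_line (\<lambda>v. a * f v) = a * gauss_line f"
proof -
  have "exp z * (a * f v) = a * (exp z * f v)" for z v by simp
  thus ?thesis unfolding gauss_line_def by (simp only: integral_mult_right_zero)
qed

lemma continuous_on_Complex_1: "continuous_on A (\<lambda>s. Complex s 1)"
  by (rule continuous_on_Complex_line)

lemma integrable_power_exp:
  "integrable lborel (\<lambda>s. exp (- (Complex s 1)\<^sup>2 / 2) * (Complex s 1 ^ k * exp (\<i> * of_real t * Complex s 1)))"
proof (rule gauss_line_integrable[where h = "\<lambda>v. v ^ k * exp (\<i> * of_real t * v)" and C = "exp (- t)" and L = k])
  show "continuous_on UNIV (\<lambda>s. Complex s 1 ^ k * exp (\<i> * of_real t * Complex s 1))"
    by (intro continuous_intros continuous_on_Complex_1)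
qed (simp add: norm_mult norm_power norm_exp_line)

text \<open>Integrating the derivatives of exp(-v^2/2) v^k exp(i t v) for k = 0 and k = 1 reduces
  the quadratic factor to the case of \<open>gauss_line_exp\<close>.\<close>

lemma gauss_line_sq_exp:
  "gauss_line (\<lambda>v. v\<^sup>2 * exp (\<i> * of_real t * v)) = of_real (sqrt (2 * pi) * ((1 - t\<^sup>2) * exp (- t\<^sup>2 / 2)))"
proof -
  let ?e = "\<lambda>v. exp (\<i> * of_real t * v)"
  let ?g = "\<lambda>k. gauss_line (\<lambda>v. v ^ k * ?e v)"
  have step: "gauss_line (\<lambda>v. (of_nat k * v ^ (k - 1) + \<i> * of_real t * v ^ k + (-1) * v ^ Suc k) * ?e v) = 0" for k
  proof (rule gauss_line_derivative[where F = "\<lambda>v. exp (- v\<^sup>2 / 2) * (v ^ k * ?e v)" and H = "\<lambda>v. v ^ k * ?e v"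
        and f = "\<lambda>v. exp (- v\<^sup>2 / 2) * ((of_nat k * v ^ (k - 1) + \<i> * of_real t * v ^ k + (-1) * v ^ Suc k) * ?e v)"
        and C = "(real k + \<bar>t\<bar> + 1) * exp (- t)" and L = "Suc k" and D = "exp (- t)" and M = k])
    show "continuous_on UNIV (\<lambda>s. (of_nat k * Complex s 1 ^ (k - 1) + \<i> * of_real t * Complex s 1 ^ k + (-1) * Complex s 1 ^ Suc k) * ?e (Complex s 1))"
      by (intro continuous_intros continuous_on_Complex_1)
    fix s
    let ?v = "Complex s 1"
    show "((\<lambda>v. exp (- v\<^sup>2 / 2) * (v ^ k * ?e v)) has_field_derivative
      exp (- ?v\<^sup>2 / 2) * ((of_nat k * ?v ^ (k - 1) + \<i> * of_real t * ?v ^ k + (-1) * ?v ^ Suc k) * ?e ?v)) (at ?v)"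
      by (auto intro!: derivative_eq_intros simp: algebra_simps)
    show "norm (?v ^ k * ?e ?v) \<le> exp (- t) * norm ?v ^ k" by (simp add: norm_mult norm_power norm_exp_line)
    show "norm ((of_nat k * ?v ^ (k - 1) + \<i> * of_real t * ?v ^ k + (-1) * ?v ^ Suc k) * ?e ?v) \<le> (real k + \<bar>t\<bar> + 1) * exp (- t) * norm ?v ^ Suc k"
    proof -
      have "norm (of_nat k * ?v ^ (k - 1) + \<i> * of_real t * ?v ^ k + (-1) * ?v ^ Suc k) \<le> real k * norm ?v ^ (k - 1) + \<bar>t\<bar> * norm ?v ^ k + norm ?v ^ Suc k"
        by (intro norm_triangle_le add_mono) (auto simp: norm_mult norm_power)
      also have "\<dots> \<le> real k * norm ?v ^ Suc k + \<bar>t\<bar> * norm ?v ^ Suc k + norm ?v ^ Suc k"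
        using norm_Complex_1_ge_1[of s] by (intro add_mono mult_left_mono power_increasing) auto
      also have "\<dots> = (real k + \<bar>t\<bar> + 1) * norm ?v ^ Suc k" by (simp only: distrib_right mult_1)
      finally have "norm (of_nat k * ?v ^ (k - 1) + \<i> * of_real t * ?v ^ k + (-1) * ?v ^ Suc k) * exp (- t) \<le> (real k + \<bar>t\<bar> + 1) * norm ?v ^ Suc k * exp (- t)"
        by (rule mult_right_mono) simp
      thus ?thesis unfolding norm_mult[of _ "?e ?v"] norm_exp_line by (simp only: mult_ac)
    qed
  qed simp_all
  have lin: "gauss_line (\<lambda>v. (of_nat k * v ^ (k - 1) + \<i> * of_real t * v ^ k + (-1) * v ^ Suc k) * ?e v) =
     of_nat k * ?g (k - 1) + \<i> * of_real t * ?g k + (-1) * ?g (Suc k)" for k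
  proof -
    have i: "integrable lborel (\<lambda>s. exp (- (Complex s 1)\<^sup>2 / 2) * (a * (Complex s 1 ^ j * exp (\<i> * of_real t * Complex s 1))))" for a j
      using integrable_mult_right[OF integrable_power_exp[of j t], of a] by (simp add: mult_ac)
    have "gauss_line (\<lambda>v. (of_nat k * v ^ (k - 1) + \<i> * of_real t * v ^ k + (-1) * v ^ Suc k) * ?e v)
       = gauss_line (\<lambda>v. (of_nat k * (v ^ (k - 1) * ?e v) + \<i> * of_real t * (v ^ k * ?e v)) + (-1) * (v ^ Suc k * ?e v))"
      by (simp only: distrib_right mult.assoc)
    also have "\<dots> = gauss_line (\<lambda>v. of_nat k * (v ^ (k - 1) * ?e v) + \<i> * of_real t * (v ^ k * ?e v)) + gauss_line (\<lambda>v. (-1) * (v ^ Suc k * ?e v))"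
      by (rule gauss_line_add) (use Bochner_Integration.integrable_add[OF i i] in \<open>simp add: distrib_left\<close>, rule i)
    also have "gauss_line (\<lambda>v. of_nat k * (v ^ (k - 1) * ?e v) + \<i> * of_real t * (v ^ k * ?e v)) =
        gauss_line (\<lambda>v. of_nat k * (v ^ (k - 1) * ?e v)) + gauss_line (\<lambda>v. \<i> * of_real t * (v ^ k * ?e v))"
      by (rule gauss_line_add) (rule i)+
    finally show ?thesis unfolding gauss_line_cmult .
  qed
  have 0: "?g 0 = of_real (sqrt (2 * pi) * exp (- t\<^sup>2 / 2))" using gauss_line_exp[of t] by simp
  have 1: "?g 1 = \<i> * of_real t * ?g 0" using step[of 0] unfolding lin by simp
  have "?g 2 = ?g 0 + \<i> * of_real t * ?g 1" using step[of 1] unfolding lin by (simp add: eval_nat_numeral)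
  also have "\<dots> = of_real (1 - t\<^sup>2) * ?g 0" unfolding 1 by (simp add: power2_eq_square algebra_simps)
  finally show ?thesis unfolding 0 by simp
qed

text \<open>After w = c v the error inside |Re w| \<le> pi/2 is that of \<open>phi_gauss\<close>.
  Outside only the Gaussian integrand is present, and there c norm v \<ge> 1, so inserting the
  square of c norm v gains the two powers of c.\<close>

lemma gauss_compare:
  "\<exists>C\<ge>0. \<forall>n c D g. 0 < c \<longrightarrow> c \<le> 1 \<longrightarrow> real n * c\<^sup>2 = 1 \<longrightarrow>
     continuous_on UNIV (\<lambda>x. g (Complex x c)) \<longrightarrow> (\<forall>x. norm (g (Complex x c)) \<le> D) \<longrightarrow>
     norm (LI c (\<lambda>w. phi n w * g w) - of_real (c ^ 3) * gauss_line (\<lambda>v. v\<^sup>2 * g (of_real c * v))) \<le> C * D * c ^ 5"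
proof -
  obtain C where C: "C \<ge> 0" "\<And>n c x. 0 < c \<Longrightarrow> c \<le> 1 \<Longrightarrow> real n * c\<^sup>2 = 1 \<Longrightarrow> \<bar>x\<bar> \<le> pi / 2 \<Longrightarrow>
     norm (phi n (Complex x c) - (Complex x c)\<^sup>2 * exp (- of_nat n * (Complex x c)\<^sup>2 / 2))
      \<le> C * c ^ 4 * (norm (Complex x c) / c) ^ 6 * exp (- real n * x\<^sup>2 / 2)"
    using phi_gauss by blast
  define B where "B = (C + exp (1/2)) * lorentz_const 6"
  have "norm (LI c (\<lambda>w. phi n w * g w) - of_real (c ^ 3) * gauss_line (\<lambda>v. v\<^sup>2 * g (of_real c * v))) \<le> (B * pi) * D * c ^ 5"
    if c: "0 < c" "c \<le> 1" "real n * c\<^sup>2 = 1" and cont: "continuous_on UNIV (\<lambda>x. g (Complex x c))"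
      and g: "\<And>x. norm (g (Complex x c)) \<le> D" for n c D g
  proof -
    have D: "0 \<le> D" using norm_ge_zero g[of 0] by (rule order_trans)
    have cv: "of_real c * Complex s 1 = Complex (c * s) c" for s by (simp add: complex_eq_iff)
    let ?I = "indicat_real {-(pi/2)..pi/2}"
    define F where "F s = of_real c * (?I (c * s) *\<^sub>R (phi n (Complex (c * s) c) * g (Complex (c * s) c)))" for s
    define G where "G s = of_real (c ^ 3) * (exp (- (Complex s 1)\<^sup>2 / 2) * ((Complex s 1)\<^sup>2 * g (Complex (c * s) c)))" for s
    have set_int: "integrable lborel (\<lambda>x. ?I x *\<^sub>R (phi n (Complex x c) * g (Complex x c)))"
      using borel_integrable_atLeastAtMost'[of "-(pi/2)" "pi/2" "\<lambda>x. phi n (Complex x c) * g (Complex x c)"]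
      unfolding set_integrable_def
      by (simp add: continuous_on_mult continuous_on_phi_line continuous_on_subset[OF cont])
    have F_int: "integrable lborel F"
      unfolding F_def using lborel_integrable_real_affine[OF set_int, of c 0] c by (intro integrable_mult_right) simp
    have LI_F: "LI c (\<lambda>w. phi n w * g w) = (\<integral>s. F s \<partial>lborel)"
    proof -
      have "LI c (\<lambda>w. phi n w * g w) = (\<integral>x. ?I x *\<^sub>R (phi n (Complex x c) * g (Complex x c)) \<partial>lborel)"
        unfolding LI_def using set_borel_integral_eq_integral(2)[of "{-(pi/2)..pi/2}" "\<lambda>x. phi n (Complex x c) * g (Complex x c)"] set_int
        by (simp add: set_integrable_def set_lebesgue_integral_def)
      also have "\<dots> = (\<integral>s. F s \<partial>lborel)"
        using lborel_integral_real_affine[of c "\<lambda>x. ?I x *\<^sub>R (phi n (Complex x c) * g (Complex x c))" 0] c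
        by (simp add: F_def scaleR_conv_of_real)
      finally show ?thesis .
    qed
    have cont': "continuous_on UNIV (\<lambda>s. g (Complex (c * s) c))"
      by (rule continuous_on_compose2[OF cont]) (auto intro!: continuous_intros)
    have G_int: "integrable lborel G"
      unfolding G_def
    proof (rule integrable_mult_right)
      show "integrable lborel (\<lambda>s. exp (- (Complex s 1)\<^sup>2 / 2) * ((Complex s 1)\<^sup>2 * g (Complex (c * s) c)))"
        using gauss_line_integrable[where h = "\<lambda>v. v\<^sup>2 * g (of_real c * v)" and C = D and L = 2] g
        by (simp add: cv norm_mult norm_power mult_right_mono mult.commute[of D] mult_left_mono continuous_on_mult continuous_on_power continuous_on_Complex_1 cont')
    qed
    have G_gauss: "of_real (c ^ 3) * gauss_line (\<lambda>v. v\<^sup>2 * g (of_real c * v)) = (\<integral>s. G s \<partial>lborel)"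
      unfolding gauss_line_def G_def cv by simp
    have bound: "norm (F s - G s) \<le> B * D * c ^ 5 * inverse (1 + s\<^sup>2)" for s
    proof -
      define v where "v = Complex s 1"
      have w: "Complex (c * s) c = of_real c * v" by (simp add: v_def cv)
      have n: "of_nat n * (of_real c * v)\<^sup>2 = v\<^sup>2"
      proof -
        have "of_nat n * (of_real c * v)\<^sup>2 = of_real (real n * c\<^sup>2) * v\<^sup>2" by (simp add: power_mult_distrib)
        thus ?thesis by (simp add: c(3))
      qed
      have v1: "1 \<le> norm v" by (simp add: v_def norm_Complex_1_ge_1)
      have "norm (F s - G s) \<le> (C + exp (1/2)) * D * c ^ 5 * (norm v ^ 6 * exp (- s\<^sup>2 / 2))"
      proof (cases "\<bar>c * s\<bar> \<le> pi / 2")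
        case True
        have ns: "real n * (c * s)\<^sup>2 = s\<^sup>2" using c(3) by (simp add: power_mult_distrib flip: mult.assoc)
        have nv: "norm (of_real c * v) / c = norm v" using c by (simp add: norm_mult)
        have "norm (phi n (of_real c * v) - (of_real c * v)\<^sup>2 * exp (- v\<^sup>2 / 2)) \<le> C * c ^ 4 * norm v ^ 6 * exp (- s\<^sup>2 / 2)"
          using C(2)[OF c True] unfolding w minus_mult_left[symmetric] n nv ns .
        hence *: "c * (norm (phi n (of_real c * v) - (of_real c * v)\<^sup>2 * exp (- v\<^sup>2 / 2)) * norm (g (of_real c * v))) \<le> c * (C * c ^ 4 * norm v ^ 6 * exp (- s\<^sup>2 / 2) * D)"
          using c C g[of "c * s"] unfolding w by (intro mult_left_mono mult_mono) auto
        have "F s - G s = of_real c * ((phi n (of_real c * v) - (of_real c * v)\<^sup>2 * exp (- v\<^sup>2 / 2)) * g (of_real c * v))"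
        proof -
          have "of_real c * (p * z) - of_real (c ^ 3) * (e * (v ^ 2 * z)) = of_real c * ((p - (of_real c * v) ^ 2 * e) * z)" for p z e
            by (simp add: power2_eq_square power3_eq_cube algebra_simps)
          moreover have "?I (c * s) = 1" using abs_le_D1[OF True] abs_le_D2[OF True] by simp
          ultimately show ?thesis unfolding F_def G_def w v_def[symmetric] by (simp only: scaleR_one)
        qed
        hence "norm (F s - G s) = c * (norm (phi n (of_real c * v) - (of_real c * v)\<^sup>2 * exp (- v\<^sup>2 / 2)) * norm (g (of_real c * v)))"
          using c by (simp add: norm_mult)
        also note *
        also have "c * (C * c ^ 4 * norm v ^ 6 * exp (- s\<^sup>2 / 2) * D) = C * D * c ^ 5 * (norm v ^ 6 * exp (- s\<^sup>2 / 2))"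
          by (simp add: eval_nat_numeral mult_ac)
        also have "\<dots> \<le> (C + exp (1/2)) * D * c ^ 5 * (norm v ^ 6 * exp (- s\<^sup>2 / 2))"
          using D c by (intro mult_right_mono) auto
        finally show ?thesis .
      next
        case False
        have "1 \<le> pi / 2" using pi_ge_two by simp
        hence "1 \<le> \<bar>c * s\<bar>" using False by linarith
        also have "\<bar>c * s\<bar> \<le> c * norm v" using c abs_Re_le_cmod[of v] by (simp add: abs_mult v_def)
        finally have "1 \<le> (c * norm v)\<^sup>2" by (rule one_le_power)
        have "norm (F s - G s) = c ^ 3 * (exp (1 / 2) * exp (- s\<^sup>2 / 2) * (norm v ^ 2 * norm (g (Complex (c * s) c))))"
        proof -
          have "?I (c * s) = 0" using False by (intro indicator_simps) auto
          hence "F s - G s = - (of_real (c ^ 3) * (exp (- (Complex s 1)\<^sup>2 / 2) * ((Complex s 1)\<^sup>2 * g (Complex (c * s) c))))"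
            by (simp only: F_def G_def scaleR_zero_left mult_zero_right diff_0)
          thus ?thesis using c unfolding v_def by (simp only: norm_minus_cancel norm_mult norm_gauss_line norm_power norm_of_real abs_of_pos zero_less_power)
        qed
        also have "\<dots> \<le> c ^ 3 * (exp (1 / 2) * exp (- s\<^sup>2 / 2) * (norm v ^ 2 * D))"
          using c g[of "c * s"] by (intro mult_left_mono) simp_all
        also have "\<dots> \<le> c ^ 3 * (exp (1 / 2) * exp (- s\<^sup>2 / 2) * (norm v ^ 2 * D)) * (c * norm v)\<^sup>2"
          using \<open>1 \<le> (c * norm v)\<^sup>2\<close> c D mult_left_mono[of 1 "(c * norm v)\<^sup>2" "c ^ 3 * (exp (1 / 2) * exp (- s\<^sup>2 / 2) * (norm v ^ 2 * D))"] by simp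
        also have "\<dots> = exp (1/2) * D * c ^ 5 * (norm v ^ 4 * exp (- s\<^sup>2 / 2))"
          by (simp add: eval_nat_numeral mult_ac)
        also have "\<dots> \<le> (C + exp (1/2)) * D * c ^ 5 * (norm v ^ 6 * exp (- s\<^sup>2 / 2))"
        proof (rule mult_mono)
          show "exp (1/2) * D * c ^ 5 \<le> (C + exp (1/2)) * D * c ^ 5" using C D c by (intro mult_right_mono) simp_all
          show "norm v ^ 4 * exp (- s\<^sup>2 / 2) \<le> norm v ^ 6 * exp (- s\<^sup>2 / 2)" using v1 by (intro mult_right_mono power_increasing) simp_all
        qed (use C D c in simp_all)
        finally show ?thesis .
      qed
      also have "\<dots> \<le> (C + exp (1/2)) * D * c ^ 5 * (lorentz_const 6 * inverse (1 + s\<^sup>2))"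
        unfolding v_def using C D c by (intro mult_left_mono power_gauss_le_lorentz) auto
      finally show ?thesis by (simp add: B_def mult_ac)
    qed
    have "LI c (\<lambda>w. phi n w * g w) - of_real (c ^ 3) * gauss_line (\<lambda>v. v\<^sup>2 * g (of_real c * v)) = (\<integral>s. F s - G s \<partial>lborel)"
      unfolding LI_F G_gauss using F_int G_int by simp
    also have "norm \<dots> \<le> (\<integral>s. B * D * c ^ 5 * inverse (1 + s\<^sup>2) \<partial>lborel)"
      by (intro order_trans[OF integral_norm_bound] integral_mono integrable_norm Bochner_Integration.integrable_diff
          F_int G_int integrable_mult_right integrable_lorentz bound)
    also have "\<dots> = (B * pi) * D * c ^ 5" by (simp add: integral_lorentz)
    finally show ?thesis .
  qed
  moreover have "B * pi \<ge> 0" using C lorentz_const_nonneg[of 6] by (simp add: B_def)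
  ultimately show ?thesis by blast
qed

section \<open>Negative powers and the higher moments\<close>

definition gauss_pole :: "nat \<Rightarrow> complex" where
  "gauss_pole m = gauss_line (\<lambda>v. 1 / v ^ m)"

lemma gauss_pole_0: "gauss_pole 0 = of_real (sqrt (2 * pi))"
  using gauss_line_exp[of 0] by (simp add: gauss_pole_def)

lemma norm_inverse_power_line_le_1: "norm (1 / Complex s 1 ^ m) \<le> 1"
proof -
  have "1 \<le> norm (Complex s 1) ^ m" using norm_Complex_1_ge_1 by (rule one_le_power)
  thus ?thesis by (simp add: norm_divide norm_power)
qed

lemma continuous_on_inverse_power_line: "continuous_on UNIV (\<lambda>s. 1 / Complex s 1 ^ m)"
  by (intro continuous_intros continuous_on_Complex_1) (simp add: Complex_line_nonzero)

lemma gauss_pole_integrable: "integrable lborel (\<lambda>s. exp (- (Complex s 1)\<^sup>2 / 2) * (1 / Complex s 1 ^ m))"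
  by (rule gauss_line_integrable[where h = "\<lambda>v. 1 / v ^ m" and C = 1 and L = 0])
    (simp_all only: continuous_on_inverse_power_line power_0 mult_1_right norm_inverse_power_line_le_1)

text \<open>Integrate the derivative of exp(-v^2/2) / v^(m+1).\<close>

lemma gauss_pole_rec: "of_nat (Suc m) * gauss_pole (m + 2) = - gauss_pole m"
proof -
  let ?a = "- of_nat (Suc m) :: complex"
  have "gauss_line (\<lambda>v. ?a * (1 / v ^ (m + 2)) + (-1) * (1 / v ^ m)) = 0"
  proof (rule gauss_line_derivative[where F = "\<lambda>v. exp (- v\<^sup>2 / 2) * (1 / v ^ Suc m)" and H = "\<lambda>v. 1 / v ^ Suc m"
        and f = "\<lambda>v. exp (- v\<^sup>2 / 2) * (?a * (1 / v ^ (m + 2)) + (-1) * (1 / v ^ m))"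
        and C = "real (Suc m) + 1" and L = 0 and D = 1 and M = 0])
    show "continuous_on UNIV (\<lambda>s. ?a * (1 / Complex s 1 ^ (m + 2)) + (-1) * (1 / Complex s 1 ^ m))"
      by (intro continuous_on_add continuous_on_mult continuous_on_const continuous_on_inverse_power_line)
    fix s
    let ?v = "Complex s 1"
    have v: "?v \<noteq> 0" by (simp add: Complex_line_nonzero)
    have "((\<lambda>v. inverse (v ^ Suc m)) has_field_derivative - (inverse (?v ^ Suc m) * (of_nat (Suc m) * ?v ^ m) * inverse (?v ^ Suc m))) (at ?v)"
      using v by (intro DERIV_inverse') (auto intro!: derivative_eq_intros simp del: power_Suc of_nat_Suc)
    moreover have "- (inverse (?v ^ Suc m) * (of_nat (Suc m) * ?v ^ m) * inverse (?v ^ Suc m)) = ?a * (1 / ?v ^ (m + 2))"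
      using v by (simp add: field_simps)
    ultimately have "((\<lambda>v. 1 / v ^ Suc m) has_field_derivative ?a * (1 / ?v ^ (m + 2))) (at ?v)"
      by (simp only: inverse_eq_divide)
    moreover have "((\<lambda>v. exp (- v\<^sup>2 / 2)) has_field_derivative exp (- ?v\<^sup>2 / 2) * (- ?v)) (at ?v)"
      by (auto intro!: derivative_eq_intros)
    ultimately have "((\<lambda>v. exp (- v\<^sup>2 / 2) * (1 / v ^ Suc m)) has_field_derivative
       exp (- ?v\<^sup>2 / 2) * (?a * (1 / ?v ^ (m + 2))) + exp (- ?v\<^sup>2 / 2) * (- ?v) * (1 / ?v ^ Suc m)) (at ?v)"
      by (rule DERIV_mult'[rotated])
    moreover have "- ?v * (1 / ?v ^ Suc m) = (-1) * (1 / ?v ^ m)" using v by simp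
    ultimately show "((\<lambda>v. exp (- v\<^sup>2 / 2) * (1 / v ^ Suc m)) has_field_derivative
       exp (- ?v\<^sup>2 / 2) * (?a * (1 / ?v ^ (m + 2)) + (-1) * (1 / ?v ^ m))) (at ?v)"
      by (simp only: distrib_left mult.assoc)
    show "norm (1 / ?v ^ Suc m) \<le> 1 * norm ?v ^ 0" using norm_inverse_power_line_le_1[of s "Suc m"] by simp
    have "norm (?a * (1 / ?v ^ (m + 2)) + (-1) * (1 / ?v ^ m)) \<le> norm ?a * norm (1 / ?v ^ (m + 2)) + norm (- 1 :: complex) * norm (1 / ?v ^ m)"
      by (rule order_trans[OF norm_triangle_ineq]) (simp only: norm_mult order_refl)
    also have "\<dots> \<le> norm ?a * 1 + norm (- 1 :: complex) * 1"
      by (intro add_mono mult_left_mono norm_inverse_power_line_le_1 norm_ge_zero)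
    also have "\<dots> = (real (Suc m) + 1) * norm ?v ^ 0" unfolding norm_minus_cancel norm_of_nat by simp
    finally show "norm (?a * (1 / ?v ^ (m + 2)) + (-1) * (1 / ?v ^ m)) \<le> (real (Suc m) + 1) * norm ?v ^ 0" .
  qed simp_all
  also have "gauss_line (\<lambda>v. ?a * (1 / v ^ (m + 2)) + (-1) * (1 / v ^ m)) = ?a * gauss_pole (m + 2) + (-1) * gauss_pole m"
  proof -
    have i: "integrable lborel (\<lambda>s. exp (- (Complex s 1)\<^sup>2 / 2) * (a * (1 / Complex s 1 ^ j)))" for a j
      using integrable_mult_right[OF gauss_pole_integrable[of j], of a] by (simp add: mult_ac)
    show ?thesis unfolding gauss_pole_def gauss_line_cmult[symmetric] by (rule gauss_line_add[OF i i])
  qed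
  finally have "?a * gauss_pole (m + 2) + (-1) * gauss_pole m = 0" .
  thus ?thesis by algebra
qed

text \<open>\<open>gauss_compare\<close> for the weight w^-(m+2), which is at most c^-(m+2) on the
  line; everything is multiplied by c^m.\<close>

lemma LI_inverse_power:
  "\<exists>C\<ge>0. \<forall>n c. 0 < c \<longrightarrow> c \<le> 1 \<longrightarrow> real n * c\<^sup>2 = 1 \<longrightarrow>
     norm (LI c (\<lambda>w. phi n w * (1 / w ^ (m + 2))) * of_real (c ^ m) - of_real c * gauss_pole m) \<le> C * c ^ 3"
proof -
  obtain C where C: "C \<ge> 0" "\<And>n c D g. 0 < c \<Longrightarrow> c \<le> 1 \<Longrightarrow> real n * c\<^sup>2 = 1 \<Longrightarrow>
     continuous_on UNIV (\<lambda>x. g (Complex x c)) \<Longrightarrow> (\<And>x. norm (g (Complex x c)) \<le> D) \<Longrightarrow>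
     norm (LI c (\<lambda>w. phi n w * g w) - of_real (c ^ 3) * gauss_line (\<lambda>v. v\<^sup>2 * g (of_real c * v))) \<le> C * D * c ^ 5"
    using gauss_compare by blast
  have "norm (LI c (\<lambda>w. phi n w * (1 / w ^ (m + 2))) * of_real (c ^ m) - of_real c * gauss_pole m) \<le> C * c ^ 3"
    if c: "0 < c" "c \<le> 1" "real n * c\<^sup>2 = 1" for n c
  proof -
    let ?L = "LI c (\<lambda>w. phi n w * (1 / w ^ (m + 2)))"
    let ?G = "gauss_line (\<lambda>v. v\<^sup>2 * (1 / (of_real c * v) ^ (m + 2)))"
    have "norm (?L - of_real (c ^ 3) * ?G) \<le> C * (1 / c ^ (m + 2)) * c ^ 5"
    proof (rule C(2)[OF c])
      show "continuous_on UNIV (\<lambda>x. 1 / Complex x c ^ (m + 2))"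
        by (intro continuous_intros continuous_on_Complex_line) (use c in \<open>simp add: Complex_line_nonzero\<close>)
      fix x
      have "c \<le> norm (Complex x c)" using abs_Im_le_cmod[of "Complex x c"] by simp
      hence "0 < norm (Complex x c)" using c by linarith
      note pos = this
      have "c ^ (m + 2) \<le> norm (Complex x c) ^ (m + 2)" using c \<open>c \<le> norm (Complex x c)\<close> by (intro power_mono) auto
      thus "norm (1 / Complex x c ^ (m + 2)) \<le> 1 / c ^ (m + 2)"
        unfolding norm_divide norm_power norm_one using c pos by (intro divide_left_mono mult_pos_pos zero_less_power) simp_all
    qed
    hence *: "c ^ m * norm (?L - of_real (c ^ 3) * ?G) \<le> c ^ m * (C * (1 / c ^ (m + 2)) * c ^ 5)"
      using c by (intro mult_left_mono) auto
    have "v\<^sup>2 * (1 / (of_real c * v) ^ (m + 2)) = (1 / of_real (c ^ (m + 2))) * (1 / v ^ m)" if "v \<noteq> 0" for v :: complex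
      using that c by (simp add: power_mult_distrib power_add power2_eq_square)
    hence "?G = gauss_line (\<lambda>v. (1 / of_real (c ^ (m + 2))) * (1 / v ^ m))"
      unfolding gauss_line_def using Complex_line_nonzero[of 1] by (simp only: zero_neq_one simp_thms)
    hence G: "?G = (1 / of_real (c ^ (m + 2))) * gauss_pole m" unfolding gauss_line_cmult gauss_pole_def .
    have "?L * of_real (c ^ m) - of_real c * gauss_pole m = of_real (c ^ m) * (?L - of_real (c ^ 3) * ?G)"
      unfolding G using c by (simp add: field_simps power_add eval_nat_numeral)
    also have "norm \<dots> = c ^ m * norm (?L - of_real (c ^ 3) * ?G)" unfolding norm_mult norm_of_real using c by simp
    also have "\<dots> \<le> c ^ m * (C * (1 / c ^ (m + 2)) * c ^ 5)" by (rule *)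
    also have "\<dots> = C * c ^ 3" using c by (simp add: field_simps power_add eval_nat_numeral)
    finally show ?thesis .
  qed
  with C(1) show ?thesis by blast
qed

text \<open>The value follows from uniqueness of limits: as n grows, the integrals of
  \<open>phi n w / w ^ 3\<close> tend to it by \<open>LI_inverse_power\<close> and to -pi i by
  \<open>LI_pole\<close>.\<close>

lemma gauss_pole_1: "gauss_pole 1 = - (of_real pi * \<i>)"
proof -
  obtain C where C: "\<And>n c. 0 < c \<Longrightarrow> c \<le> 1 \<Longrightarrow> real n * c\<^sup>2 = 1 \<Longrightarrow>
     norm (LI c (\<lambda>w. phi n w * (1 / w ^ (1 + 2))) * of_real (c ^ 1) - of_real c * gauss_pole 1) \<le> C * c ^ 3"
    using LI_inverse_power by blast
  obtain D where D: "\<And>n c. 0 < c \<Longrightarrow> c \<le> 1 \<Longrightarrow> real n * c\<^sup>2 = 1 \<Longrightarrow>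
    norm (LI c (\<lambda>w. phi n w * (1 / w ^ 3)) + of_real pi * \<i>) \<le> D * c ^ 2"
    using LI_pole by blast
  have "norm (gauss_pole 1 + of_real pi * \<i>) \<le> (C + D) * (1 / sqrt (real n)) ^ 2" if n: "n > 0" for n
  proof -
    define c where "c = 1 / sqrt (real n)"
    have c: "0 < c" "c \<le> 1" "real n * c\<^sup>2 = 1" using n by (auto simp: c_def power_divide)
    let ?L = "LI c (\<lambda>w. phi n w * (1 / w ^ 3))"
    have "norm (of_real c * (?L - gauss_pole 1)) \<le> C * c ^ 3"
      using C[OF c] by (simp add: right_diff_distrib mult.commute power3_eq_cube mult.assoc)
    hence "c * norm (?L - gauss_pole 1) \<le> c * (C * c ^ 2)"
      using c unfolding norm_mult by (simp add: eval_nat_numeral mult_ac)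
    hence 1: "norm (gauss_pole 1 - ?L) \<le> C * c ^ 2" using c by (simp add: norm_minus_commute)
    have "gauss_pole 1 + of_real pi * \<i> = (gauss_pole 1 - ?L) + (?L + of_real pi * \<i>)" by simp
    also have "norm \<dots> \<le> C * c ^ 2 + D * c ^ 2" using 1 D[OF c] by (rule norm_triangle_mono)
    finally show ?thesis by (simp only: c_def distrib_right)
  qed
  hence "eventually (\<lambda>n. norm (gauss_pole 1 + of_real pi * \<i>) \<le> (C + D) * (1 / sqrt (real n)) ^ 2) at_top"
    by (rule eventually_mono[OF eventually_gt_at_top[of 0]])
  moreover have "(\<lambda>n::nat. (C + D) * (1 / sqrt (real n)) ^ 2) \<longlonglongrightarrow> 0" by real_asymp
  ultimately have "norm (gauss_pole 1 + of_real pi * \<i>) \<le> 0"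
    by (intro tendsto_le[OF sequentially_bot _ tendsto_const]) auto
  thus ?thesis by (simp add: eq_neg_iff_add_eq_0)
qed

text \<open>\<open>gauss_pole_rec\<close> and the functional equation of Gamma give both sides the
  same two-step recursion, so only m = 0 and m = 1 have to be compared.\<close>

lemma Im_gauss_pole:
  "Im (\<i> ^ Suc m * gauss_pole m) = sqrt pi * Gamma ((real m + 2) / 2) * 2 powr ((real m + 1) / 2) / fact m"
proof (induction m rule: induct_nat_012)
  case 0
  have "2 powr (1 / 2) = sqrt (2 :: real)" by (simp add: powr_half_sqrt)
  thus ?case by (simp add: gauss_pole_0 real_sqrt_mult)
next
  case 1
  have "Gamma (3 / 2 :: real) = sqrt pi / 2"
    using Gamma_plus1[of "1/2 :: real"] Gamma_one_half_real nonpos_Ints_nonpos[of "1/2 :: real"] by auto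
  moreover have "sqrt pi * (sqrt pi / 2) * 2 = pi" by simp
  ultimately show ?case using gauss_pole_1 by (simp add: mult_ac)
next
  case (ge2 m)
  have rec: "gauss_pole (Suc (Suc m)) = - (gauss_pole m / of_nat (Suc m))"
    using gauss_pole_rec[of m] by (simp add: field_simps del: of_nat_Suc)
  have "\<i> ^ Suc (Suc (Suc m)) * gauss_pole (Suc (Suc m)) = \<i> ^ Suc m * gauss_pole m / of_real (real (Suc m))"
    unfolding rec by (simp add: mult.assoc)
  hence "Im (\<i> ^ Suc (Suc (Suc m)) * gauss_pole (Suc (Suc m))) = Im (\<i> ^ Suc m * gauss_pole m) / real (Suc m)"
    by (simp only: Im_divide_of_real)
  also have "\<dots> = sqrt pi * Gamma ((real m + 2) / 2) * 2 powr ((real m + 1) / 2) / fact m / real (Suc m)" by (simp only: ge2)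
  also have "\<dots> = sqrt pi * ((real m + 2) / 2 * Gamma ((real m + 2) / 2)) * (2 * 2 powr ((real m + 1) / 2)) / fact (Suc (Suc m))"
  proof -
    have "fact (Suc (Suc m)) = (real m + 2) * (real (Suc m) * fact m)" by simp
    thus ?thesis by (simp only:) (simp add: mult_ac del: of_nat_Suc)
  qed
  also have "(real m + 2) / 2 * Gamma ((real m + 2) / 2) = Gamma ((real (Suc (Suc m)) + 2) / 2)"
  proof -
    have "(real m + 2) / 2 \<notin> \<int>\<^sub>\<le>\<^sub>0"
    proof
      assume "(real m + 2) / 2 \<in> \<int>\<^sub>\<le>\<^sub>0"
      from nonpos_Ints_nonpos[OF this] show False by (simp add: divide_le_0_iff)
    qed
    from Gamma_plus1[OF this] show ?thesis by (simp add: add_divide_distrib)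
  qed
  also have "2 * 2 powr ((real m + 1) / 2) = 2 powr ((real (Suc (Suc m)) + 1) / 2)"
    using powr_add[of 2 1 "(real m + 1) / 2"] by (simp add: add_divide_distrib)
  finally show ?case .
qed

definition moment_limit :: "nat \<Rightarrow> real" where
  "moment_limit r = real r / sqrt pi * Gamma ((real r + 1) / 2) * (2 ^ (r + 1) - 1) * 2 powr (- (real r / 2)) * zeta (real r + 1)"

lemma moment_limit_eq:
  assumes "1 \<le> r"
  shows "moment_limit r = 1 / pi * sinh_mom r * Im (\<i> ^ r * gauss_pole (r - 1))"
proof -
  obtain m where r: "r = Suc m" using assms by (cases r) auto
  have p: "2 powr (real r / 2) = 2 ^ r * 2 powr (- (real r / 2))"
    by (simp add: powr_minus field_simps flip: powr_add powr_realpow)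
  have "1 / pi * sinh_mom r * Im (\<i> ^ r * gauss_pole (r - 1))
    = 1 / pi * (2 * fact r * (1 - 1 / 2 ^ Suc r) * zeta (real r + 1)) * (sqrt pi * Gamma ((real r + 1) / 2) * (2 ^ r * 2 powr (- (real r / 2))) / fact m)"
    unfolding sinh_mom_zeta[OF assms] p[symmetric] using Im_gauss_pole[of m] by (simp add: r add.commute)
  also have "\<dots> = (sqrt pi / pi) * (fact r / fact m) * Gamma ((real r + 1) / 2) * (2 * 2 ^ r * (1 - 1 / 2 ^ Suc r)) * 2 powr (- (real r / 2)) * zeta (real r + 1)"
    by simp
  also have "sqrt pi / pi = 1 / sqrt pi" by (simp add: field_simps)
  also have "fact r / fact m = real r" by (simp add: r)
  also have "2 * 2 ^ r * (1 - 1 / 2 ^ Suc r) = (2 ^ (r + 1) - 1 :: real)" by (simp add: field_simps)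
  finally show ?thesis by (simp add: moment_limit_def)
qed

text \<open>\<open>moment_expansion\<close> with K = 1 has no boundary terms and is already exact to
  relative order c. This covers every r, beyond the range r \<le> 2 in which boundary terms could be
  moved to the real axis.\<close>

lemma moment_scaled_bound:
  assumes "1 \<le> r"
  shows "\<exists>C\<ge>0. \<forall>n c. 0 < c \<longrightarrow> c \<le> 1 \<longrightarrow> real n * c\<^sup>2 = 1 \<longrightarrow> \<bar>moment r n * c ^ r * real n - moment_limit r\<bar> \<le> C * c"
proof -
  obtain m where r: "r = Suc m" using assms by (cases r) auto
  obtain C where C: "C \<ge> 0" "\<And>n c. 0 < c \<Longrightarrow> c \<le> 1 \<Longrightarrow> real n * c\<^sup>2 = 1 \<Longrightarrow>
     \<bar>moment r n - 1 / pi * Im (\<i> ^ r * of_real (sinh_mom r) * LI c (\<lambda>w. phi n w * (1 / w ^ Suc r)))\<bar> \<le> C * (c ^ 5 / c ^ (r + 2))"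
    using moment_expansion[OF assms order_refl] by (auto simp: eval_nat_numeral)
  obtain D where D: "D \<ge> 0" "\<And>n c. 0 < c \<Longrightarrow> c \<le> 1 \<Longrightarrow> real n * c\<^sup>2 = 1 \<Longrightarrow>
     norm (LI c (\<lambda>w. phi n w * (1 / w ^ (m + 2))) * of_real (c ^ m) - of_real c * gauss_pole m) \<le> D * c ^ 3"
    using LI_inverse_power by blast
  have "\<bar>moment r n * c ^ r * real n - moment_limit r\<bar> \<le> (C + \<bar>sinh_mom r\<bar> * D) * c"
    if c: "0 < c" "c \<le> 1" "real n * c\<^sup>2 = 1" for n c
  proof -
    define L where "L = LI c (\<lambda>w. phi n w * (1 / w ^ (m + 2)))"
    have rn: "real n = 1 / c\<^sup>2" using c by (simp add: field_simps)
    have 1: "\<bar>moment r n - 1 / pi * Im (\<i> ^ r * of_real (sinh_mom r) * L)\<bar> * (c ^ m / c) \<le> C * (c ^ 5 / c ^ (r + 2)) * (c ^ m / c)"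
      using C(2)[OF c] c by (intro mult_right_mono) (auto simp: L_def r)
    have cc: "C * (c ^ 5 / c ^ (r + 2)) * (c ^ m / c) = C * c"
      using c by (simp add: r field_simps power_add eval_nat_numeral)
    define E where "E = L * of_real (c ^ m) - of_real c * gauss_pole m"
    have E: "norm E \<le> D * c ^ 3" unfolding E_def L_def by (rule D(2)[OF c])
    have LE: "1 / pi * Im (\<i> ^ r * of_real (sinh_mom r) * L) * (c ^ m / c) - moment_limit r = 1 / pi * sinh_mom r * Im (\<i> ^ r * E) / c"
    proof -
      have "Im (\<i> ^ r * E) = Im (\<i> ^ r * L) * c ^ m - c * Im (\<i> ^ r * gauss_pole m)"
      proof -
        have "\<i> ^ r * E = \<i> ^ r * L * of_real (c ^ m) - of_real c * (\<i> ^ r * gauss_pole m)" by (simp add: E_def algebra_simps)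
        moreover have "Im (of_real a * z) = a * Im z" "Im (z * of_real a) = Im z * a" for a z by simp_all
        ultimately show ?thesis by (simp only: minus_complex.sel)
      qed
      moreover have "Im (\<i> ^ r * of_real (sinh_mom r) * L) = sinh_mom r * Im (\<i> ^ r * L)"
      proof -
        have "\<i> ^ r * of_real (sinh_mom r) * L = of_real (sinh_mom r) * (\<i> ^ r * L)" by simp
        moreover have "Im (of_real a * z) = a * Im z" for a z by simp
        ultimately show ?thesis by (simp only:)
      qed
      moreover have "1 / pi * (k * Y) * (p / c) - 1 / pi * k * X = 1 / pi * k * (Y * p - c * X) / c" for k Y p X :: real
        using c by (simp add: field_simps)
      moreover have "moment_limit r = 1 / pi * sinh_mom r * Im (\<i> ^ r * gauss_pole m)"
        using moment_limit_eq[OF assms] by (simp add: r)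
      ultimately show ?thesis by (simp only:)
    qed
    have "\<bar>1 / pi * sinh_mom r * Im (\<i> ^ r * E) / c\<bar> \<le> \<bar>sinh_mom r\<bar> * D * c\<^sup>2"
    proof -
      have "\<bar>Im (\<i> ^ r * E)\<bar> \<le> D * c ^ 3"
        using abs_Im_le_cmod[of "\<i> ^ r * E"] E by (simp add: norm_mult norm_power)
      hence "\<bar>1 / pi * sinh_mom r * Im (\<i> ^ r * E) / c\<bar> \<le> 1 * \<bar>sinh_mom r\<bar> * (D * c ^ 3) / c"
      proof -
        have "\<bar>1 / pi * sinh_mom r * Im (\<i> ^ r * E) / c\<bar> = (1 / pi * \<bar>sinh_mom r\<bar>) * \<bar>Im (\<i> ^ r * E)\<bar> / c"
          using c by (simp add: abs_mult abs_divide)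
        moreover have "(1 / pi * \<bar>sinh_mom r\<bar>) * \<bar>Im (\<i> ^ r * E)\<bar> \<le> (1 * \<bar>sinh_mom r\<bar>) * (D * c ^ 3)"
          using pi_ge_two \<open>\<bar>Im (\<i> ^ r * E)\<bar> \<le> D * c ^ 3\<close> by (intro mult_mono) simp_all
        ultimately show ?thesis using c by (simp only: divide_right_mono less_imp_le)
      qed
      also have "\<dots> = \<bar>sinh_mom r\<bar> * D * c\<^sup>2" using c by (simp add: eval_nat_numeral)
      finally show ?thesis .
    qed
    also have "\<dots> \<le> \<bar>sinh_mom r\<bar> * D * c"
      using c D by (intro mult_left_mono) (auto simp: power2_eq_square mult_le_cancel_left1)
    finally have 2: "\<bar>1 / pi * Im (\<i> ^ r * of_real (sinh_mom r) * L) * (c ^ m / c) - moment_limit r\<bar> \<le> \<bar>sinh_mom r\<bar> * D * c"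
      unfolding LE .
    have "moment r n * c ^ r * real n = moment r n * (c ^ m / c)"
      using c by (simp add: rn r field_simps power2_eq_square)
    hence "moment r n * c ^ r * real n - moment_limit r =
      (moment r n - 1 / pi * Im (\<i> ^ r * of_real (sinh_mom r) * L)) * (c ^ m / c) +
      (1 / pi * Im (\<i> ^ r * of_real (sinh_mom r) * L) * (c ^ m / c) - moment_limit r)"
      by (simp only: left_diff_distrib)
    also have "\<bar>\<dots>\<bar> \<le> C * c + \<bar>sinh_mom r\<bar> * D * c"
      using 1 c 2 unfolding cc by (intro order_trans[OF abs_triangle_ineq] add_mono) (auto simp: abs_mult)
    finally show ?thesis by (simp only: distrib_right)
  qed
  moreover have "C + \<bar>sinh_mom r\<bar> * D \<ge> 0" using C D by simp
  ultimately show ?thesis by blast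
qed

lemma shifted_moment_limit:
  assumes "1 \<le> r"
  shows "(\<lambda>n. moment r n / q n / sqrt (real n) ^ r) \<longlonglongrightarrow> moment_limit r"
proof -
  obtain C where C: "\<And>n c. 0 < c \<Longrightarrow> c \<le> 1 \<Longrightarrow> real n * c\<^sup>2 = 1 \<Longrightarrow> \<bar>moment r n * c ^ r * real n - moment_limit r\<bar> \<le> C * c"
    using moment_scaled_bound[OF assms] by blast
  have "eventually (\<lambda>n. norm (moment r n * (1 / sqrt (real n)) ^ r * real n - moment_limit r) \<le> C * (1 / sqrt (real n))) at_top"
    using eventually_gt_at_top[of 0]
  proof eventually_elim
    case (elim n)
    thus ?case unfolding real_norm_def by (intro C) (auto simp: power_divide)
  qed
  moreover have "(\<lambda>n::nat. C * (1 / sqrt (real n))) \<longlonglongrightarrow> 0" by real_asymp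
  ultimately have "(\<lambda>n. moment r n * (1 / sqrt (real n)) ^ r * real n - moment_limit r) \<longlonglongrightarrow> 0"
    by (rule Lim_null_comparison)
  hence "(\<lambda>n. moment r n * (1 / sqrt (real n)) ^ r * real n) \<longlonglongrightarrow> moment_limit r"
    by (rule Lim_transform[OF tendsto_const, rotated, THEN iffD1[OF tendsto_cong, rotated]]) simp
  from tendsto_divide[OF this n_q_limit]
  have "(\<lambda>n. moment r n * (1 / sqrt (real n)) ^ r * real n / (real n * q n)) \<longlonglongrightarrow> moment_limit r" by simp
  moreover have "eventually (\<lambda>n. moment r n * (1 / sqrt (real n)) ^ r * real n / (real n * q n) = moment r n / q n / sqrt (real n) ^ r) at_top"
    using eventually_gt_at_top[of 0] by eventually_elim (simp add: power_divide)
  ultimately show ?thesis by (rule Lim_transform_eventually)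
qed

lemma power_shift_diff:
  fixes x :: real
  assumes "0 \<le> x"
  shows "0 \<le> (x + 2) ^ Suc m - x ^ Suc m" "(x + 2) ^ Suc m - x ^ Suc m \<le> 2 * real (Suc m) * (x + 2) ^ m"
proof -
  show "0 \<le> (x + 2) ^ Suc m - x ^ Suc m" using assms power_mono[of x "x + 2" "Suc m"] by simp
  have "(x + 2) ^ Suc m - x ^ Suc m = 2 * (\<Sum>p<Suc m. (x + 2) ^ p * x ^ (m - p))"
    using power_diff_sumr2[of "x + 2" "Suc m" x] by (simp add: mult.commute del: sum.lessThan_Suc power_Suc)
  also have "(\<Sum>p<Suc m. (x + 2) ^ p * x ^ (m - p)) \<le> (\<Sum>p<Suc m. (x + 2) ^ m)"
  proof (rule sum_mono)
    fix p assume "p \<in> {..<Suc m}"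
    hence "(x + 2) ^ m = (x + 2) ^ p * (x + 2) ^ (m - p)" by (simp flip: power_add)
    moreover have "x ^ (m - p) \<le> (x + 2) ^ (m - p)" using assms by (intro power_mono) auto
    ultimately show "(x + 2) ^ p * x ^ (m - p) \<le> (x + 2) ^ m" using assms by (simp add: mult_left_mono)
  qed
  finally show "(x + 2) ^ Suc m - x ^ Suc m \<le> 2 * real (Suc m) * (x + 2) ^ m"
    by (simp add: mult.assoc del: power_Suc of_nat_Suc)
qed

text \<open>Going back from h + 2 to h costs a moment of one order less, which is smaller by a
  factor of order n^(-1/2).\<close>

lemma height_moment_diff:
  "\<bar>moment (Suc m) n / q n - measure_pmf.expectation (height_law n) (\<lambda>h. real h ^ Suc m)\<bar> \<le> 2 * real (Suc m) * (moment m n / q n)"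
proof -
  have p: "0 \<le> qh n h / q n" for h using qh_nonneg q_pos[of n] by simp
  have e: "moment (Suc m) n / q n - measure_pmf.expectation (height_law n) (\<lambda>h. real h ^ Suc m)
    = (\<Sum>h\<le>n. ((real h + 2) ^ Suc m - real h ^ Suc m) * (qh n h / q n))"
    unfolding expectation_shifted_power[symmetric] expectation_height_law sum_subtractf[symmetric] left_diff_distrib ..
  have "\<dots> \<le> (\<Sum>h\<le>n. (2 * real (Suc m) * (real h + 2) ^ m) * (qh n h / q n))"
    by (intro sum_mono mult_right_mono power_shift_diff p) simp
  also have "\<dots> = 2 * real (Suc m) * (moment m n / q n)"
    unfolding expectation_shifted_power[symmetric] expectation_height_law sum_distrib_left mult.assoc ..
  finally have "(\<Sum>h\<le>n. ((real h + 2) ^ Suc m - real h ^ Suc m) * (qh n h / q n)) \<le> 2 * real (Suc m) * (moment m n / q n)" .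
  moreover have "0 \<le> (\<Sum>h\<le>n. ((real h + 2) ^ Suc m - real h ^ Suc m) * (qh n h / q n))"
    by (intro sum_nonneg mult_nonneg_nonneg power_shift_diff p) simp
  ultimately show ?thesis unfolding e by simp
qed

lemma zeta_pos: "1 < s \<Longrightarrow> 0 < zeta s"
proof -
  assume s: "1 < s"
  have "summable (\<lambda>k. 1 / real k powr s)"
    using summable_real_powr_iff[of "- s"] s by (simp add: powr_minus divide_inverse)
  hence "summable (\<lambda>k. 1 / real (Suc k) powr s)" by (subst summable_Suc_iff)
  thus "0 < zeta s" unfolding zeta_def by (rule suminf_pos) simp
qed

theorem height_moments:
  assumes "1 \<le> r"
  shows "(\<lambda>n. measure_pmf.expectation (height_law n) (\<lambda>h. real h ^ r)) \<sim>[at_top]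
      (\<lambda>n. real r / sqrt pi * Gamma ((real r + 1) / 2) * (2 ^ (r + 1) - 1)
              * 2 powr (- (real r / 2)) * zeta (real r + 1) * real n powr (real r / 2))"
proof -
  obtain m where r: "r = Suc m" using assms by (cases r) auto
  let ?E = "\<lambda>n. measure_pmf.expectation (height_law n) (\<lambda>h. real h ^ r)"
  have lower: "(\<lambda>n. moment m n / q n / sqrt (real n) ^ m * (1 / sqrt (real n))) \<longlonglongrightarrow> 0"
  \<comment> \<open>\<open>shifted_moment_limit\<close> covers m \<ge> 1; for m = 0 the normalised
    moment is constantly 1.\<close>
  proof (cases "m = 0")
    case True
    have "moment 0 n / q n = 1" for n using q_pos[of n] by (simp add: moment_0)
    moreover have "(\<lambda>n::nat. 1 / sqrt (real n)) \<longlonglongrightarrow> 0" by real_asymp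
    ultimately show ?thesis by (simp only: True power_0 div_by_1 mult_1)
  next
    case False
    have "(\<lambda>n::nat. 1 / sqrt (real n)) \<longlonglongrightarrow> 0" by real_asymp
    from tendsto_mult[OF shifted_moment_limit this, of m] False show ?thesis by simp
  qed
  have "(\<lambda>n. moment r n / q n / sqrt (real n) ^ r - ?E n / sqrt (real n) ^ r) \<longlonglongrightarrow> 0"
  proof (rule Lim_null_comparison)
    show "(\<lambda>n. 2 * real r * (moment m n / q n / sqrt (real n) ^ m * (1 / sqrt (real n)))) \<longlonglongrightarrow> 0"
      using tendsto_mult_left[OF lower, of "2 * real r"] by simp
    show "eventually (\<lambda>n. norm (moment r n / q n / sqrt (real n) ^ r - ?E n / sqrt (real n) ^ r) \<le>
      2 * real r * (moment m n / q n / sqrt (real n) ^ m * (1 / sqrt (real n)))) at_top"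
    proof (rule always_eventually, rule allI)
      fix n
      have "\<bar>moment r n / q n - ?E n\<bar> / sqrt (real n) ^ r \<le> 2 * real r * (moment m n / q n) / sqrt (real n) ^ r"
        unfolding r by (intro divide_right_mono height_moment_diff) simp
      moreover have "\<bar>u / t - e / t\<bar> = \<bar>u - e\<bar> / t" if "0 \<le> t" for u e t :: real
        using that by (simp add: abs_divide diff_divide_distrib[symmetric])
      moreover have "a * b / sqrt (real n) ^ r = a * (b / sqrt (real n) ^ m * (1 / sqrt (real n)))" for a b
        by (simp add: r)
      ultimately show "norm (moment r n / q n / sqrt (real n) ^ r - ?E n / sqrt (real n) ^ r) \<le>
        2 * real r * (moment m n / q n / sqrt (real n) ^ m * (1 / sqrt (real n)))"
        by (simp only: real_norm_def real_sqrt_ge_zero of_nat_0_le_iff zero_le_power)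
    qed
  qed
  from tendsto_diff[OF shifted_moment_limit[OF assms] this]
  have E: "(\<lambda>n. ?E n / sqrt (real n) ^ r) \<longlonglongrightarrow> moment_limit r" by simp
  \<comment> \<open>The limit must be nonzero for the ratio form of asymptotic equivalence.\<close>
  have "(1 :: real) < 2 ^ (r + 1)" by (rule one_less_power) simp_all
  hence ml: "moment_limit r > 0"
    unfolding moment_limit_def using assms by (intro mult_pos_pos Gamma_real_pos zeta_pos divide_pos_pos) auto
  have "eventually (\<lambda>n. moment_limit r * real n powr (real r / 2) = moment_limit r * sqrt (real n) ^ r) at_top"
    using eventually_gt_at_top[of 0]
  proof eventually_elim
    case (elim n)
    hence "real n powr (real r / 2) = sqrt (real n) ^ r"
      by (simp add: powr_powr powr_half_sqrt[symmetric] flip: powr_realpow)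
    thus ?case by simp
  qed
  note p = this
  have "?E \<sim>[at_top] (\<lambda>n. moment_limit r * real n powr (real r / 2))"
  proof (rule asymp_equivI', rule Lim_transform_eventually)
    show "(\<lambda>n. ?E n / sqrt (real n) ^ r / moment_limit r) \<longlonglongrightarrow> 1"
      using tendsto_divide[OF E tendsto_const[of "moment_limit r"]] ml by simp
    show "eventually (\<lambda>n. ?E n / sqrt (real n) ^ r / moment_limit r = ?E n / (moment_limit r * real n powr (real r / 2))) at_top"
      using p by eventually_elim (simp only: divide_divide_eq_left mult.commute)
  qed
  thus ?thesis unfolding moment_limit_def .
qed

section \<open>chi as a line integral and the approximation of qh\<close>

lemma inverse_sin_sums:
  assumes "0 < Im z"
  shows "(\<lambda>k. - (2 * \<i>) * exp (\<i> * of_real (2 * real k + 1) * z)) sums (1 / sin z)"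
proof -
  define E where "E = exp (\<i> * z)"
  have E: "norm E < 1" "E \<noteq> 0" using assms by (simp_all add: E_def norm_exp_eq_Re)
  have E2: "norm (E\<^sup>2) < 1" using E by (simp add: norm_power power_less_one_iff)
  hence "E\<^sup>2 \<noteq> 1" by auto
  have "(\<lambda>k. - (2 * \<i>) * E * (E\<^sup>2) ^ k) sums (- (2 * \<i>) * E * (1 / (1 - E\<^sup>2)))"
    by (intro sums_mult geometric_sums E2)
  moreover have "- (2 * \<i>) * E * (E\<^sup>2) ^ k = - (2 * \<i>) * exp (\<i> * of_real (2 * real k + 1) * z)" for k
  proof -
    have "E * (E\<^sup>2) ^ k = E ^ (2 * k + 1)" by (simp add: power_mult)
    also have "\<dots> = exp (\<i> * of_real (2 * real k + 1) * z)"
      unfolding E_def exp_of_nat_mult[symmetric] by (simp add: mult_ac add_ac)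
    finally show ?thesis by (simp only: mult.assoc)
  qed
  moreover have "- (2 * \<i>) * E * (1 / (1 - E\<^sup>2)) = 1 / sin z"
  proof -
    have "sin z = (E - 1 / E) / (2 * \<i>)" by (simp add: sin_exp_eq E_def exp_minus inverse_eq_divide)
    moreover have "E - 1 / E = (E\<^sup>2 - 1) / E" using E by (simp add: field_simps power2_eq_square)
    ultimately have "1 / sin z = 2 * \<i> * E / (E\<^sup>2 - 1)" by (simp only: divide_divide_eq_left divide_divide_eq_right mult_1 mult_ac)
    also have "\<dots> = - (2 * \<i>) * E / - (E\<^sup>2 - 1)" by (simp only: mult_minus_left minus_divide_divide)
    finally show ?thesis by simp
  qed
  ultimately show ?thesis by (simp only:)
qed

lemma Im_scaled_line: "Im (of_real \<eta> * Complex s 1) = \<eta>"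
  by simp

text \<open>Expand 1 / sin(\<eta> v) in odd exponentials and integrate each by
  \<open>gauss_line_sq_exp\<close>. On Im v = 1 the exponentials have norm exp(-(2k+1) \<eta>),
  which makes the exchange absolutely convergent.\<close>

lemma chi_series_sums:
  assumes "0 < \<eta>"
  shows "(\<lambda>k. ((2 * real k + 1)\<^sup>2 * \<eta>\<^sup>2 - 1) * exp (- ((2 * real k + 1)\<^sup>2 * \<eta>\<^sup>2 / 2))) sums
    (1 / (2 * sqrt (2 * pi)) * Im (gauss_line (\<lambda>v. v\<^sup>2 * (1 / sin (of_real \<eta> * v)))))"
proof -
  define t where "t k = (2 * real k + 1) * \<eta>" for k
  define f where "f k s = exp (- (Complex s 1)\<^sup>2 / 2) * (- (2 * \<i>) * ((Complex s 1)\<^sup>2 * exp (\<i> * of_real (t k) * Complex s 1)))" for k s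
  have int: "integrable lborel (f k)" for k
    unfolding f_def using integrable_mult_right[OF integrable_power_exp[of 2 "t k"], of "- (2 * \<i>)"]
    by (simp only: mult_ac)
  have bound: "norm (f k s) \<le> 2 * exp (- t k) * exp (1/2) * lorentz_const 2 * inverse (1 + s\<^sup>2)" for k s
    unfolding f_def by (rule gauss_line_integrand_bound) (simp add: norm_mult norm_power norm_exp_line)
  have sm: "summable (\<lambda>k. 2 * exp (- t k))"
    using inverse_sinh_sums[OF assms] by (simp add: t_def sums_iff)
  have sums: "(\<lambda>k. integral\<^sup>L lborel (f k)) sums (\<integral>s. (\<Sum>k. f k s) \<partial>lborel)"
  proof (rule sums_integral[OF int])
    show "AE s in lborel. summable (\<lambda>k. norm (f k s))"
    proof (rule AE_I2)
      fix s
      have "summable (\<lambda>k. 2 * exp (- t k) * exp (1/2) * lorentz_const 2 * inverse (1 + s\<^sup>2))"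
        by (intro summable_mult2 sm)
      thus "summable (\<lambda>k. norm (f k s))" by (rule summable_comparison_test'[of _ 0]) (simp add: bound)
    qed
    show "summable (\<lambda>k. \<integral>s. norm (f k s) \<partial>lborel)"
    proof (rule summable_comparison_test'[of "\<lambda>k. 2 * exp (- t k) * exp (1/2) * lorentz_const 2 * pi" 0])
      show "summable (\<lambda>k. 2 * exp (- t k) * exp (1/2) * lorentz_const 2 * pi)" by (intro summable_mult2 sm)
      fix k
      have "(\<integral>s. norm (f k s) \<partial>lborel) \<le> (\<integral>s. 2 * exp (- t k) * exp (1/2) * lorentz_const 2 * inverse (1 + s\<^sup>2) \<partial>lborel)"
        by (intro integral_mono integrable_norm int integrable_mult_right integrable_lorentz bound)
      thus "norm (\<integral>s. norm (f k s) \<partial>lborel) \<le> 2 * exp (- t k) * exp (1/2) * lorentz_const 2 * pi"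
        by (simp add: integral_lorentz)
    qed
  qed
  have "(\<Sum>k. f k s) = exp (- (Complex s 1)\<^sup>2 / 2) * ((Complex s 1)\<^sup>2 * (1 / sin (of_real \<eta> * Complex s 1)))" for s
  proof -
    have "(\<lambda>k. exp (- (Complex s 1)\<^sup>2 / 2) * ((Complex s 1)\<^sup>2 * (- (2 * \<i>) * exp (\<i> * of_real (2 * real k + 1) * (of_real \<eta> * Complex s 1))))) sums
      (exp (- (Complex s 1)\<^sup>2 / 2) * ((Complex s 1)\<^sup>2 * (1 / sin (of_real \<eta> * Complex s 1))))"
      using assms by (intro sums_mult inverse_sin_sums) simp
    moreover have "exp (- (Complex s 1)\<^sup>2 / 2) * ((Complex s 1)\<^sup>2 * (- (2 * \<i>) * exp (\<i> * of_real (2 * real k + 1) * (of_real \<eta> * Complex s 1)))) = f k s" for k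
      unfolding f_def t_def of_real_mult by (simp only: mult_ac)
    ultimately show ?thesis by (simp only: sums_iff)
  qed
  hence g: "(\<integral>s. (\<Sum>k. f k s) \<partial>lborel) = gauss_line (\<lambda>v. v\<^sup>2 * (1 / sin (of_real \<eta> * v)))"
    by (simp only: gauss_line_def)
  have "integral\<^sup>L lborel (f k) = - (2 * \<i>) * of_real (sqrt (2 * pi) * ((1 - (t k)\<^sup>2) * exp (- (t k)\<^sup>2 / 2)))" for k
  proof -
    have "integral\<^sup>L lborel (f k) = gauss_line (\<lambda>v. - (2 * \<i>) * (v\<^sup>2 * exp (\<i> * of_real (t k) * v)))"
      by (simp only: f_def[abs_def] gauss_line_def)
    also have "\<dots> = - (2 * \<i>) * gauss_line (\<lambda>v. v\<^sup>2 * exp (\<i> * of_real (t k) * v))" by (rule gauss_line_cmult)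
    finally show ?thesis by (simp only: gauss_line_sq_exp)
  qed
  note fk = this
  have i: "Im (integral\<^sup>L lborel (f k)) = 2 * sqrt (2 * pi) * (((t k)\<^sup>2 - 1) * exp (- (t k)\<^sup>2 / 2))" for k
  proof -
    have "- (2 * \<i>) * complex_of_real (a * ((1 - b) * e)) = \<i> * of_real (2 * a * ((b - 1) * e))" for a b e
      by (simp add: algebra_simps)
    thus ?thesis by (simp only: fk Im_i_times Re_complex_of_real)
  qed
  have "(\<lambda>k. 2 * sqrt (2 * pi) * (((t k)\<^sup>2 - 1) * exp (- (t k)\<^sup>2 / 2))) sums Im (gauss_line (\<lambda>v. v\<^sup>2 * (1 / sin (of_real \<eta> * v))))"
    using sums_Im[OF sums] unfolding g i .
  from sums_mult[OF this, of "1 / (2 * sqrt (2 * pi))"]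
  have "(\<lambda>k. ((t k)\<^sup>2 - 1) * exp (- (t k)\<^sup>2 / 2)) sums (1 / (2 * sqrt (2 * pi)) * Im (gauss_line (\<lambda>v. v\<^sup>2 * (1 / sin (of_real \<eta> * v)))))"
    by simp
  thus ?thesis by (simp add: t_def power_mult_distrib)
qed

text \<open>The common form of both series: in this shape \<open>chi\<close> appears as the limit of
  \<open>qh\<close>, and the residue theorem can be applied to it.\<close>

lemma chi_gauss_line:
  assumes "0 < \<eta>"
  shows "chi \<eta> = 1 / pi * Im (gauss_line (\<lambda>v. v\<^sup>2 * (1 / sin (of_real \<eta> * v))))"
proof -
  have "chi \<eta> = 2 * sqrt 2 / sqrt pi * (1 / (2 * sqrt (2 * pi)) * Im (gauss_line (\<lambda>v. v\<^sup>2 * (1 / sin (of_real \<eta> * v)))))"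
    using chi_series_sums[OF assms] by (simp only: chi_def sums_iff)
  also have "2 * sqrt 2 / sqrt pi * (1 / (2 * sqrt (2 * pi)) * Y) = 1 / pi * Y" for Y :: real
    by (simp add: real_sqrt_mult field_simps)
  finally show ?thesis .
qed

lemma norm_inverse_sin_scaled:
  assumes "0 < \<eta>"
  shows "norm (1 / sin (of_real \<eta> * Complex s 1)) \<le> 1 / \<eta>"
proof -
  have "norm (sin (of_real \<eta> * Complex s 1)) \<ge> sinh \<eta>"
    using norm_sin_ge_sinh[of "of_real \<eta> * Complex s 1"] assms by simp
  moreover have "sinh \<eta> \<ge> \<eta>" using real_le_x_sinh[of \<eta>] assms by (simp add: sinh_field_def exp_minus)
  ultimately show ?thesis using assms by (simp add: norm_divide frac_le)
qed

lemma continuous_on_inverse_sin_line: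
  assumes "0 < \<eta>" "0 < c"
  shows "continuous_on UNIV (\<lambda>x. 1 / sin (of_real \<eta> * Complex x c))"
  by (intro continuous_intros continuous_on_Complex_line) (use assms in \<open>auto simp: sin_nonzero_upper\<close>)

text \<open>On the strip up to height \<eta> + \<delta> the sine has Lipschitz constant exp(\<eta> +
  \<delta>), and this growth is cancelled by the decay of 1 / sin b at that height.\<close>

lemma inverse_sin_diff:
  assumes "0 < \<eta>" "0 \<le> \<delta>"
  shows "norm (1 / sin (of_real (\<eta> + \<delta>) * Complex s 1) - 1 / sin (of_real \<eta> * Complex s 1)) \<le> 4 * \<delta> * (1 + 1 / \<eta>)\<^sup>2 * norm (Complex s 1)"
proof -
  define v where "v = Complex s 1"
  define a b where "a = of_real \<eta> * v" and "b = of_real (\<eta> + \<delta>) * v"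
  have Im: "Im a = \<eta>" "Im b = \<eta> + \<delta>" by (simp_all add: a_def b_def v_def)
  have nz: "sin a \<noteq> 0" "sin b \<noteq> 0" using sin_nonzero_upper[of a] sin_nonzero_upper[of b] Im assms by simp_all
  have diff: "norm (sin a - sin b) \<le> exp (\<eta> + \<delta>) * norm (a - b)"
  proof (rule field_differentiable_bound[of "{z. 0 \<le> Im z \<and> Im z \<le> \<eta> + \<delta>}" sin cos])
    show "convex {z. 0 \<le> Im z \<and> Im z \<le> \<eta> + \<delta>}"
      unfolding Collect_conj_eq by (intro convex_Int convex_halfspace_Im_ge convex_halfspace_Im_le)
    fix z assume "z \<in> {z. 0 \<le> Im z \<and> Im z \<le> \<eta> + \<delta>}"
    thus "norm (cos z) \<le> exp (\<eta> + \<delta>)"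
      by (intro order_trans[OF norm_cos_le_exp]) auto
    show "(sin has_field_derivative cos z) (at z within {z. 0 \<le> Im z \<and> Im z \<le> \<eta> + \<delta>})"
      by (rule has_field_derivative_at_within[OF DERIV_sin])
  qed (use Im assms in auto)
  have ab: "norm (a - b) = \<delta> * norm v"
  proof -
    have "a - b = - (of_real \<delta> * v)" by (simp add: a_def b_def algebra_simps)
    thus ?thesis using assms by (simp only: norm_minus_cancel norm_mult norm_of_real abs_of_nonneg)
  qed
  have ia: "1 / norm (sin a) \<le> 2 * exp (- \<eta>) * (1 + 1 / \<eta>)" using inverse_sin_le[of a] Im assms by simp
  have ib: "1 / norm (sin b) \<le> 2 * exp (- (\<eta> + \<delta>)) * (1 + 1 / \<eta>)"
  proof -
    have "1 / norm (sin b) \<le> 2 * exp (- (\<eta> + \<delta>)) * (1 + 1 / (\<eta> + \<delta>))"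
      using inverse_sin_le[of b] Im assms by simp
    also have "\<dots> \<le> 2 * exp (- (\<eta> + \<delta>)) * (1 + 1 / \<eta>)"
      using assms by (intro mult_left_mono add_left_mono frac_le) auto
    finally show ?thesis .
  qed
  have "1 / sin b - 1 / sin a = (sin a - sin b) * (1 / sin a) * (1 / sin b)"
    using nz by (simp add: field_simps)
  hence "norm (1 / sin b - 1 / sin a) = norm (sin a - sin b) * (1 / norm (sin a)) * (1 / norm (sin b))"
    by (simp only: norm_mult norm_divide norm_one)
  also have "\<dots> \<le> (exp (\<eta> + \<delta>) * norm (a - b)) * (2 * exp (- \<eta>) * (1 + 1 / \<eta>)) * (2 * exp (- (\<eta> + \<delta>)) * (1 + 1 / \<eta>))"
    using assms by (intro mult_mono diff ia ib mult_nonneg_nonneg) auto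
  also have "\<dots> = exp (- \<eta>) * (4 * \<delta> * (1 + 1 / \<eta>)\<^sup>2 * norm v) * (exp (\<eta> + \<delta>) * exp (- (\<eta> + \<delta>)))"
    unfolding ab by (simp only: power2_eq_square) (simp only: mult_ac, simp)
  also have "exp (\<eta> + \<delta>) * exp (- (\<eta> + \<delta>)) = 1" unfolding exp_add[symmetric] by simp
  also have "exp (- \<eta>) * (4 * \<delta> * (1 + 1 / \<eta>)\<^sup>2 * norm v) * 1 \<le> 1 * (4 * \<delta> * (1 + 1 / \<eta>)\<^sup>2 * norm v) * 1"
    using assms by (intro mult_right_mono) auto
  finally show ?thesis by (simp only: a_def b_def v_def mult_1 mult_1_right)
qed

text \<open>Since the kernel contains H = h + 2, the approximation first appears at \<eta> + 2c;
  this lemma moves it to \<eta>.\<close>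

lemma chi_shift:
  assumes "0 < \<eta>" "0 \<le> \<delta>"
  shows "\<bar>chi (\<eta> + \<delta>) - chi \<eta>\<bar> \<le> 4 * exp (1/2) * lorentz_const 3 * (\<delta> * (1 + 1 / \<eta>)\<^sup>2)"
proof -
  let ?a = "\<lambda>v::complex. 1 / sin (of_real (\<eta> + \<delta>) * v)" and ?b = "\<lambda>v::complex. 1 / sin (of_real \<eta> * v)"
  have pos: "0 < \<eta> + \<delta>" using assms by simp
  have int: "integrable lborel (\<lambda>s. exp (- (Complex s 1)\<^sup>2 / 2) * ((Complex s 1)\<^sup>2 * (1 / sin (of_real \<theta> * Complex s 1))))" if "0 < \<theta>" for \<theta>
  proof (rule gauss_line_integrable[where h = "\<lambda>v. v\<^sup>2 * (1 / sin (of_real \<theta> * v))" and C = "1 / \<theta>" and L = 2])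
    show "continuous_on UNIV (\<lambda>s. (Complex s 1)\<^sup>2 * (1 / sin (of_real \<theta> * Complex s 1)))"
      by (intro continuous_on_mult continuous_on_power continuous_on_Complex_1 continuous_on_inverse_sin_line that) simp
    fix s
    have "norm (Complex s 1) ^ 2 * norm (1 / sin (of_real \<theta> * Complex s 1)) \<le> norm (Complex s 1) ^ 2 * (1 / \<theta>)"
      by (intro mult_left_mono norm_inverse_sin_scaled that) simp
    thus "norm ((Complex s 1)\<^sup>2 * (1 / sin (of_real \<theta> * Complex s 1))) \<le> 1 / \<theta> * norm (Complex s 1) ^ 2"
      by (simp only: norm_mult norm_power mult.commute)
  qed
  let ?G = "\<lambda>h s. exp (- (Complex s 1)\<^sup>2 / 2) * ((Complex s 1)\<^sup>2 * h (Complex s 1))"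
  have eq: "gauss_line (\<lambda>v. v\<^sup>2 * ?a v) - gauss_line (\<lambda>v. v\<^sup>2 * ?b v) = (\<integral>s. ?G ?a s - ?G ?b s \<partial>lborel)"
    unfolding gauss_line_def by (rule Bochner_Integration.integral_diff[symmetric]) (rule int pos assms)+
  have "norm (\<integral>s. ?G ?a s - ?G ?b s \<partial>lborel) \<le> (\<integral>s. 4 * \<delta> * (1 + 1 / \<eta>)\<^sup>2 * exp (1/2) * lorentz_const 3 * inverse (1 + s\<^sup>2) \<partial>lborel)"
  proof (intro order_trans[OF integral_norm_bound] integral_mono integrable_norm Bochner_Integration.integrable_diff int pos assms integrable_mult_right integrable_lorentz)
    fix s
    have "norm ((Complex s 1)\<^sup>2 * (?a (Complex s 1) - ?b (Complex s 1))) \<le> norm (Complex s 1) ^ 2 * (4 * \<delta> * (1 + 1 / \<eta>)\<^sup>2 * norm (Complex s 1))"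
      unfolding norm_mult norm_power by (intro mult_left_mono inverse_sin_diff assms) simp
    also have "\<dots> = 4 * \<delta> * (1 + 1 / \<eta>)\<^sup>2 * norm (Complex s 1) ^ 3" by (simp add: eval_nat_numeral)
    finally have "norm (exp (- (Complex s 1)\<^sup>2 / 2) * ((Complex s 1)\<^sup>2 * (?a (Complex s 1) - ?b (Complex s 1)))) \<le> 4 * \<delta> * (1 + 1 / \<eta>)\<^sup>2 * exp (1/2) * lorentz_const 3 * inverse (1 + s\<^sup>2)"
      by (rule gauss_line_integrand_bound)
    thus "norm (?G ?a s - ?G ?b s) \<le> 4 * \<delta> * (1 + 1 / \<eta>)\<^sup>2 * exp (1/2) * lorentz_const 3 * inverse (1 + s\<^sup>2)"
      by (simp only: right_diff_distrib)
  qed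
  also have "\<dots> = 4 * \<delta> * (1 + 1 / \<eta>)\<^sup>2 * exp (1/2) * lorentz_const 3 * pi"
    by (simp only: integral_mult_right_zero integral_lorentz)
  finally have "norm (gauss_line (\<lambda>v. v\<^sup>2 * ?a v) - gauss_line (\<lambda>v. v\<^sup>2 * ?b v)) \<le> 4 * \<delta> * (1 + 1 / \<eta>)\<^sup>2 * exp (1/2) * lorentz_const 3 * pi"
    unfolding eq .
  from order_trans[OF abs_Im_le_cmod this]
  have "\<bar>Im (gauss_line (\<lambda>v. v\<^sup>2 * ?a v)) - Im (gauss_line (\<lambda>v. v\<^sup>2 * ?b v))\<bar> \<le> 4 * \<delta> * (1 + 1 / \<eta>)\<^sup>2 * exp (1/2) * lorentz_const 3 * pi"
    by simp
  hence "1 / pi * \<bar>Im (gauss_line (\<lambda>v. v\<^sup>2 * ?a v)) - Im (gauss_line (\<lambda>v. v\<^sup>2 * ?b v))\<bar> \<le> 1 / pi * (4 * \<delta> * (1 + 1 / \<eta>)\<^sup>2 * exp (1/2) * lorentz_const 3 * pi)"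
    by (rule mult_left_mono) simp
  also have "1 / pi * (4 * \<delta> * (1 + 1 / \<eta>)\<^sup>2 * exp (1/2) * lorentz_const 3 * pi) = 4 * exp (1/2) * lorentz_const 3 * (\<delta> * (1 + 1 / \<eta>)\<^sup>2)"
  proof -
    have "1 / pi * (4 * d * y * e * l * pi) = 4 * e * l * (d * y)" for d y e l :: real by simp
    thus ?thesis .
  qed
  also have "1 / pi * \<bar>Im (gauss_line (\<lambda>v. v\<^sup>2 * ?a v)) - Im (gauss_line (\<lambda>v. v\<^sup>2 * ?b v))\<bar> = \<bar>chi (\<eta> + \<delta>) - chi \<eta>\<bar>"
    unfolding chi_gauss_line[OF pos] chi_gauss_line[OF assms(1)] right_diff_distrib[symmetric] abs_mult by simp
  finally show ?thesis .
qed

text \<open>\<open>gauss_compare\<close> with the weight 1 / sin(H w), which is at most 1/(H c) on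
  the line, followed by \<open>chi_shift\<close> with shift 2c. The error is additive, so a lower
  bound for \<open>chi\<close> is still required.\<close>

lemma qh_chi:
  "\<exists>C\<ge>0. \<forall>n c h. 0 < c \<longrightarrow> c \<le> 1 / 2 \<longrightarrow> real n * c\<^sup>2 = 1 \<longrightarrow> even (n + h) \<longrightarrow> 0 < h \<longrightarrow>
     \<bar>qh n h / c ^ 3 - 2 * chi (real h * c)\<bar> \<le> C * c * (1 + 1 / (real h * c))\<^sup>2"
proof -
  obtain C where C: "C \<ge> 0" "\<And>n c D g. 0 < c \<Longrightarrow> c \<le> 1 \<Longrightarrow> real n * c\<^sup>2 = 1 \<Longrightarrow>
     continuous_on UNIV (\<lambda>x. g (Complex x c)) \<Longrightarrow> (\<And>x. norm (g (Complex x c)) \<le> D) \<Longrightarrow>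
     norm (LI c (\<lambda>w. phi n w * g w) - of_real (c ^ 3) * gauss_line (\<lambda>v. v\<^sup>2 * g (of_real c * v))) \<le> C * D * c ^ 5"
    using gauss_compare by blast
  define D where "D = 4 * exp (1/2) * lorentz_const 3"
  have D: "D \<ge> 0" by (simp add: D_def lorentz_const_nonneg)
  have "\<bar>qh n h / c ^ 3 - 2 * chi (real h * c)\<bar> \<le> (C + 4 * D) * c * (1 + 1 / (real h * c))\<^sup>2"
    if c: "0 < c" "c \<le> 1 / 2" "real n * c\<^sup>2 = 1" and h: "even (n + h)" "0 < h" for n c h
  proof -
    define \<eta> where "\<eta> = real h * c"
    define H where "H = h + 2"
    have c1: "c \<le> 1" using c by simp
    have \<eta>: "\<eta> > 0" using c h by (simp add: \<eta>_def)
    have H: "2 \<le> H" "even (n + H)" "H - 2 = h" using h by (auto simp: H_def)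
    have Hc: "real H * c = \<eta> + 2 * c" by (simp add: H_def \<eta>_def algebra_simps)
    have Hpos: "0 < real H" using H by simp
    let ?g = "\<lambda>w::complex. 1 / sin (of_real (real H) * w)"
    have le: "norm (LI c (\<lambda>w. phi n w * ?g w) - of_real (c ^ 3) * gauss_line (\<lambda>v. v\<^sup>2 * ?g (of_real c * v))) \<le> C * (1 / (real H * c)) * c ^ 5"
    proof (rule C(2)[OF c(1) c1 c(3)])
      show "continuous_on UNIV (\<lambda>x. ?g (Complex x c))" using Hpos c(1) by (rule continuous_on_inverse_sin_line)
      fix x
      have "of_real (real H) * Complex x c = of_real (real H * c) * Complex (x / c) 1" using c by (simp add: complex_eq_iff)
      moreover have "norm (1 / sin (of_real (real H * c) * Complex (x / c) 1)) \<le> 1 / (real H * c)"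
        using Hpos c by (intro norm_inverse_sin_scaled mult_pos_pos)
      ultimately show "norm (?g (Complex x c)) \<le> 1 / (real H * c)" by (simp only:)
    qed
    have gl: "gauss_line (\<lambda>v. v\<^sup>2 * ?g (of_real c * v)) = gauss_line (\<lambda>v. v\<^sup>2 * (1 / sin (of_real (\<eta> + 2 * c) * v)))"
      unfolding Hc[symmetric] of_real_mult mult.assoc ..
    have Lq: "qh n h = 2 / pi * Im (LI c (\<lambda>w. phi n w * ?g w))"
      using qh_LI[OF c(1) H(1,2)] by (simp add: H(3))
    have chi': "2 * chi (\<eta> + 2 * c) * c ^ 3 = 2 / pi * Im (of_real (c ^ 3) * gauss_line (\<lambda>v. v\<^sup>2 * ?g (of_real c * v)))"
      unfolding gl using chi_gauss_line[of "\<eta> + 2 * c"] \<eta> c by (simp del: of_real_power)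
    have "\<bar>qh n h - 2 * chi (\<eta> + 2 * c) * c ^ 3\<bar> = 2 / pi * \<bar>Im (LI c (\<lambda>w. phi n w * ?g w) - of_real (c ^ 3) * gauss_line (\<lambda>v. v\<^sup>2 * ?g (of_real c * v)))\<bar>"
      unfolding Lq chi' by (simp only: minus_complex.sel right_diff_distrib[symmetric] abs_mult) simp
    also have "\<dots> \<le> 1 * (C * (1 / (real H * c)) * c ^ 5)"
      using pi_ge_two by (intro mult_mono order_trans[OF abs_Im_le_cmod le]) auto
    also have "\<dots> \<le> C * (1 / \<eta>) * c ^ 5"
      unfolding Hc mult_1 using c C \<eta> by (intro mult_right_mono mult_left_mono frac_le) auto
    finally have "\<bar>qh n h - 2 * chi (\<eta> + 2 * c) * c ^ 3\<bar> / c ^ 3 \<le> C * (1 / \<eta>) * c ^ 5 / c ^ 3"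
      using c by (intro divide_right_mono) auto
    moreover have "\<bar>qh n h - 2 * chi (\<eta> + 2 * c) * c ^ 3\<bar> / c ^ 3 = \<bar>qh n h / c ^ 3 - 2 * chi (\<eta> + 2 * c)\<bar>"
    proof -
      have "qh n h / c ^ 3 - 2 * chi (\<eta> + 2 * c) = (qh n h - 2 * chi (\<eta> + 2 * c) * c ^ 3) / c ^ 3"
        using c by (simp add: field_simps)
      thus ?thesis using c by (simp only: abs_divide) simp
    qed
    moreover have "C * (1 / \<eta>) * c ^ 5 / c ^ 3 = C * c * (c * (1 / \<eta>))" using c by (simp add: eval_nat_numeral)
    moreover have "C * c * (c * (1 / \<eta>)) \<le> C * c * (1 + 1 / \<eta>)\<^sup>2"
    proof -
      have "c * (1 / \<eta>) \<le> 1 * (1 / \<eta>)" using c1 \<eta> by (intro mult_right_mono) auto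
      also have "\<dots> \<le> (1 + 1 / \<eta>)\<^sup>2"
      proof -
        have "1 * u \<le> (1 + u)\<^sup>2" if "0 \<le> u" for u :: real
          using that mult_nonneg_nonneg[OF that that] by (simp add: power2_eq_square algebra_simps)
        thus ?thesis using \<eta> by simp
      qed
      finally show ?thesis using C c by (intro mult_left_mono) auto
    qed
    ultimately have 1: "\<bar>qh n h / c ^ 3 - 2 * chi (\<eta> + 2 * c)\<bar> \<le> C * c * (1 + 1 / \<eta>)\<^sup>2" by linarith
    have 2: "\<bar>chi (\<eta> + 2 * c) - chi \<eta>\<bar> \<le> D * (2 * c * (1 + 1 / \<eta>)\<^sup>2)"
      unfolding D_def using c \<eta> by (intro chi_shift) auto
    have tri: "\<bar>x - 2 * y\<bar> \<le> \<bar>x - 2 * z\<bar> + 2 * \<bar>z - y\<bar>" for x y z :: real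
      using abs_triangle_ineq[of "x - 2 * z" "2 * (z - y)"] unfolding abs_mult by simp
    have "\<bar>qh n h / c ^ 3 - 2 * chi \<eta>\<bar> \<le> \<bar>qh n h / c ^ 3 - 2 * chi (\<eta> + 2 * c)\<bar> + 2 * \<bar>chi (\<eta> + 2 * c) - chi \<eta>\<bar>"
      by (rule tri)
    also have "\<dots> \<le> C * c * (1 + 1 / \<eta>)\<^sup>2 + 2 * (D * (2 * c * (1 + 1 / \<eta>)\<^sup>2))"
      using 1 2 by (intro add_mono mult_left_mono) simp_all
    also have "\<dots> = (C + 4 * D) * c * (1 + 1 / \<eta>)\<^sup>2" by (simp add: algebra_simps)
    finally show ?thesis unfolding \<eta>_def .
  qed
  moreover have "C + 4 * D \<ge> 0" using C D by simp
  ultimately show ?thesis by blast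
qed

section \<open>The dual series of chi by residues\<close>

definition theta_kernel :: "real \<Rightarrow> complex \<Rightarrow> complex" where
  "theta_kernel \<eta> z = exp (- z\<^sup>2 / 2) * (z\<^sup>2 * (1 / sin (of_real \<eta> * z)))"

definition theta_residue :: "real \<Rightarrow> int \<Rightarrow> real" where
  "theta_residue \<eta> k = (if even k then 1 else -1) * (of_int k * pi / \<eta>)\<^sup>2 * exp (- (of_int k * pi / \<eta>)\<^sup>2 / 2) / \<eta>"

lemma sin_scaled_eq_0_iff:
  fixes z :: complex
  assumes "0 < \<eta>"
  shows "sin (of_real \<eta> * z) = 0 \<longleftrightarrow> (\<exists>k::int. z = of_real (of_int k * pi / \<eta>))"
proof -
  have "of_real \<eta> * z = of_real (of_int k * pi) \<longleftrightarrow> z = of_real (of_int k * pi / \<eta>)" for k :: int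
    using assms by (auto simp: field_simps)
  thus ?thesis by (simp only: sin_eq_0)
qed

text \<open>sin(\<eta> z) has a simple zero with derivative (-1)^k \<eta> there. At k = 0 the factor
  z^2 makes both the singularity removable and the formula zero.\<close>

lemma residue_theta_kernel:
  assumes \<eta>: "0 < \<eta>"
  shows "residue (theta_kernel \<eta>) (of_real (of_int k * pi / \<eta>)) = of_real (theta_residue \<eta> k)"
proof -
  define x where "x = of_int k * pi / \<eta>"
  define a where "a = complex_of_real x"
  have "sin (of_real \<eta> * z) \<noteq> 0" if z: "z \<in> ball a (pi / \<eta>)" "z \<noteq> a" for z
  proof
    assume "sin (of_real \<eta> * z) = 0"
    then obtain m :: int where m: "z = of_real (of_int m * pi / \<eta>)" using sin_scaled_eq_0_iff[OF \<eta>] by blast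
    have "norm (a - z) = \<bar>of_int (k - m)\<bar> * (pi / \<eta>)"
    proof -
      have "a - z = of_real (of_int (k - m) * (pi / \<eta>))"
        by (simp add: m a_def x_def left_diff_distrib diff_divide_distrib)
      thus ?thesis using \<eta> by (simp only: norm_of_real abs_mult) simp
    qed
    moreover have "norm (a - z) < pi / \<eta>" using z(1) by (simp add: dist_norm)
    ultimately have "\<bar>of_int (k - m)\<bar> * (pi / \<eta>) < 1 * (pi / \<eta>)" by simp
    hence "\<bar>of_int (k - m) :: real\<bar> < 1" using \<eta> by (simp only: mult_less_cancel_right) auto
    hence "k = m" by linarith
    with z(2) m show False by (simp add: a_def x_def)
  qed
  note nz = this
  have "cos (of_real \<eta> * a) = of_real (if even k then 1 else -1)"
  proof -
    have "of_real \<eta> * a = of_real (pi * of_int k)" using \<eta> by (simp add: a_def x_def)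
    hence "cos (of_real \<eta> * a) = of_real (cos (pi * of_int k))" by (simp only: cos_of_real)
    thus ?thesis by (simp only: cos_npi_int)
  qed
  note cosa = this
  have sina: "sin (of_real \<eta> * a) = 0" unfolding sin_scaled_eq_0_iff[OF \<eta>] a_def x_def by blast
  have "((\<lambda>z. sin (of_real \<eta> * z)) has_field_derivative cos (of_real \<eta> * a) * of_real \<eta>) (at a)"
    by (auto intro!: derivative_eq_intros)
  hence "((\<lambda>z. (sin (of_real \<eta> * z) - sin (of_real \<eta> * a)) / (z - a)) \<longlongrightarrow> cos (of_real \<eta> * a) * of_real \<eta>) (at a)"
    unfolding has_field_derivative_iff .
  hence "((\<lambda>z. inverse ((sin (of_real \<eta> * z) - sin (of_real \<eta> * a)) / (z - a))) \<longlongrightarrow> inverse (cos (of_real \<eta> * a) * of_real \<eta>)) (at a)"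
    by (rule tendsto_inverse) (use \<eta> in \<open>simp add: cosa\<close>)
  hence lim: "((\<lambda>z. (z - a) / sin (of_real \<eta> * z)) \<longlongrightarrow> inverse (cos (of_real \<eta> * a) * of_real \<eta>)) (at a)"
    by (simp add: sina)
  have "((\<lambda>z. (exp (- z\<^sup>2 / 2) * z\<^sup>2) * ((z - a) / sin (of_real \<eta> * z))) \<longlongrightarrow> (exp (- a\<^sup>2 / 2) * a\<^sup>2) * inverse (cos (of_real \<eta> * a) * of_real \<eta>)) (at a)"
    by (intro tendsto_mult[OF _ lim] tendsto_intros) auto
  moreover have "(exp (- z\<^sup>2 / 2) * z\<^sup>2) * ((z - a) / sin (of_real \<eta> * z)) = theta_kernel \<eta> z * (z - a)" for z
    by (simp add: theta_kernel_def)
  moreover have "(exp (- a\<^sup>2 / 2) * a\<^sup>2) * inverse (cos (of_real \<eta> * a) * of_real \<eta>) = of_real (theta_residue \<eta> k)"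
  proof -
    have "exp (- a\<^sup>2 / 2) = of_real (exp (- x\<^sup>2 / 2))" unfolding a_def exp_of_real[symmetric] by simp
    moreover have "e * x\<^sup>2 * inverse (sg * \<eta>) = sg * x\<^sup>2 * e / \<eta>" if "inverse sg = sg" for e sg :: real
      using that by (simp add: divide_inverse)
    moreover have "inverse (if even k then 1 else - 1) = (if even k then 1 else - 1 :: real)" by simp
    ultimately show ?thesis
      unfolding cosa theta_residue_def x_def[symmetric]
      by (simp only: a_def of_real_mult[symmetric] of_real_power[symmetric] of_real_inverse[symmetric])
  qed
  ultimately have "((\<lambda>z. theta_kernel \<eta> z * (z - a)) \<longlongrightarrow> of_real (theta_residue \<eta> k)) (at a)" by (simp only:)
  moreover have "theta_kernel \<eta> holomorphic_on (ball a (pi / \<eta>) - {a})"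
    unfolding theta_kernel_def[abs_def] by (intro holomorphic_intros) (use nz in auto)
  ultimately have "residue (theta_kernel \<eta>) a = of_real (theta_residue \<eta> k)"
    using \<eta> by (intro residue_simple'[of "ball a (pi / \<eta>)"]) auto
  thus ?thesis by (simp only: a_def x_def)
qed

lemma theta_kernel_minus: "theta_kernel \<eta> (- z) = - theta_kernel \<eta> z"
  by (simp add: theta_kernel_def)

text \<open>Places the vertical sides midway between consecutive poles k pi / \<eta>.\<close>

definition half_width :: "real \<Rightarrow> nat \<Rightarrow> real" where
  "half_width \<eta> N = (real N + 1 / 2) * pi / \<eta>"

lemma half_width_pos: "0 < \<eta> \<Longrightarrow> 0 < half_width \<eta> N"
  unfolding half_width_def by (intro divide_pos_pos mult_pos_pos) auto

lemma theta_rect: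
  assumes \<eta>: "0 < \<eta>"
  defines "R \<equiv> half_width \<eta>"
  shows "contour_integral (rectpath (Complex (- R N) (-1)) (Complex (R N) 1)) (theta_kernel \<eta>) =
    2 * of_real pi * \<i> * of_real (\<Sum>k\<in>{- int N..int N}. theta_residue \<eta> k)"
    "theta_kernel \<eta> contour_integrable_on rectpath (Complex (- R N) (-1)) (Complex (R N) 1)"
    "continuous_on (path_image (rectpath (Complex (- R N) (-1)) (Complex (R N) 1))) (theta_kernel \<eta>)"
proof -
  let ?g = "rectpath (Complex (- R N) (-1)) (Complex (R N) 1)"
  define p where "p k = complex_of_real (of_int k * pi / \<eta>)" for k :: int
  define S where "S = {z. Re z < (real N + 1) * pi / \<eta>} \<inter> {z. Re z > - ((real N + 1) * pi / \<eta>)}"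
  define P where "P = p ` {- int N..int N}"
  have R: "R N > 0" "R N < (real N + 1) * pi / \<eta>"
    unfolding R_def by (rule half_width_pos[OF \<eta>])
      (unfold half_width_def, intro divide_strict_right_mono mult_strict_right_mono \<eta>, auto)
  have S: "open S" "convex S" unfolding S_def
    by (intro open_Int open_halfspace_Re_lt open_halfspace_Re_gt, intro convex_Int convex_halfspace_Re_lt convex_halfspace_Re_gt)
  have bound: "\<bar>real_of_int k * pi / \<eta>\<bar> < (real M) * pi / \<eta> \<longleftrightarrow> \<bar>k\<bar> < int M" for k M
  proof -
    have "\<bar>real_of_int k * pi / \<eta>\<bar> = \<bar>real_of_int k\<bar> * (pi / \<eta>)" using \<eta> by (simp add: abs_mult)
    moreover have "real M * pi / \<eta> = real M * (pi / \<eta>)" by simp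
    moreover have "0 < pi / \<eta>" using \<eta> by simp
    ultimately have "\<bar>real_of_int k * pi / \<eta>\<bar> < (real M) * pi / \<eta> \<longleftrightarrow> \<bar>real_of_int k\<bar> < real M"
      by (simp only: mult_less_cancel_right_pos)
    also have "\<dots> \<longleftrightarrow> \<bar>k\<bar> < int M" by linarith
    finally show ?thesis .
  qed
  have pS: "p k \<in> S \<longleftrightarrow> p k \<in> P" for k
  proof -
    have "p k \<in> S \<longleftrightarrow> \<bar>real_of_int k * pi / \<eta>\<bar> < real (N + 1) * pi / \<eta>"
      unfolding S_def p_def
      by (simp only: Int_iff mem_Collect_eq Re_complex_of_real abs_less_iff of_nat_add of_nat_1) linarith
    also have "\<dots> \<longleftrightarrow> k \<in> {- int N..int N}" unfolding bound by auto
    also have "\<dots> \<longleftrightarrow> p k \<in> P"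
    proof -
      have "inj p" using \<eta> by (auto simp: inj_def p_def)
      thus ?thesis by (auto simp: P_def inj_image_mem_iff)
    qed
    finally show ?thesis .
  qed
  have inj: "inj_on p {- int N..int N}" using \<eta> by (auto simp: inj_on_def p_def)
  have nz: "sin (of_real \<eta> * z) \<noteq> 0" if "z \<in> S - P" for z
    using that pS unfolding sin_scaled_eq_0_iff[OF \<eta>] p_def[symmetric] by auto
  have hol: "theta_kernel \<eta> holomorphic_on S - P"
    unfolding theta_kernel_def[abs_def] by (intro holomorphic_intros nz) auto
  have image: "path_image ?g \<subseteq> S - P"
  proof
    fix z assume z: "z \<in> path_image ?g"
    have "z \<in> S" using z R by (auto simp: path_image_rectpath S_def)
    moreover have "z \<notin> P"
    proof
      assume "z \<in> P"
      then obtain k where k: "z = p k" by (auto simp: P_def)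
      have "Im z = 0" by (simp add: k p_def)
      hence "\<bar>Re z\<bar> = R N" using z R by (auto simp: path_image_rectpath)
      hence "\<bar>real_of_int k\<bar> * (pi / \<eta>) = (real N + 1 / 2) * (pi / \<eta>)"
        using \<eta> by (simp add: k p_def R_def half_width_def abs_mult)
      hence "\<bar>real_of_int k\<bar> = real N + 1 / 2" using \<eta> by (simp only: mult_cancel_right) auto
      hence "real_of_int (2 * \<bar>k\<bar>) = real_of_int (2 * int N + 1)" by simp
      hence "2 * \<bar>k\<bar> = 2 * int N + 1" by (simp only: of_int_eq_iff)
      thus False by presburger
    qed
    ultimately show "z \<in> S - P" by blast
  qed
  show "continuous_on (path_image ?g) (theta_kernel \<eta>)"
    using holomorphic_on_imp_continuous_on[OF hol] image by (rule continuous_on_subset)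
  have fin: "finite P" by (simp add: P_def)
  show "theta_kernel \<eta> contour_integrable_on ?g"
    by (rule contour_integrable_holomorphic_simple[OF hol _ _ image]) (use S fin in \<open>auto intro: open_Diff finite_imp_closed\<close>)
  have "contour_integral ?g (theta_kernel \<eta>) = 2 * pi * \<i> * (\<Sum>z\<in>P. winding_number ?g z * residue (theta_kernel \<eta>) z)"
  proof (rule Residue_theorem[OF S(1) _ fin hol _ _ image])
    show "connected S" using S(2) by (rule convex_connected)
    show "\<forall>z. z \<notin> S \<longrightarrow> winding_number ?g z = 0"
      using image by (intro allI impI winding_number_zero_outside[OF _ S(2)]) auto
  qed auto
  also have "(\<Sum>z\<in>P. winding_number ?g z * residue (theta_kernel \<eta>) z) = (\<Sum>z\<in>P. residue (theta_kernel \<eta>) z)"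
  proof (rule sum.cong[OF refl])
    fix z assume "z \<in> P"
    then obtain k where k: "z = p k" "\<bar>k\<bar> \<le> int N" by (auto simp: P_def)
    have "\<bar>Re z\<bar> < R N"
    proof -
      have "\<bar>Re z\<bar> = \<bar>real_of_int k\<bar> * (pi / \<eta>)" using \<eta> by (simp add: k p_def abs_mult)
      also have "\<dots> < (real N + 1 / 2) * (pi / \<eta>)"
        using \<eta> k(2) by (intro mult_strict_right_mono divide_pos_pos) (linarith, auto)
      finally show ?thesis by (simp add: R_def half_width_def)
    qed
    hence "- R N < Re z" "Re z < R N" by linarith+
    moreover have "Im z = 0" by (simp add: k p_def)
    ultimately have "winding_number ?g z = 1"
      by (intro winding_number_rectpath) (simp add: in_box_complex_iff)
    thus "winding_number ?g z * residue (theta_kernel \<eta>) z = residue (theta_kernel \<eta>) z" by simp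
  qed
  also have "\<dots> = (\<Sum>k\<in>{- int N..int N}. residue (theta_kernel \<eta>) (p k))"
    unfolding P_def by (rule sum.reindex_cong[OF inj]) auto
  also have "\<dots> = of_real (\<Sum>k\<in>{- int N..int N}. theta_residue \<eta> k)"
    unfolding p_def residue_theta_kernel[OF \<eta>] of_real_sum ..
  finally show "contour_integral ?g (theta_kernel \<eta>) = 2 * of_real pi * \<i> * of_real (\<Sum>k\<in>{- int N..int N}. theta_residue \<eta> k)"
    by (simp only: of_real_mult of_real_numeral)
qed

lemma sum_symmetric_int:
  fixes f :: "int \<Rightarrow> real"
  assumes "\<And>k. f (- k) = f k" "f 0 = 0"
  shows "(\<Sum>k\<in>{- int N..int N}. f k) = 2 * (\<Sum>k<N. f (int k + 1))"
proof (induction N)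
  case (Suc N)
  have "{- int (Suc N)..int (Suc N)} = insert (int N + 1) (insert (- (int N + 1)) {- int N..int N})"
    by auto
  hence "(\<Sum>k\<in>{- int (Suc N)..int (Suc N)}. f k) = f (int N + 1) + (f (- (int N + 1)) + (\<Sum>k\<in>{- int N..int N}. f k))"
    by simp
  thus ?case using Suc assms(1)[of "int N + 1"] by simp
qed (simp add: assms)

text \<open>On these sides cos(\<eta> t) = 0, hence |sin(\<eta> z)| = cosh(\<eta> y) \<ge> 1, and
  the Gaussian factor alone makes the kernel small.\<close>

lemma theta_side_bound:
  assumes \<eta>: "0 < \<eta>" and y: "-1 \<le> y" "y \<le> 1" and t: "\<bar>t\<bar> = half_width \<eta> N"
  shows "norm (theta_kernel \<eta> (Complex t y)) \<le> exp (1 / 2) * exp (- (half_width \<eta> N)\<^sup>2 / 2) * ((half_width \<eta> N)\<^sup>2 + 1)"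
proof -
  let ?R = "half_width \<eta> N"
  have "1 \<le> norm (sin (of_real \<eta> * Complex t y))"
  proof -
    have "\<eta> * ?R = (real N + 1 / 2) * pi" using \<eta> by (simp add: half_width_def)
    also have "\<dots> = pi / 2 + real N * pi" by (simp add: algebra_simps)
    finally have "\<eta> * ?R = pi / 2 + real N * pi" .
    hence "cos (\<eta> * ?R) = 0" by (simp add: cos_add sin_npi)
    moreover have "cos (\<eta> * t) = cos (\<eta> * ?R)"
      using cos_minus[of "\<eta> * t"] by (simp add: t[symmetric] abs_if)
    ultimately have "(sin (\<eta> * t))\<^sup>2 = 1" using sin_cos_squared_add[of "\<eta> * t"] by simp
    hence "cos (2 * (\<eta> * t)) = -1" by (simp only: cos_double_sin)
    moreover have "2 \<le> exp (2 * (\<eta> * y)) + inverse (exp (2 * (\<eta> * y)))"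
      using cosh_real_ge_1[of "2 * (\<eta> * y)"] by (simp add: cosh_field_def exp_minus)
    moreover have "norm (sin (of_real \<eta> * Complex t y)) ^ 2 = (exp (2 * (\<eta> * y)) + inverse (exp (2 * (\<eta> * y))) - 2 * cos (2 * (\<eta> * t))) / 4"
      using norm_sin_squared[of "of_real \<eta> * Complex t y"] by simp
    ultimately have "1\<^sup>2 \<le> norm (sin (of_real \<eta> * Complex t y)) ^ 2" by simp
    thus ?thesis by (rule power2_le_imp_le) simp
  qed
  hence s: "norm (1 / sin (of_real \<eta> * Complex t y)) \<le> 1" by (simp add: norm_divide divide_le_eq_1)
  have t2: "t\<^sup>2 = ?R\<^sup>2" using t by (metis power2_abs)
  have y2: "y\<^sup>2 \<le> 1" using y by (simp add: abs_square_le_1 abs_le_iff)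
  have n: "(norm (Complex t y))\<^sup>2 \<le> ?R\<^sup>2 + 1" using y2 by (simp add: cmod_power2 t2)
  have e: "norm (exp (- (Complex t y)\<^sup>2 / 2)) \<le> exp (1 / 2) * exp (- ?R\<^sup>2 / 2)"
  proof -
    have "norm (exp (- (Complex t y)\<^sup>2 / 2)) = exp ((y\<^sup>2 - ?R\<^sup>2) / 2)"
      by (simp add: norm_exp_eq_Re t2[symmetric]) (simp add: power2_eq_square field_simps)
    also have "\<dots> \<le> exp (1 / 2 + - ?R\<^sup>2 / 2)" using y2 by simp
    finally show ?thesis by (simp only: exp_add)
  qed
  have "norm (theta_kernel \<eta> (Complex t y)) = norm (exp (- (Complex t y)\<^sup>2 / 2)) * ((norm (Complex t y))\<^sup>2 * norm (1 / sin (of_real \<eta> * Complex t y)))"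
    by (simp only: theta_kernel_def norm_mult norm_power)
  also have "\<dots> \<le> (exp (1 / 2) * exp (- ?R\<^sup>2 / 2)) * ((?R\<^sup>2 + 1) * 1)"
    by (intro mult_mono e n s mult_nonneg_nonneg) auto
  finally show ?thesis by simp
qed

lemma half_width_at_top: "0 < \<eta> \<Longrightarrow> filterlim (half_width \<eta>) at_top at_top"
proof -
  assume "0 < \<eta>"
  hence "pi / \<eta> > 0" by simp
  define c where "c = pi / \<eta>"
  have "c > 0" using \<open>pi / \<eta> > 0\<close> by (simp add: c_def)
  hence "filterlim (\<lambda>N. (real N + 1 / 2) * c) at_top at_top" by real_asymp
  thus ?thesis by (simp add: half_width_def[abs_def] c_def)
qed

lemma gauss_line_theta:
  assumes \<eta>: "0 < \<eta>"
  shows "(\<lambda>N. integral {- half_width \<eta> N..half_width \<eta> N} (\<lambda>x. theta_kernel \<eta> (Complex x 1)))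
     \<longlonglongrightarrow> gauss_line (\<lambda>v. v\<^sup>2 * (1 / sin (of_real \<eta> * v)))"
proof -
  let ?f = "\<lambda>x. theta_kernel \<eta> (Complex x 1)" and ?R = "half_width \<eta>"
  have cont: "continuous_on UNIV (\<lambda>s. (Complex s 1)\<^sup>2 * (1 / sin (of_real \<eta> * Complex s 1)))"
    by (intro continuous_on_mult continuous_on_power continuous_on_Complex_1 continuous_on_inverse_sin_line \<eta>) simp
  have int: "integrable lborel ?f"
    unfolding theta_kernel_def
  proof (rule gauss_line_integrable[where h = "\<lambda>v. v\<^sup>2 * (1 / sin (of_real \<eta> * v))" and C = "1 / \<eta>" and L = 2, OF cont])
    fix s
    have "norm (Complex s 1) ^ 2 * norm (1 / sin (of_real \<eta> * Complex s 1)) \<le> norm (Complex s 1) ^ 2 * (1 / \<eta>)"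
      by (intro mult_left_mono norm_inverse_sin_scaled \<eta>) simp
    thus "norm ((Complex s 1)\<^sup>2 * (1 / sin (of_real \<eta> * Complex s 1))) \<le> 1 / \<eta> * norm (Complex s 1) ^ 2"
      by (simp only: norm_mult norm_power mult.commute)
  qed
  have "(\<lambda>N. \<integral>x. indicator {- ?R N..?R N} x *\<^sub>R ?f x \<partial>lborel) \<longlonglongrightarrow> (\<integral>x. ?f x \<partial>lborel)"
  proof (rule integral_dominated_convergence[where w = "\<lambda>x. norm (?f x)"])
    show "AE x in lborel. (\<lambda>N. indicator {- ?R N..?R N} x *\<^sub>R ?f x) \<longlonglongrightarrow> ?f x"
    proof (rule AE_I2, rule tendsto_eventually)
      fix x :: real
      have "eventually (\<lambda>N. ?R N \<ge> \<bar>x\<bar>) at_top" using half_width_at_top[OF \<eta>] by (simp add: filterlim_at_top)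
      thus "eventually (\<lambda>N. indicator {- ?R N..?R N} x *\<^sub>R ?f x = ?f x) at_top"
        by eventually_elim (auto simp: indicator_def)
    qed
  qed (use int in \<open>auto simp: indicator_def\<close>)
  moreover have "(\<integral>x. indicator {- ?R N..?R N} x *\<^sub>R ?f x \<partial>lborel) = integral {- ?R N..?R N} ?f" for N
    using set_borel_integral_eq_integral(2)[of "{- ?R N..?R N}" ?f] integrable_mult_indicator[of "{- ?R N..?R N}" lborel ?f] int
    by (simp add: set_integrable_def set_lebesgue_integral_def)
  moreover have "(\<integral>x. ?f x \<partial>lborel) = gauss_line (\<lambda>v. v\<^sup>2 * (1 / sin (of_real \<eta> * v)))"
    by (simp only: gauss_line_def theta_kernel_def)
  ultimately show ?thesis by (simp only:)
qed

text \<open>The kernel is odd, so the lower side of the rectangle doubles the upper one, while the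
  vertical sides disappear as N grows: twice the line integral is -2 pi i times the sum of all
  residues. These are even in k and zero at k = 0, which folds the sum onto k \<ge> 1.\<close>

lemma chi_theta_sums:
  assumes \<eta>: "0 < \<eta>"
  shows "(\<lambda>k. - 2 * theta_residue \<eta> (int k + 1)) sums chi \<eta>"
proof -
  let ?R = "half_width \<eta>" and ?f = "theta_kernel \<eta>"
  define G where "G = gauss_line (\<lambda>v. v\<^sup>2 * (1 / sin (of_real \<eta> * v)))"
  define I where "I N = integral {- ?R N..?R N} (\<lambda>x. ?f (Complex x 1))" for N
  define s where "s N = (\<Sum>k<N. theta_residue \<eta> (int k + 1))" for N
  define M where "M N = exp (1 / 2) * exp (- (?R N)\<^sup>2 / 2) * ((?R N)\<^sup>2 + 1)" for N
  have bound: "norm (2 * I N + 4 * of_real pi * \<i> * of_real (s N)) \<le> 4 * M N" for N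
  proof -
    have R: "?R N > 0" using \<eta> by (simp add: half_width_def)
    have sym: "(\<Sum>k\<in>{- int N..int N}. theta_residue \<eta> k) = 2 * s N"
      unfolding s_def by (rule sum_symmetric_int) (simp_all add: theta_residue_def)
    have "integral {- ?R N..?R N} (\<lambda>x. ?f (Complex x (-1))) = - I N"
    proof -
      have "integral {- ?R N..?R N} (\<lambda>x. ?f (Complex x (-1))) = integral {- ?R N..?R N} (\<lambda>x. ?f (Complex (- x) (-1)))"
        using Henstock_Kurzweil_Integration.integral_reflect_real[of "?R N" "- ?R N" "\<lambda>x. ?f (Complex x (-1))"] by simp
      also have "(\<lambda>x. ?f (Complex (- x) (-1))) = (\<lambda>x. - ?f (Complex x 1))"
      proof
        fix x
        have "Complex (- x) (-1) = - Complex x 1" by (simp add: complex_eq_iff)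
        thus "?f (Complex (- x) (-1)) = - ?f (Complex x 1)" by (simp only: theta_kernel_minus)
      qed
      finally show ?thesis by (simp add: I_def)
    qed
    note bottom = this
    have "norm (integral {- ?R N..?R N} (\<lambda>x. ?f (Complex x 1)) - integral {- ?R N..?R N} (\<lambda>x. ?f (Complex x (-1)))
        + 2 * of_real pi * \<i> * of_real (\<Sum>k\<in>{- int N..int N}. theta_residue \<eta> k)) \<le> 2 * (1 - (-1)) * M N"
    proof (rule rect_integral[OF R])
      show "(?f has_contour_integral 2 * of_real pi * \<i> * of_real (\<Sum>k\<in>{- int N..int N}. theta_residue \<eta> k))
         (rectpath (Complex (- ?R N) (-1)) (Complex (?R N) 1))"
        using has_contour_integral_integral[OF theta_rect(2)[OF \<eta>]] unfolding theta_rect(1)[OF \<eta>] .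
      show "continuous_on (path_image (rectpath (Complex (- ?R N) (-1)) (Complex (?R N) 1))) ?f"
        by (rule theta_rect(3)[OF \<eta>])
      fix y :: real assume "-1 \<le> y" "y \<le> 1"
      note side = theta_side_bound[OF \<eta> this]
      show "norm (?f (Complex (?R N) y)) \<le> M N" unfolding M_def by (rule side) (use R in simp)
      show "norm (?f (Complex (- ?R N) y)) \<le> M N" unfolding M_def by (rule side) (use R in simp)
    qed simp
    thus ?thesis unfolding bottom sym I_def[symmetric] by (simp add: algebra_simps)
  qed
  have M: "M \<longlonglongrightarrow> 0"
  proof -
    have "((\<lambda>x::real. exp (1 / 2) * exp (- x\<^sup>2 / 2) * (x\<^sup>2 + 1)) \<longlongrightarrow> 0) at_top" by real_asymp
    from filterlim_compose[OF this half_width_at_top[OF \<eta>]] show ?thesis by (simp only: M_def[abs_def])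
  qed
  have I: "I \<longlonglongrightarrow> G" unfolding I_def[abs_def] G_def by (rule gauss_line_theta[OF \<eta>])
  have "(\<lambda>N. 2 * I N + 4 * of_real pi * \<i> * of_real (s N)) \<longlonglongrightarrow> 0"
    by (rule Lim_null_comparison[OF always_eventually tendsto_mult_right_zero[OF M, of 4]]) (use bound in blast)
  from tendsto_diff[OF this tendsto_mult[OF tendsto_const I, of 2]]
  have "(\<lambda>N. 4 * of_real pi * \<i> * of_real (s N)) \<longlonglongrightarrow> - (2 * G)" by simp
  from tendsto_Im[OF this] have "(\<lambda>N. 4 * pi * s N) \<longlonglongrightarrow> - (2 * Im G)" by simp
  from tendsto_mult[OF tendsto_const this, of "- (1 / (2 * pi))"]
  have "(\<lambda>N. - 2 * s N) \<longlonglongrightarrow> 1 / pi * Im G" by simp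
  also have "1 / pi * Im G = chi \<eta>" unfolding G_def chi_gauss_line[OF \<eta>] ..
  also have "(\<lambda>N. - 2 * s N) = (\<lambda>N. \<Sum>k<N. - 2 * theta_residue \<eta> (int k + 1))"
    by (simp only: s_def sum_distrib_left)
  finally show ?thesis by (simp only: sums_def)
qed

lemma theta_residue_nat:
  assumes "0 < \<eta>"
  shows "- 2 * theta_residue \<eta> (int k + 1) = 2 * pi ^ 2 / \<eta> ^ 3 * ((- 1) ^ k * (real k + 1) ^ 2 * exp (- (pi ^ 2 * (real k + 1) ^ 2 / (2 * \<eta> ^ 2))))"
proof -
  have "- (if even (int k + 1) then 1 else -1) = (- 1 :: real) ^ k" by simp
  moreover have "- ((real k + 1) * pi / \<eta>)\<^sup>2 / 2 = - (pi ^ 2 * (real k + 1) ^ 2 / (2 * \<eta> ^ 2))"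
    by (simp add: power_divide power_mult_distrib mult.commute)
  moreover have "((real k + 1) * pi / \<eta>)\<^sup>2 / \<eta> = pi\<^sup>2 / \<eta> ^ 3 * (real k + 1)\<^sup>2"
    by (simp add: power_divide power_mult_distrib power3_eq_cube power2_eq_square)
  moreover have "- 2 * (sg * x * e / \<eta>) = 2 * (- sg * e * (x / \<eta>))" for sg x e :: real by simp
  ultimately show ?thesis unfolding theta_residue_def by (simp add: mult_ac)
qed

theorem chi_theta:
  assumes "0 < \<eta>"
  shows "chi \<eta> = 2 * pi ^ 2 / \<eta> ^ 3 *
      (\<Sum>k. (- 1) ^ k * (real k + 1) ^ 2 * exp (- (pi ^ 2 * (real k + 1) ^ 2 / (2 * \<eta> ^ 2))))"
proof -
  have "2 * pi ^ 2 / \<eta> ^ 3 > 0" using assms by simp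
  then obtain K where K: "K = 2 * pi ^ 2 / \<eta> ^ 3" "K \<noteq> 0" by (metis less_irrefl)
  let ?a = "\<lambda>k. (- 1) ^ k * (real k + 1) ^ 2 * exp (- (pi ^ 2 * (real k + 1) ^ 2 / (2 * \<eta> ^ 2)))"
  have "(\<lambda>k. K * ?a k) sums chi \<eta>"
    using chi_theta_sums[OF assms] unfolding theta_residue_nat[OF assms] K(1) .
  from sums_mult[OF this, of "1 / K"] have "?a sums (chi \<eta> / K)" using K(2) by simp
  hence "(\<Sum>k. ?a k) = chi \<eta> / K" by (simp only: sums_iff)
  thus ?thesis using K(2) unfolding K(1)[symmetric] by simp
qed

section \<open>Lower bounds for chi and the local limit theorem\<close>

text \<open>For \<eta> \<ge> 2 all terms of the defining series are nonnegative, and the first alone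
  suffices since \<eta>^2 - 1 \<ge> 1 and the prefactor is at least 1.\<close>

lemma chi_ge_large:
  assumes "2 \<le> \<eta>"
  shows "exp (- \<eta>\<^sup>2 / 2) \<le> chi \<eta>"
proof -
  let ?t = "\<lambda>k. ((2 * real k + 1)\<^sup>2 * \<eta>\<^sup>2 - 1) * exp (- ((2 * real k + 1)\<^sup>2 * \<eta>\<^sup>2 / 2))"
  have "summable ?t" using chi_series_sums[of \<eta>] assms by (simp add: sums_iff)
  have \<eta>2: "4 \<le> \<eta>\<^sup>2" using power_mono[OF assms, of 2] by simp
  have nonneg: "0 \<le> ?t k" for k
  proof -
    have "1 * 1 \<le> (2 * real k + 1)\<^sup>2 * \<eta>\<^sup>2" using assms by (intro mult_mono one_le_power) auto
    thus ?thesis by simp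
  qed
  have "sum ?t {0} \<le> suminf ?t" by (rule sum_le_suminf) (use \<open>summable ?t\<close> nonneg in auto)
  hence 1: "(\<eta>\<^sup>2 - 1) * exp (- (\<eta>\<^sup>2 / 2)) \<le> suminf ?t" by simp
  have "1 * exp (- (\<eta>\<^sup>2 / 2)) \<le> (\<eta>\<^sup>2 - 1) * exp (- (\<eta>\<^sup>2 / 2))" using \<eta>2 by (intro mult_right_mono) auto
  also note 1
  finally have s: "exp (- (\<eta>\<^sup>2 / 2)) \<le> suminf ?t" by simp
  have "sqrt pi \<le> 2" using pi_less_4 real_sqrt_le_mono[of pi 4] by simp
  also have "2 \<le> 2 * sqrt (2 :: real)" by simp
  finally have "1 \<le> 2 * sqrt 2 / sqrt pi" by simp
  hence "1 * exp (- (\<eta>\<^sup>2 / 2)) \<le> 2 * sqrt 2 / sqrt pi * suminf ?t" using s by (intro mult_mono) auto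
  thus ?thesis by (simp add: chi_def)
qed

text \<open>For \<eta> \<le> 2 the dual series alternates and its terms at least halve, so it is at
  least half of its first term; the prefactor, being at least 2, makes up for the half.\<close>

lemma chi_ge_small:
  assumes "0 < \<eta>" "\<eta> \<le> 2"
  shows "exp (- (pi\<^sup>2 / (2 * \<eta>\<^sup>2))) \<le> chi \<eta>"
proof -
  define a where "a k = (real k + 1) ^ 2 * exp (- (pi ^ 2 * (real k + 1) ^ 2 / (2 * \<eta> ^ 2)))" for k
  define K where "K = 2 * pi ^ 2 / \<eta> ^ 3"
  have a0: "0 \<le> a k" for k by (simp add: a_def)
  have K: "2 \<le> K"
  proof -
    have "3\<^sup>2 \<le> pi\<^sup>2" using pi_gt3 by (intro power_mono) auto
    moreover have "\<eta> ^ 3 \<le> 2 ^ 3" using assms by (intro power_mono) auto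
    ultimately have "2 * \<eta> ^ 3 \<le> 2 * pi ^ 2" by simp
    thus ?thesis using assms by (simp add: K_def le_divide_eq)
  qed
  have half: "a (Suc k) \<le> 1 / 2 * a k" for k
  proof -
    have "(real (Suc k) + 1)\<^sup>2 \<le> (2 * (real k + 1))\<^sup>2" by (intro power_mono) auto
    also have "\<dots> = 4 * (real k + 1)\<^sup>2" by (simp only: power_mult_distrib) simp
    finally have p: "(real (Suc k) + 1)\<^sup>2 \<le> 4 * (real k + 1)\<^sup>2" .
    have "3\<^sup>2 \<le> pi\<^sup>2" using pi_gt3 by (intro power_mono) auto
    moreover have "\<eta>\<^sup>2 \<le> 2\<^sup>2" using assms by (intro power_mono) auto
    ultimately have "2 * \<eta>\<^sup>2 \<le> pi\<^sup>2" by simp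
    hence "1 \<le> pi\<^sup>2 / (2 * \<eta>\<^sup>2)" using assms by (simp add: le_divide_eq)
    \<comment> \<open>Consecutive exponents differ by at least 3, and exp 3 \<ge> 8 outweighs the
      growth of the squares by at most 4.\<close>
    hence "1 * 3 \<le> pi\<^sup>2 / (2 * \<eta>\<^sup>2) * (2 * real k + 3)" by (intro mult_mono) auto
    moreover have "pi\<^sup>2 * (real (Suc k) + 1)\<^sup>2 / (2 * \<eta>\<^sup>2) = pi\<^sup>2 * (real k + 1)\<^sup>2 / (2 * \<eta>\<^sup>2) + pi\<^sup>2 / (2 * \<eta>\<^sup>2) * (2 * real k + 3)"
    proof -
      have "(real (Suc k) + 1)\<^sup>2 = (real k + 1)\<^sup>2 + (2 * real k + 3)" by (simp add: power2_eq_square algebra_simps)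
      thus ?thesis by (simp add: distrib_left add_divide_distrib)
    qed
    ultimately have "exp (- (pi\<^sup>2 * (real (Suc k) + 1)\<^sup>2 / (2 * \<eta>\<^sup>2))) \<le> exp (- 3 + - (pi\<^sup>2 * (real k + 1)\<^sup>2 / (2 * \<eta>\<^sup>2)))"
      by (simp only: exp_le_cancel_iff)
    also have "\<dots> \<le> 1 / 8 * exp (- (pi\<^sup>2 * (real k + 1)\<^sup>2 / (2 * \<eta>\<^sup>2)))"
    proof -
      have "8 \<le> exp (3 :: real)" using exp_lower_Taylor_quadratic[of "3 :: real"] by (simp add: power2_eq_square)
      hence "exp (- 3 :: real) \<le> 1 / 8" by (simp add: exp_minus inverse_eq_divide)
      thus ?thesis unfolding exp_add by (intro mult_right_mono) auto
    qed
    finally have "a (Suc k) \<le> 4 * (real k + 1)\<^sup>2 * (1 / 8 * exp (- (pi\<^sup>2 * (real k + 1)\<^sup>2 / (2 * \<eta>\<^sup>2))))"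
      unfolding a_def by (intro mult_mono p) auto
    thus ?thesis by (simp add: a_def)
  qed
  have sums: "(\<lambda>k. K * ((- 1) ^ k * a k)) sums chi \<eta>"
    using chi_theta_sums[OF assms(1)] unfolding theta_residue_nat[OF assms(1)] K_def[symmetric] a_def mult.assoc .
  have lim: "a \<longlonglongrightarrow> 0"
  proof -
    have "(\<lambda>k. K * ((- 1) ^ k * a k)) \<longlonglongrightarrow> 0" using sums by (intro summable_LIMSEQ_zero) (simp add: sums_iff)
    from tendsto_mult[OF tendsto_const tendsto_norm_zero[OF this], of "1 / K"]
    show ?thesis using K a0 by (simp add: abs_mult power_abs)
  qed
  have dec: "a (Suc k) \<le> a k" for k using half[of k] a0[of k] by linarith
  have sm: "summable (\<lambda>k. (- 1) ^ k * a k)" 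
    and le: "(\<Sum>i<2 * 1. (- 1) ^ i * a i) \<le> (\<Sum>i. (- 1) ^ i * a i)"
    by (rule summable_Leibniz'(1)[OF lim a0 dec], rule summable_Leibniz'(2)[OF lim a0 dec])
  have "a 0 - a 1 \<le> (\<Sum>i. (- 1) ^ i * a i)" using le by (simp add: eval_nat_numeral)
  moreover have "a 0 - a 1 \<ge> a 0 / 2" using half[of 0] by simp
  ultimately have "a 0 / 2 \<le> (\<Sum>i. (- 1) ^ i * a i)" by linarith
  hence "2 * (a 0 / 2) \<le> K * (\<Sum>i. (- 1) ^ i * a i)" using K a0 by (intro mult_mono) auto
  also have "\<dots> = chi \<eta>" using sums_unique[OF sums] suminf_mult[OF sm, of K] by (simp only:)
  finally show ?thesis by (simp add: a_def)
qed

text \<open>For L = ln n the bound is n^(-1/6). Each end of the window serves one regime: \<eta>^2 <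
  L/4 for the large arguments, \<eta>^2 > 36/L together with pi^2 \<le> 12 for the small
  ones.\<close>

lemma chi_ge_power:
  assumes "0 < L" "6 / sqrt L < \<eta>" "\<eta> < sqrt L / 2"
  shows "exp (- L / 6) \<le> chi \<eta>"
proof -
  have "0 < 6 / sqrt L" using assms by simp
  hence \<eta>: "0 < \<eta>" using assms(2) by linarith
  show ?thesis
  proof (cases "\<eta> \<le> 2")
    case False
    have "\<eta>\<^sup>2 \<le> (sqrt L / 2)\<^sup>2" using assms \<eta> by (intro power_mono) auto
    also have "\<dots> = L / 4" using assms by (simp add: power_divide)
    finally have "exp (- L / 6) \<le> exp (- \<eta>\<^sup>2 / 2)" using assms by simp
    also have "\<dots> \<le> chi \<eta>" using False by (intro chi_ge_large) simp
    finally show ?thesis .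
  next
    case True
    have "(6 / sqrt L)\<^sup>2 \<le> \<eta>\<^sup>2" using assms \<open>0 < 6 / sqrt L\<close> by (intro power_mono) auto
    hence "36 \<le> L * \<eta>\<^sup>2" using assms by (simp add: power_divide divide_le_eq mult.commute)
    moreover have "pi\<^sup>2 \<le> 4\<^sup>2 * (3 / 4)"
    proof -
      have "pi\<^sup>2 \<le> (3.2 :: real)\<^sup>2" using pi_approx by (intro power_mono) auto
      thus ?thesis by (simp add: power2_eq_square)
    qed
    ultimately have "6 * pi\<^sup>2 \<le> L * (2 * \<eta>\<^sup>2)" by simp
    hence "pi\<^sup>2 / (2 * \<eta>\<^sup>2) \<le> L / 6" using \<eta> by (simp add: divide_le_eq)
    hence "exp (- L / 6) \<le> exp (- (pi\<^sup>2 / (2 * \<eta>\<^sup>2)))" by simp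
    also have "\<dots> \<le> chi \<eta>" using \<eta> True by (rule chi_ge_small)
    finally show ?thesis .
  qed
qed

lemma ratio_close:
  fixes x y :: real
  assumes "1 / 2 \<le> y"
  shows "\<bar>x / y - 1\<bar> \<le> 2 * (\<bar>x - 1\<bar> + \<bar>y - 1\<bar>)"
proof -
  have "x / y - 1 = ((x - 1) - (y - 1)) / y" using assms by (simp add: field_simps)
  hence "\<bar>x / y - 1\<bar> = \<bar>(x - 1) - (y - 1)\<bar> * (1 / y)" using assms by (simp add: abs_divide)
  also have "\<dots> \<le> (\<bar>x - 1\<bar> + \<bar>y - 1\<bar>) * 2"
    using assms by (intro mult_mono abs_triangle_ineq4) (auto simp: divide_le_eq)
  finally show ?thesis by simp
qed

text \<open>In the window the error of \<open>qh_chi\<close> is O(n^(-1/2) log n) uniformly in h,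
  while \<open>chi\<close> is at least n^(-1/6); the quotient tends to 0. Dividing by n
  \<open>q n\<close>, which tends to 1, passes from \<open>qh\<close> to the law of the
  height.\<close>

theorem local_limit:
  "\<forall>\<epsilon>>0. \<forall>\<^sub>F n in at_top. \<forall>h::nat.
      (let \<eta> = real h / sqrt (real n) in
        6 / sqrt (ln (real n)) < \<eta> \<and> \<eta> < sqrt (ln (real n)) / 2 \<and> h mod 2 = n mod 2 \<longrightarrow>
        \<bar>pmf (height_law n) h / (2 * chi \<eta> / sqrt (real n)) - 1\<bar> < \<epsilon>)"
proof (intro allI impI)
  fix \<epsilon> :: real assume \<epsilon>: "0 < \<epsilon>"
  obtain C where C: "C \<ge> 0" "\<And>n c h. 0 < c \<Longrightarrow> c \<le> 1 / 2 \<Longrightarrow> real n * c\<^sup>2 = 1 \<Longrightarrow> even (n + h) \<Longrightarrow> 0 < h \<Longrightarrow>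
     \<bar>qh n h / c ^ 3 - 2 * chi (real h * c)\<bar> \<le> C * c * (1 + 1 / (real h * c))\<^sup>2"
    using qh_chi by blast
  \<comment> \<open>Bound for the relative error: sqrt(ln n)/6 dominates 1/\<eta> in the window, and
    the exponential is the reciprocal of the lower bound for \<open>chi\<close>.\<close>
  define \<delta> where "\<delta> n = C * (1 / sqrt (real n) * (1 + sqrt (ln (real n)) / 6)\<^sup>2 * exp (ln (real n) / 6))" for n
  have "(\<lambda>n::nat. 1 / sqrt (real n) * (1 + sqrt (ln (real n)) / 6)\<^sup>2 * exp (ln (real n) / 6)) \<longlonglongrightarrow> 0"
    by real_asymp
  from tendsto_mult[OF tendsto_const this, of C] have \<delta>: "\<delta> \<longlonglongrightarrow> 0" by (simp add: \<delta>_def[abs_def])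
  have "(\<lambda>n. 2 * (\<delta> n + \<bar>real n * q n - 1\<bar>)) \<longlonglongrightarrow> 2 * (0 + \<bar>1 - 1\<bar>)"
    by (intro tendsto_intros \<delta> n_q_limit)
  hence "eventually (\<lambda>n. 2 * (\<delta> n + \<bar>real n * q n - 1\<bar>) < \<epsilon>) at_top"
    by (rule order_tendstoD) (use \<epsilon> in simp)
  moreover have "eventually (\<lambda>n. 1 / 2 < real n * q n) at_top"
    by (rule order_tendstoD[OF n_q_limit]) simp
  ultimately show "\<forall>\<^sub>F n in at_top. \<forall>h::nat. (let \<eta> = real h / sqrt (real n) in
        6 / sqrt (ln (real n)) < \<eta> \<and> \<eta> < sqrt (ln (real n)) / 2 \<and> h mod 2 = n mod 2 \<longrightarrow>
        \<bar>pmf (height_law n) h / (2 * chi \<eta> / sqrt (real n)) - 1\<bar> < \<epsilon>)"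
    using eventually_ge_at_top[of 4]
  proof eventually_elim
    case (elim n)
    show ?case unfolding Let_def
    proof (intro allI impI)
      fix h :: nat
      define \<eta> where "\<eta> = real h / sqrt (real n)"
      define c where "c = 1 / sqrt (real n)"
      define L where "L = ln (real n)"
      assume "6 / sqrt (ln (real n)) < real h / sqrt (real n) \<and> real h / sqrt (real n) < sqrt (ln (real n)) / 2 \<and> h mod 2 = n mod 2"
      hence h: "6 / sqrt L < \<eta>" "\<eta> < sqrt L / 2" "h mod 2 = n mod 2" by (simp_all add: \<eta>_def L_def)
      have L: "L > 0" using elim(3) by (simp add: L_def)
      hence "0 < 6 / sqrt L" by simp
      hence \<eta>: "0 < \<eta>" using h(1) by linarith
      have hpos: "0 < h" using \<eta> by (cases h) (auto simp: \<eta>_def)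
      have ev: "even (n + h)" using h(3) by presburger
      have "sqrt 4 \<le> sqrt (real n)" using elim(3) by (intro real_sqrt_le_mono) simp
      hence "2 \<le> sqrt (real n)" by simp
      hence c: "0 < c" "c \<le> 1 / 2" "real n * c\<^sup>2 = 1" using elim(3) by (auto simp: c_def power_divide divide_le_eq)
      have hc: "real h * c = \<eta>" by (simp add: c_def \<eta>_def)
      define X where "X = 2 * chi \<eta>"
      have chi: "exp (- L / 6) \<le> chi \<eta>" using L h by (intro chi_ge_power)
      have "0 < exp (- L / 6)" by simp
      hence "0 < chi \<eta>" using chi by linarith
      hence X: "0 < X" "exp (- L / 6) \<le> X" unfolding X_def using chi by linarith+
      have "1 / \<eta> \<le> sqrt L / 6"
      proof -
        have "1 / \<eta> \<le> 1 / (6 / sqrt L)" using h(1) \<open>0 < 6 / sqrt L\<close> \<eta> by (intro divide_left_mono) auto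
        thus ?thesis by simp
      qed
      hence sq: "(1 + 1 / \<eta>)\<^sup>2 \<le> (1 + sqrt L / 6)\<^sup>2" using \<eta> by (intro power_mono) auto
      have "\<bar>qh n h / c ^ 3 / X - 1\<bar> = \<bar>qh n h / c ^ 3 - X\<bar> / X"
      proof -
        have "qh n h / c ^ 3 / X - 1 = (qh n h / c ^ 3 - X) / X" using X by (simp add: diff_divide_distrib)
        thus ?thesis using X by (simp only: abs_divide abs_of_pos)
      qed
      also have "\<dots> \<le> (C * c * (1 + sqrt L / 6)\<^sup>2) / exp (- L / 6)"
      proof (rule frac_le)
        have "\<bar>qh n h / c ^ 3 - X\<bar> \<le> C * c * (1 + 1 / \<eta>)\<^sup>2"
          using C(2)[OF c ev hpos] unfolding hc X_def .
        also have "\<dots> \<le> C * c * (1 + sqrt L / 6)\<^sup>2" using C(1) c(1) by (intro mult_left_mono sq) simp_all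
        finally show "\<bar>qh n h / c ^ 3 - X\<bar> \<le> C * c * (1 + sqrt L / 6)\<^sup>2" .
      qed (use X C(1) c(1) in simp_all)
      also have "\<dots> = C * (c * (1 + sqrt L / 6)\<^sup>2 * exp (L / 6))"
      proof -
        have "exp (- L / 6) = inverse (exp (L / 6))"
          unfolding minus_divide_left[symmetric] by (rule exp_minus)
        hence "x / exp (- L / 6) = x * exp (L / 6)" for x
          by (simp only: divide_inverse inverse_inverse_eq)
        thus ?thesis by (simp only: mult.assoc)
      qed
      also have "\<dots> = \<delta> n" by (simp only: \<delta>_def c_def L_def)
      finally have x: "\<bar>qh n h / c ^ 3 / X - 1\<bar> \<le> \<delta> n" .
      have "pmf (height_law n) h / (X / sqrt (real n)) = (qh n h / c ^ 3 / X) / (real n * q n)"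
      proof -
        have "1 / c ^ 3 = real n * sqrt (real n)" by (simp add: c_def power_divide power3_eq_cube)
        hence "qh n h / c ^ 3 = qh n h * (real n * sqrt (real n))" by (simp only: divide_inverse mult_1)
        moreover have "real n \<noteq> 0" using elim(3) by simp
        ultimately show ?thesis by (simp add: pmf_height_law)
      qed
      hence "\<bar>pmf (height_law n) h / (X / sqrt (real n)) - 1\<bar> \<le> 2 * (\<bar>qh n h / c ^ 3 / X - 1\<bar> + \<bar>real n * q n - 1\<bar>)"
        using ratio_close[of "real n * q n" "qh n h / c ^ 3 / X"] elim(2) by simp
      also have "\<dots> \<le> 2 * (\<delta> n + \<bar>real n * q n - 1\<bar>)" using x by simp
      also have "\<dots> < \<epsilon>" by (rule elim(1))
      finally show "\<bar>pmf (height_law n) h / (2 * chi (real h / sqrt (real n)) / sqrt (real n)) - 1\<bar> < \<epsilon>"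
        unfolding X_def \<eta>_def .
    qed
  qed
qed

theorem theorem4p2:
  shows
    "(\<lambda>n. q n - (1 / real n - 4 / (3 * real n ^ 2) + 88 / (45 * real n ^ 3)
        - 976 / (315 * real n ^ 4) + 3488 / (675 * real n ^ 5) - 276928 / (31185 * real n ^ 6)))
      \<in> O(\<lambda>n. 1 / real n ^ 7) \<and>
    (\<lambda>n. measure_pmf.expectation (height_law n) real -
        (sqrt (2 * pi ^ 3) / 4 * sqrt (real n) - 2
          + 3 * sqrt (2 * pi ^ 3) / (16 * sqrt (real n))
          - 539 * sqrt (2 * pi ^ 3) / (5760 * sqrt (real n ^ 3))
          + 50713 * sqrt (2 * pi ^ 3) / (483840 * sqrt (real n ^ 5))))
      \<in> O(\<lambda>n. 1 / sqrt (real n ^ 7)) \<and>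
    (\<lambda>n. measure_pmf.variance (height_law n) real -
        ((28 * zeta 3 - pi ^ 3) / 8 * real n
          + (224 * zeta 3 - 9 * pi ^ 3) / 48
          - (1792 * zeta 3 - 67 * pi ^ 3) / (2880 * real n)
          + (107520 * zeta 3 - 4189 * pi ^ 3) / (120960 * real n ^ 2)))
      \<in> O(\<lambda>n. 1 / real n ^ 3) \<and>
    (\<forall>r::nat. 1 \<le> r \<longrightarrow>
      (\<lambda>n. measure_pmf.expectation (height_law n) (\<lambda>h. real h ^ r)) \<sim>[at_top]
      (\<lambda>n. real r / sqrt pi * Gamma ((real r + 1) / 2) * (2 ^ (r + 1) - 1)
              * 2 powr (- (real r / 2)) * zeta (real r + 1) * real n powr (real r / 2))) \<and>
    (\<forall>\<epsilon>>0. \<forall>\<^sub>F n in at_top. \<forall>h::nat.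
      (let \<eta> = real h / sqrt (real n) in
        6 / sqrt (ln (real n)) < \<eta> \<and> \<eta> < sqrt (ln (real n)) / 2 \<and> h mod 2 = n mod 2 \<longrightarrow>
        \<bar>pmf (height_law n) h / (2 * chi \<eta> / sqrt (real n)) - 1\<bar> < \<epsilon>)) \<and>
    (\<forall>\<eta>>0. chi \<eta> = 2 * pi ^ 2 / \<eta> ^ 3 *
      (\<Sum>k. (- 1) ^ k * (real k + 1) ^ 2 * exp (- (pi ^ 2 * (real k + 1) ^ 2 / (2 * \<eta> ^ 2)))))"
  using q_asymp mean_asymp variance_asymp height_moments local_limit chi_theta by blast

end
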